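(* Let $G$ be a finite group, let $\alpha=(D_g,\alpha_g)_{g\in G}$ be a unital partial action of $G$ on a commutative ring $R$, and assume that $R\supseteq R^\alpha$ is an $\alpha$-partial Galois extension. Then the map $$\varphi_6\colon H^1(G,\alpha^*,\mathbf{PicS}(R))\to H^3(G,\alpha,R),\qquad \mathrm{cls}(f)\mapsto\mathrm{cls}(\omega),$$ where $\omega$ is the partial $3$-cocycle attached to $f$ (constructed in the context), is a group homomorphism.
   Context: A unital partial action $\alpha=(D_g,\alpha_g)_{g\in G}$ of a group $G$ on a commutative ring $R$ consists of ideals $D_g=R1_g$ generated by idempotents $1_g$ (possibly zero) and ring isomorphisms $\alpha_g\colon D_{g^{-1}}\to D_g$ such that $D_1=R$, $\alpha_1=\mathrm{id}_R$, $\alpha_g(D_{g^{-1}}D_h)=D_gD_{gh}$, and $\alpha_g(\alpha_h(t))=\alpha_{gh}(t)$ for all $t\in D_{h^{-1}}D_{(gh)^{-1}}$. $R^\alpha=\{r\in R:\alpha_g(r1_{g^{-1}})=r1_g\ \forall g\in G\}$. The extension $R\supseteq R^\alpha$ is $\alpha$-partial Galois if there are $m\in\mathbb N$ and $x_i,y_i\in R$ ($1\le i\le m$) with $\sum_i x_i\alpha_g(y_i1_{g^{-1}})=\delta_{1,g}$ for all $g\in G$. Unadorned $\otimes$ means $\otimes_R$. $\mathbf{PicS}(R)$ is the commutative monoid (under $\otimes$) of isomorphism classes of finitely generated projective (central) $R$-modules $E$ admitting a surjective $R$-algebra homomorphism $R\to\mathrm{End}_R(E)$ (equivalently, for every prime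 $\mathfrak p$ either $E_{\mathfrak p}=0$ or $E_{\mathfrak p}\cong R_{\mathfrak p}$); its unit group is $\mathbf{Pic}(R)$. For $g\in G$ put $X_g=[D_g]\mathbf{PicS}(R)=\{[E]\in\mathbf{PicS}(R):E=1_gE\}$, an ideal with identity $[D_g]$. For $[E]\in X_{g^{-1}}$, $E_g$ is $E$ with $R$-action $r\bullet x=\alpha_{g^{-1}}(r1_g)x$. The maps $\alpha_g^*\colon X_{g^{-1}}\to X_g$, $[E]\mapsto[E_g]$, form a partial action $\alpha^*$ of $G$ on $\mathbf{PicS}(R)$. $Z^1(G,\alpha^*,\mathbf{PicS}(R))$ is the group (pointwise multiplication) of maps $f\colon G\to\mathbf{PicS}(R)$ with $f(g)\in\mathcal U(X_g)$ and $f(gh)[D_g]=f(g)\,\alpha_g^*(f(h)[D_{g^{-1}}])$ for all $g,h$; $B^1(G,\alpha^*,\mathbf{PicS}(R))$ consists of those $f$ of the form $f(g)=\alpha_g^*([P][D_{g^{-1}}])[P^*]$ with $[P]\in\mathbf{Pic}(R)$, $P^*=\mathrm{Hom}_R(P,R)$; $H^1=Z^1/B^1$. $C^n(G,\alpha,R)$ ($n\ge1$) is the group (pointwise multiplication) of functions $w\colon G^n\to R$ with $w(g_1,\dots,g_n)\in\mathcal U(R1_{g_1}1_{g_1g_2}\cdots1_{g_1\cdots g_n})$. With inverses taken in the corresponding ideals, $$(\delta^2w)(g,h,l)=\alpha_g(w(h,l)1_{g^{-1}})\,w(gh,l)^{-1}w(g,hl)\,w(g,h)^{-1},$$ $$(\delta^3w)(g,h,l,t)=\alpha_g(w(h,l,t)1_{g^{-1}})\,w(gh,l,t)^{-1}w(g,hl,t)\,w(g,h,lt)^{-1}w(g,h,l).$$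 $Z^3=\ker\delta^3$, $B^3=\mathrm{im}\,\delta^2$, $H^3(G,\alpha,R)=Z^3/B^3$. Construction of $\varphi_6$: let ${}_g(D_{g^{-1}})_I$ be the $R$-$R$-bimodule $D_{g^{-1}}$ with actions $r*d=\alpha_{g^{-1}}(r1_g)d$ and $d*r=dr$. For $f\in Z^1(G,\alpha^*,\mathbf{PicS}(R))$ write $f(g)=[M_g]$ and let $J_g=M_g\otimes{}_g(D_{g^{-1}})_I$, an $R$-$R$-bimodule, for which $x r=\alpha_g(r1_{g^{-1}})x$ ($x\in J_g$, $r\in R$). There are $R$-$R$-bimodule isomorphisms $\chi_{g,h}\colon J_g\otimes J_h\to D_g\otimes J_{gh}$ ($g,h\in G$); choose such a family. Let $\kappa_{g,h}\colon J_g\otimes D_h\to D_{gh}\otimes J_g$ be the $R$-$R$-bimodule isomorphism $a\otimes b\mapsto\alpha_g(b1_{g^{-1}})\otimes a$, and $\tau_{gh,g}\colon D_{gh}\otimes D_g\to D_g\otimes D_{gh}$ the flip $u\otimes v\mapsto v\otimes u$. For $g,h,l\in G$ the composition $$\tilde\omega(g,h,l)=(\mathrm{id}_{D_g}\otimes\chi_{gh,l})\circ(\chi_{g,h}\otimes\mathrm{id}_{J_l})\circ(\mathrm{id}_{J_g}\otimes\chi_{h,l})^{-1}\circ(\kappa_{g,h}\otimes\mathrm{id}_{J_{hl}})^{-1}\circ(\mathrm{id}_{D_{gh}}\otimes\chi_{g,hl})^{-1}\circ(\tau_{gh,g}\otimes\mathrm{id}_{J_{ghl}})^{-1}$$ is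 a left $R$-linear automorphism of $D_g\otimes D_{gh}\otimes J_{ghl}$, and there is a unique $\omega(g,h,l)\in\mathcal U(D_gD_{gh}D_{ghl})$ with $\tilde\omega(g,h,l)(z)=\omega(g,h,l)z$ for all $z$. The function $\omega$ lies in $Z^3(G,\alpha,R)$ and its class depends only on $\mathrm{cls}(f)$ (not on the choices of $\chi_{g,h}$ or of representatives); put $\varphi_6(\mathrm{cls}(f))=\mathrm{cls}(\omega)$. *)

theory Defs
  imports "HOL-Algebra.Algebra"
begin

section \<open>Modules and bimodules\<close>

text \<open>
  Modules over \<open>R\<close> are the library's \<^locale>\<open>module\<close>s. That locale does not look at the
  fields \<open>mult\<close> and \<open>one\<close> of the record, which are left undefined where they have no meaning.
\<close>

definition mod_hom ::
  "('a, 'r) ring_scheme \<Rightarrow> ('a, 'm, 'x) module_scheme \<Rightarrow> ('a, 'n, 'y) module_scheme \<Rightarrow> ('m \<Rightarrow> 'n) set" where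
  "mod_hom R M N = {f \<in> carrier M \<rightarrow> carrier N.
     (\<forall>x\<in>carrier M. \<forall>y\<in>carrier M. f (x \<oplus>\<^bsub>M\<^esub> y) = f x \<oplus>\<^bsub>N\<^esub> f y) \<and>
     (\<forall>r\<in>carrier R. \<forall>x\<in>carrier M. f (r \<odot>\<^bsub>M\<^esub> x) = r \<odot>\<^bsub>N\<^esub> f x)}"

definition mod_iso ::
  "('a, 'r) ring_scheme \<Rightarrow> ('a, 'm, 'x) module_scheme \<Rightarrow> ('a, 'n, 'y) module_scheme \<Rightarrow> ('m \<Rightarrow> 'n) set" where
  "mod_iso R M N = {f \<in> mod_hom R M N. bij_betw f (carrier M) (carrier N)}"

text \<open>An ideal \<open>I\<close> of \<open>R\<close>, in particular \<open>R\<close> itself, as an \<open>R\<close>-module.\<close>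

definition ideal_module :: "('a, 'r) ring_scheme \<Rightarrow> 'a set \<Rightarrow> ('a, 'a) module" where
  "ideal_module R I =
     \<lparr>carrier = I, monoid.mult = (\<otimes>\<^bsub>R\<^esub>), one = undefined, ring.zero = \<zero>\<^bsub>R\<^esub>, ring.add = (\<oplus>\<^bsub>R\<^esub>),
      smult = (\<otimes>\<^bsub>R\<^esub>)\<rparr>"

definition free_module :: "('a, 'r) ring_scheme \<Rightarrow> nat \<Rightarrow> ('a, nat \<Rightarrow> 'a) module" where
  "free_module R n =
     \<lparr>carrier = {..<n} \<rightarrow>\<^sub>E carrier R, monoid.mult = undefined, one = undefined,
      ring.zero = (\<lambda>i\<in>{..<n}. \<zero>\<^bsub>R\<^esub>), ring.add = (\<lambda>x y. \<lambda>i\<in>{..<n}. x i \<oplus>\<^bsub>R\<^esub> y i),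
      smult = (\<lambda>r x. \<lambda>i\<in>{..<n}. r \<otimes>\<^bsub>R\<^esub> x i)\<rparr>"

text \<open>\<open>Hom\<^sub>R(M, N)\<close>; its elements are extensional, so that equal homomorphisms are equal functions.\<close>

definition hom_module ::
  "('a, 'r) ring_scheme \<Rightarrow> ('a, 'm, 'x) module_scheme \<Rightarrow> ('a, 'n, 'y) module_scheme \<Rightarrow> ('a, 'm \<Rightarrow> 'n) module" where
  "hom_module R M N =
     \<lparr>carrier = mod_hom R M N \<inter> extensional (carrier M), monoid.mult = undefined, one = undefined,
      ring.zero = (\<lambda>x\<in>carrier M. \<zero>\<^bsub>N\<^esub>), ring.add = (\<lambda>f f'. \<lambda>x\<in>carrier M. f x \<oplus>\<^bsub>N\<^esub> f' x),
      smult = (\<lambda>r f. \<lambda>x\<in>carrier M. r \<odot>\<^bsub>N\<^esub> f x)\<rparr>"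

definition End_algebra ::
  "('a, 'r) ring_scheme \<Rightarrow> ('a, 'm, 'x) module_scheme \<Rightarrow> ('a, 'm \<Rightarrow> 'm) module" where
  "End_algebra R M =
     (hom_module R M M)\<lparr>monoid.mult := compose (carrier M), one := (\<lambda>x\<in>carrier M. x)\<rparr>"

definition dual_module ::
  "('a, 'r) ring_scheme \<Rightarrow> ('a, 'm, 'x) module_scheme \<Rightarrow> ('a, 'm \<Rightarrow> 'a) module" where
  "dual_module R P = hom_module R P (ideal_module R (carrier R))"

text \<open>Finitely generated projective: a direct summand (retract) of some \<open>R\<^sup>n\<close>.\<close>

definition fg_projective :: "('a, 'r) ring_scheme \<Rightarrow> ('a, 'm, 'x) module_scheme \<Rightarrow> bool" where
  "fg_projective R E \<longleftrightarrow> module R E \<and>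
     (\<exists>n. \<exists>i \<in> mod_hom R E (free_module R n). \<exists>p \<in> mod_hom R (free_module R n) E.
        \<forall>x\<in>carrier E. p (i x) = x)"

definition picS_module :: "('a, 'r) ring_scheme \<Rightarrow> ('a, 'm, 'x) module_scheme \<Rightarrow> bool" where
  "picS_module R E \<longleftrightarrow> fg_projective R E \<and>
     (\<exists>\<phi> \<in> ring_hom R (End_algebra R E).
        (\<forall>r\<in>carrier R. \<forall>s\<in>carrier R. \<phi> (r \<otimes>\<^bsub>R\<^esub> s) = r \<odot>\<^bsub>End_algebra R E\<^esub> \<phi> s) \<and>
        \<phi> ` carrier R = carrier (End_algebra R E))"

record ('a, 'm) bimodule = "('a, 'm) module" +
  rsmult :: "'m \<Rightarrow> 'a \<Rightarrow> 'm"

text \<open>A module over the commutative ring \<open>R\<close> as a central bimodule: \<open>x r = r x\<close>.\<close>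

definition central :: "('a, 'm) module \<Rightarrow> ('a, 'm) bimodule" where
  "central M = module.extend M (bimodule.fields (\<lambda>x r. r \<odot>\<^bsub>M\<^esub> x))"

definition bimod_iso ::
  "('a, 'r) ring_scheme \<Rightarrow> ('a, 'm) bimodule \<Rightarrow> ('a, 'n) bimodule \<Rightarrow> ('m \<Rightarrow> 'n) set" where
  "bimod_iso R M N = {f \<in> mod_iso R M N.
     \<forall>x\<in>carrier M. \<forall>r\<in>carrier R. f (rsmult M x r) = rsmult N (f x) r}"


section \<open>Tensor products over \<open>R\<close>\<close>

text \<open>
  \<open>M \<otimes>\<^sub>R N\<close> is the free abelian group on \<open>M \<times> N\<close> modulo the usual relations; it uses the right
  action on \<open>M\<close> and the left action on \<open>N\<close>.
\<close>

definition tensor_relations ::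
  "('a, 'r) ring_scheme \<Rightarrow> ('a, 'm) bimodule \<Rightarrow> ('a, 'n) bimodule \<Rightarrow> ('m \<times> 'n \<Rightarrow>\<^sub>0 int) set" where
  "tensor_relations R M N = generate (free_Abelian_group (carrier M \<times> carrier N))
     ({frag_of (x \<oplus>\<^bsub>M\<^esub> x', y) - frag_of (x, y) - frag_of (x', y) | x x' y.
          x \<in> carrier M \<and> x' \<in> carrier M \<and> y \<in> carrier N}
    \<union> {frag_of (x, y \<oplus>\<^bsub>N\<^esub> y') - frag_of (x, y) - frag_of (x, y') | x y y'.
          x \<in> carrier M \<and> y \<in> carrier N \<and> y' \<in> carrier N}
    \<union> {frag_of (rsmult M x r, y) - frag_of (x, r \<odot>\<^bsub>N\<^esub> y) | x r y.
          x \<in> carrier M \<and> r \<in> carrier R \<and> y \<in> carrier N})"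

definition tensor_group ::
  "('a, 'r) ring_scheme \<Rightarrow> ('a, 'm) bimodule \<Rightarrow> ('a, 'n) bimodule \<Rightarrow> ('m \<times> 'n \<Rightarrow>\<^sub>0 int) set monoid" where
  "tensor_group R M N = free_Abelian_group (carrier M \<times> carrier N) Mod tensor_relations R M N"

definition ptensor ::
  "('a, 'r) ring_scheme \<Rightarrow> ('a, 'm) bimodule \<Rightarrow> ('a, 'n) bimodule \<Rightarrow> 'm \<Rightarrow> 'n \<Rightarrow> ('m \<times> 'n \<Rightarrow>\<^sub>0 int) set" where
  "ptensor R M N x y =
     tensor_relations R M N #>\<^bsub>free_Abelian_group (carrier M \<times> carrier N)\<^esub> frag_of (x, y)"

text \<open>
  The additive map \<open>M \<otimes> N \<rightarrow> A\<close> with \<open>x \<otimes> y \<mapsto> F x y\<close>; it is meant for biadditive \<open>R\<close>-balanced \<open>F\<close>.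
  The abelian group \<open>A\<close> is given as a multiplicative group record.
\<close>

definition tensor_lift ::
  "('a, 'r) ring_scheme \<Rightarrow> ('a, 'm) bimodule \<Rightarrow> ('a, 'n) bimodule \<Rightarrow> ('c, 'x) monoid_scheme \<Rightarrow>
   ('m \<Rightarrow> 'n \<Rightarrow> 'c) \<Rightarrow> ('m \<times> 'n \<Rightarrow>\<^sub>0 int) set \<Rightarrow> 'c" where
  "tensor_lift R M N A F = (THE h. h \<in> hom (tensor_group R M N) A \<and>
     h \<in> extensional (carrier (tensor_group R M N)) \<and>
     (\<forall>x\<in>carrier M. \<forall>y\<in>carrier N. h (ptensor R M N x y) = F x y))"

text \<open>The bimodule structure: \<open>r (x \<otimes> y) = r x \<otimes> y\<close> and \<open>(x \<otimes> y) r = x \<otimes> y r\<close>.\<close>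

definition tensor ::
  "('a, 'r) ring_scheme \<Rightarrow> ('a, 'm) bimodule \<Rightarrow> ('a, 'n) bimodule \<Rightarrow>
   ('a, ('m \<times> 'n \<Rightarrow>\<^sub>0 int) set) bimodule" where
  "tensor R M N =
     \<lparr>carrier = carrier (tensor_group R M N), monoid.mult = undefined, one = undefined,
      ring.zero = \<one>\<^bsub>tensor_group R M N\<^esub>, ring.add = (\<otimes>\<^bsub>tensor_group R M N\<^esub>),
      smult = (\<lambda>r. tensor_lift R M N (tensor_group R M N) (\<lambda>x y. ptensor R M N (r \<odot>\<^bsub>M\<^esub> x) y)),
      rsmult = (\<lambda>t r. tensor_lift R M N (tensor_group R M N) (\<lambda>x y. ptensor R M N x (rsmult N y r)) t)\<rparr>"

definition tensor_map ::
  "('a, 'r) ring_scheme \<Rightarrow> ('a, 'm) bimodule \<Rightarrow> ('a, 'n) bimodule \<Rightarrow>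
   ('a, 'm2) bimodule \<Rightarrow> ('a, 'n2) bimodule \<Rightarrow> ('m \<Rightarrow> 'm2) \<Rightarrow> ('n \<Rightarrow> 'n2) \<Rightarrow>
   ('m \<times> 'n \<Rightarrow>\<^sub>0 int) set \<Rightarrow> ('m2 \<times> 'n2 \<Rightarrow>\<^sub>0 int) set" where
  "tensor_map R M N M' N' f f' =
     tensor_lift R M N (tensor_group R M' N') (\<lambda>x y. ptensor R M' N' (f x) (f' y))"

text \<open>The canonical map \<open>(A \<otimes> B) \<otimes> C \<rightarrow> A \<otimes> (B \<otimes> C)\<close>, \<open>(a \<otimes> b) \<otimes> c \<mapsto> a \<otimes> (b \<otimes> c)\<close>.\<close>

definition tensor_assoc ::
  "('a, 'r) ring_scheme \<Rightarrow> ('a, 'm) bimodule \<Rightarrow> ('a, 'n) bimodule \<Rightarrow> ('a, 'k) bimodule \<Rightarrow>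
   (('m \<times> 'n \<Rightarrow>\<^sub>0 int) set \<times> 'k \<Rightarrow>\<^sub>0 int) set \<Rightarrow> ('m \<times> ('n \<times> 'k \<Rightarrow>\<^sub>0 int) set \<Rightarrow>\<^sub>0 int) set" where
  "tensor_assoc R A B C =
     tensor_lift R (tensor R A B) C (tensor_group R A (tensor R B C))
       (\<lambda>t c. tensor_lift R A B (tensor_group R A (tensor R B C))
                (\<lambda>a b. ptensor R A (tensor R B C) a (ptensor R B C b c)) t)"


section \<open>The monoid \<open>PicS(R)\<close>\<close>

text \<open>
  Every finitely generated projective \<open>R\<close>-module is isomorphic to a submodule of some
  \<^term>\<open>free_module R n\<close>, so the modules with elements of type \<^typ>\<open>nat \<Rightarrow> 'a\<close> represent all
  isomorphism classes. The class \<open>[M]\<close> of a module \<open>M\<close> over an arbitrary type of elements is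
  the set of the modules of that type which are isomorphic to \<open>M\<close>.
\<close>

type_synonym 'a small_module = "('a, nat \<Rightarrow> 'a) module"

definition iso_class :: "('a, 'r) ring_scheme \<Rightarrow> ('a, 'm, 'x) module_scheme \<Rightarrow> 'a small_module set" where
  "iso_class R M = {N. module R N \<and> mod_iso R M N \<noteq> {}}"

definition PicS :: "('a, 'r) ring_scheme \<Rightarrow> 'a small_module set monoid" where
  "PicS R =
     \<lparr>carrier = {iso_class R E | E :: 'a small_module. picS_module R E},
      monoid.mult = (\<lambda>c c'. \<Union>E\<in>c. \<Union>F\<in>c'. iso_class R (tensor R (central E) (central F))),
      one = iso_class R (ideal_module R (carrier R))\<rparr>"


section \<open>Unital partial actions\<close>

text \<open>For an idempotent \<open>u\<close>, the ring \<open>R u\<close> with identity \<open>u\<close>.\<close>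

definition corner :: "('a, 'r) ring_scheme \<Rightarrow> 'a \<Rightarrow> ('a, 'r) ring_scheme" where
  "corner R u = R\<lparr>carrier := PIdl\<^bsub>R\<^esub> u, one := u\<rparr>"

text \<open>\<open>\<epsilon> g\<close> is the idempotent \<open>1\<^sub>g\<close>, so that \<open>D\<^sub>g = R 1\<^sub>g\<close> is \<^term>\<open>PIdl\<^bsub>R\<^esub> (\<epsilon> g)\<close>.\<close>

locale unital_partial_action = G: group G + R: cring R
  for G :: "('g, 'c) monoid_scheme" and R :: "('a, 'r) ring_scheme" +
  fixes \<epsilon> :: "'g \<Rightarrow> 'a" and \<alpha> :: "'g \<Rightarrow> 'a \<Rightarrow> 'a"
  assumes eps_closed: "g \<in> carrier G \<Longrightarrow> \<epsilon> g \<in> carrier R"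
    and eps_idem: "g \<in> carrier G \<Longrightarrow> \<epsilon> g \<otimes>\<^bsub>R\<^esub> \<epsilon> g = \<epsilon> g"
    and alpha_iso: "g \<in> carrier G \<Longrightarrow>
          \<alpha> g \<in> ring_iso (corner R (\<epsilon> (inv\<^bsub>G\<^esub> g))) (corner R (\<epsilon> g))"
    and D_one: "PIdl\<^bsub>R\<^esub> (\<epsilon> \<one>\<^bsub>G\<^esub>) = carrier R"
    and alpha_one: "r \<in> carrier R \<Longrightarrow> \<alpha> \<one>\<^bsub>G\<^esub> r = r"
    and alpha_image: "\<lbrakk>g \<in> carrier G; h \<in> carrier G\<rbrakk> \<Longrightarrow>
          \<alpha> g ` ((PIdl\<^bsub>R\<^esub> (\<epsilon> (inv\<^bsub>G\<^esub> g))) \<cdot>\<^bsub>R\<^esub> (PIdl\<^bsub>R\<^esub> (\<epsilon> h))) =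
          (PIdl\<^bsub>R\<^esub> (\<epsilon> g)) \<cdot>\<^bsub>R\<^esub> (PIdl\<^bsub>R\<^esub> (\<epsilon> (g \<otimes>\<^bsub>G\<^esub> h)))"
    and alpha_comp: "\<lbrakk>g \<in> carrier G; h \<in> carrier G;
          t \<in> (PIdl\<^bsub>R\<^esub> (\<epsilon> (inv\<^bsub>G\<^esub> h))) \<cdot>\<^bsub>R\<^esub> (PIdl\<^bsub>R\<^esub> (\<epsilon> (inv\<^bsub>G\<^esub> (g \<otimes>\<^bsub>G\<^esub> h))))\<rbrakk> \<Longrightarrow>
          \<alpha> g (\<alpha> h t) = \<alpha> (g \<otimes>\<^bsub>G\<^esub> h) t"
begin

definition D :: "'g \<Rightarrow> 'a set" where
  "D g = PIdl\<^bsub>R\<^esub> (\<epsilon> g)"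

definition invariants :: "'a set" where
  "invariants = {r \<in> carrier R. \<forall>g\<in>carrier G. \<alpha> g (r \<otimes>\<^bsub>R\<^esub> \<epsilon> (inv\<^bsub>G\<^esub> g)) = r \<otimes>\<^bsub>R\<^esub> \<epsilon> g}"

definition partial_Galois_extension :: "'a set \<Rightarrow> bool" where
  "partial_Galois_extension S \<longleftrightarrow> S = invariants \<and>
     (\<exists>m::nat. \<exists>x \<in> {1..m} \<rightarrow> carrier R. \<exists>y \<in> {1..m} \<rightarrow> carrier R. \<forall>g\<in>carrier G.
        (\<Oplus>\<^bsub>R\<^esub>i\<in>{1..m}. x i \<otimes>\<^bsub>R\<^esub> \<alpha> g (y i \<otimes>\<^bsub>R\<^esub> \<epsilon> (inv\<^bsub>G\<^esub> g))) =
          (if g = \<one>\<^bsub>G\<^esub> then \<one>\<^bsub>R\<^esub> else \<zero>\<^bsub>R\<^esub>))"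


subsection \<open>The group \<open>H\<^sup>1(G, \<alpha>*, PicS(R))\<close>\<close>

definition D_class :: "'g \<Rightarrow> 'a small_module set" where
  "D_class g = iso_class R (ideal_module R (D g))"

definition X_ideal :: "'g \<Rightarrow> 'a small_module set monoid" where
  "X_ideal g = (PicS R)\<lparr>carrier := (\<lambda>c. D_class g \<otimes>\<^bsub>PicS R\<^esub> c) ` carrier (PicS R), one := D_class g\<rparr>"

definition twist :: "'g \<Rightarrow> 'a small_module \<Rightarrow> 'a small_module" where
  "twist g E = E\<lparr>smult := (\<lambda>r x. \<alpha> (inv\<^bsub>G\<^esub> g) (r \<otimes>\<^bsub>R\<^esub> \<epsilon> g) \<odot>\<^bsub>E\<^esub> x)\<rparr>"

definition alpha_star :: "'g \<Rightarrow> 'a small_module set \<Rightarrow> 'a small_module set" where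
  "alpha_star g c = (\<Union>E\<in>c. iso_class R (twist g E))"

definition Z1 :: "('g \<Rightarrow> 'a small_module set) monoid" where
  "Z1 =
     \<lparr>carrier = {f \<in> extensional (carrier G).
        (\<forall>g\<in>carrier G. f g \<in> Units (X_ideal g)) \<and>
        (\<forall>g\<in>carrier G. \<forall>h\<in>carrier G.
           f (g \<otimes>\<^bsub>G\<^esub> h) \<otimes>\<^bsub>PicS R\<^esub> D_class g =
           f g \<otimes>\<^bsub>PicS R\<^esub> alpha_star g (f h \<otimes>\<^bsub>PicS R\<^esub> D_class (inv\<^bsub>G\<^esub> g)))},
      monoid.mult = (\<lambda>f f'. \<lambda>g\<in>carrier G. f g \<otimes>\<^bsub>PicS R\<^esub> f' g),
      one = (\<lambda>g\<in>carrier G. D_class g)\<rparr>"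

definition B1 :: "('g \<Rightarrow> 'a small_module set) set" where
  "B1 = {\<lambda>g\<in>carrier G. alpha_star g (iso_class R P \<otimes>\<^bsub>PicS R\<^esub> D_class (inv\<^bsub>G\<^esub> g))
                          \<otimes>\<^bsub>PicS R\<^esub> iso_class R (dual_module R P)
         | P :: 'a small_module. picS_module R P \<and> iso_class R P \<in> Units (PicS R)}"

definition H1 :: "('g \<Rightarrow> 'a small_module set) set monoid" where
  "H1 = Z1 Mod B1"


subsection \<open>The group \<open>H\<^sup>3(G, \<alpha>, R)\<close>\<close>

text \<open>Cochains are functions on lists of group elements.\<close>

definition tuples :: "nat \<Rightarrow> 'g list set" where
  "tuples n = {gs. length gs = n \<and> set gs \<subseteq> carrier G}"

text \<open>The idempotent \<open>1\<^bsub>g\<^sub>1\<^esub> 1\<^bsub>g\<^sub>1g\<^sub>2\<^esub> \<dots> 1\<^bsub>g\<^sub>1\<dots>g\<^sub>n\<^esub>\<close>.\<close>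

definition eps_tuple :: "'g list \<Rightarrow> 'a" where
  "eps_tuple gs =
     (\<Otimes>\<^bsub>R\<^esub>i\<in>{1..length gs}. \<epsilon> (foldr (\<otimes>\<^bsub>G\<^esub>) (take i gs) \<one>\<^bsub>G\<^esub>))"

definition cochains :: "nat \<Rightarrow> ('g list \<Rightarrow> 'a) monoid" where
  "cochains n =
     \<lparr>carrier = {w \<in> extensional (tuples n).
        \<forall>gs\<in>tuples n. w gs \<in> Units (corner R (eps_tuple gs))},
      monoid.mult = (\<lambda>w w'. \<lambda>gs\<in>tuples n. w gs \<otimes>\<^bsub>R\<^esub> w' gs),
      one = (\<lambda>gs\<in>tuples n. eps_tuple gs)\<rparr>"

definition cinv :: "('g list \<Rightarrow> 'a) \<Rightarrow> 'g list \<Rightarrow> 'a" where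
  "cinv w gs = inv\<^bsub>corner R (eps_tuple gs)\<^esub> (w gs)"

definition delta2 :: "('g list \<Rightarrow> 'a) \<Rightarrow> 'g list \<Rightarrow> 'a" where
  "delta2 w = (\<lambda>gs\<in>tuples 3. let g = gs ! 0; h = gs ! 1; l = gs ! 2 in
     \<alpha> g (w [h, l] \<otimes>\<^bsub>R\<^esub> \<epsilon> (inv\<^bsub>G\<^esub> g)) \<otimes>\<^bsub>R\<^esub> cinv w [g \<otimes>\<^bsub>G\<^esub> h, l] \<otimes>\<^bsub>R\<^esub>
     w [g, h \<otimes>\<^bsub>G\<^esub> l] \<otimes>\<^bsub>R\<^esub> cinv w [g, h])"

definition delta3 :: "('g list \<Rightarrow> 'a) \<Rightarrow> 'g list \<Rightarrow> 'a" where
  "delta3 w = (\<lambda>gs\<in>tuples 4. let g = gs ! 0; h = gs ! 1; l = gs ! 2; t = gs ! 3 in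
     \<alpha> g (w [h, l, t] \<otimes>\<^bsub>R\<^esub> \<epsilon> (inv\<^bsub>G\<^esub> g)) \<otimes>\<^bsub>R\<^esub> cinv w [g \<otimes>\<^bsub>G\<^esub> h, l, t] \<otimes>\<^bsub>R\<^esub>
     w [g, h \<otimes>\<^bsub>G\<^esub> l, t] \<otimes>\<^bsub>R\<^esub> cinv w [g, h, l \<otimes>\<^bsub>G\<^esub> t] \<otimes>\<^bsub>R\<^esub> w [g, h, l])"

definition Z3 :: "('g list \<Rightarrow> 'a) monoid" where
  "Z3 = (cochains 3)\<lparr>carrier := {w \<in> carrier (cochains 3). delta3 w = \<one>\<^bsub>cochains 4\<^esub>}\<rparr>"

definition B3 :: "('g list \<Rightarrow> 'a) set" where
  "B3 = delta2 ` carrier (cochains 2)"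

definition H3 :: "('g list \<Rightarrow> 'a) set monoid" where
  "H3 = Z3 Mod B3"


subsection \<open>The map \<open>\<phi>\<^sub>6\<close>\<close>

abbreviation tens (infixr \<open>\<boxtimes>\<close> 72) where
  "A \<boxtimes> B \<equiv> tensor R A B"

abbreviation D_bimodule :: "'g \<Rightarrow> ('a, 'a) bimodule" where
  "D_bimodule g \<equiv> central (ideal_module R (D g))"

text \<open>The bimodule \<open>\<^sub>g(D\<^bsub>g\<^sup>-\<^sup>1\<^esub>)\<^sub>I\<close>.\<close>

definition D_twisted :: "'g \<Rightarrow> ('a, 'a) bimodule" where
  "D_twisted g = (D_bimodule (inv\<^bsub>G\<^esub> g))
     \<lparr>smult := (\<lambda>r d. \<alpha> (inv\<^bsub>G\<^esub> g) (r \<otimes>\<^bsub>R\<^esub> \<epsilon> g) \<otimes>\<^bsub>R\<^esub> d), rsmult := (\<lambda>d r. d \<otimes>\<^bsub>R\<^esub> r)\<rparr>"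

type_synonym 'b J_elem = "((nat \<Rightarrow> 'b) \<times> 'b \<Rightarrow>\<^sub>0 int) set"

definition J :: "('g \<Rightarrow> 'a small_module) \<Rightarrow> 'g \<Rightarrow> ('a, 'a J_elem) bimodule" where
  "J M g = central (M g) \<boxtimes> D_twisted g"

definition kappa :: "('g \<Rightarrow> 'a small_module) \<Rightarrow> 'g \<Rightarrow> 'g \<Rightarrow>
    ('a J_elem \<times> 'a \<Rightarrow>\<^sub>0 int) set \<Rightarrow> ('a \<times> 'a J_elem \<Rightarrow>\<^sub>0 int) set" where
  "kappa M g h =
     tensor_lift R (J M g) (D_bimodule h) (tensor_group R (D_bimodule (g \<otimes>\<^bsub>G\<^esub> h)) (J M g))
       (\<lambda>a b. ptensor R (D_bimodule (g \<otimes>\<^bsub>G\<^esub> h)) (J M g) (\<alpha> g (b \<otimes>\<^bsub>R\<^esub> \<epsilon> (inv\<^bsub>G\<^esub> g))) a)"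

definition flip :: "'g \<Rightarrow> 'g \<Rightarrow> ('a \<times> 'a \<Rightarrow>\<^sub>0 int) set \<Rightarrow> ('a \<times> 'a \<Rightarrow>\<^sub>0 int) set" where
  "flip g h =
     tensor_lift R (D_bimodule g) (D_bimodule h) (tensor_group R (D_bimodule h) (D_bimodule g))
       (\<lambda>u v. ptensor R (D_bimodule h) (D_bimodule g) v u)"

type_synonym 'b chi_map =
  "('b J_elem \<times> 'b J_elem \<Rightarrow>\<^sub>0 int) set \<Rightarrow> ('b \<times> 'b J_elem \<Rightarrow>\<^sub>0 int) set"

definition representatives ::
    "('g \<Rightarrow> 'a small_module set) \<Rightarrow> ('g \<Rightarrow> 'a small_module) \<Rightarrow> bool" where
  "representatives f M \<longleftrightarrow> (\<forall>g\<in>carrier G. picS_module R (M g) \<and> f g = iso_class R (M g))"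

definition chi_family :: "('g \<Rightarrow> 'a small_module) \<Rightarrow> ('g \<Rightarrow> 'g \<Rightarrow> 'a chi_map) \<Rightarrow> bool" where
  "chi_family M \<chi> \<longleftrightarrow> (\<forall>g\<in>carrier G. \<forall>h\<in>carrier G.
     \<chi> g h \<in> bimod_iso R (J M g \<boxtimes> J M h) (D_bimodule g \<boxtimes> J M (g \<otimes>\<^bsub>G\<^esub> h)))"

text \<open>
  The composite \<open>\<omega>\<^sup>~(g, h, l)\<close>. All threefold tensor products are understood up to the associativity
  isomorphism, which is made explicit here; the domain and codomain is
  \<open>D\<^sub>g \<otimes> (D\<^bsub>gh\<^esub> \<otimes> J\<^bsub>ghl\<^esub>)\<close>. An inverse of \<open>u : A \<rightarrow> B\<close> is \<^term>\<open>inv_into (carrier A) u\<close>.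
\<close>

definition omega_tilde :: "('g \<Rightarrow> 'a small_module) \<Rightarrow> ('g \<Rightarrow> 'g \<Rightarrow> 'a chi_map) \<Rightarrow> 'g \<Rightarrow> 'g \<Rightarrow> 'g \<Rightarrow>
    ('a \<times> ('a \<times> 'a J_elem \<Rightarrow>\<^sub>0 int) set \<Rightarrow>\<^sub>0 int) set \<Rightarrow>
    ('a \<times> ('a \<times> 'a J_elem \<Rightarrow>\<^sub>0 int) set \<Rightarrow>\<^sub>0 int) set" where
  "omega_tilde M \<chi> g h l =
    (let gh = g \<otimes>\<^bsub>G\<^esub> h; hl = h \<otimes>\<^bsub>G\<^esub> l; ghl = g \<otimes>\<^bsub>G\<^esub> h \<otimes>\<^bsub>G\<^esub> l;
         Dg = D_bimodule g; Dh = D_bimodule h; Dgh = D_bimodule gh;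
         Jg = J M g; Jh = J M h; Jl = J M l; Jgh = J M gh; Jhl = J M hl; Jghl = J M ghl
     in
       tensor_map R Dg (Jgh \<boxtimes> Jl) Dg (Dgh \<boxtimes> Jghl) id (\<chi> gh l)
     \<circ> tensor_assoc R Dg Jgh Jl
     \<circ> tensor_map R (Jg \<boxtimes> Jh) Jl (Dg \<boxtimes> Jgh) Jl (\<chi> g h) id
     \<circ> inv_into (carrier ((Jg \<boxtimes> Jh) \<boxtimes> Jl)) (tensor_assoc R Jg Jh Jl)
     \<circ> inv_into (carrier (Jg \<boxtimes> Jh \<boxtimes> Jl)) (tensor_map R Jg (Jh \<boxtimes> Jl) Jg (Dh \<boxtimes> Jhl) id (\<chi> h l))
     \<circ> tensor_assoc R Jg Dh Jhl
     \<circ> inv_into (carrier ((Jg \<boxtimes> Dh) \<boxtimes> Jhl))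
         (tensor_map R (Jg \<boxtimes> Dh) Jhl (Dgh \<boxtimes> Jg) Jhl (kappa M g h) id)
     \<circ> inv_into (carrier ((Dgh \<boxtimes> Jg) \<boxtimes> Jhl)) (tensor_assoc R Dgh Jg Jhl)
     \<circ> inv_into (carrier (Dgh \<boxtimes> Jg \<boxtimes> Jhl))
         (tensor_map R Dgh (Jg \<boxtimes> Jhl) Dgh (Dg \<boxtimes> Jghl) id (\<chi> g hl))
     \<circ> tensor_assoc R Dgh Dg Jghl
     \<circ> inv_into (carrier ((Dgh \<boxtimes> Dg) \<boxtimes> Jghl))
         (tensor_map R (Dgh \<boxtimes> Dg) Jghl (Dg \<boxtimes> Dgh) Jghl (flip gh g) id)
     \<circ> inv_into (carrier ((Dg \<boxtimes> Dgh) \<boxtimes> Jghl)) (tensor_assoc R Dg Dgh Jghl))"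

definition omega :: "('g \<Rightarrow> 'a small_module) \<Rightarrow> ('g \<Rightarrow> 'g \<Rightarrow> 'a chi_map) \<Rightarrow> 'g list \<Rightarrow> 'a" where
  "omega M \<chi> = (\<lambda>gs\<in>tuples 3. let g = gs ! 0; h = gs ! 1; l = gs ! 2;
       V = D_bimodule g \<boxtimes> D_bimodule (g \<otimes>\<^bsub>G\<^esub> h) \<boxtimes> J M (g \<otimes>\<^bsub>G\<^esub> h \<otimes>\<^bsub>G\<^esub> l)
     in THE u. u \<in> Units (corner R (eps_tuple gs)) \<and>
               (\<forall>z\<in>carrier V. omega_tilde M \<chi> g h l z = u \<odot>\<^bsub>V\<^esub> z))"

text \<open>
  The value at a class \<open>c = cls(f)\<close> is the class of \<open>\<omega>\<close> common to all choices of the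
  representative \<open>f\<close>, of the modules \<open>M\<^sub>g\<close> and of the isomorphisms \<open>\<chi>\<^bsub>g,h\<^esub>\<close>.
\<close>

definition phi6 :: "('g \<Rightarrow> 'a small_module set) set \<Rightarrow> ('g list \<Rightarrow> 'a) set" where
  "phi6 c = (THE d. \<exists>f\<in>c. \<exists>M \<chi>. representatives f M \<and> chi_family M \<chi> \<and> d = B3 #>\<^bsub>Z3\<^esub> omega M \<chi>)"

end

end

theory Submission
  imports Defs
begin

text \<open>
  The proof replaces the tensor products in the definition of \<open>\<omega>\<close> by bilinear maps. The target of
  \<open>\<chi>\<^bsub>g,h\<^esub>\<close> is \<open>D\<^sub>g \<otimes> J\<^bsub>gh\<^esub>\<close>; multiplying its two factors turns \<open>\<chi>\<^bsub>g,h\<^esub>\<close> into a multiplication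
  \<open>J\<^sub>g \<times> J\<^sub>h \<rightarrow> J\<^bsub>gh\<^esub>\<close>, written \<open>xy\<close> here, which is linear in \<open>x\<close>, satisfies
  \<open>x(ry) = \<alpha>\<^sub>g(r1)(xy)\<close>, and has values that span \<open>1\<^sub>g J\<^bsub>gh\<^esub>\<close>. Such a family of multiplications
  (\<open>crossed_system\<close>) looks like a partial crossed product, except that it is associative only up to
  units: \<open>(xy)z = w(g,h,l) x(yz)\<close>. The function \<open>w\<close> is called the defect of the system. After all
  threefold tensor products are multiplied out into \<open>J\<^bsub>ghl\<^esub>\<close>, the composite \<open>\<omega>\<^sup>~(g,h,l)\<close> is seen to be
  multiplication by \<open>w(g,h,l)\<close>, that is, \<open>\<omega>\<close> is the defect (\<open>omega_tilde_defect\<close>, \<open>omega_eq\<close>).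

  Everything about defects rests on one property of modules \<open>E\<close> of rank at most one: every balanced
  biadditive form on \<open>E\<close> is symmetric (\<open>balanced_form_symmetric\<close>). Hence, if \<open>A\<close> and \<open>B\<close> are two
  expressions with values in a rank one module \<open>L\<close>, with the same variables and with the same twisted
  linearity in each of them, then \<open>\<psi>(B t) A t'\<close> is symmetric in \<open>t\<close> and \<open>t'\<close> for every functional
  \<open>\<psi>\<close> on \<open>L\<close>, as one sees by exchanging one variable at a time (\<open>slot_exchange\<close>). This makes \<open>A\<close> and
  \<open>B\<close> proportional, and the factor is a unit if both families of values span (\<open>unit_ratio\<close>).

  This principle is applied three times.
  \<^item> \<open>A = x(yz)\<close> and \<open>B = (xy)z\<close> give the defect; the five bracketings of a fourfold product
    show that it is a cocycle (\<open>defect_exists\<close>, \<open>defect_cocycle\<close>).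
  \<^item> Let three systems be related by perfect pairings \<open>N\<^sub>g \<times> N'\<^sub>g \<rightarrow> N''\<^sub>g\<close>. Comparing the product of two
    paired elements with the pairing of the two products gives a 2-cochain \<open>\<rho>\<close>, and the defects satisfy
    \<open>w w' = w'' \<delta>\<^sup>2\<rho>\<close> (\<open>defect_product\<close>). Representatives of \<open>f\<close>, \<open>f'\<close> and \<open>ff'\<close> are related in this way.
  \<^item> If a system acts on a module \<open>Q\<close> of rank one by maps \<open>N\<^sub>g \<times> Q \<rightarrow> Q\<close>, comparing \<open>(xy)q\<close> with
    \<open>x(yq)\<close> shows that the defect is a coboundary (\<open>defect_of_acting_system\<close>). When \<open>f\<close> is the
    coboundary of \<open>[P]\<close>, the modules \<open>J\<^sub>g\<close> act in this way on \<open>Q = P\<^sup>*\<close>, because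
    \<open>f(g) \<alpha>\<^sub>g\<^sup>*([Q][D\<^bsub>g\<^sup>-\<^sup>1\<^esub>]) = [Q][D\<^sub>g]\<close>.

  The second item with \<open>f \<in> B\<^sup>1\<close>, combined with the third, shows that the class of \<open>\<omega>\<close> depends only on
  the class of \<open>f\<close> (\<open>phi6_eq\<close>); the second item itself is multiplicativity (\<open>phi6_hom\<close>). That \<open>B\<^sup>3\<close> is contained in
  \<open>Z\<^sup>3\<close> also follows from the theory of defects, applied to systems on the ideals \<open>D\<^sub>g\<close> (\<open>delta2_Z3\<close>).

  The modules in \<open>PicS(R)\<close> enter only through the elementary predicate \<open>rank_one R E e\<close>, in which the
  idempotent \<open>e\<close> is the support of \<open>E\<close>. Both directions of its equivalence with \<open>picS_module R E\<close> are
  proved (\<open>rank_one_picS_module\<close>, \<open>picS_module_rank_one\<close>), and the classes with a given support form a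
  group, which for the support \<open>1\<^sub>g\<close> is the unit group of \<open>X\<^sub>g\<close> (\<open>Units_X_ideal\<close>).
\<close>

text \<open>Structures with a one-letter name are attached to operations by a plain subscript.\<close>

syntax "_index" :: "logic \<Rightarrow> index" (\<open>(00\<^sub>_)\<close> [1000])

section \<open>Tensor products of bimodules\<close>

text \<open>
  Zero and negatives are absent: the sets to be spanned below are closed under scalar multiplication, so that
  non-empty sums suffice and inductions have no further cases.
\<close>

inductive_set additive_span :: "('b, 'x) ring_scheme \<Rightarrow> 'b set \<Rightarrow> 'b set"
  for A :: "('b, 'x) ring_scheme" and S :: "'b set" where
  gen: "x \<in> S \<Longrightarrow> x \<in> additive_span A S"
| add: "x \<in> additive_span A S \<Longrightarrow> y \<in> additive_span A S \<Longrightarrow> x \<oplus>\<^sub>A y \<in> additive_span A S"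

definition is_bimodule :: "('a, 'r) ring_scheme \<Rightarrow> ('a, 'm) bimodule \<Rightarrow> bool" where
  "is_bimodule R M \<longleftrightarrow> module R M \<and>
     (\<forall>x\<in>carrier M. \<forall>r\<in>carrier R. rsmult M x r \<in> carrier M) \<and>
     (\<forall>x\<in>carrier M. \<forall>y\<in>carrier M. \<forall>r\<in>carrier R.
        rsmult M (x \<oplus>\<^sub>M y) r = rsmult M x r \<oplus>\<^sub>M rsmult M y r) \<and>
     (\<forall>x\<in>carrier M. \<forall>r\<in>carrier R. \<forall>s\<in>carrier R.
        r \<odot>\<^sub>M rsmult M x s = rsmult M (r \<odot>\<^sub>M x) s)"

definition balanced ::
  "('a, 'r) ring_scheme \<Rightarrow> ('a, 'm) bimodule \<Rightarrow> ('a, 'n) bimodule \<Rightarrow> ('c, 'x) ring_scheme \<Rightarrow>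
   ('m \<Rightarrow> 'n \<Rightarrow> 'c) \<Rightarrow> bool" where
  "balanced R M N L F \<longleftrightarrow>
     (\<forall>x\<in>carrier M. \<forall>y\<in>carrier N. F x y \<in> carrier L) \<and>
     (\<forall>x\<in>carrier M. \<forall>x'\<in>carrier M. \<forall>y\<in>carrier N. F (x \<oplus>\<^sub>M x') y = F x y \<oplus>\<^sub>L F x' y) \<and>
     (\<forall>x\<in>carrier M. \<forall>y\<in>carrier N. \<forall>y'\<in>carrier N. F x (y \<oplus>\<^sub>N y') = F x y \<oplus>\<^sub>L F x y') \<and>
     (\<forall>x\<in>carrier M. \<forall>r\<in>carrier R. \<forall>y\<in>carrier N. F (rsmult M x r) y = F x (r \<odot>\<^sub>N y))"

definition additive_map :: "('m, 'x) ring_scheme \<Rightarrow> ('n, 'y) ring_scheme \<Rightarrow> ('m \<Rightarrow> 'n) \<Rightarrow> bool" where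
  "additive_map M N f \<longleftrightarrow> (\<forall>x\<in>carrier M. f x \<in> carrier N) \<and>
     (\<forall>x\<in>carrier M. \<forall>y\<in>carrier M. f (x \<oplus>\<^sub>M y) = f x \<oplus>\<^sub>N f y)"

lemma bimoduleD:
  assumes "is_bimodule R M"
  shows "module R M" "abelian_group M" "cring R"
    "\<And>x r. x \<in> carrier M \<Longrightarrow> r \<in> carrier R \<Longrightarrow> rsmult M x r \<in> carrier M"
    "\<And>x y r. x \<in> carrier M \<Longrightarrow> y \<in> carrier M \<Longrightarrow> r \<in> carrier R \<Longrightarrow>
        rsmult M (x \<oplus>\<^sub>M y) r = rsmult M x r \<oplus>\<^sub>M rsmult M y r"
    "\<And>x r s. x \<in> carrier M \<Longrightarrow> r \<in> carrier R \<Longrightarrow> s \<in> carrier R \<Longrightarrow>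
        r \<odot>\<^sub>M rsmult M x s = rsmult M (r \<odot>\<^sub>M x) s"
    "\<And>x y. x \<in> carrier M \<Longrightarrow> y \<in> carrier M \<Longrightarrow> x \<oplus>\<^sub>M y \<in> carrier M"
    "\<zero>\<^sub>M \<in> carrier M"
    "\<And>x r. x \<in> carrier M \<Longrightarrow> r \<in> carrier R \<Longrightarrow> r \<odot>\<^sub>M x \<in> carrier M"
proof -
  show m: "module R M" using assms by (simp add: is_bimodule_def)
  show a: "abelian_group M" "cring R" using m by (auto simp: module_def)
  show "\<And>x r. x \<in> carrier M \<Longrightarrow> r \<in> carrier R \<Longrightarrow> r \<odot>\<^sub>M x \<in> carrier M"
    using m by (rule module.smult_closed)
  interpret abelian_group M by fact
  show "\<And>x y. x \<in> carrier M \<Longrightarrow> y \<in> carrier M \<Longrightarrow> x \<oplus>\<^sub>M y \<in> carrier M" "\<zero>\<^sub>M \<in> carrier M"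
    by auto
qed (use assms in \<open>auto simp: is_bimodule_def\<close>)

text \<open>
  \<^const>\<open>tensor_lift\<close> takes its target as a multiplicative group, so a module has to be offered in
  this form.
\<close>

definition additive_group :: "('c, 'x) ring_scheme \<Rightarrow> 'c monoid" where
  "additive_group L = \<lparr>carrier = carrier L, monoid.mult = (\<oplus>\<^sub>L), one = \<zero>\<^sub>L\<rparr>"

lemma additive_group_simps [simp]:
  "carrier (additive_group L) = carrier L" "x \<otimes>\<^bsub>additive_group L\<^esub> y = x \<oplus>\<^sub>L y" 
  "\<one>\<^bsub>additive_group L\<^esub> = \<zero>\<^sub>L"
  by (simp_all add: additive_group_def)

lemma additive_group_tensor: "additive_group (tensor R M N) = tensor_group R M N"
  by (simp add: tensor_def tensor_group_def FactGroup_def additive_group_def)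

lemma comm_group_additive_group: "comm_group (additive_group L) \<longleftrightarrow> abelian_group L"
proof -
  have "comm_group (additive_group L) = comm_group (add_monoid L)"
    by (simp add: additive_group_def comm_group_def comm_monoid_def comm_monoid_axioms_def
      group_def group_axioms_def monoid_def Units_def)
  then show ?thesis
    by (auto simp: abelian_group_def abelian_group_axioms_def abelian_monoid_def comm_group_def)
qed

lemma carrier_tensor: "carrier (tensor R M N) = carrier (tensor_group R M N)"
  by (simp add: tensor_def)

locale tensor_product =
  fixes R :: "('a, 'r) ring_scheme" and M :: "('a, 'm) bimodule" and N :: "('a, 'n) bimodule"
  assumes M: "is_bimodule R M" and N: "is_bimodule R N"
begin

abbreviation "Fr \<equiv> free_Abelian_group (carrier M \<times> carrier N)"
abbreviation "T \<equiv> tensor R M N"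
abbreviation "pt \<equiv> ptensor R M N"
abbreviation "Rel \<equiv> tensor_relations R M N"

lemma Fr_comm_group: "comm_group Fr" by (rule abelian_free_Abelian_group)

lemma frag_diff_carrier: "a \<in> carrier Fr \<Longrightarrow> b \<in> carrier Fr \<Longrightarrow> a - b \<in> carrier Fr"
  using keys_diff by (fastforce)

lemmas MD = bimoduleD[OF M] and ND = bimoduleD[OF N]

lemma Rel_subgroup: "subgroup Rel Fr"
proof -
  have *: "z \<in> carrier Fr"
    if "z \<in> {frag_of (x \<oplus>\<^sub>M x', y) - frag_of (x, y) - frag_of (x', y) | x x' y.
          x \<in> carrier M \<and> x' \<in> carrier M \<and> y \<in> carrier N}
    \<union> {frag_of (x, y \<oplus>\<^sub>N y') - frag_of (x, y) - frag_of (x, y') | x y y'.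
          x \<in> carrier M \<and> y \<in> carrier N \<and> y' \<in> carrier N}
    \<union> {frag_of (rsmult M x r, y) - frag_of (x, r \<odot>\<^sub>N y) | x r y.
          x \<in> carrier M \<and> r \<in> carrier R \<and> y \<in> carrier N}" for z
    using that by (elim UnE CollectE exE conjE; hypsubst; intro frag_diff_carrier; simp add: MD ND)
  show ?thesis unfolding tensor_relations_def
    by (rule group.generate_is_subgroup) (rule group_free_Abelian_group, rule subsetI, erule *)
qed

lemma Rel_normal: "Rel \<lhd> Fr"
  using Fr_comm_group Rel_subgroup by (simp add: comm_group.normal_iff_subgroup)

lemma tensor_abelian: "abelian_group T"
proof -
  have "comm_group (additive_group T)"
    unfolding additive_group_tensor tensor_group_def
    by (rule comm_group.abelian_FactGroup[OF Fr_comm_group Rel_subgroup])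
  then show ?thesis by (simp only: comm_group_additive_group)
qed

lemma coset_add: "a \<in> carrier Fr \<Longrightarrow> b \<in> carrier Fr \<Longrightarrow>
    (Rel #>\<^bsub>Fr\<^esub> a) \<oplus>\<^sub>T (Rel #>\<^bsub>Fr\<^esub> b) = Rel #>\<^bsub>Fr\<^esub> (a + b)"
  using normal.rcos_sum[OF Rel_normal, of a b] by (simp add: tensor_def tensor_group_def)

lemma coset_eqI:
  assumes "a \<in> carrier Fr" "b \<in> carrier Fr" "a - b \<in> Rel"
  shows "Rel #>\<^bsub>Fr\<^esub> a = Rel #>\<^bsub>Fr\<^esub> b"
proof -
  have "a \<in> Rel #>\<^bsub>Fr\<^esub> b"
    using assms(3) by (auto simp: r_coset_def intro!: bexI[of _ "a - b"])
  then show ?thesis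
    using group.repr_independence[OF group_free_Abelian_group _ assms(2) Rel_subgroup] by simp
qed

lemma coset_carrier: "a \<in> carrier Fr \<Longrightarrow> Rel #>\<^bsub>Fr\<^esub> a \<in> carrier T"
  by (auto simp: carrier_tensor tensor_group_def carrier_FactGroup)

lemma pt_closed [simp, intro]: "x \<in> carrier M \<Longrightarrow> y \<in> carrier N \<Longrightarrow> pt x y \<in> carrier T"
  unfolding ptensor_def by (rule coset_carrier) simp

lemma pt_add_left: 
  assumes "x \<in> carrier M" "x' \<in> carrier M" "y \<in> carrier N"
  shows "pt (x \<oplus>\<^sub>M x') y = pt x y \<oplus>\<^sub>T pt x' y"
proof -
  have "frag_of (x \<oplus>\<^sub>M x', y) - (frag_of (x, y) + frag_of (x', y)) \<in> Rel"
    unfolding tensor_relations_def diff_diff_eq[symmetric] using assms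
    by (intro generate.incl) blast
  moreover have "frag_of (x, y) + frag_of (x', y) \<in> carrier Fr"
    using group.is_monoid[OF group_free_Abelian_group, THEN monoid.m_closed, of "frag_of (x, y)" "carrier M \<times> carrier N" "frag_of (x', y)"] assms 
    by simp
  ultimately show ?thesis unfolding ptensor_def
    using assms by (subst coset_add) (simp, simp, rule coset_eqI, simp_all add: MD)
qed

lemma pt_add_right: 
  assumes "x \<in> carrier M" "y \<in> carrier N" "y' \<in> carrier N"
  shows "pt x (y \<oplus>\<^sub>N y') = pt x y \<oplus>\<^sub>T pt x y'"
proof -
  have "frag_of (x, y \<oplus>\<^sub>N y') - (frag_of (x, y) + frag_of (x, y')) \<in> Rel"
    unfolding tensor_relations_def diff_diff_eq[symmetric] using assms
    by (intro generate.incl) blast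
  moreover have "frag_of (x, y) + frag_of (x, y') \<in> carrier Fr"
    using group.is_monoid[OF group_free_Abelian_group, THEN monoid.m_closed, of "frag_of (x, y)" "carrier M \<times> carrier N" "frag_of (x, y')"] assms 
    by simp
  ultimately show ?thesis unfolding ptensor_def
    using assms by (subst coset_add) (simp, simp, rule coset_eqI, simp_all add: ND)
qed

lemma pt_balanced: 
  assumes "x \<in> carrier M" "r \<in> carrier R" "y \<in> carrier N"
  shows "pt (rsmult M x r) y = pt x (r \<odot>\<^sub>N y)"
proof -
  have "frag_of (rsmult M x r, y) - frag_of (x, r \<odot>\<^sub>N y) \<in> Rel"
    unfolding tensor_relations_def using assms by (intro generate.incl) blast
  then show ?thesis unfolding ptensor_def
    using assms by (intro coset_eqI) (simp_all add: ND MD)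
qed

text \<open>
  A general element of the free abelian group is a difference of sums of generators. The negatives can be dropped
  because \<open>- (x \<otimes> y) = (- x) \<otimes> y\<close>; to carry them through the induction over the free
  group, the statement is proved for an element together with its negative.
\<close>

lemma tensor_induct [consumes 1, case_names pt add]:
  assumes t: "t \<in> carrier T"
    and pt: "\<And>x y. x \<in> carrier M \<Longrightarrow> y \<in> carrier N \<Longrightarrow> P (pt x y)"
    and add: "\<And>s t. s \<in> carrier T \<Longrightarrow> t \<in> carrier T \<Longrightarrow> P s \<Longrightarrow> P t \<Longrightarrow> P (s \<oplus>\<^sub>T t)"
  shows "P t"
proof -
  interpret T: abelian_group T by (rule tensor_abelian)
  interpret MM: abelian_group M by (rule MD)
  have neg: "\<ominus>\<^sub>T pt x y = pt (\<ominus>\<^sub>M x) y" and zero: "pt \<zero>\<^sub>M y = \<zero>\<^sub>T"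
    if "x \<in> carrier M" "y \<in> carrier N" for x y
  proof -
    have "pt \<zero>\<^sub>M y \<oplus>\<^sub>T pt \<zero>\<^sub>M y = pt \<zero>\<^sub>M y"
      using that pt_add_left[of "\<zero>\<^sub>M" "\<zero>\<^sub>M" y] by simp
    then show z: "pt \<zero>\<^sub>M y = \<zero>\<^sub>T" using that by simp
    have "pt (\<ominus>\<^sub>M x) y \<oplus>\<^sub>T pt x y = \<zero>\<^sub>T"
      using that pt_add_left[of "\<ominus>\<^sub>M x" x y] z by (simp add: MM.l_neg)
    then show "\<ominus>\<^sub>T pt x y = pt (\<ominus>\<^sub>M x) y"
      using that by (intro T.minus_equality) auto
  qed
  obtain c where c: "c \<in> carrier Fr" "t = Rel #>\<^bsub>Fr\<^esub> c"
    using t by (auto simp: carrier_tensor tensor_group_def carrier_FactGroup)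
  let ?Q = "\<lambda>c. P (Rel #>\<^bsub>Fr\<^esub> c) \<and> P (\<ominus>\<^sub>T (Rel #>\<^bsub>Fr\<^esub> c))"
  have "?Q c"
  proof (rule free_Abelian_group_induct[where S = "carrier M \<times> carrier N"])
    show "Poly_Mapping.keys c \<subseteq> carrier M \<times> carrier N" using c by simp
    have z: "Rel #>\<^bsub>Fr\<^esub> 0 = \<zero>\<^sub>T"
      using group.coset_mult_one[OF group_free_Abelian_group subgroup.subset[OF Rel_subgroup]]
      by (simp add: tensor_def tensor_group_def)
    have "P \<zero>\<^sub>T" using pt[OF MD(8) ND(8)] zero[OF MD(8) ND(8)] by simp
    then show "?Q 0" by (metis z T.l_zero T.minus_equality T.zero_closed)
    fix x y :: "'m \<times> 'n \<Rightarrow>\<^sub>0 int"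
    assume x: "Poly_Mapping.keys x \<subseteq> carrier M \<times> carrier N"
      and y: "Poly_Mapping.keys y \<subseteq> carrier M \<times> carrier N" and Q: "?Q x" "?Q y"
    have cx: "Rel #>\<^bsub>Fr\<^esub> x \<in> carrier T" "Rel #>\<^bsub>Fr\<^esub> y \<in> carrier T" "Rel #>\<^bsub>Fr\<^esub> (x - y) \<in> carrier T"
      using x y frag_diff_carrier[of x y] by (auto intro: coset_carrier)
    have "(Rel #>\<^bsub>Fr\<^esub> (x - y)) \<oplus>\<^sub>T (Rel #>\<^bsub>Fr\<^esub> y) = Rel #>\<^bsub>Fr\<^esub> x"
      using x y frag_diff_carrier[of x y] by (subst coset_add) auto
    then have e: "Rel #>\<^bsub>Fr\<^esub> (x - y) = (Rel #>\<^bsub>Fr\<^esub> x) \<oplus>\<^sub>T \<ominus>\<^sub>T (Rel #>\<^bsub>Fr\<^esub> y)"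
      using cx by (metis T.a_closed T.r_neg1 T.r_neg2 T.a_comm T.a_inv_closed)
    then have e': "\<ominus>\<^sub>T (Rel #>\<^bsub>Fr\<^esub> (x - y)) = (\<ominus>\<^sub>T (Rel #>\<^bsub>Fr\<^esub> x)) \<oplus>\<^sub>T (Rel #>\<^bsub>Fr\<^esub> y)"
      using cx by (simp add: T.minus_add)
    show "?Q (x - y)" using Q cx unfolding e' unfolding e by (auto intro!: add)
  next
    fix a assume "a \<in> carrier M \<times> carrier N"
    then obtain x y where a: "a = (x, y)" "x \<in> carrier M" "y \<in> carrier N" by auto
    show "?Q (frag_of a)"
      using pt[of x y] pt[of "\<ominus>\<^sub>M x" y] neg[of x y] a by (simp add: ptensor_def)
  qed
  then show ?thesis using c by simp
qed

lemma additive_map_eqI: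
  assumes "additive_map T L h" "additive_map T L h'" "t \<in> carrier T"
    and "\<And>x y. x \<in> carrier M \<Longrightarrow> y \<in> carrier N \<Longrightarrow> h (pt x y) = h' (pt x y)"
  shows "h t = h' t"
  using assms(3) by (induction rule: tensor_induct) (use assms in \<open>auto simp: additive_map_def\<close>)

text \<open>
  The homomorphism from the free abelian group determined by \<open>F\<close> vanishes on the relations and
  therefore factors through the quotient. \<^const>\<open>tensor_lift\<close> is a definite description; its
  uniqueness is \<open>additive_map_eqI\<close> together with extensionality.
\<close>

lemma
  assumes L: "abelian_group L" and F: "balanced R M N L F"
  shows lift_additive: "additive_map T L (tensor_lift R M N (additive_group L) F)"
    and lift_pt: "\<And>x y. x \<in> carrier M \<Longrightarrow> y \<in> carrier N \<Longrightarrow>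
       tensor_lift R M N (additive_group L) F (pt x y) = F x y"
proof -
  interpret L: abelian_group L by fact
  have cL: "comm_group (additive_group L)" using L by (simp only: comm_group_additive_group)
  obtain h where h: "h \<in> hom Fr (additive_group L)"
    "\<And>z. z \<in> carrier M \<times> carrier N \<Longrightarrow> h (frag_of z) = (case z of (x, y) \<Rightarrow> F x y)"
    by (rule comm_group.free_Abelian_group_universal[OF cL, of "\<lambda>(x, y). F x y" "carrier M \<times> carrier N"])
      (use F in \<open>auto simp: balanced_def\<close>)
  interpret h: group_hom Fr "additive_group L" h
    using h(1) cL by (simp add: group_hom_def group_hom_axioms_def comm_group_def)
  have hdiff: "h (a - b) = h a \<ominus>\<^sub>L h b" if "a \<in> carrier Fr" "b \<in> carrier Fr" for a b
  proof -
    have "h ((a - b) + b) = h (a - b) \<oplus>\<^sub>L h b"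
      using h.hom_mult[of "a - b" b] that frag_diff_carrier[of a b] by simp
    moreover have "h a \<in> carrier L" "h b \<in> carrier L" "h (a - b) \<in> carrier L"
      using h.hom_closed that frag_diff_carrier[of a b] by (auto simp del: carrier_free_Abelian_group_iff)
    ultimately show ?thesis by (simp add: L.minus_eq L.a_assoc L.r_neg)
  qed
  have fr: "frag_of z \<in> carrier Fr" if "z \<in> carrier M \<times> carrier N" for z using that by simp
  have Fc: "\<And>x y. x \<in> carrier M \<Longrightarrow> y \<in> carrier N \<Longrightarrow> F x y \<in> carrier L" 
    using F by (simp add: balanced_def)
  have minus0: "(a \<oplus>\<^sub>L b) \<ominus>\<^sub>L a \<ominus>\<^sub>L b = \<zero>\<^sub>L" if "a \<in> carrier L" "b \<in> carrier L" for a b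
    using that by (simp add: L.minus_eq L.a_assoc L.r_neg L.a_comm[of a] L.r_neg1)
  have minus1: "a \<ominus>\<^sub>L a = \<zero>\<^sub>L" if "a \<in> carrier L" for a using that by (simp add: L.minus_eq L.r_neg)
  have "Rel \<subseteq> kernel Fr (additive_group L) h"
    unfolding tensor_relations_def
  proof (rule group.generate_subgroup_incl[OF group_free_Abelian_group _ h.subgroup_kernel], rule subsetI)
    fix z assume "z \<in> {frag_of (x \<oplus>\<^sub>M x', y) - frag_of (x, y) - frag_of (x', y) | x x' y.
          x \<in> carrier M \<and> x' \<in> carrier M \<and> y \<in> carrier N}
    \<union> {frag_of (x, y \<oplus>\<^sub>N y') - frag_of (x, y) - frag_of (x, y') | x y y'.
          x \<in> carrier M \<and> y \<in> carrier N \<and> y' \<in> carrier N}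
    \<union> {frag_of (rsmult M x r, y) - frag_of (x, r \<odot>\<^sub>N y) | x r y.
          x \<in> carrier M \<and> r \<in> carrier R \<and> y \<in> carrier N}"
    then consider
      (1) x x' y where "x \<in> carrier M" "x' \<in> carrier M" "y \<in> carrier N"
        "z = frag_of (x \<oplus>\<^sub>M x', y) - frag_of (x, y) - frag_of (x', y)"
    | (2) x y y' where "x \<in> carrier M" "y \<in> carrier N" "y' \<in> carrier N"
        "z = frag_of (x, y \<oplus>\<^sub>N y') - frag_of (x, y) - frag_of (x, y')"
    | (3) x r y where "x \<in> carrier M" "r \<in> carrier R" "y \<in> carrier N"
        "z = frag_of (rsmult M x r, y) - frag_of (x, r \<odot>\<^sub>N y)"
      by blast
    then have "z \<in> carrier Fr \<and> h z = \<zero>\<^sub>L"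
    proof cases
      case 1
      then have i: "(x \<oplus>\<^sub>M x', y) \<in> carrier M \<times> carrier N" "(x, y) \<in> carrier M \<times> carrier N" "(x', y) \<in> carrier M \<times> carrier N"
        by (auto simp: MD)
      have "h z = F (x \<oplus>\<^sub>M x') y \<ominus>\<^sub>L F x y \<ominus>\<^sub>L F x' y"
        unfolding 1 by (simp only: i fr frag_diff_carrier hdiff h(2) split_conv)
      also have "\<dots> = \<zero>\<^sub>L" using 1 F minus0 by (simp add: balanced_def)
      finally show ?thesis unfolding 1 by (simp only: i fr frag_diff_carrier simp_thms)
    next
      case 2
      then have i: "(x, y \<oplus>\<^sub>N y') \<in> carrier M \<times> carrier N" "(x, y) \<in> carrier M \<times> carrier N" "(x, y') \<in> carrier M \<times> carrier N"
        by (auto simp: ND)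
      have "h z = F x (y \<oplus>\<^sub>N y') \<ominus>\<^sub>L F x y \<ominus>\<^sub>L F x y'"
        unfolding 2 by (simp only: i fr frag_diff_carrier hdiff h(2) split_conv)
      also have "\<dots> = \<zero>\<^sub>L" using 2 F minus0 by (simp add: balanced_def)
      finally show ?thesis unfolding 2 by (simp only: i fr frag_diff_carrier simp_thms)
    next
      case 3
      then have i: "(rsmult M x r, y) \<in> carrier M \<times> carrier N" "(x, r \<odot>\<^sub>N y) \<in> carrier M \<times> carrier N"
        by (auto simp: MD ND)
      have "h z = F (rsmult M x r) y \<ominus>\<^sub>L F x (r \<odot>\<^sub>N y)"
        unfolding 3 by (simp only: i fr frag_diff_carrier hdiff h(2) split_conv)
      also have "\<dots> = \<zero>\<^sub>L" using 3 F minus1 Fc ND by (simp add: balanced_def)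
      finally show ?thesis unfolding 3 by (simp only: i fr frag_diff_carrier simp_thms)
    qed
    then show "z \<in> kernel Fr (additive_group L) h" by (simp add: kernel_def)
  qed
  then have hz: "h z = \<zero>\<^sub>L" if "z \<in> Rel" for z using that by (auto simp: kernel_def)
  have inv: "h a = h b" if "a \<in> carrier Fr" "b \<in> carrier Fr" "Rel #>\<^bsub>Fr\<^esub> a = Rel #>\<^bsub>Fr\<^esub> b" for a b
  proof -
    have "a \<in> Rel #>\<^bsub>Fr\<^esub> b"
      using group.rcos_self[OF group_free_Abelian_group that(1) Rel_subgroup] that(3) by simp
    then obtain r where r: "r \<in> Rel" "a = r + b" by (auto simp: r_coset_def)
    moreover have "r \<in> carrier Fr" using r Rel_subgroup subgroup.mem_carrier by fastforce
    ultimately have "h a = h r \<oplus>\<^sub>L h b" using h.hom_mult[of r b] that by simp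
    then show ?thesis using hz r that h.hom_closed[of b] by simp
  qed
  obtain g where g: "g \<in> hom (Fr Mod Rel) (additive_group L)"
    "\<And>x. x \<in> carrier Fr \<Longrightarrow> g (Rel #>\<^bsub>Fr\<^esub> x) = h x"
    using FactGroup_universal[OF h(1) Rel_normal inv] by blast
  define k where "k = restrict g (carrier (tensor_group R M N))"
  let ?P = "\<lambda>h. h \<in> hom (tensor_group R M N) (additive_group L) \<and>
     h \<in> extensional (carrier (tensor_group R M N)) \<and>
     (\<forall>x\<in>carrier M. \<forall>y\<in>carrier N. h (pt x y) = F x y)"
  interpret T: abelian_group T by (rule tensor_abelian)
  have add_iff: "h \<in> hom (tensor_group R M N) (additive_group L) \<longleftrightarrow> additive_map T L h" for h
    by (auto simp: hom_def additive_map_def tensor_def)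
  have "additive_map T L g" using g(1) add_iff by (simp add: tensor_group_def)
  then have "additive_map T L k"
    by (auto simp: additive_map_def k_def simp flip: carrier_tensor)
  moreover have "\<forall>x\<in>carrier M. \<forall>y\<in>carrier N. k (pt x y) = F x y"
  proof (intro ballI)
    fix x y assume "x \<in> carrier M" "y \<in> carrier N"
    then show "k (pt x y) = F x y"
      using g(2)[of "frag_of (x, y)"] h(2)[of "(x, y)"] pt_closed[of x y]
      by (simp add: k_def ptensor_def flip: carrier_tensor)
  qed
  ultimately have k: "?P k" unfolding add_iff by (simp add: k_def)
  have "tensor_lift R M N (additive_group L) F = k"
    unfolding tensor_lift_def
  proof (rule the_equality)
    show "?P k" by (rule k)
    fix h assume h: "?P h"
    show "h = k"
    proof (rule extensionalityI)
      show "h \<in> extensional (carrier T)" "k \<in> extensional (carrier T)" using h k by (simp_all add: carrier_tensor)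
      fix t assume "t \<in> carrier T"
      then show "h t = k t"
        by (rule additive_map_eqI[of L h k, rotated 2]) (use h k in \<open>auto simp: add_iff\<close>)
    qed
  qed
  then show "additive_map T L (tensor_lift R M N (additive_group L) F)"
    "\<And>x y. x \<in> carrier M \<Longrightarrow> y \<in> carrier N \<Longrightarrow> tensor_lift R M N (additive_group L) F (pt x y) = F x y"
    using k unfolding add_iff by auto
qed

end

section \<open>Bimodule structure, functoriality and associativity of the tensor product\<close>

definition bimod_hom ::
  "('a, 'r) ring_scheme \<Rightarrow> ('a, 'm) bimodule \<Rightarrow> ('a, 'n) bimodule \<Rightarrow> ('m \<Rightarrow> 'n) set" where
  "bimod_hom R M N = {f \<in> mod_hom R M N.
     \<forall>x\<in>carrier M. \<forall>r\<in>carrier R. f (rsmult M x r) = rsmult N (f x) r}"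

lemma mod_homD:
  assumes "f \<in> mod_hom R M N"
  shows "\<And>x. x \<in> carrier M \<Longrightarrow> f x \<in> carrier N"
    "\<And>x y. x \<in> carrier M \<Longrightarrow> y \<in> carrier M \<Longrightarrow> f (x \<oplus>\<^sub>M y) = f x \<oplus>\<^sub>N f y"
    "\<And>r x. r \<in> carrier R \<Longrightarrow> x \<in> carrier M \<Longrightarrow> f (r \<odot>\<^sub>M x) = r \<odot>\<^sub>N f x"
  using assms by (auto simp: mod_hom_def)

lemma mod_homI:
  assumes "\<And>x. x \<in> carrier M \<Longrightarrow> f x \<in> carrier N"
    "\<And>x y. x \<in> carrier M \<Longrightarrow> y \<in> carrier M \<Longrightarrow> f (x \<oplus>\<^sub>M y) = f x \<oplus>\<^sub>N f y"
    "\<And>r x. r \<in> carrier R \<Longrightarrow> x \<in> carrier M \<Longrightarrow> f (r \<odot>\<^sub>M x) = r \<odot>\<^sub>N f x"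
  shows "f \<in> mod_hom R M N"
  using assms by (auto simp: mod_hom_def)

lemma mod_hom_additive: "f \<in> mod_hom R M N \<Longrightarrow> additive_map M N f"
  by (auto simp: mod_hom_def additive_map_def)

lemma bimod_hom_mod_hom: "f \<in> bimod_hom R M N \<Longrightarrow> f \<in> mod_hom R M N"
  by (simp add: bimod_hom_def)

lemma bimod_hom_rsmult: "f \<in> bimod_hom R M N \<Longrightarrow> x \<in> carrier M \<Longrightarrow> r \<in> carrier R \<Longrightarrow>
    f (rsmult M x r) = rsmult N (f x) r"
  by (simp add: bimod_hom_def)

lemma bimod_iso_iff: "f \<in> bimod_iso R M N \<longleftrightarrow> f \<in> bimod_hom R M N \<and> bij_betw f (carrier M) (carrier N)"
  by (auto simp: bimod_iso_def bimod_hom_def mod_iso_def)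

lemma bimod_hom_id: "id \<in> bimod_hom R M M"
  by (simp add: bimod_hom_def mod_hom_def)

lemma bimod_iso_id: "id \<in> bimod_iso R M M"
  by (simp add: bimod_iso_iff bimod_hom_id)

lemma mod_iso_inv:
  assumes "f \<in> mod_iso R M N" "module R M"
  shows "inv_into (carrier M) f \<in> mod_iso R N M"
proof -
  interpret M: module R M by fact
  let ?g = "inv_into (carrier M) f"
  have h: "f \<in> mod_hom R M N" and b: "bij_betw f (carrier M) (carrier N)"
    using assms by (auto simp: mod_iso_def)
  note H = mod_homD[OF h]
  have g: "bij_betw ?g (carrier N) (carrier M)" using b by (rule bij_betw_inv_into)
  then have gc: "\<And>y. y \<in> carrier N \<Longrightarrow> ?g y \<in> carrier M" by (auto simp: bij_betw_def)
  have fg: "\<And>y. y \<in> carrier N \<Longrightarrow> f (?g y) = y" using b by (simp add: bij_betw_inv_into_right)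
  have inj: "\<And>x. x \<in> carrier M \<Longrightarrow> ?g (f x) = x" using b by (simp add: bij_betw_inv_into_left)
  have "?g \<in> mod_hom R N M"
  proof (rule mod_homI)
    fix x y assume "x \<in> carrier N" "y \<in> carrier N"
    then show "?g (x \<oplus>\<^sub>N y) = ?g x \<oplus>\<^sub>M ?g y"
      using inj[of "?g x \<oplus>\<^sub>M ?g y"] by (simp add: gc H fg)
  next
    fix r x assume "r \<in> carrier R" "x \<in> carrier N"
    then show "?g (r \<odot>\<^sub>N x) = r \<odot>\<^sub>M ?g x"
      using inj[of "r \<odot>\<^sub>M ?g x"] by (simp add: gc H fg)
  qed (rule gc)
  then show ?thesis using g by (simp add: mod_iso_def)
qed

lemma bimod_iso_inv:
  assumes "f \<in> bimod_iso R M N" "is_bimodule R M"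
  shows "inv_into (carrier M) f \<in> bimod_iso R N M"
proof -
  let ?g = "inv_into (carrier M) f"
  have b: "bij_betw f (carrier M) (carrier N)" and f: "f \<in> bimod_hom R M N"
    using assms by (auto simp: bimod_iso_iff)
  have g: "bij_betw ?g (carrier N) (carrier M)" using b by (rule bij_betw_inv_into)
  then have gc: "\<And>y. y \<in> carrier N \<Longrightarrow> ?g y \<in> carrier M" by (auto simp: bij_betw_def)
  have fg: "\<And>y. y \<in> carrier N \<Longrightarrow> f (?g y) = y" using b by (simp add: bij_betw_inv_into_right)
  have inj: "\<And>x. x \<in> carrier M \<Longrightarrow> ?g (f x) = x" using b by (simp add: bij_betw_inv_into_left)
  have "?g \<in> mod_iso R N M"
    using assms by (intro mod_iso_inv) (auto simp: bimod_iso_def bimoduleD)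
  moreover have "?g (rsmult N y r) = rsmult M (?g y) r" if "y \<in> carrier N" "r \<in> carrier R" for y r
    using inj[of "rsmult M (?g y) r"] that by (simp add: gc bimod_hom_rsmult[OF f] fg bimoduleD(4)[OF assms(2)])
  ultimately show ?thesis by (simp add: bimod_iso_def)
qed

lemma module_abelian: "module R M \<Longrightarrow> abelian_group M"
  by (simp add: module_def)

context tensor_product
begin

lemma lift_closed:
  assumes "abelian_group L" "balanced R M N L F" "t \<in> carrier T"
  shows "tensor_lift R M N (additive_group L) F t \<in> carrier L"
  using lift_additive[OF assms(1,2)] assms(3) by (simp add: additive_map_def)

lemma lift_add:
  assumes "abelian_group L" "balanced R M N L F" "s \<in> carrier T" "t \<in> carrier T"
  shows "tensor_lift R M N (additive_group L) F (s \<oplus>\<^sub>T t) =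
    tensor_lift R M N (additive_group L) F s \<oplus>\<^sub>L tensor_lift R M N (additive_group L) F t"
  using lift_additive[OF assms(1,2)] assms(3,4) by (simp add: additive_map_def)

lemma tensor_smult: "r \<odot>\<^sub>T t = tensor_lift R M N (additive_group T) (\<lambda>x y. pt (r \<odot>\<^sub>M x) y) t"
  unfolding additive_group_tensor by (simp add: tensor_def)

lemma tensor_rsmult: "rsmult T t r = tensor_lift R M N (additive_group T) (\<lambda>x y. pt x (rsmult N y r)) t"
  unfolding additive_group_tensor by (simp add: tensor_def)

lemma smult_balanced: "r \<in> carrier R \<Longrightarrow> balanced R M N T (\<lambda>x y. pt (r \<odot>\<^sub>M x) y)"
  by (simp add: balanced_def MD ND pt_add_left pt_add_right pt_balanced module.smult_r_distr[OF MD(1)])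

lemma rsmult_balanced: "r \<in> carrier R \<Longrightarrow> balanced R M N T (\<lambda>x y. pt x (rsmult N y r))"
  by (simp add: balanced_def MD ND pt_add_left pt_add_right pt_balanced flip: ND(6))

lemma smult_closed: "r \<in> carrier R \<Longrightarrow> t \<in> carrier T \<Longrightarrow> r \<odot>\<^sub>T t \<in> carrier T"
  unfolding tensor_smult by (intro lift_closed tensor_abelian smult_balanced)

lemma smult_pt: "r \<in> carrier R \<Longrightarrow> x \<in> carrier M \<Longrightarrow> y \<in> carrier N \<Longrightarrow>
    r \<odot>\<^sub>T pt x y = pt (r \<odot>\<^sub>M x) y"
  unfolding tensor_smult by (simp add: lift_pt tensor_abelian smult_balanced)

lemma smult_add: "r \<in> carrier R \<Longrightarrow> s \<in> carrier T \<Longrightarrow> t \<in> carrier T \<Longrightarrow>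
    r \<odot>\<^sub>T (s \<oplus>\<^sub>T t) = r \<odot>\<^sub>T s \<oplus>\<^sub>T r \<odot>\<^sub>T t"
  unfolding tensor_smult by (intro lift_add tensor_abelian smult_balanced)

lemma rsmult_closed: "r \<in> carrier R \<Longrightarrow> t \<in> carrier T \<Longrightarrow> rsmult T t r \<in> carrier T"
  unfolding tensor_rsmult by (intro lift_closed tensor_abelian rsmult_balanced)

lemma rsmult_pt: "r \<in> carrier R \<Longrightarrow> x \<in> carrier M \<Longrightarrow> y \<in> carrier N \<Longrightarrow>
    rsmult T (pt x y) r = pt x (rsmult N y r)"
  unfolding tensor_rsmult by (simp add: lift_pt tensor_abelian rsmult_balanced)

lemma rsmult_add: "r \<in> carrier R \<Longrightarrow> s \<in> carrier T \<Longrightarrow> t \<in> carrier T \<Longrightarrow>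
    rsmult T (s \<oplus>\<^sub>T t) r = rsmult T s r \<oplus>\<^sub>T rsmult T t r"
  unfolding tensor_rsmult by (intro lift_add tensor_abelian rsmult_balanced)

lemma tensor_module: "module R T"
proof -
  interpret T: abelian_group T by (rule tensor_abelian)
  interpret MM: module R M by (rule MD)
  note c = smult_closed smult_pt smult_add
  show ?thesis
  proof (rule moduleI)
    fix a b t assume ab: "a \<in> carrier R" "b \<in> carrier R" and t: "t \<in> carrier T"
    show "(a \<oplus>\<^sub>R b) \<odot>\<^sub>T t = a \<odot>\<^sub>T t \<oplus>\<^sub>T b \<odot>\<^sub>T t"
      using t
    proof (induction rule: tensor_induct)
      case (add s t)
      then show ?case using ab by (simp add: c T.a_ac)
    qed (use ab in \<open>simp add: c pt_add_left MM.smult_l_distr\<close>)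
    show "(a \<otimes>\<^sub>R b) \<odot>\<^sub>T t = a \<odot>\<^sub>T (b \<odot>\<^sub>T t)"
      using t by (induction rule: tensor_induct) (use ab in \<open>simp_all add: c MM.smult_assoc1\<close>)
  next
    fix t assume t: "t \<in> carrier T"
    show "\<one>\<^sub>R \<odot>\<^sub>T t = t"
      using t by (induction rule: tensor_induct) (simp_all add: c)
  qed (use MD tensor_abelian c in auto)
qed

lemma tensor_bimodule: "is_bimodule R T"
proof -
  have "r \<odot>\<^sub>T rsmult T t s = rsmult T (r \<odot>\<^sub>T t) s"
    if rs: "r \<in> carrier R" "s \<in> carrier R" and t: "t \<in> carrier T" for r s t
    using t by (induction rule: tensor_induct) (use rs in \<open>simp_all add: smult_closed smult_pt smult_add rsmult_closed rsmult_pt rsmult_add MD ND\<close>)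
  then show ?thesis
    by (simp add: is_bimodule_def tensor_module rsmult_closed rsmult_add)
qed

lemma lift_mod_hom:
  assumes L: "module R L" and F: "balanced R M N L F"
    and lin: "\<And>r x y. r \<in> carrier R \<Longrightarrow> x \<in> carrier M \<Longrightarrow> y \<in> carrier N \<Longrightarrow> F (r \<odot>\<^sub>M x) y = r \<odot>\<^sub>L F x y"
  shows "tensor_lift R M N (additive_group L) F \<in> mod_hom R T L"
proof -
  interpret L: module R L by fact
  note l = lift_closed[OF module_abelian[OF L] F] lift_add[OF module_abelian[OF L] F] lift_pt[OF module_abelian[OF L] F]
  show ?thesis
  proof (rule mod_homI)
    fix r t assume r: "r \<in> carrier R" and t: "t \<in> carrier T"
    show "tensor_lift R M N (additive_group L) F (r \<odot>\<^sub>T t) = r \<odot>\<^sub>L tensor_lift R M N (additive_group L) F t"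
      using t by (induction rule: tensor_induct)
        (use r in \<open>simp_all add: l smult_closed smult_pt smult_add MD lin L.smult_r_distr\<close>)
  qed (simp_all add: l)
qed

lemma lift_bimod_hom:
  assumes L: "is_bimodule R L" and F: "balanced R M N L F"
    and lin: "\<And>r x y. r \<in> carrier R \<Longrightarrow> x \<in> carrier M \<Longrightarrow> y \<in> carrier N \<Longrightarrow> F (r \<odot>\<^sub>M x) y = r \<odot>\<^sub>L F x y"
    and rlin: "\<And>r x y. r \<in> carrier R \<Longrightarrow> x \<in> carrier M \<Longrightarrow> y \<in> carrier N \<Longrightarrow> F x (rsmult N y r) = rsmult L (F x y) r"
  shows "tensor_lift R M N (additive_group L) F \<in> bimod_hom R T L"
proof -
  note LD = bimoduleD[OF L]
  note l = lift_closed[OF LD(2) F] lift_add[OF LD(2) F] lift_pt[OF LD(2) F]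
  have Fc: "\<And>x y. x \<in> carrier M \<Longrightarrow> y \<in> carrier N \<Longrightarrow> F x y \<in> carrier L"
    using F by (simp add: balanced_def)
  have "tensor_lift R M N (additive_group L) F (rsmult T t r) = rsmult L (tensor_lift R M N (additive_group L) F t) r"
    if r: "r \<in> carrier R" and t: "t \<in> carrier T" for r t
    using t by (induction rule: tensor_induct)
      (use r in \<open>simp_all add: l rsmult_closed rsmult_pt rsmult_add MD ND rlin LD(5)\<close>)
  then show ?thesis
    using lift_mod_hom[OF LD(1) F lin] by (simp add: bimod_hom_def)
qed

end

lemmas (in tensor_product) tensor_simps =
  pt_closed pt_add_left pt_add_right pt_balanced smult_pt smult_add rsmult_pt rsmult_add smult_closed rsmult_closed

lemma
  assumes "is_bimodule R M" "is_bimodule R N" "is_bimodule R M'" "is_bimodule R N'"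
    and f: "f \<in> bimod_hom R M M'" and g: "g \<in> bimod_hom R N N'"
  shows tensor_map_hom: "tensor_map R M N M' N' f g \<in> bimod_hom R (tensor R M N) (tensor R M' N')"
    and tensor_map_pt: "\<And>x y. x \<in> carrier M \<Longrightarrow> y \<in> carrier N \<Longrightarrow>
      tensor_map R M N M' N' f g (ptensor R M N x y) = ptensor R M' N' (f x) (g y)"
proof -
  interpret A: tensor_product R M N using assms by (simp add: tensor_product_def)
  interpret B: tensor_product R M' N' using assms by (simp add: tensor_product_def)
  note F = mod_homD[OF bimod_hom_mod_hom[OF f]] bimod_hom_rsmult[OF f]
  note G = mod_homD[OF bimod_hom_mod_hom[OF g]] bimod_hom_rsmult[OF g]
  have bal: "balanced R M N (tensor R M' N') (\<lambda>x y. ptensor R M' N' (f x) (g y))"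
    by (simp add: balanced_def F G B.pt_add_left B.pt_add_right B.pt_balanced)
  show "tensor_map R M N M' N' f g \<in> bimod_hom R (tensor R M N) (tensor R M' N')"
    unfolding tensor_map_def additive_group_tensor[symmetric]
    by (rule A.lift_bimod_hom[OF B.tensor_bimodule bal]) (simp_all add: F G B.smult_pt B.rsmult_pt)
  show "\<And>x y. x \<in> carrier M \<Longrightarrow> y \<in> carrier N \<Longrightarrow>
      tensor_map R M N M' N' f g (ptensor R M N x y) = ptensor R M' N' (f x) (g y)"
    unfolding tensor_map_def additive_group_tensor[symmetric]
    by (rule A.lift_pt[OF B.tensor_abelian bal])
qed

lemma bimod_iso_byWitness:
  assumes "f \<in> bimod_hom R M N" "g \<in> bimod_hom R N M"
    "\<And>x. x \<in> carrier M \<Longrightarrow> g (f x) = x" "\<And>y. y \<in> carrier N \<Longrightarrow> f (g y) = y"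
  shows "f \<in> bimod_iso R M N"
  unfolding bimod_iso_iff using assms
  by (auto intro!: bij_betw_byWitness[where f' = g] simp: bimod_hom_def mod_hom_def)

lemma additive_map_comp: "additive_map A B f \<Longrightarrow> additive_map B C g \<Longrightarrow> additive_map A C (\<lambda>x. g (f x))"
  by (auto simp: additive_map_def)

lemma additive_map_ident: "additive_map A A (\<lambda>x. x)"
  by (auto simp: additive_map_def)

lemma tensor_map_iso:
  assumes "is_bimodule R M" "is_bimodule R N" "is_bimodule R M'" "is_bimodule R N'"
    and f: "f \<in> bimod_iso R M M'" and g: "g \<in> bimod_iso R N N'"
  shows "tensor_map R M N M' N' f g \<in> bimod_iso R (tensor R M N) (tensor R M' N')"
proof -
  interpret A: tensor_product R M N using assms by (simp add: tensor_product_def)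
  interpret B: tensor_product R M' N' using assms by (simp add: tensor_product_def)
  let ?f = "inv_into (carrier M) f" and ?g = "inv_into (carrier N) g"
  have i: "f \<in> bimod_hom R M M'" "g \<in> bimod_hom R N N'" "?f \<in> bimod_hom R M' M" "?g \<in> bimod_hom R N' N"
    using f g bimod_iso_inv assms by (auto simp: bimod_iso_iff)
  note c = mod_homD(1)[OF bimod_hom_mod_hom]
  have inv: "\<And>x. x \<in> carrier M \<Longrightarrow> ?f (f x) = x" "\<And>x. x \<in> carrier M' \<Longrightarrow> f (?f x) = x"
    "\<And>x. x \<in> carrier N \<Longrightarrow> ?g (g x) = x" "\<And>x. x \<in> carrier N' \<Longrightarrow> g (?g x) = x"
    using f g by (auto simp: bimod_iso_iff bij_betw_inv_into_left bij_betw_inv_into_right)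
  note t = tensor_map_hom[OF assms(1-4) i(1,2)] tensor_map_hom[OF assms(3,4,1,2) i(3,4)]
  note p = tensor_map_pt[OF assms(1-4) i(1,2)] tensor_map_pt[OF assms(3,4,1,2) i(3,4)]
  note ad = t[THEN bimod_hom_mod_hom, THEN mod_hom_additive]
  show ?thesis
  proof (rule bimod_iso_byWitness[OF t])
    fix t assume "t \<in> carrier (tensor R M N)"
    then show "tensor_map R M' N' M N ?f ?g (tensor_map R M N M' N' f g t) = t"
      by (rule A.additive_map_eqI[OF additive_map_comp[OF ad] additive_map_ident])
        (simp add: p c[OF i(1)] c[OF i(2)] inv)
  next
    fix t assume "t \<in> carrier (tensor R M' N')"
    then show "tensor_map R M N M' N' f g (tensor_map R M' N' M N ?f ?g t) = t"
      by (rule B.additive_map_eqI[OF additive_map_comp[OF ad(2,1)] additive_map_ident])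
        (simp add: p c[OF i(3)] c[OF i(4)] inv)
  qed
qed

text \<open>
  Both bracketings of a threefold tensor product with the tensor products that occur in them. The final letters
  distinguish the left bracketing \<open>L\<close> from the right one \<open>U\<close>.
\<close>

locale tensor_triple =
  fixes R :: "('a, 'r) ring_scheme" and A :: "('a, 'm) bimodule" and B :: "('a, 'n) bimodule"
    and C :: "('a, 'k) bimodule"
  assumes A: "is_bimodule R A" and B: "is_bimodule R B" and C: "is_bimodule R C"
begin

sublocale AB: tensor_product R A B using A B by unfold_locales
sublocale BC: tensor_product R B C using B C by unfold_locales
sublocale L: tensor_product R "tensor R A B" C using AB.tensor_bimodule C by unfold_locales
sublocale U: tensor_product R A "tensor R B C" using A BC.tensor_bimodule by unfold_locales

lemmas AD = bimoduleD[OF A] and BD = bimoduleD[OF B] and CD = bimoduleD[OF C]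

lemma assoc_inner:
  assumes "c \<in> carrier C"
  shows "balanced R A B (tensor R A (tensor R B C)) (\<lambda>a b. U.pt a (BC.pt b c))"
  using assms by (simp add: balanced_def U.tensor_simps BC.tensor_simps AD BD CD flip: BC.smult_pt)

lemma assoc_inner_bilinear:
  "balanced R (tensor R A B) C (tensor R A (tensor R B C))
     (\<lambda>t c. tensor_lift R A B (additive_group (tensor R A (tensor R B C))) (\<lambda>a b. U.pt a (BC.pt b c)) t)"
  (is "balanced R _ _ ?U ?F")
proof -
  interpret UU: abelian_group ?U by (rule U.tensor_abelian)
  note l = AB.lift_closed[OF U.tensor_abelian assoc_inner] AB.lift_add[OF U.tensor_abelian assoc_inner]
    AB.lift_pt[OF U.tensor_abelian assoc_inner]
  have 1: "?F t (c \<oplus>\<^sub>C c') = ?F t c \<oplus>\<^bsub>?U\<^esub> ?F t c'"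
    if c: "c \<in> carrier C" "c' \<in> carrier C" and t: "t \<in> carrier (tensor R A B)" for t c c'
    using t by (induction rule: AB.tensor_induct)
      (use c in \<open>simp_all add: l CD U.tensor_simps BC.tensor_simps UU.a_ac\<close>)
  have 2: "?F (rsmult (tensor R A B) t r) c = ?F t (r \<odot>\<^sub>C c)"
    if c: "c \<in> carrier C" "r \<in> carrier R" and t: "t \<in> carrier (tensor R A B)" for t c r
    using t by (induction rule: AB.tensor_induct)
      (use c in \<open>simp_all add: l CD BD AB.tensor_simps BC.tensor_simps\<close>)
  show ?thesis by (simp add: balanced_def 1 2 l)
qed

lemma assoc_hom: "tensor_assoc R A B C \<in> bimod_hom R (tensor R (tensor R A B) C) (tensor R A (tensor R B C))"
proof -
  let ?U = "tensor R A (tensor R B C)"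
  interpret UU: abelian_group ?U by (rule U.tensor_abelian)
  note l = AB.lift_closed[OF U.tensor_abelian assoc_inner] AB.lift_add[OF U.tensor_abelian assoc_inner]
    AB.lift_pt[OF U.tensor_abelian assoc_inner]
  let ?F = "\<lambda>t c. tensor_lift R A B (additive_group (tensor R A (tensor R B C))) (\<lambda>a b. U.pt a (BC.pt b c)) t"
  show ?thesis
    unfolding tensor_assoc_def additive_group_tensor[symmetric]
  proof (rule L.lift_bimod_hom[OF U.tensor_bimodule assoc_inner_bilinear])
    fix r t c assume r: "r \<in> carrier R" and t: "t \<in> carrier (tensor R A B)" and c: "c \<in> carrier C"
    show "?F (r \<odot>\<^bsub>tensor R A B\<^esub> t) c = r \<odot>\<^bsub>?U\<^esub> ?F t c"
      using t by (induction rule: AB.tensor_induct)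
        (use r c in \<open>simp_all add: l AD BC.tensor_simps U.tensor_simps AB.tensor_simps\<close>)
    show "?F t (rsmult C c r) = rsmult ?U (?F t c) r"
      using t by (induction rule: AB.tensor_induct)
        (use r c in \<open>simp_all add: l CD BC.tensor_simps U.tensor_simps AB.tensor_simps\<close>)
  qed
qed

lemma assoc_pt: "a \<in> carrier A \<Longrightarrow> b \<in> carrier B \<Longrightarrow> c \<in> carrier C \<Longrightarrow>
    tensor_assoc R A B C (L.pt (AB.pt a b) c) = U.pt a (BC.pt b c)"
  unfolding tensor_assoc_def additive_group_tensor[symmetric]
  by (simp add: L.lift_pt[OF U.tensor_abelian assoc_inner_bilinear] AB.lift_pt[OF U.tensor_abelian assoc_inner])

lemma coassoc_inner:
  assumes "a \<in> carrier A"
  shows "balanced R B C (tensor R (tensor R A B) C) (\<lambda>b c. L.pt (AB.pt a b) c)"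
  using assms by (simp add: balanced_def L.tensor_simps AB.tensor_simps AD BD CD flip: AB.rsmult_pt)

text \<open>The inverse of \<^const>\<open>tensor_assoc\<close>.\<close>

definition coassoc where
  "coassoc = tensor_lift R A (tensor R B C) (additive_group (tensor R (tensor R A B) C))
     (\<lambda>a t. tensor_lift R B C (additive_group (tensor R (tensor R A B) C)) (\<lambda>b c. L.pt (AB.pt a b) c) t)"

lemma coassoc_inner_bilinear:
  "balanced R A (tensor R B C) (tensor R (tensor R A B) C)
     (\<lambda>a t. tensor_lift R B C (additive_group (tensor R (tensor R A B) C)) (\<lambda>b c. L.pt (AB.pt a b) c) t)"
  (is "balanced R _ _ ?L ?F")
proof -
  interpret LL: abelian_group ?L by (rule L.tensor_abelian)
  note l = BC.lift_closed[OF L.tensor_abelian coassoc_inner] BC.lift_add[OF L.tensor_abelian coassoc_inner]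
    BC.lift_pt[OF L.tensor_abelian coassoc_inner]
  have 1: "?F (a \<oplus>\<^sub>A a') t = ?F a t \<oplus>\<^bsub>?L\<^esub> ?F a' t"
    if c: "a \<in> carrier A" "a' \<in> carrier A" and t: "t \<in> carrier (tensor R B C)" for t a a'
    using t by (induction rule: BC.tensor_induct)
      (use c in \<open>simp_all add: l AD L.tensor_simps AB.tensor_simps LL.a_ac\<close>)
  have 2: "?F (rsmult A a r) t = ?F a (r \<odot>\<^bsub>tensor R B C\<^esub> t)"
    if c: "a \<in> carrier A" "r \<in> carrier R" and t: "t \<in> carrier (tensor R B C)" for t a r
    using t by (induction rule: BC.tensor_induct)
      (use c in \<open>simp_all add: l AD BD AB.tensor_simps BC.tensor_simps\<close>)
  show ?thesis by (simp add: balanced_def 1 2 l)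
qed

lemma coassoc_hom: "coassoc \<in> bimod_hom R (tensor R A (tensor R B C)) (tensor R (tensor R A B) C)"
proof -
  let ?L = "tensor R (tensor R A B) C"
  interpret LL: abelian_group ?L by (rule L.tensor_abelian)
  note l = BC.lift_closed[OF L.tensor_abelian coassoc_inner] BC.lift_add[OF L.tensor_abelian coassoc_inner]
    BC.lift_pt[OF L.tensor_abelian coassoc_inner]
  let ?F = "\<lambda>a t. tensor_lift R B C (additive_group (tensor R (tensor R A B) C)) (\<lambda>b c. L.pt (AB.pt a b) c) t"
  show ?thesis
    unfolding coassoc_def
  proof (rule U.lift_bimod_hom[OF L.tensor_bimodule coassoc_inner_bilinear])
    fix r a t assume r: "r \<in> carrier R" and t: "t \<in> carrier (tensor R B C)" and a: "a \<in> carrier A"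
    show "?F (r \<odot>\<^sub>A a) t = r \<odot>\<^bsub>?L\<^esub> ?F a t"
      using t by (induction rule: BC.tensor_induct)
        (use r a in \<open>simp_all add: l AD BC.tensor_simps L.tensor_simps AB.tensor_simps\<close>)
    show "?F a (rsmult (tensor R B C) t r) = rsmult ?L (?F a t) r"
      using t by (induction rule: BC.tensor_induct)
        (use r a in \<open>simp_all add: l CD BC.tensor_simps L.tensor_simps AB.tensor_simps\<close>)
  qed
qed

lemma coassoc_pt: "a \<in> carrier A \<Longrightarrow> b \<in> carrier B \<Longrightarrow> c \<in> carrier C \<Longrightarrow>
    coassoc (U.pt a (BC.pt b c)) = L.pt (AB.pt a b) c"
  unfolding coassoc_def
  by (simp add: U.lift_pt[OF L.tensor_abelian coassoc_inner_bilinear] BC.lift_pt[OF L.tensor_abelian coassoc_inner])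

lemma triple_left_eqI:
  assumes "additive_map (tensor R (tensor R A B) C) Z h" "additive_map (tensor R (tensor R A B) C) Z h'"
    and "\<And>a b c. a \<in> carrier A \<Longrightarrow> b \<in> carrier B \<Longrightarrow> c \<in> carrier C \<Longrightarrow>
       h (L.pt (AB.pt a b) c) = h' (L.pt (AB.pt a b) c)"
    and "t \<in> carrier (tensor R (tensor R A B) C)"
  shows "h t = h' t"
proof (rule L.additive_map_eqI[OF assms(1,2,4)])
  fix s c assume s: "s \<in> carrier (tensor R A B)" and c: "c \<in> carrier C"
  show "h (L.pt s c) = h' (L.pt s c)"
    using s by (induction rule: AB.tensor_induct)
      (use c assms in \<open>simp_all add: L.tensor_simps additive_map_def\<close>)
qed

lemma triple_right_eqI:
  assumes "additive_map (tensor R A (tensor R B C)) Z h" "additive_map (tensor R A (tensor R B C)) Z h'"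
    and "\<And>a b c. a \<in> carrier A \<Longrightarrow> b \<in> carrier B \<Longrightarrow> c \<in> carrier C \<Longrightarrow>
       h (U.pt a (BC.pt b c)) = h' (U.pt a (BC.pt b c))"
    and "t \<in> carrier (tensor R A (tensor R B C))"
  shows "h t = h' t"
proof (rule U.additive_map_eqI[OF assms(1,2,4)])
  fix s a assume s: "s \<in> carrier (tensor R B C)" and c: "a \<in> carrier A"
  show "h (U.pt a s) = h' (U.pt a s)"
    using s by (induction rule: BC.tensor_induct)
      (use c assms in \<open>simp_all add: U.tensor_simps additive_map_def\<close>)
qed

lemma assoc_iso: "tensor_assoc R A B C \<in> bimod_iso R (tensor R (tensor R A B) C) (tensor R A (tensor R B C))"
proof (rule bimod_iso_byWitness[OF assoc_hom coassoc_hom])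
  note ad = assoc_hom[THEN bimod_hom_mod_hom, THEN mod_hom_additive] coassoc_hom[THEN bimod_hom_mod_hom, THEN mod_hom_additive]
  show "coassoc (tensor_assoc R A B C t) = t" if "t \<in> carrier (tensor R (tensor R A B) C)" for t
    by (rule triple_left_eqI[OF additive_map_comp[OF ad] additive_map_ident _ that])
      (simp add: assoc_pt coassoc_pt)
  show "tensor_assoc R A B C (coassoc t) = t" if "t \<in> carrier (tensor R A (tensor R B C))" for t
    by (rule triple_right_eqI[OF additive_map_comp[OF ad(2,1)] additive_map_ident _ that])
      (simp add: assoc_pt coassoc_pt)
qed

end

section \<open>Modules of rank at most one\<close>

lemma additive_span_mono_span: "S \<subseteq> additive_span A S' \<Longrightarrow> x \<in> additive_span A S \<Longrightarrow> x \<in> additive_span A S'"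
  by (rotate_tac 1, induction rule: additive_span.induct) (auto intro: additive_span.intros)

lemma additive_span_closed:
  assumes "abelian_group A" "S \<subseteq> carrier A" "x \<in> additive_span A S"
  shows "x \<in> carrier A"
proof -
  interpret abelian_group A by fact
  show ?thesis using assms(3) by (induction rule: additive_span.induct) (use assms in auto)
qed

lemma additive_span_image:
  assumes "abelian_group A" "additive_map A B f" "S \<subseteq> carrier A" "x \<in> additive_span A S"
  shows "f x \<in> additive_span B (f ` S)"
  using assms(4)
proof (induction rule: additive_span.induct)
  case (add x y)
  then show ?case using assms additive_span_closed[OF assms(1,3)]
    by (auto simp: additive_map_def intro: additive_span.add)
qed (auto intro: additive_span.gen)

lemma additive_map_zero:
  assumes "abelian_group A" "abelian_group B" "additive_map A B f"
  shows "f \<zero>\<^sub>A = \<zero>\<^sub>B"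
proof -
  interpret A: abelian_group A by fact
  interpret B: abelian_group B by fact
  have "f \<zero>\<^sub>A \<oplus>\<^sub>B f \<zero>\<^sub>A = f \<zero>\<^sub>A"
    using assms(3) by (metis A.l_zero A.zero_closed additive_map_def)
  then show ?thesis using assms(3) by (simp add: additive_map_def)
qed

lemma additive_map_minus:
  assumes "abelian_group A" "abelian_group B" "additive_map A B f" "x \<in> carrier A" "y \<in> carrier A"
  shows "f (x \<ominus>\<^sub>A y) = f x \<ominus>\<^sub>B f y"
proof -
  interpret A: abelian_group A by fact
  interpret B: abelian_group B by fact
  have c: "f x \<in> carrier B" "f y \<in> carrier B" "f (x \<ominus>\<^sub>A y) \<in> carrier B" using assms by (auto simp: additive_map_def)
  have "f (x \<ominus>\<^sub>A y) \<oplus>\<^sub>B f y = f (x \<ominus>\<^sub>A y \<oplus>\<^sub>A y)"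
    using assms by (simp add: additive_map_def)
  also have "x \<ominus>\<^sub>A y \<oplus>\<^sub>A y = x" using assms by (simp add: A.minus_eq A.a_assoc A.l_neg)
  finally show ?thesis using c by (metis B.add.inv_solve_right B.minus_eq)
qed

lemma additive_map_finsum:
  assumes "abelian_group A" "abelian_group B" "additive_map A B f" "finite I" "g \<in> I \<rightarrow> carrier A"
  shows "f (finsum A g I) = finsum B (\<lambda>i. f (g i)) I"
proof -
  interpret A: abelian_group A by fact
  interpret B: abelian_group B by fact
  show ?thesis using assms(4,5)
  proof (induction I)
    case empty
    then show ?case using additive_map_zero[OF assms(1-3)] by simp
  next
    case (insert i I)
    then show ?case using assms(3) by (auto simp: additive_map_def Pi_iff A.finsum_insert B.finsum_insert)
  qed
qed

abbreviation functionals :: "('a, 'r) ring_scheme \<Rightarrow> ('a, 'm, 'x) module_scheme \<Rightarrow> ('m \<Rightarrow> 'a) set" where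
  "functionals R E \<equiv> mod_hom R E (ideal_module R (carrier R))"

definition evaluations :: "('a, 'r) ring_scheme \<Rightarrow> ('a, 'm, 'x) module_scheme \<Rightarrow> 'a set" where
  "evaluations R E = {\<phi> x | \<phi> x. \<phi> \<in> functionals R E \<and> x \<in> carrier E}"

text \<open>
  Locally \<open>E\<close> is zero or free of rank one, and \<open>e\<close> is the idempotent that supports it. The
  symmetry \<open>\<phi>(x) y = \<phi>(y) x\<close> says that the rank is at most one, and the last condition says
  that the functionals generate the ideal \<open>R e\<close>. Stated in this way the notion is free of localisation,
  and it passes to duals, tensor products and twisted modules by computation with functionals.
\<close>

definition rank_one :: "('a, 'r) ring_scheme \<Rightarrow> ('a, 'm, 'x) module_scheme \<Rightarrow> 'a \<Rightarrow> bool" where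
  "rank_one R E e \<longleftrightarrow> module R E \<and> e \<in> carrier R \<and> (\<forall>x\<in>carrier E. e \<odot>\<^sub>E x = x) \<and>
     (\<forall>\<phi>\<in>functionals R E. \<forall>x\<in>carrier E. \<forall>y\<in>carrier E. \<phi> x \<odot>\<^sub>E y = \<phi> y \<odot>\<^sub>E x) \<and>
     e \<in> additive_span R (evaluations R E)"

lemma evaluationsI: "\<phi> \<in> functionals R E \<Longrightarrow> x \<in> carrier E \<Longrightarrow> \<phi> x \<in> evaluations R E"
  by (auto simp: evaluations_def)

lemma ideal_module_simps [simp]:
  "carrier (ideal_module R I) = I" "x \<oplus>\<^bsub>ideal_module R I\<^esub> y = x \<oplus>\<^sub>R y"
  "r \<odot>\<^bsub>ideal_module R I\<^esub> x = r \<otimes>\<^sub>R x" "\<zero>\<^bsub>ideal_module R I\<^esub> = \<zero>\<^sub>R"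
  by (simp_all add: ideal_module_def)

lemma central_simps [simp]:
  "carrier (central M) = carrier M" "x \<oplus>\<^bsub>central M\<^esub> y = x \<oplus>\<^sub>M y"
  "r \<odot>\<^bsub>central M\<^esub> x = r \<odot>\<^sub>M x" "\<zero>\<^bsub>central M\<^esub> = \<zero>\<^sub>M" "rsmult (central M) x r = r \<odot>\<^sub>M x"
  by (simp_all add: central_def module.defs bimodule.defs)

lemma mod_hom_compose: "f \<in> mod_hom R A B \<Longrightarrow> g \<in> mod_hom R B C \<Longrightarrow> (\<lambda>x. g (f x)) \<in> mod_hom R A C"
  by (auto intro!: mod_homI simp: mod_homD)

text \<open>
  An additive and \<open>R\<close>-linear bijection, or more generally surjection, transports the module laws to its
  image.
\<close>

lemma module_image:
  assumes E: "module R E"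
    and c: "carrier S = f ` carrier E"
    and add: "\<And>x y. x \<in> carrier E \<Longrightarrow> y \<in> carrier E \<Longrightarrow> f (x \<oplus>\<^sub>E y) = f x \<oplus>\<^sub>S f y"
    and smult: "\<And>r x. r \<in> carrier R \<Longrightarrow> x \<in> carrier E \<Longrightarrow> f (r \<odot>\<^sub>E x) = r \<odot>\<^sub>S f x"
    and zero: "\<zero>\<^sub>S = f \<zero>\<^sub>E"
  shows "module R S"
proof -
  interpret E: module R E by fact
  have cr: "cring R" using E by (simp add: module_def)
  show ?thesis
  proof (rule moduleI[OF cr])
    show "abelian_group S"
    proof (rule abelian_groupI)
      fix x assume "x \<in> carrier S"
      then obtain u where u: "u \<in> carrier E" "x = f u" by (auto simp: c)
      have "f (\<ominus>\<^sub>E u) \<oplus>\<^sub>S x = \<zero>\<^sub>S"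
        using u add[of "\<ominus>\<^sub>E u" u] by (simp add: zero E.M.l_neg)
      then show "\<exists>y\<in>carrier S. y \<oplus>\<^sub>S x = \<zero>\<^sub>S" using u by (auto simp: c)
    qed (auto simp: c zero E.M.a_ac simp flip: add)
  qed (auto simp: c E.smult_l_distr E.smult_r_distr E.smult_assoc1 simp flip: add smult)
qed

lemma is_bimodule_central:
  assumes "module R M" shows "is_bimodule R (central M)"
proof -
  interpret M: module R M by fact
  have "module R (central M)"
    by (rule module_image[OF assms, of _ "\<lambda>x. x"]) auto
  then show ?thesis
    by (auto simp: is_bimodule_def M.smult_r_distr M.R.m_comm simp flip: M.smult_assoc1)
qed

context cring
begin

lemma functionalD:
  assumes "\<phi> \<in> functionals R E"
  shows "\<And>x. x \<in> carrier E \<Longrightarrow> \<phi> x \<in> carrier R"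
    "\<And>x y. x \<in> carrier E \<Longrightarrow> y \<in> carrier E \<Longrightarrow> \<phi> (x \<oplus>\<^sub>E y) = \<phi> x \<oplus> \<phi> y"
    "\<And>r x. r \<in> carrier R \<Longrightarrow> x \<in> carrier E \<Longrightarrow> \<phi> (r \<odot>\<^sub>E x) = r \<otimes> \<phi> x"
  using assms by (auto simp: mod_hom_def)

lemma functional_additive: "\<phi> \<in> functionals R E \<Longrightarrow> additive_map E R \<phi>"
  by (auto simp: additive_map_def functionalD)

lemma ideal_module_module:
  assumes "e \<in> carrier R" shows "module R (ideal_module R (PIdl e))"
proof -
  interpret I: ideal "PIdl e" R by (rule cgenideal_ideal[OF assms])
  show ?thesis
  proof (rule moduleI[OF is_cring])
    show "abelian_group (ideal_module R (PIdl e))"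
    proof (rule abelian_groupI)
      fix x assume "x \<in> carrier (ideal_module R (PIdl e))"
      then show "\<exists>y\<in>carrier (ideal_module R (PIdl e)). y \<oplus>\<^bsub>ideal_module R (PIdl e)\<^esub> x = \<zero>\<^bsub>ideal_module R (PIdl e)\<^esub>"
        by (auto intro!: bexI[of _ "\<ominus> x"] simp: l_neg)
    qed (auto simp: a_ac)
  qed (auto simp: l_distr r_distr m_assoc I.I_l_closed)
qed

lemma PIdl_one: "PIdl \<one> = carrier R"
  by (force simp: cgenideal_def)

lemma PIdl_iff: "e \<in> carrier R \<Longrightarrow> e \<otimes> e = e \<Longrightarrow> x \<in> PIdl e \<longleftrightarrow> x \<in> carrier R \<and> e \<otimes> x = x"
  by (auto simp: cgenideal_def) (metis m_assoc m_comm m_closed, metis m_comm)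

lemma evaluations_closed: "evaluations R E \<subseteq> carrier R"
  by (auto simp: evaluations_def functionalD)

lemma span_evaluations_closed: "x \<in> additive_span R (evaluations R E) \<Longrightarrow> x \<in> carrier R"
  by (rule additive_span_closed[OF abelian_group_axioms evaluations_closed])

lemma rank_one_module: "rank_one R E e \<Longrightarrow> module R E"
  by (simp add: rank_one_def)

lemma rank_one_support_closed [simp]: "rank_one R E e \<Longrightarrow> e \<in> carrier R"
  by (simp add: rank_one_def)

lemma rank_one_support: "rank_one R E e \<Longrightarrow> x \<in> carrier E \<Longrightarrow> e \<odot>\<^sub>E x = x"
  by (simp add: rank_one_def)

lemma rank_one_sym: "rank_one R E e \<Longrightarrow> \<phi> \<in> functionals R E \<Longrightarrow> x \<in> carrier E \<Longrightarrow> y \<in> carrier E \<Longrightarrow>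
    \<phi> x \<odot>\<^sub>E y = \<phi> y \<odot>\<^sub>E x"
  by (simp add: rank_one_def)

text \<open>
  How \<open>e\<close> being a sum of values of functionals is used: a property that is stable under addition has to
  be checked at values \<open>\<phi> x\<close> only.
\<close>

lemma rank_one_induct [consumes 1, case_names eval add]:
  assumes "rank_one R E e"
    and "\<And>\<phi> x. \<phi> \<in> functionals R E \<Longrightarrow> x \<in> carrier E \<Longrightarrow> Q (\<phi> x)"
    and "\<And>r s. r \<in> carrier R \<Longrightarrow> s \<in> carrier R \<Longrightarrow> Q r \<Longrightarrow> Q s \<Longrightarrow> Q (r \<oplus> s)"
  shows "Q e"
proof -
  have "e \<in> additive_span R (evaluations R E)" using assms(1) by (simp add: rank_one_def)
  then show ?thesis
  proof (induction rule: additive_span.induct)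
    case (add x y)
    then show ?case using assms(3) additive_span_closed[OF abelian_group_axioms evaluations_closed] by blast
  qed (use assms(2) in \<open>auto simp: evaluations_def\<close>)
qed

lemma rank_one_eval_support:
  assumes "rank_one R E e" "\<phi> \<in> functionals R E" "x \<in> carrier E"
  shows "e \<otimes> \<phi> x = \<phi> x"
  using functionalD(3)[OF assms(2), of e x] assms rank_one_support[OF assms(1,3)] by simp

text \<open>
  The support acts as the identity on \<open>E\<close>, hence fixes every value of a functional, and it is a sum of
  such values.
\<close>

lemma rank_one_idem:
  assumes "rank_one R E e" shows "e \<otimes> e = e"
proof -
  have "e \<otimes> s = s \<Longrightarrow> e \<otimes> t = t \<Longrightarrow> e \<otimes> (s \<oplus> t) = s \<oplus> t" if "s \<in> carrier R" "t \<in> carrier R" for s t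
    using that assms by (simp add: r_distr)
  note this[rule_format]
  then show ?thesis
    using rank_one_induct[OF assms, of "\<lambda>s. e \<otimes> s = s"] rank_one_eval_support[OF assms] by blast
qed

text \<open>
  For \<open>r = \<phi>(z)\<close> the symmetry of \<open>E\<close> moves \<open>r\<close> around:
  \<open>F(\<phi>(z) x, y) = F(\<phi>(x) z, y) = F(z, \<phi>(x) y) = F(z, \<phi>(y) x) = F(\<phi>(y) z, x) =
  F(\<phi>(z) y, x)\<close>. Summing such \<open>r\<close> up to the support \<open>e\<close> gives the claim.
\<close>

lemma balanced_form_symmetric:
  assumes E: "rank_one R E e" and L: "abelian_group L"
    and x: "x \<in> carrier E" and y: "y \<in> carrier E"
    and c: "\<And>x y. x \<in> carrier E \<Longrightarrow> y \<in> carrier E \<Longrightarrow> F x y \<in> carrier L"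
    and l: "\<And>x x' y. x \<in> carrier E \<Longrightarrow> x' \<in> carrier E \<Longrightarrow> y \<in> carrier E \<Longrightarrow>
        F (x \<oplus>\<^sub>E x') y = F x y \<oplus>\<^sub>L F x' y"
    and r: "\<And>x y y'. x \<in> carrier E \<Longrightarrow> y \<in> carrier E \<Longrightarrow> y' \<in> carrier E \<Longrightarrow>
        F x (y \<oplus>\<^sub>E y') = F x y \<oplus>\<^sub>L F x y'"
    and b: "\<And>x y r. x \<in> carrier E \<Longrightarrow> y \<in> carrier E \<Longrightarrow> r \<in> carrier R \<Longrightarrow>
        F (r \<odot>\<^sub>E x) y = F x (r \<odot>\<^sub>E y)"
  shows "F x y = F y x"
proof -
  interpret E: module R E using E by (rule rank_one_module)
  have "F (e \<odot>\<^sub>E x) y = F (e \<odot>\<^sub>E y) x"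
    using E
  proof (induction rule: rank_one_induct)
    case (eval \<phi> z)
    note p = functionalD(1)[OF eval(1)] and s = rank_one_sym[OF E eval(1)]
    have "F (\<phi> z \<odot>\<^sub>E x) y = F (\<phi> x \<odot>\<^sub>E z) y" using x eval s[of z x] by simp
    also have "\<dots> = F z (\<phi> y \<odot>\<^sub>E x)" using x y eval b p s[of x y] by simp
    also have "\<dots> = F (\<phi> z \<odot>\<^sub>E y) x" using x y eval b[symmetric] p s[of y z] by simp
    finally show ?case .
  next
    case (add r s)
    then show ?case using x y by (simp add: E.smult_l_distr l)
  qed
  then show ?thesis using rank_one_support[OF E] x y by simp
qed

text \<open>
  Apply the functionals of \<open>E\<close> to the assumed equation and sum up to \<open>e\<close>.
\<close>

lemma rank_one_faithful:
  assumes E: "rank_one R E e" and r: "r \<in> carrier R" "s \<in> carrier R"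
    and eq: "\<And>x. x \<in> carrier E \<Longrightarrow> r \<odot>\<^sub>E x = s \<odot>\<^sub>E x"
  shows "r \<otimes> e = s \<otimes> e"
  using E
proof (induction rule: rank_one_induct)
  case (eval \<phi> x)
  then show ?case
    using eq[of x] functionalD(3)[OF eval(1), of r x] functionalD(3)[OF eval(1), of s x] r by simp
qed (use r in \<open>simp add: r_distr\<close>)

lemma rank_one_support_le:
  assumes E: "rank_one R E e" and "rank_one R E e'"
  shows "e' \<otimes> e = e"
proof -
  have "e' \<otimes> e = \<one> \<otimes> e"
    by (rule rank_one_faithful[OF E])
      (simp_all add: rank_one_support[OF assms(2)] rank_one_support_closed[OF assms(2)]
        module.smult_one[OF rank_one_module[OF E]])
  then show ?thesis using assms by simp
qed

lemma rank_one_support_unique: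
  assumes E: "rank_one R E e" and "rank_one R E e'"
  shows "e = e'"
  by (metis assms rank_one_support_le m_comm rank_one_support_closed)

text \<open>
  Let \<open>f k = 0\<close>. Then \<open>\<phi>(k)\<close> kills \<open>L = f(E)\<close>, since \<open>\<phi>(k)
  f(z) = \<phi>(z) f(k)\<close>; as \<open>L\<close> has the same support as \<open>E\<close>, every functional
  vanishes on \<open>k\<close>. But \<open>k = e k\<close> is a sum of elements \<open>\<phi>(x) k = \<phi>(k)
  x\<close>.
\<close>

lemma rank_one_surj_iso:
  assumes E: "rank_one R E e" and L: "rank_one R L e" and f: "f \<in> mod_hom R E L"
    and surj: "carrier L \<subseteq> f ` carrier E"
  shows "f \<in> mod_iso R E L"
proof -
  interpret E: module R E using E by (rule rank_one_module)
  interpret L: module R L using L by (rule rank_one_module)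
  note F = mod_homD[OF f]
  have ker: "k = \<zero>\<^sub>E" if k: "k \<in> carrier E" and fk: "f k = \<zero>\<^sub>L" for k
  proof -
    have z: "\<phi> k = \<zero>" if p: "\<phi> \<in> functionals R E" for \<phi>
    proof -
      have "\<phi> k \<otimes> e = \<zero> \<otimes> e"
      proof (rule rank_one_faithful[OF L])
        fix y assume "y \<in> carrier L"
        then obtain z where z: "z \<in> carrier E" "y = f z" using surj by auto
        have "\<phi> k \<odot>\<^sub>L y = f (\<phi> z \<odot>\<^sub>E k)"
          using z k p rank_one_sym[OF E p, of k z] by (simp add: functionalD flip: F(3))
        then show "\<phi> k \<odot>\<^sub>L y = \<zero> \<odot>\<^sub>L y" using z k p by (simp add: F functionalD fk)
      qed (use k p in \<open>auto simp: functionalD\<close>)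
      then show ?thesis
        using rank_one_eval_support[OF E p k] k p E by (simp add: functionalD m_comm)
    qed
    have "e \<odot>\<^sub>E k = \<zero>\<^sub>E"
      using E
    proof (induction rule: rank_one_induct)
      case (eval \<phi> x)
      then show ?case using rank_one_sym[OF E eval k] z[OF eval(1)] by simp
    qed (use k in \<open>simp add: E.smult_l_distr\<close>)
    then show ?thesis using rank_one_support[OF E k] by simp
  qed
  have "inj_on f (carrier E)"
  proof (rule inj_onI)
    fix x y assume xy: "x \<in> carrier E" "y \<in> carrier E" "f x = f y"
    have "f (x \<ominus>\<^sub>E y) = f x \<ominus>\<^sub>L f y"
      by (rule additive_map_minus[OF module_abelian[OF rank_one_module[OF E]]
            module_abelian[OF rank_one_module[OF L]] mod_hom_additive[OF f] xy(1,2)])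
    then have "x \<ominus>\<^sub>E y = \<zero>\<^sub>E" using xy F by (intro ker) (auto simp: L.M.minus_eq L.M.r_neg)
    moreover have "x = (x \<ominus>\<^sub>E y) \<oplus>\<^sub>E y" using xy by (simp add: E.M.minus_eq E.M.a_assoc E.M.l_neg)
    ultimately show "x = y" using xy by simp
  qed
  then show ?thesis using f surj F(1) by (auto simp: mod_iso_def bij_betw_def)
qed

lemma rank_one_ideal:
  assumes e: "e \<in> carrier R" "e \<otimes> e = e"
  shows "rank_one R (ideal_module R (PIdl e)) e"
proof -
  note I = PIdl_iff[OF e]
  have sym: "\<phi> x \<otimes> y = \<phi> y \<otimes> x" if p: "\<phi> \<in> functionals R (ideal_module R (PIdl e))"
    and x: "x \<in> PIdl e" "y \<in> PIdl e" for \<phi> x y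
  proof -
    have "\<phi> x \<otimes> y = x \<otimes> \<phi> e \<otimes> y" "\<phi> y \<otimes> x = y \<otimes> \<phi> e \<otimes> x" "\<phi> e \<in> carrier R"
      using x e functionalD(3)[OF p, of x e] functionalD(3)[OF p, of y e] functionalD(1)[OF p, of e]
      by (simp_all add: I m_comm[of x e] m_comm[of y e])
    moreover have "x \<in> carrier R" "y \<in> carrier R" using x by (auto simp: I)
    ultimately show ?thesis by (simp add: m_ac)
  qed
  have "(\<lambda>x. x) \<in> functionals R (ideal_module R (PIdl e))"
    by (auto simp: mod_hom_def I)
  then have "e \<in> evaluations R (ideal_module R (PIdl e))"
    by (force simp: evaluations_def I e)
  then show ?thesis unfolding rank_one_def using e sym ideal_module_module
    by (auto intro: additive_span.gen simp: I)
qed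

lemma rank_one_iso:
  assumes E: "rank_one R E e" and f: "f \<in> mod_iso R E E'" and E': "module R E'"
  shows "rank_one R E' e"
proof -
  interpret E': module R E' by fact
  have h: "f \<in> mod_hom R E E'" and b: "carrier E' = f ` carrier E"
    using f by (auto simp: mod_iso_def bij_betw_def)
  note F = mod_homD[OF h]
  have comp: "(\<lambda>x. \<phi> (f x)) \<in> functionals R E" if p: "\<phi> \<in> functionals R E'" for \<phi>
    using mod_hom_compose[OF h p] .
  let ?g = "inv_into (carrier E) f"
  have g: "?g \<in> mod_iso R E' E" using mod_iso_inv[OF f] rank_one_module[OF E] by simp
  have gf: "?g (f x) = x" if "x \<in> carrier E" for x
    using f that by (auto simp: mod_iso_def bij_betw_inv_into_left)
  note G = mod_homD[of ?g R E' E]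
  have "evaluations R E \<subseteq> evaluations R E'"
  proof
    fix a assume "a \<in> evaluations R E"
    then obtain \<phi> x where a: "a = \<phi> x" "\<phi> \<in> functionals R E" "x \<in> carrier E" by (auto simp: evaluations_def)
    have "(\<lambda>y. \<phi> (?g y)) \<in> functionals R E'" 
      using mod_hom_compose[OF _ a(2), of ?g E'] g by (simp add: mod_iso_def)
    then show "a \<in> evaluations R E'" unfolding evaluations_def
      using a gf F(1) by (auto intro!: exI[of _ "\<lambda>y. \<phi> (?g y)"] exI[of _ "f x"])
  qed
  then have "e \<in> additive_span R (evaluations R E')"
    using E additive_span_mono_span[of "evaluations R E" R "evaluations R E'" e]
    by (auto simp: rank_one_def intro: additive_span.gen)
  moreover have "\<phi> x \<odot>\<^bsub>E'\<^esub> y = \<phi> y \<odot>\<^bsub>E'\<^esub> x"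
    if p: "\<phi> \<in> functionals R E'" and xy: "x \<in> carrier E'" "y \<in> carrier E'" for \<phi> x y
  proof -
    obtain u v where uv: "u \<in> carrier E" "v \<in> carrier E" "x = f u" "y = f v" using xy b by auto
    then show ?thesis using rank_one_sym[OF E comp[OF p], of u v]
      by (simp add: F functionalD[OF p] flip: F(3))
  qed
  moreover have "e \<odot>\<^bsub>E'\<^esub> x = x" if "x \<in> carrier E'" for x
    using that E by (auto simp: b rank_one_support simp flip: F(3))
  ultimately show ?thesis using E E' by (auto simp: rank_one_def)
qed

lemma tensor_central: "module R E \<Longrightarrow> module R F \<Longrightarrow> tensor_product R (central E) (central F)"
  by (simp add: tensor_product_def is_bimodule_central)

text \<open>
  Functionals on the factors multiply to functionals on the tensor product, so \<open>e f\<close> is a sum of their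
  values. A functional on \<open>E \<otimes> F\<close> with one argument fixed is a functional on a factor, so the
  symmetry of \<open>E\<close> and of \<open>F\<close> exchanges the arguments of pure tensors one after the other.
\<close>

lemma rank_one_tensor:
  assumes E: "rank_one R E e" and F: "rank_one R F f"
  shows "rank_one R (tensor R (central E) (central F)) (e \<otimes> f)"
proof -
  interpret T: tensor_product R "central E" "central F"
    using assms by (intro tensor_central rank_one_module)
  interpret E: module R E using E by (rule rank_one_module)
  interpret F: module R F using F by (rule rank_one_module)
  interpret TM: module R T.T by (rule T.tensor_module)
  have ef: "e \<in> carrier R" "f \<in> carrier R" using E F by auto
  have bal: "r \<odot>\<^bsub>T.T\<^esub> T.pt x y = T.pt x (r \<odot>\<^sub>F y)"
    if "r \<in> carrier R" "x \<in> carrier E" "y \<in> carrier F" for r x y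
    using that T.pt_balanced[of x r y] T.smult_pt[of r x y] by simp
  have supp: "(e \<otimes> f) \<odot>\<^bsub>T.T\<^esub> t = t" if t: "t \<in> carrier T.T" for t
    using t
  proof (induction rule: T.tensor_induct)
    case (pt x y)
    then show ?case using ef bal[of f x y] T.smult_pt[of e x y]
      by (simp add: TM.smult_assoc1 rank_one_support[OF E] rank_one_support[OF F])
  qed (use ef in \<open>simp add: TM.smult_r_distr\<close>)
  have sym: "\<phi> s \<odot>\<^bsub>T.T\<^esub> t = \<phi> t \<odot>\<^bsub>T.T\<^esub> s"
    if p: "\<phi> \<in> functionals R T.T" and s: "s \<in> carrier T.T" and t: "t \<in> carrier T.T" for \<phi> s t
  proof -
    note P = functionalD[OF p]
    have 1: "\<phi> (T.pt x y) \<odot>\<^bsub>T.T\<^esub> T.pt x' y' = \<phi> (T.pt x' y') \<odot>\<^bsub>T.T\<^esub> T.pt x y"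
      if xy: "x \<in> carrier E" "x' \<in> carrier E" "y \<in> carrier F" "y' \<in> carrier F" for x y x' y'
    proof -
      have a: "(\<lambda>x. \<phi> (T.pt x y)) \<in> functionals R E"
        using xy T.pt_add_left[of _ _ y] T.smult_pt[symmetric] by (auto intro!: mod_homI simp: P)
      have b: "(\<lambda>y. \<phi> (T.pt x' y)) \<in> functionals R F"
        using xy T.pt_add_right[of x'] bal[symmetric] by (auto intro!: mod_homI simp: P)
      have "\<phi> (T.pt x y) \<odot>\<^bsub>T.T\<^esub> T.pt x' y' = \<phi> (T.pt x' y) \<odot>\<^bsub>T.T\<^esub> T.pt x y'"
        using xy rank_one_sym[OF E a, of x x'] by (simp add: T.smult_pt P)
      also have "\<dots> = \<phi> (T.pt x' y') \<odot>\<^bsub>T.T\<^esub> T.pt x y"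
        using xy rank_one_sym[OF F b, of y y'] by (simp add: bal P)
      finally show ?thesis .
    qed
    have 2: "\<phi> s \<odot>\<^bsub>T.T\<^esub> T.pt x' y' = \<phi> (T.pt x' y') \<odot>\<^bsub>T.T\<^esub> s"
      if xy: "x' \<in> carrier E" "y' \<in> carrier F" for x' y'
      using s by (induction rule: T.tensor_induct)
        (use xy in \<open>simp_all add: 1 P TM.smult_l_distr TM.smult_r_distr\<close>)
    show ?thesis
      using t by (induction rule: T.tensor_induct)
        (use s in \<open>simp_all add: 2 P TM.smult_l_distr TM.smult_r_distr\<close>)
  qed
  have prod: "a \<otimes> b \<in> evaluations R T.T"
    if a: "a \<in> evaluations R E" and b: "b \<in> evaluations R F" for a b
  proof -
    obtain \<phi> x where x: "a = \<phi> x" "\<phi> \<in> functionals R E" "x \<in> carrier E" using a by (auto simp: evaluations_def)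
    obtain \<psi> y where y: "b = \<psi> y" "\<psi> \<in> functionals R F" "y \<in> carrier F" using b by (auto simp: evaluations_def)
    note P = functionalD[OF x(2)] functionalD[OF y(2)]
    let ?I = "ideal_module R (carrier R)"
    have I: "module R ?I" using ideal_module_module[of \<one>] by (simp add: PIdl_one)
    have bl: "balanced R (central E) (central F) ?I (\<lambda>x y. \<phi> x \<otimes> \<psi> y)"
      by (simp add: balanced_def P l_distr r_distr m_ac)
    have "tensor_lift R (central E) (central F) (additive_group ?I) (\<lambda>x y. \<phi> x \<otimes> \<psi> y) \<in> functionals R T.T"
      by (rule T.lift_mod_hom[OF I bl]) (simp add: P m_assoc)
    moreover have "tensor_lift R (central E) (central F) (additive_group ?I) (\<lambda>x y. \<phi> x \<otimes> \<psi> y) (T.pt x y) = a \<otimes> b"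
      using x y T.lift_pt[OF module_abelian[OF I] bl, of x y] by simp
    moreover have "T.pt x y \<in> carrier T.T" using x y by simp
    ultimately show ?thesis by (metis evaluationsI)
  qed
  have s1: "a \<otimes> b \<in> additive_span R (evaluations R T.T)"
    if a: "a \<in> additive_span R (evaluations R E)" and b: "b \<in> evaluations R F" for a b
    using a
  proof (induction rule: additive_span.induct)
    case (add x y)
    then show ?case using span_evaluations_closed[OF add(1)] span_evaluations_closed[OF add(2)] b evaluations_closed
      by (subst l_distr) (auto intro: additive_span.add)
  qed (use prod b in \<open>auto intro: additive_span.gen\<close>)
  have s2: "a \<otimes> b \<in> additive_span R (evaluations R T.T)"
    if a: "a \<in> additive_span R (evaluations R E)" and b: "b \<in> additive_span R (evaluations R F)" for a b
    using b
  proof (induction rule: additive_span.induct)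
    case (add x y)
    then show ?case
      using span_evaluations_closed[OF add(1)] span_evaluations_closed[OF add(2)] span_evaluations_closed[OF a]
      by (subst r_distr) (auto intro: additive_span.add)
  qed (use s1 a in auto)
  show ?thesis
    unfolding rank_one_def using supp sym s2[of e f] E F T.tensor_module ef
    by (auto simp: rank_one_def)
qed

end

section \<open>Pairings, duals and ratios of families\<close>

text \<open>
  The twist \<open>\<sigma>\<close> is the identity for a pairing and \<open>r \<mapsto>
  \<alpha>\<^sub>g(r1)\<close> for the multiplication of a crossed system.
\<close>

definition bilinear_map ::
  "('a, 'r) ring_scheme \<Rightarrow> ('a \<Rightarrow> 'a) \<Rightarrow> ('a, 'm, 'x) module_scheme \<Rightarrow> ('a, 'n, 'y) module_scheme \<Rightarrow>
   ('a, 'k, 'z) module_scheme \<Rightarrow> ('m \<Rightarrow> 'n \<Rightarrow> 'k) \<Rightarrow> bool" where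
  "bilinear_map R \<sigma> M N L b \<longleftrightarrow>
     (\<forall>x\<in>carrier M. \<forall>y\<in>carrier N. b x y \<in> carrier L) \<and>
     (\<forall>x\<in>carrier M. \<forall>x'\<in>carrier M. \<forall>y\<in>carrier N. b (x \<oplus>\<^sub>M x') y = b x y \<oplus>\<^sub>L b x' y) \<and>
     (\<forall>x\<in>carrier M. \<forall>y\<in>carrier N. \<forall>y'\<in>carrier N. b x (y \<oplus>\<^sub>N y') = b x y \<oplus>\<^sub>L b x y') \<and>
     (\<forall>r\<in>carrier R. \<forall>x\<in>carrier M. \<forall>y\<in>carrier N. b (r \<odot>\<^sub>M x) y = r \<odot>\<^sub>L b x y) \<and>
     (\<forall>r\<in>carrier R. \<forall>x\<in>carrier M. \<forall>y\<in>carrier N. b x (r \<odot>\<^sub>N y) = \<sigma> r \<odot>\<^sub>L b x y)"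

definition values_of :: "('m, 'x) partial_object_scheme \<Rightarrow> ('n, 'y) partial_object_scheme \<Rightarrow> ('m \<Rightarrow> 'n \<Rightarrow> 'k) \<Rightarrow> 'k set" where
  "values_of M N b = {b x y | x y. x \<in> carrier M \<and> y \<in> carrier N}"

text \<open>
  For rank one modules such a pairing is the same as an isomorphism \<open>M \<otimes> N \<cong> L\<close>, but it
  relates modules with elements of arbitrary types without tensor products.
\<close>

definition perfect_pairing ::
  "('a, 'r) ring_scheme \<Rightarrow> ('a, 'm, 'x) module_scheme \<Rightarrow> ('a, 'n, 'y) module_scheme \<Rightarrow>
   ('a, 'k, 'z) module_scheme \<Rightarrow> ('m \<Rightarrow> 'n \<Rightarrow> 'k) \<Rightarrow> bool" where
  "perfect_pairing R M N L b \<longleftrightarrow> bilinear_map R (\<lambda>r. r) M N L b \<and>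
     carrier L \<subseteq> additive_span L (values_of M N b)"

lemma bilinear_mapD:
  assumes "bilinear_map R \<sigma> M N L b"
  shows "\<And>x y. x \<in> carrier M \<Longrightarrow> y \<in> carrier N \<Longrightarrow> b x y \<in> carrier L"
    "\<And>x x' y. x \<in> carrier M \<Longrightarrow> x' \<in> carrier M \<Longrightarrow> y \<in> carrier N \<Longrightarrow> b (x \<oplus>\<^sub>M x') y = b x y \<oplus>\<^sub>L b x' y"
    "\<And>x y y'. x \<in> carrier M \<Longrightarrow> y \<in> carrier N \<Longrightarrow> y' \<in> carrier N \<Longrightarrow> b x (y \<oplus>\<^sub>N y') = b x y \<oplus>\<^sub>L b x y'"
    "\<And>r x y. r \<in> carrier R \<Longrightarrow> x \<in> carrier M \<Longrightarrow> y \<in> carrier N \<Longrightarrow> b (r \<odot>\<^sub>M x) y = r \<odot>\<^sub>L b x y"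
    "\<And>r x y. r \<in> carrier R \<Longrightarrow> x \<in> carrier M \<Longrightarrow> y \<in> carrier N \<Longrightarrow> b x (r \<odot>\<^sub>N y) = \<sigma> r \<odot>\<^sub>L b x y"
  using assms by (auto simp: bilinear_map_def)

lemma bilinear_mapI:
  assumes "\<And>x y. x \<in> carrier M \<Longrightarrow> y \<in> carrier N \<Longrightarrow> b x y \<in> carrier L"
    "\<And>x x' y. x \<in> carrier M \<Longrightarrow> x' \<in> carrier M \<Longrightarrow> y \<in> carrier N \<Longrightarrow> b (x \<oplus>\<^sub>M x') y = b x y \<oplus>\<^sub>L b x' y"
    "\<And>x y y'. x \<in> carrier M \<Longrightarrow> y \<in> carrier N \<Longrightarrow> y' \<in> carrier N \<Longrightarrow> b x (y \<oplus>\<^sub>N y') = b x y \<oplus>\<^sub>L b x y'"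
    "\<And>r x y. r \<in> carrier R \<Longrightarrow> x \<in> carrier M \<Longrightarrow> y \<in> carrier N \<Longrightarrow> b (r \<odot>\<^sub>M x) y = r \<odot>\<^sub>L b x y"
    "\<And>r x y. r \<in> carrier R \<Longrightarrow> x \<in> carrier M \<Longrightarrow> y \<in> carrier N \<Longrightarrow> b x (r \<odot>\<^sub>N y) = \<sigma> r \<odot>\<^sub>L b x y"
  shows "bilinear_map R \<sigma> M N L b"
  using assms unfolding bilinear_map_def by blast

lemma values_ofI: "x \<in> carrier M \<Longrightarrow> y \<in> carrier N \<Longrightarrow> b x y \<in> values_of M N b"
  by (auto simp: values_of_def)

lemma values_of_closed: "bilinear_map R \<sigma> M N L b \<Longrightarrow> values_of M N b \<subseteq> carrier L"
  by (auto simp: values_of_def bilinear_mapD)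

lemma mod_iso_ident: "(\<lambda>x. x) \<in> mod_iso R M M"
  by (auto simp: mod_iso_def mod_hom_def bij_betw_def)

lemma mod_iso_compose: "f \<in> mod_iso R A B \<Longrightarrow> g \<in> mod_iso R B C \<Longrightarrow> (\<lambda>x. g (f x)) \<in> mod_iso R A C"
  using bij_betw_trans[of f "carrier A" "carrier B" g "carrier C"]
  by (auto simp: mod_iso_def comp_def intro: mod_hom_compose)

lemma mod_iso_imp_hom: "f \<in> mod_iso R A B \<Longrightarrow> f \<in> mod_hom R A B"
  by (simp add: mod_iso_def)

lemma iso_class_cong:
  assumes "f \<in> mod_iso R M N" "module R M"
  shows "iso_class R M = iso_class R N"
  using mod_iso_compose[OF assms(1)] mod_iso_compose[OF mod_iso_inv[OF assms]]
  by (fastforce simp: iso_class_def)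

lemma iso_class_self: "module R M \<Longrightarrow> M \<in> iso_class R M"
  using mod_iso_ident by (auto simp: iso_class_def)

lemma iso_classD:
  assumes "N \<in> iso_class R M"
  obtains f where "module R N" "f \<in> mod_iso R M N"
  using assms by (auto simp: iso_class_def)

text \<open>
  The class of a module contains only modules of one type and could be empty. A common member \<open>S\<close> is
  what links \<open>M\<close> and \<open>N\<close>.
\<close>

lemma iso_class_eqD:
  assumes "iso_class R M = iso_class R N" "module R N" "S \<in> iso_class R M"
  obtains f where "f \<in> mod_iso R M N"
proof -
  obtain f where "f \<in> mod_iso R M S" using assms(3) by (auto simp: iso_class_def)
  moreover obtain g where "g \<in> mod_iso R N S" using assms by (auto simp: iso_class_def)
  ultimately show ?thesis using that mod_iso_compose mod_iso_inv[OF _ assms(2)] by blast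
qed

lemma module_add_closed: "module R M \<Longrightarrow> x \<in> carrier M \<Longrightarrow> y \<in> carrier M \<Longrightarrow> x \<oplus>\<^sub>M y \<in> carrier M"
  by (simp add: module_def abelian_group_def abelian_monoid.a_closed)

lemma central_iso: "f \<in> mod_iso R M N \<Longrightarrow> f \<in> bimod_iso R (central M) (central N)"
  by (auto simp: bimod_iso_def mod_iso_def mod_hom_def)

context cring
begin

lemma dual_simps [simp]:
  "carrier (dual_module R P) = functionals R P \<inter> extensional (carrier P)"
  "\<phi> \<oplus>\<^bsub>dual_module R P\<^esub> \<psi> = (\<lambda>x\<in>carrier P. \<phi> x \<oplus> \<psi> x)"
  "r \<odot>\<^bsub>dual_module R P\<^esub> \<phi> = (\<lambda>x\<in>carrier P. r \<otimes> \<phi> x)"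
  "\<zero>\<^bsub>dual_module R P\<^esub> = (\<lambda>x\<in>carrier P. \<zero>)"
  by (simp_all add: dual_module_def hom_module_def)

lemma dual_module:
  assumes P: "module R P" shows "module R (dual_module R P)"
proof -
  interpret P: module R P by fact
  have add: "(\<lambda>x\<in>carrier P. \<phi> x \<oplus> \<psi> x) \<in> functionals R P"
    if "\<phi> \<in> functionals R P" "\<psi> \<in> functionals R P" for \<phi> \<psi>
    using functionalD[OF that(1)] functionalD[OF that(2)]
    by (intro mod_homI) (simp_all add: a_ac r_distr)
  have smult: "(\<lambda>x\<in>carrier P. r \<otimes> \<phi> x) \<in> functionals R P"
    if "\<phi> \<in> functionals R P" "r \<in> carrier R" for \<phi> r
    using functionalD[OF that(1)] that(2)
    by (intro mod_homI) (simp_all add: m_ac r_distr)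
  have zero: "(\<lambda>x\<in>carrier P. \<zero>) \<in> functionals R P"
    by (intro mod_homI) simp_all
  show ?thesis
  proof (rule moduleI[OF is_cring])
    show "abelian_group (dual_module R P)"
    proof (rule abelian_groupI)
      fix \<phi> assume p: "\<phi> \<in> carrier (dual_module R P)"
      then have "(\<lambda>x\<in>carrier P. \<ominus> \<one> \<otimes> \<phi> x) \<in> carrier (dual_module R P)" using smult by simp
      moreover have "(\<lambda>x\<in>carrier P. \<ominus> \<one> \<otimes> \<phi> x) \<oplus>\<^bsub>dual_module R P\<^esub> \<phi> = \<zero>\<^bsub>dual_module R P\<^esub>"
        using p by (auto simp: functionalD l_minus l_neg)
      ultimately show "\<exists>\<psi>\<in>carrier (dual_module R P). \<psi> \<oplus>\<^bsub>dual_module R P\<^esub> \<phi> = \<zero>\<^bsub>dual_module R P\<^esub>" by blast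
    next
      fix \<phi> assume p: "\<phi> \<in> carrier (dual_module R P)"
      then have "\<phi> x = (if x \<in> carrier P then \<phi> x else undefined)" for x by (auto simp: extensional_def)
      then show "\<zero>\<^bsub>dual_module R P\<^esub> \<oplus>\<^bsub>dual_module R P\<^esub> \<phi> = \<phi>"
        using p by (auto simp: functionalD fun_eq_iff extensional_def)
    qed (auto simp: add zero functionalD a_ac)
  next
    fix \<phi> assume p: "\<phi> \<in> carrier (dual_module R P)"
    then show "\<one> \<odot>\<^bsub>dual_module R P\<^esub> \<phi> = \<phi>"
      by (auto simp: functionalD fun_eq_iff extensional_def)
  qed (auto simp: smult functionalD l_distr r_distr m_assoc)
qed

lemma functional_exchange:
  assumes P: "rank_one R P e" and "\<phi> \<in> functionals R P" "\<psi> \<in> functionals R P" "x \<in> carrier P" "y \<in> carrier P"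
  shows "\<psi> x \<otimes> \<phi> y = \<phi> x \<otimes> \<psi> y"
  using assms functionalD(3)[OF assms(2), of "\<psi> x" y] functionalD(3)[OF assms(2), of "\<psi> y" x]
    rank_one_sym[OF P assms(3), of x y] by (simp add: functionalD m_comm)

text \<open>
  Evaluation at a point \<open>x\<close> is a functional on the dual, so every value of a functional on
  \<open>P\<close> is also a value of one on the dual. The symmetry comes from \<open>\<psi>(x) \<phi> = \<phi>(x)
  \<psi>\<close>.
\<close>

lemma rank_one_dual:
  assumes P: "rank_one R P e" shows "rank_one R (dual_module R P) e"
proof -
  note M = rank_one_module[OF P]
  have ext: "\<psi> x = undefined" if "\<psi> \<in> extensional (carrier P)" "x \<notin> carrier P" for \<psi> :: "_ \<Rightarrow> 'a" and x
    using that by (auto simp: extensional_def)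
  have D: "module R (dual_module R P)" by (rule dual_module[OF M])
  interpret D: module R "dual_module R P" by (rule D)
  have sym: "\<Phi> \<phi> \<odot>\<^bsub>dual_module R P\<^esub> \<psi> = \<Phi> \<psi> \<odot>\<^bsub>dual_module R P\<^esub> \<phi>"
    if F: "\<Phi> \<in> functionals R (dual_module R P)" and p: "\<phi> \<in> carrier (dual_module R P)"
      and q: "\<psi> \<in> carrier (dual_module R P)" for \<Phi> \<phi> \<psi>
  proof -
    have "\<Phi> \<phi> \<otimes> \<psi> x = \<Phi> \<psi> \<otimes> \<phi> x" if x: "x \<in> carrier P" for x
    proof -
      have e: "\<psi> x \<odot>\<^bsub>dual_module R P\<^esub> \<phi> = \<phi> x \<odot>\<^bsub>dual_module R P\<^esub> \<psi>"
        using functional_exchange[OF P, of \<phi> \<psi> x] p q x by auto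
      have c: "\<psi> x \<in> carrier R" "\<phi> x \<in> carrier R" "\<Phi> \<phi> \<in> carrier R" "\<Phi> \<psi> \<in> carrier R"
        using p q x F functionalD(1)[OF F] by (auto simp: functionalD)
      have "\<psi> x \<otimes> \<Phi> \<phi> = \<phi> x \<otimes> \<Phi> \<psi>"
        using functionalD(3)[OF F c(1) p] functionalD(3)[OF F c(2) q] e by simp
      then show ?thesis using c by (simp add: m_comm)
    qed
    then show ?thesis by auto
  qed
  have "evaluations R P \<subseteq> evaluations R (dual_module R P)"
  proof
    fix a assume "a \<in> evaluations R P"
    then obtain \<phi> x where a: "a = \<phi> x" "\<phi> \<in> functionals R P" "x \<in> carrier P" by (auto simp: evaluations_def)
    have "restrict \<phi> (carrier P) \<in> carrier (dual_module R P)"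
      using a(2) module.smult_closed[OF M] module_add_closed[OF M]
      by (auto simp: mod_hom_def)
    moreover have "(\<lambda>\<psi>. \<psi> x) \<in> functionals R (dual_module R P)"
      using a by (intro mod_homI) (auto simp: functionalD)
    ultimately show "a \<in> evaluations R (dual_module R P)"
      using evaluationsI[of "\<lambda>\<psi>. \<psi> x" R "dual_module R P" "restrict \<phi> (carrier P)"] a by simp
  qed
  then have "e \<in> additive_span R (evaluations R (dual_module R P))"
    using P additive_span_mono_span[of "evaluations R P" R "evaluations R (dual_module R P)" e]
    by (auto simp: rank_one_def intro: additive_span.gen)
  moreover have "e \<odot>\<^bsub>dual_module R P\<^esub> \<phi> = \<phi>" if "\<phi> \<in> carrier (dual_module R P)" for \<phi>
    using that rank_one_eval_support[OF P, of \<phi>] by (auto simp: fun_eq_iff ext)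
  ultimately show ?thesis unfolding rank_one_def using sym D P by auto
qed

lemma dual_pairing:
  assumes P: "rank_one R P e"
  shows "perfect_pairing R P (dual_module R P) (ideal_module R (PIdl e)) (\<lambda>x \<phi>. \<phi> x)"
proof -
  note M = rank_one_module[OF P]
  have e: "e \<in> carrier R" "e \<otimes> e = e" using P rank_one_idem by auto
  have bl: "bilinear_map R (\<lambda>r. r) P (dual_module R P) (ideal_module R (PIdl e)) (\<lambda>x \<phi>. \<phi> x)"
    using rank_one_eval_support[OF P] by (intro bilinear_mapI) (auto simp: functionalD PIdl_iff[OF e])
  have "z \<in> additive_span (ideal_module R (PIdl e)) (values_of P (dual_module R P) (\<lambda>x \<phi>. \<phi> x))"
    (is "_ \<in> ?S") if z: "z \<in> PIdl e" for z
  proof -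
    have zc: "z \<in> carrier R" "e \<otimes> z = z" using z by (auto simp: PIdl_iff[OF e])
    define I where "I = ideal_module R (PIdl e)"
    have I: "r \<oplus>\<^sub>I s = r \<oplus> s" for r s by (simp add: I_def)
    have "z \<otimes> e \<in> additive_span I (values_of P (dual_module R P) (\<lambda>x \<phi>. \<phi> x))"
      using P
    proof (induction rule: rank_one_induct)
      case (eval \<phi> x)
      have "restrict \<phi> (carrier P) \<in> carrier (dual_module R P)"
        using eval(1) module.smult_closed[OF M] module_add_closed[OF M]
        by (auto simp: mod_hom_def)
      moreover have "z \<odot>\<^sub>P x \<in> carrier P" using eval zc module.smult_closed[OF M] by auto
      ultimately have "restrict \<phi> (carrier P) (z \<odot>\<^sub>P x) \<in> values_of P (dual_module R P) (\<lambda>x \<phi>. \<phi> x)"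
        by (intro values_ofI[where b = "\<lambda>x \<phi>. \<phi> x"])
      then show ?case using eval zc \<open>z \<odot>\<^bsub>P\<^esub> x \<in> carrier P\<close> by (auto simp: functionalD intro: additive_span.gen)
    next
      case (add r s)
      then show ?case using zc additive_span.add[of "z \<otimes> r" I _ "z \<otimes> s"] by (simp add: I r_distr)
    qed
    then show ?thesis using zc e by (simp add: m_comm I_def)
  qed
  then show ?thesis using bl by (auto simp: perfect_pairing_def)
qed

text \<open>
  The pairing induces a surjection of \<open>E \<otimes> F\<close> onto \<open>L\<close>, and both have the same
  support.
\<close>

lemma tensor_iso_of_pairing:
  assumes E: "rank_one R E e" and F: "rank_one R F f" and L: "rank_one R L (e \<otimes> f)"
    and b: "perfect_pairing R E F L b"
  obtains \<theta> where "\<theta> \<in> mod_iso R (tensor R (central E) (central F)) L"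
    "\<And>x y. x \<in> carrier E \<Longrightarrow> y \<in> carrier F \<Longrightarrow> \<theta> (ptensor R (central E) (central F) x y) = b x y"
proof -
  interpret T: tensor_product R "central E" "central F"
    using assms by (intro tensor_central rank_one_module)
  note LM = rank_one_module[OF L]
  have bl: "bilinear_map R (\<lambda>r. r) E F L b" and sp: "carrier L \<subseteq> additive_span L (values_of E F b)"
    using b by (auto simp: perfect_pairing_def)
  note B = bilinear_mapD[OF bl]
  have bal: "balanced R (central E) (central F) L b" by (simp add: balanced_def B)
  let ?t = "tensor_lift R (central E) (central F) (additive_group L) b"
  have h: "?t \<in> mod_hom R T.T L" by (rule T.lift_mod_hom[OF LM bal]) (simp add: B)
  have pt: "?t (T.pt x y) = b x y" if "x \<in> carrier E" "y \<in> carrier F" for x y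
    using T.lift_pt[OF module_abelian[OF LM] bal] that by simp
  have "z \<in> ?t ` carrier T.T" if "z \<in> additive_span L (values_of E F b)" for z
    using that
  proof (induction rule: additive_span.induct)
    case (gen x)
    then show ?case using pt by (auto simp: values_of_def intro!: image_eqI[of _ _ "T.pt _ _"])
  next
    case (add x y)
    then obtain s t where "s \<in> carrier T.T" "t \<in> carrier T.T" "x = ?t s" "y = ?t t" by auto
    then show ?case using mod_homD(2)[OF h, of s t] module_add_closed[OF T.tensor_module, of s t]
      by (auto intro!: image_eqI[of _ _ "s \<oplus>\<^bsub>T.T\<^esub> t"])
  qed
  then have "?t \<in> mod_iso R T.T L"
    using sp by (intro rank_one_surj_iso[OF rank_one_tensor[OF E F] L h]) auto
  then show ?thesis using that pt by blast
qed

text \<open>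
  If \<open>z\<close> is a sum of elements \<open>A t'\<close>, then \<open>\<psi>(z) B t\<close> is a sum of
  elements \<open>\<psi>(A t') B t = \<psi>(B t) A t' = \<psi>(B t') A t\<close>, a multiple of \<open>A t\<close>
  by a scalar that is independent of \<open>t\<close>. Summing the factors \<open>\<psi>(z)\<close> up to the
  support of \<open>L\<close> turns the left hand side into \<open>B t\<close>.
\<close>

lemma ratio:
  assumes L: "rank_one R L e" and i: "i \<in> carrier R"
    and A: "\<And>t. t \<in> X0 \<Longrightarrow> A t \<in> carrier L" and B: "\<And>t. t \<in> X0 \<Longrightarrow> B t \<in> carrier L"
    and span: "\<And>z. z \<in> carrier L \<Longrightarrow> i \<odot>\<^sub>L z \<in> additive_span L (A ` X0)"
    and iB: "\<And>t. t \<in> X0 \<Longrightarrow> i \<odot>\<^sub>L B t = B t"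
    and sym: "\<And>\<psi> t t'. \<psi> \<in> functionals R L \<Longrightarrow> t \<in> X0 \<Longrightarrow> t' \<in> X0 \<Longrightarrow>
       \<psi> (B t) \<odot>\<^sub>L A t' = \<psi> (B t') \<odot>\<^sub>L A t"
  shows "\<exists>w\<in>carrier R. \<forall>t\<in>X0. B t = w \<odot>\<^sub>L A t"
proof -
  interpret L: module R L using L by (rule rank_one_module)
  have AX: "A ` X0 \<subseteq> carrier L" using A by auto
  have 1: "\<exists>w\<in>carrier R. \<forall>t\<in>X0. \<psi> z \<odot>\<^sub>L B t = w \<odot>\<^sub>L A t"
    if z: "z \<in> additive_span L (A ` X0)" and p: "\<psi> \<in> functionals R L" for z \<psi>
    using z
  proof (induction rule: additive_span.induct)
    case (gen x)
    then obtain t' where t': "t' \<in> X0" "x = A t'" by auto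
    have "\<psi> x \<odot>\<^sub>L B t = \<psi> (B t') \<odot>\<^sub>L A t" if "t \<in> X0" for t
      using rank_one_sym[OF L p, of "A t'" "B t"] sym[OF p that t'(1)] A B t' that by simp
    then show ?case using functionalD(1)[OF p B[OF t'(1)]] by blast
  next
    case (add x y)
    have xy: "x \<in> carrier L" "y \<in> carrier L"
      using add additive_span_closed[OF L.M.abelian_group_axioms AX] by auto
    obtain v w where vw: "v \<in> carrier R" "w \<in> carrier R" "\<forall>t\<in>X0. \<psi> x \<odot>\<^sub>L B t = v \<odot>\<^sub>L A t"
      "\<forall>t\<in>X0. \<psi> y \<odot>\<^sub>L B t = w \<odot>\<^sub>L A t" using add by blast
    then show ?case using xy A B p
      by (intro bexI[of _ "v \<oplus> w"]) (simp_all add: functionalD L.smult_l_distr)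
  qed
  have "\<exists>w\<in>carrier R. \<forall>t\<in>X0. e \<odot>\<^sub>L (i \<odot>\<^sub>L B t) = w \<odot>\<^sub>L A t"
    using L
  proof (induction rule: rank_one_induct)
    case (eval \<psi> z)
    have "\<psi> z \<odot>\<^sub>L (i \<odot>\<^sub>L B t) = \<psi> (i \<odot>\<^sub>L z) \<odot>\<^sub>L B t" if "t \<in> X0" for t
      using eval i B[OF that] by (simp add: functionalD m_comm flip: L.smult_assoc1)
    then show ?case using 1[OF span eval(1)] eval by simp
  next
    case (add r s)
    then obtain v w where vw: "v \<in> carrier R" "w \<in> carrier R" "\<forall>t\<in>X0. r \<odot>\<^sub>L (i \<odot>\<^sub>L B t) = v \<odot>\<^sub>L A t"
      "\<forall>t\<in>X0. s \<odot>\<^sub>L (i \<odot>\<^sub>L B t) = w \<odot>\<^sub>L A t" by blast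
    then show ?case using A B i add
      by (intro bexI[of _ "v \<oplus> w"]) (simp_all add: L.smult_l_distr)
  qed
  then show ?thesis using rank_one_support[OF L] iB B by auto
qed

end

section \<open>Rank one modules and PicS modules\<close>

lemma free_module_simps [simp]:
  "carrier (free_module R n) = {..<n} \<rightarrow>\<^sub>E carrier R"
  "x \<oplus>\<^bsub>free_module R n\<^esub> y = (\<lambda>i\<in>{..<n}. x i \<oplus>\<^sub>R y i)"
  "r \<odot>\<^bsub>free_module R n\<^esub> x = (\<lambda>i\<in>{..<n}. r \<otimes>\<^sub>R x i)"
  by (simp_all add: free_module_def)

lemma End_algebra_simps [simp]:
  "carrier (End_algebra R M) = mod_hom R M M \<inter> extensional (carrier M)"
  "f \<otimes>\<^bsub>End_algebra R M\<^esub> g = compose (carrier M) f g"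
  "f \<oplus>\<^bsub>End_algebra R M\<^esub> g = (\<lambda>x\<in>carrier M. f x \<oplus>\<^sub>M g x)"
  "r \<odot>\<^bsub>End_algebra R M\<^esub> f = (\<lambda>x\<in>carrier M. r \<odot>\<^sub>M f x)"
  "\<one>\<^bsub>End_algebra R M\<^esub> = (\<lambda>x\<in>carrier M. x)"
  by (simp_all add: End_algebra_def hom_module_def)

context cring
begin

text \<open>
  The sum of values of functionals is brought into the form of a finite sum over an index range by adding its terms
  to an accumulated sum \<open>t\<close>.
\<close>

lemma rank_one_trace:
  assumes E: "rank_one R E e"
  obtains n :: nat and \<phi> x where "\<And>k. k < n \<Longrightarrow> \<phi> k \<in> functionals R E" "\<And>k. k < n \<Longrightarrow> x k \<in> carrier E"
    "e = finsum R (\<lambda>k. \<phi> k (x k)) {..<n}"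
proof -
  let ?P = "\<lambda>s. \<exists>(n::nat) \<phi> x. (\<forall>k<n. \<phi> k \<in> functionals R E) \<and> (\<forall>k<n. x k \<in> carrier E) \<and>
    s = finsum R (\<lambda>k. \<phi> k (x k)) {..<n}"
  have "\<forall>t\<in>carrier R. ?P t \<longrightarrow> ?P (t \<oplus> e)"
    using E
  proof (induction rule: rank_one_induct)
    case (eval \<phi> x)
    show ?case
    proof (intro ballI impI)
      fix t assume t: "t \<in> carrier R" "?P t"
      then obtain n :: nat and \<psi> y where n: "\<forall>k<n. \<psi> k \<in> functionals R E" "\<forall>k<n. y k \<in> carrier E"
        "t = finsum R (\<lambda>k. \<psi> k (y k)) {..<n}" by blast
      have "finsum R (\<lambda>k. (\<psi>(n := \<phi>)) k ((y(n := x)) k)) {..<Suc n} =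
        \<phi> x \<oplus> finsum R (\<lambda>k. (\<psi>(n := \<phi>)) k ((y(n := x)) k)) {..<n}"
        unfolding lessThan_Suc using n eval
        by (subst finsum_insert) (auto simp: functionalD)
      also have "finsum R (\<lambda>k. (\<psi>(n := \<phi>)) k ((y(n := x)) k)) {..<n} = t"
        unfolding n(3) using n(1,2) by (intro finsum_cong') (auto simp: functionalD)
      finally have "t \<oplus> \<phi> x = finsum R (\<lambda>k. (\<psi>(n := \<phi>)) k ((y(n := x)) k)) {..<Suc n}"
        using t eval by (simp add: functionalD a_comm)
      then show "?P (t \<oplus> \<phi> x)"
        using n(1,2) eval by (intro exI[of _ "Suc n"] exI[of _ "\<psi>(n := \<phi>)"] exI[of _ "y(n := x)"]) auto
    qed
  next
    case (add r s)
    show ?case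
    proof (intro ballI impI)
      fix t assume t: "t \<in> carrier R" "?P t"
      have "?P (t \<oplus> r)" using add(3) t by blast
      then have "?P ((t \<oplus> r) \<oplus> s)" using add(1,4) t(1) by blast
      then show "?P (t \<oplus> (r \<oplus> s))" using add(1,2) t(1) by (simp only: a_assoc)
    qed
  qed
  moreover have "?P \<zero>" by (intro exI[of _ 0]) simp
  ultimately have "?P (\<zero> \<oplus> e)" by blast
  then show ?thesis using that E by auto
qed

text \<open>
  From \<open>e = \<Sum> \<phi>\<^sub>k(x\<^sub>k)\<close> one obtains \<open>y = e y = \<Sum>
  \<phi>\<^sub>k(x\<^sub>k) y = \<Sum> \<phi>\<^sub>k(y) x\<^sub>k\<close>.
\<close>

lemma rank_one_dual_basis:
  assumes E: "rank_one R E e"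
  obtains n :: nat and \<phi> x where "\<And>k. k < n \<Longrightarrow> \<phi> k \<in> functionals R E" "\<And>k. k < n \<Longrightarrow> x k \<in> carrier E"
    "\<And>y. y \<in> carrier E \<Longrightarrow> finsum E (\<lambda>k. \<phi> k y \<odot>\<^sub>E x k) {..<n} = y"
proof -
  obtain n :: nat and \<phi> x where n: "\<And>k. k < n \<Longrightarrow> \<phi> k \<in> functionals R E" "\<And>k. k < n \<Longrightarrow> x k \<in> carrier E"
    "e = finsum R (\<lambda>k. \<phi> k (x k)) {..<n}" using rank_one_trace[OF E] by metis
  have "finsum E (\<lambda>k. \<phi> k y \<odot>\<^sub>E x k) {..<n} = y" if y: "y \<in> carrier E" for y
  proof -
    interpret E: module R E using E by (rule rank_one_module)
    have "y = e \<odot>\<^sub>E y" using rank_one_support[OF E y] by simp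
    also have "\<dots> = finsum E (\<lambda>k. \<phi> k (x k) \<odot>\<^sub>E y) {..<n}"
      unfolding n(3)
      by (rule additive_map_finsum[OF abelian_group_axioms module_abelian[OF rank_one_module[OF E]]])
        (use y in \<open>auto simp: additive_map_def E.smult_l_distr intro: functionalD(1)[OF n(1) n(2)]\<close>)
    also have "\<dots> = finsum E (\<lambda>k. \<phi> k y \<odot>\<^sub>E x k) {..<n}"
      using n(2) y rank_one_sym[OF E n(1) n(2) y] by (intro E.M.finsum_cong') (auto intro: functionalD(1)[OF n(1)])
    finally show ?thesis by simp
  qed
  then show ?thesis using that n by blast
qed

lemma rank_one_fg_projective:
  assumes E: "rank_one R E e"
  shows "\<exists>n. \<exists>i \<in> mod_hom R E (free_module R n). \<exists>p \<in> mod_hom R (free_module R n) E. \<forall>x\<in>carrier E. p (i x) = x"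
proof -
  interpret E: module R E using E by (rule rank_one_module)
  obtain n :: nat and \<phi> x where n: "\<And>k. k < n \<Longrightarrow> \<phi> k \<in> functionals R E" "\<And>k. k < n \<Longrightarrow> x k \<in> carrier E"
    "\<And>y. y \<in> carrier E \<Longrightarrow> finsum E (\<lambda>k. \<phi> k y \<odot>\<^sub>E x k) {..<n} = y" 
    by (rule rank_one_dual_basis[OF E]) blast
  let ?i = "\<lambda>y. \<lambda>k\<in>{..<n}. \<phi> k y" and ?p = "\<lambda>v. finsum E (\<lambda>k. v k \<odot>\<^sub>E x k) {..<n}"
  have i: "?i \<in> mod_hom R E (free_module R n)"
    using functionalD[OF n(1)] by (intro mod_homI) (auto simp: fun_eq_iff)
  have p: "?p \<in> mod_hom R (free_module R n) E"
  proof (rule mod_homI)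
    fix v assume "v \<in> carrier (free_module R n)"
    then show "?p v \<in> carrier E" using n(2) by (intro E.M.finsum_closed) auto
  next
    fix v w assume vw: "v \<in> carrier (free_module R n)" "w \<in> carrier (free_module R n)"
    have v: "v k \<in> carrier R" "w k \<in> carrier R" if "k < n" for k using vw that by auto
    have "?p v \<oplus>\<^sub>E ?p w = finsum E (\<lambda>k. v k \<odot>\<^sub>E x k \<oplus>\<^sub>E w k \<odot>\<^sub>E x k) {..<n}"
      using v n(2) by (intro E.M.finsum_addf[symmetric]) auto
    also have "\<dots> = ?p (v \<oplus>\<^bsub>free_module R n\<^esub> w)"
      using v n(2) by (intro E.M.finsum_cong') (auto simp: E.smult_l_distr)
    finally show "?p (v \<oplus>\<^bsub>free_module R n\<^esub> w) = ?p v \<oplus>\<^sub>E ?p w" ..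
  next
    fix r v assume r: "r \<in> carrier R" and v0: "v \<in> carrier (free_module R n)"
    have v: "v k \<in> carrier R" if "k < n" for k using v0 that by auto
    have "r \<odot>\<^sub>E ?p v = finsum E (\<lambda>k. r \<odot>\<^sub>E (v k \<odot>\<^sub>E x k)) {..<n}"
      using r v n(2) by (intro E.finsum_smult_ldistr) auto
    also have "\<dots> = ?p (r \<odot>\<^bsub>free_module R n\<^esub> v)"
      using r v n(2) by (intro E.M.finsum_cong') (auto simp: E.smult_assoc1)
    finally show "?p (r \<odot>\<^bsub>free_module R n\<^esub> v) = r \<odot>\<^sub>E ?p v" ..
  qed
  have "?p (?i y) = y" if y: "y \<in> carrier E" for y
  proof -
    have "?p (?i y) = finsum E (\<lambda>k. \<phi> k y \<odot>\<^sub>E x k) {..<n}"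
      using y n(2) functionalD(1)[OF n(1)] by (intro E.M.finsum_cong') auto
    then show ?thesis using n(3)[OF y] by simp
  qed
  then show ?thesis by (intro exI[of _ n] bexI[OF _ i] bexI[OF _ p]) (rule ballI)
qed

text \<open>
  The dual basis embeds \<open>E\<close> into a free module, and the image of the embedding has elements of the type
  that is used for classes.
\<close>

lemma iso_class_nonempty:
  assumes E: "rank_one R E e"
  obtains S :: "'a small_module" where "S \<in> iso_class R E" "rank_one R S e"
proof -
  note M = rank_one_module[OF E]
  interpret E: module R E by (rule M)
  obtain n i p where ip: "i \<in> mod_hom R E (free_module R n)" "p \<in> mod_hom R (free_module R n) E"
    "\<forall>x\<in>carrier E. p (i x) = x" using rank_one_fg_projective[OF E] by blast
  define S :: "'a small_module" where "S = \<lparr>carrier = i ` carrier E, monoid.mult = undefined, one = undefined,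
    ring.zero = i \<zero>\<^sub>E, ring.add = (\<oplus>\<^bsub>free_module R n\<^esub>), smult = (\<odot>\<^bsub>free_module R n\<^esub>)\<rparr>"
  note I = mod_homD[OF ip(1)]
  have S: "module R S" by (rule module_image[OF M, of S i]) (use I in \<open>auto simp: S_def\<close>)
  have "inj_on i (carrier E)" using ip(3) by (metis inj_onI)
  moreover have "i \<in> mod_hom R E S" using I by (intro mod_homI) (auto simp: S_def)
  ultimately have iso: "i \<in> mod_iso R E S" by (auto simp: mod_iso_def bij_betw_def S_def)
  then have "S \<in> iso_class R E" using S by (auto simp: iso_class_def)
  then show ?thesis using that rank_one_iso[OF E iso S] by blast
qed

text \<open>
  Every endomorphism \<open>T\<close> is a scalar: the symmetry gives \<open>\<phi>(z) T x = T(\<phi>(x) z) =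
  \<phi>(x) T z = \<phi>(T z) x\<close>, and the factors \<open>\<phi>(z)\<close> add up to \<open>e\<close>, which
  acts as the identity.
\<close>

lemma rank_one_picS_module:
  assumes E: "rank_one R E e" shows "picS_module R E"
proof -
  note M = rank_one_module[OF E]
  interpret E: module R E by (rule M)
  have fg: "fg_projective R E" using rank_one_fg_projective[OF E] M by (simp add: fg_projective_def)
  let ?\<phi> = "\<lambda>r. \<lambda>x\<in>carrier E. r \<odot>\<^sub>E x"
  have c: "?\<phi> r \<in> carrier (End_algebra R E)" if "r \<in> carrier R" for r
    using that by (auto intro!: mod_homI simp: E.smult_r_distr m_comm simp flip: E.smult_assoc1)
  have hom: "?\<phi> \<in> ring_hom R (End_algebra R E)"
    using c by (intro ring_hom_memI) (auto simp: E.smult_l_distr E.smult_assoc1 compose_def restrict_def fun_eq_iff)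
  have surj: "T \<in> ?\<phi> ` carrier R" if T: "T \<in> carrier (End_algebra R E)" for T
  proof -
    have h: "T \<in> mod_hom R E E" and ex: "T \<in> extensional (carrier E)" using T by auto
    note H = mod_homD[OF h]
    have "\<exists>r\<in>carrier R. \<forall>x\<in>carrier E. e \<odot>\<^sub>E T x = r \<odot>\<^sub>E x"
      using E
    proof (induction rule: rank_one_induct)
      case (eval \<phi> z)
      have "\<phi> z \<odot>\<^sub>E T x = \<phi> (T z) \<odot>\<^sub>E x" if x: "x \<in> carrier E" for x
      proof -
        have "\<phi> z \<odot>\<^sub>E T x = T (\<phi> x \<odot>\<^sub>E z)"
          using eval x rank_one_sym[OF E eval x] H(3)[of "\<phi> z" x] by (simp add: functionalD)
        also have "\<dots> = \<phi> x \<odot>\<^sub>E T z" using eval x by (simp add: functionalD H)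
        also have "\<dots> = \<phi> (T z) \<odot>\<^sub>E x" using rank_one_sym[OF E eval(1) x H(1)[OF eval(2)]] .
        finally show ?thesis .
      qed
      then show ?case using eval by (intro bexI[of _ "\<phi> (T z)"]) (auto simp: functionalD H)
    next
      case (add r s)
      then obtain v w where "v \<in> carrier R" "w \<in> carrier R" "\<forall>x\<in>carrier E. r \<odot>\<^sub>E T x = v \<odot>\<^sub>E x"
        "\<forall>x\<in>carrier E. s \<odot>\<^sub>E T x = w \<odot>\<^sub>E x" by blast
      then show ?case using add by (intro bexI[of _ "v \<oplus> w"]) (auto simp: E.smult_l_distr H)
    qed
    then obtain r where r: "r \<in> carrier R" "\<forall>x\<in>carrier E. T x = r \<odot>\<^sub>E x"
      using rank_one_support[OF E] H by auto
    then have "T = ?\<phi> r" using ex by (auto simp: fun_eq_iff extensional_def)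
    then show ?thesis using r by blast
  qed
  show ?thesis unfolding picS_module_def
  proof (intro conjI bexI[OF _ hom] ballI fg)
    show "?\<phi> (r \<otimes> s) = r \<odot>\<^bsub>End_algebra R E\<^esub> ?\<phi> s" if "r \<in> carrier R" "s \<in> carrier R" for r s
      using that by (auto simp: E.smult_assoc1)
    show "?\<phi> ` carrier R = carrier (End_algebra R E)" using c surj by blast
  qed
qed

text \<open>
  This is the ring identity behind \<open>picS_module_rank_one\<close>: if elements \<open>a\<^sub>i\<close> with
  \<open>c a\<^sub>i\<^sup>2 = 0\<close> add up to an element that acts on \<open>c M\<close> as the identity, then
  \<open>c M = 0\<close>. The induction removes one \<open>a\<^sub>j\<close> at a time: on \<open>c a\<^sub>j
  M\<close> the remaining sum still acts as the identity because \<open>c a\<^sub>j\<^sup>2 = 0\<close>, so \<open>c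
  a\<^sub>j M = 0\<close> by the induction hypothesis, and then \<open>a\<^sub>j\<close> no longer contributes on
  \<open>c M\<close>.
\<close>

lemma square_zero_sum:
  assumes "finite S" "\<And>i. i \<in> S \<Longrightarrow> a i \<in> carrier R" and M: "module R M"
    and "c \<in> carrier R" "\<And>i x. i \<in> S \<Longrightarrow> x \<in> carrier M \<Longrightarrow> c \<odot>\<^sub>M (a i \<odot>\<^sub>M (a i \<odot>\<^sub>M x)) = \<zero>\<^sub>M"
    and "\<And>x. x \<in> carrier M \<Longrightarrow> c \<odot>\<^sub>M x = c \<odot>\<^sub>M (finsum R a S \<odot>\<^sub>M x)"
  shows "x \<in> carrier M \<Longrightarrow> c \<odot>\<^sub>M x = \<zero>\<^sub>M"
  using assms(1,2,4-)
proof (induction S arbitrary: c x)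
  interpret M: module R M by (rule M)
  case empty
  then show ?case by simp
next
  interpret M: module R M by (rule M)
  case (insert j S)
  let ?s = "finsum R a S"
  note ac = insert.prems(2) and c = insert.prems(3) and sq = insert.prems(4) and unit = insert.prems(5)
  have aj: "a j \<in> carrier R" and s: "?s \<in> carrier R" using ac by auto
  have sum: "finsum R a (insert j S) = a j \<oplus> ?s"
    using insert.hyps ac by (intro finsum_insert) auto
  have eq: "c \<odot>\<^sub>M x = c \<odot>\<^sub>M (a j \<odot>\<^sub>M x) \<oplus>\<^sub>M c \<odot>\<^sub>M (?s \<odot>\<^sub>M x)" if "x \<in> carrier M" for x
    using unit[OF that] that aj s c by (simp add: sum M.smult_l_distr M.smult_r_distr)
  have comm: "r \<odot>\<^sub>M (t \<odot>\<^sub>M x) = t \<odot>\<^sub>M (r \<odot>\<^sub>M x)"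
    if "r \<in> carrier R" "t \<in> carrier R" "x \<in> carrier M" for r t x
    using that by (simp add: m_comm flip: M.smult_assoc1)
  have 1: "(c \<otimes> a j) \<odot>\<^sub>M x = \<zero>\<^sub>M" if x: "x \<in> carrier M" for x
  proof (rule insert.IH)
    fix i x assume i: "i \<in> S" and x: "x \<in> carrier M"
    then have "a i \<in> carrier R" using ac by auto
    then show "(c \<otimes> a j) \<odot>\<^sub>M (a i \<odot>\<^sub>M (a i \<odot>\<^sub>M x)) = \<zero>\<^sub>M"
      using sq[of i "a j \<odot>\<^sub>M x"] i x c aj
      by (simp add: M.smult_assoc1 comm[of "a j"])
  next
    fix x assume x: "x \<in> carrier M"
    show "(c \<otimes> a j) \<odot>\<^sub>M x = (c \<otimes> a j) \<odot>\<^sub>M (?s \<odot>\<^sub>M x)"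
      using eq[of "a j \<odot>\<^sub>M x"] sq[of j x] x c aj s
      by (simp add: M.smult_assoc1 comm[of ?s "a j"])
  qed (use ac c aj x in auto)
  show ?case
  proof (rule insert.IH)
    fix x assume x: "x \<in> carrier M"
    show "c \<odot>\<^sub>M x = c \<odot>\<^sub>M (?s \<odot>\<^sub>M x)"
      using eq[OF x] 1[OF x] x c aj s by (simp add: M.smult_assoc1)
  qed (use ac c sq insert.prems(1) in auto)
qed

lemma free_module_hom_expand:
  assumes M: "module R M" and p: "p \<in> mod_hom R (free_module R n) M"
    and v: "v \<in> carrier (free_module R n)"
  shows "p v = finsum M (\<lambda>k. v k \<odot>\<^sub>M p (\<lambda>i\<in>{..<n}. if i = k then \<one> else \<zero>)) {..<n}"
proof -
  interpret M: module R M by (rule M)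
  note P = mod_homD[OF p]
  let ?u = "\<lambda>k. \<lambda>i\<in>{..<n}. if i = k then \<one> else \<zero>"
  have u: "?u k \<in> carrier (free_module R n)" for k by auto
  have vk: "v k \<in> carrier R" if "k < n" for k using v that by auto
  have "p (\<lambda>i\<in>{..<n}. if i < m then v i else \<zero>) = finsum M (\<lambda>k. v k \<odot>\<^sub>M p (?u k)) {..<m}" if "m \<le> n" for m
    using that
  proof (induction m)
    case 0
    let ?z = "\<lambda>i\<in>{..<n}. \<zero>"
    have z: "?z \<in> carrier (free_module R n)" by auto
    have "p ?z = p (\<zero> \<odot>\<^bsub>free_module R n\<^esub> ?z)" by (rule arg_cong[of _ _ p]) auto
    then have "p ?z = \<zero> \<odot>\<^sub>M p ?z" using P(3)[OF zero_closed z] by (rule trans)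
    then have "p ?z = \<zero>\<^sub>M" using M.smult_l_null[OF P(1)[OF z]] by (rule trans)
    then show ?case by (simp only: not_less_zero if_False lessThan_0 M.M.finsum_empty)
  next
    case (Suc m)
    let ?w = "\<lambda>m. \<lambda>i\<in>{..<n}. if i < m then v i else \<zero>"
    have w: "?w m \<in> carrier (free_module R n)" using vk by auto
    have vu: "v m \<odot>\<^bsub>free_module R n\<^esub> ?u m \<in> carrier (free_module R n)" using vk Suc.prems by auto
    have "?w (Suc m) = v m \<odot>\<^bsub>free_module R n\<^esub> ?u m \<oplus>\<^bsub>free_module R n\<^esub> ?w m"
      using vk Suc.prems by (auto simp: fun_eq_iff less_Suc_eq)
    then have "p (?w (Suc m)) = p (v m \<odot>\<^bsub>free_module R n\<^esub> ?u m) \<oplus>\<^sub>M p (?w m)"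
      using P(2)[OF vu w] by presburger
    also have "p (v m \<odot>\<^bsub>free_module R n\<^esub> ?u m) = v m \<odot>\<^sub>M p (?u m)"
      by (rule P(3)[OF _ u]) (use vk Suc.prems in auto)
    also have "p (?w m) = finsum M (\<lambda>k. v k \<odot>\<^sub>M p (?u k)) {..<m}" by (rule Suc.IH) (use Suc.prems in simp)
    also have "v m \<odot>\<^sub>M p (?u m) \<oplus>\<^sub>M \<dots> = finsum M (\<lambda>k. v k \<odot>\<^sub>M p (?u k)) {..<Suc m}"
      unfolding lessThan_Suc using vk Suc.prems P(1)[OF u]
      by (intro M.M.finsum_insert[symmetric]) auto
    finally show ?case .
  qed
  from this[of n] have "p (\<lambda>i\<in>{..<n}. if i < n then v i else \<zero>) = finsum M (\<lambda>k. v k \<odot>\<^sub>M p (?u k)) {..<n}" by simp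
  moreover have "(\<lambda>i\<in>{..<n}. if i < n then v i else \<zero>) = v"
    using v by (auto simp: fun_eq_iff PiE_def extensional_def)
  ultimately show ?thesis by simp
qed

text \<open>
  Take a dual basis \<open>\<phi>\<^sub>k, x\<^sub>k\<close>, and let \<open>e = \<Sum>
  \<phi>\<^sub>k(x\<^sub>k)\<close> be its trace. Every endomorphism is a scalar; in particular \<open>z \<mapsto>
  \<phi>\<^sub>k(z) x\<^sub>k\<close> is multiplication by some \<open>a\<^sub>k\<close>, and taking traces gives
  \<open>\<phi>\<^sub>k(x\<^sub>k) = a\<^sub>k e\<close>. On \<open>E\<close> one has \<open>\<Sum> a\<^sub>k =
  1\<close>, and \<open>a\<^sub>k\<^sup>2 = a\<^sub>k\<^sup>2 e\<close> because \<open>a\<^sub>k x\<^sub>k =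
  \<phi>\<^sub>k(x\<^sub>k) x\<^sub>k\<close>. So \<open>(1 - e) a\<^sub>k\<^sup>2 = 0\<close> on \<open>E\<close>,
  and \<open>square_zero_sum\<close> yields \<open>(1 - e) E = 0\<close>. The symmetry follows again by comparing
  the scalar of \<open>z \<mapsto> \<psi>(z) y\<close> with its trace \<open>\<psi>(y)\<close>.
\<close>

lemma picS_module_rank_one:
  assumes E: "picS_module R E" shows "\<exists>e. rank_one R E e"
proof -
  have M: "module R E" using E by (auto simp: picS_module_def fg_projective_def)
  interpret E: module R E by (rule M)
  obtain \<Theta> where \<Theta>: "\<Theta> \<in> ring_hom R (End_algebra R E)"
    "\<forall>r\<in>carrier R. \<forall>s\<in>carrier R. \<Theta> (r \<otimes> s) = r \<odot>\<^bsub>End_algebra R E\<^esub> \<Theta> s"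
    "\<Theta> ` carrier R = carrier (End_algebra R E)" using E unfolding picS_module_def by blast
  have scal: "\<exists>r\<in>carrier R. \<forall>x\<in>carrier E. T x = r \<odot>\<^sub>E x" if T: "T \<in> mod_hom R E E" for T
  proof -
    have "restrict T (carrier E) \<in> carrier (End_algebra R E)" using T by (auto simp: mod_hom_def)
    then have "restrict T (carrier E) \<in> \<Theta> ` carrier R" using \<Theta>(3) by (simp only:)
    then obtain r where r: "r \<in> carrier R" "restrict T (carrier E) = \<Theta> r" by blast
    have "\<Theta> r = r \<odot>\<^bsub>End_algebra R E\<^esub> \<one>\<^bsub>End_algebra R E\<^esub>"
      using \<Theta>(2) r(1) ring_hom_one[OF \<Theta>(1)] by (metis one_closed r_one)
    then have "\<forall>x\<in>carrier E. T x = r \<odot>\<^sub>E x" using r(2) by (auto simp: fun_eq_iff split: if_splits)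
    then show ?thesis using r(1) by blast
  qed
  obtain n i p where ip: "i \<in> mod_hom R E (free_module R n)" "p \<in> mod_hom R (free_module R n) E"
    "\<forall>x\<in>carrier E. p (i x) = x" using E by (auto simp: picS_module_def fg_projective_def)
  define \<phi> where "\<phi> = (\<lambda>k y. i y k)"
  define x where "x = (\<lambda>k. p (\<lambda>i\<in>{..<n}. if i = k then \<one> else \<zero>))"
  have \<phi>: "\<phi> k \<in> functionals R E" if "k < n" for k
    using mod_homD[OF ip(1)] that by (intro mod_homI) (auto simp: \<phi>_def)
  have x: "x k \<in> carrier E" for k using mod_homD(1)[OF ip(2)] by (auto simp: x_def)
  have basis: "finsum E (\<lambda>k. \<phi> k y \<odot>\<^sub>E x k) {..<n} = y" if "y \<in> carrier E" for y
    using free_module_hom_expand[OF M ip(2) mod_homD(1)[OF ip(1) that]] ip(3) that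
    by (simp add: \<phi>_def x_def)
  define e where "e = finsum R (\<lambda>k. \<phi> k (x k)) {..<n}"
  have ec: "e \<in> carrier R" unfolding e_def using x functionalD(1)[OF \<phi>] by (intro finsum_closed) auto
  have trace: "\<psi> y = r \<otimes> e"
    if p: "\<psi> \<in> functionals R E" and y: "y \<in> carrier E" and r: "r \<in> carrier R"
      and eq: "\<And>z. z \<in> carrier E \<Longrightarrow> \<psi> z \<odot>\<^sub>E y = r \<odot>\<^sub>E z" for \<psi> y r
  proof -
    note P = functionalD[OF p]
    have "\<psi> y = \<psi> (finsum E (\<lambda>k. \<phi> k y \<odot>\<^sub>E x k) {..<n})" using basis[OF y] by simp
    also have "\<dots> = finsum R (\<lambda>k. \<psi> (\<phi> k y \<odot>\<^sub>E x k)) {..<n}"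
      by (rule additive_map_finsum[OF module_abelian[OF M] abelian_group_axioms functional_additive[OF p]])
        (use x y functionalD(1)[OF \<phi>] in auto)
    also have "\<dots> = finsum R (\<lambda>k. r \<otimes> \<phi> k (x k)) {..<n}"
    proof (rule finsum_cong')
      fix k assume k: "k \<in> {..<n}"
      note K = functionalD[OF \<phi>, of k]
      have "\<psi> (\<phi> k y \<odot>\<^sub>E x k) = \<phi> k (\<psi> (x k) \<odot>\<^sub>E y)" using k x y by (simp add: K P m_comm)
      also have "\<dots> = r \<otimes> \<phi> k (x k)" using k x r by (simp add: eq K)
      finally show "\<psi> (\<phi> k y \<odot>\<^sub>E x k) = r \<otimes> \<phi> k (x k)" .
    qed (use x r functionalD(1)[OF \<phi>] in auto)
    also have "\<dots> = r \<otimes> e"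
      unfolding e_def by (rule finsum_rdistr[symmetric]) (use x r functionalD(1)[OF \<phi>] in auto)
    finally show ?thesis .
  qed
  have scal2: "\<exists>r\<in>carrier R. \<forall>z\<in>carrier E. \<psi> z \<odot>\<^sub>E y = r \<odot>\<^sub>E z"
    if p: "\<psi> \<in> functionals R E" and y: "y \<in> carrier E" for \<psi> y
    by (rule scal) (use functionalD[OF p] y in \<open>auto intro!: mod_homI simp: E.smult_l_distr E.smult_assoc1\<close>)
  obtain a where a: "\<And>k. k < n \<Longrightarrow> a k \<in> carrier R"
    "\<And>k z. k < n \<Longrightarrow> z \<in> carrier E \<Longrightarrow> \<phi> k z \<odot>\<^sub>E x k = a k \<odot>\<^sub>E z"
  proof -
    have "\<forall>k. \<exists>r. k < n \<longrightarrow> r \<in> carrier R \<and> (\<forall>z\<in>carrier E. \<phi> k z \<odot>\<^sub>E x k = r \<odot>\<^sub>E z)"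
      using scal2[OF \<phi> x] by blast
    then obtain a where "\<forall>k. k < n \<longrightarrow> a k \<in> carrier R \<and> (\<forall>z\<in>carrier E. \<phi> k z \<odot>\<^sub>E x k = a k \<odot>\<^sub>E z)"
      by (rule choice[THEN exE])
    then show ?thesis using that by blast
  qed
  have ak: "\<phi> k (x k) = a k \<otimes> e" if "k < n" for k
    by (rule trace) (use that a \<phi> x in auto)
  define c where "c = \<one> \<ominus> e"
  have cc: "c \<in> carrier R" using ec by (simp add: c_def)
  have cz: "c \<odot>\<^sub>E z = z \<ominus>\<^sub>E e \<odot>\<^sub>E z" if "z \<in> carrier E" for z
    using that ec by (simp add: c_def minus_eq E.smult_l_distr E.smult_l_minus E.M.minus_eq)
  have sumz: "finsum R a {..<n} \<odot>\<^sub>E z = z" if z: "z \<in> carrier E" for z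
  proof -
    have "finsum R a {..<n} \<odot>\<^sub>E z = finsum E (\<lambda>k. a k \<odot>\<^sub>E z) {..<n}"
      by (rule additive_map_finsum[OF abelian_group_axioms module_abelian[OF M], of "\<lambda>r. r \<odot>\<^sub>E z"])
        (use z a in \<open>auto simp: additive_map_def E.smult_l_distr\<close>)
    also have "\<dots> = finsum E (\<lambda>k. \<phi> k z \<odot>\<^sub>E x k) {..<n}"
      by (rule E.M.finsum_cong') (use z a x functionalD(1)[OF \<phi>] in auto)
    finally show ?thesis using basis[OF z] by simp
  qed
  have "c \<odot>\<^sub>E z = \<zero>\<^sub>E" if z: "z \<in> carrier E" for z
  proof (rule square_zero_sum[OF _ _ M cc _ _ z, of "{..<n}" a])
    fix k z assume k: "k \<in> {..<n}" and z: "z \<in> carrier E"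
    then have ck: "a k \<in> carrier R" "\<phi> k z \<in> carrier R" "\<phi> k (x k) \<in> carrier R" using a x functionalD(1)[OF \<phi>] by auto
    have "a k \<odot>\<^sub>E (a k \<odot>\<^sub>E z) = a k \<odot>\<^sub>E (\<phi> k z \<odot>\<^sub>E x k)" using a k z by simp
    also have "\<dots> = \<phi> k z \<odot>\<^sub>E (a k \<odot>\<^sub>E x k)"
      using ck x by (simp add: m_comm flip: E.smult_assoc1)
    also have "\<dots> = \<phi> k z \<odot>\<^sub>E (\<phi> k (x k) \<odot>\<^sub>E x k)" using a(2)[of k "x k"] k x by simp
    also have "\<dots> = (a k \<otimes> e) \<odot>\<^sub>E (\<phi> k z \<odot>\<^sub>E x k)"
      using ck x k ak[of k] by (simp add: m_comm flip: E.smult_assoc1)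
    also have "\<dots> = e \<odot>\<^sub>E (a k \<odot>\<^sub>E (a k \<odot>\<^sub>E z))"
      using ck x k z a(2)[of k z] ec by (simp add: m_ac E.smult_assoc1[symmetric])
    finally show "c \<odot>\<^sub>E (a k \<odot>\<^sub>E (a k \<odot>\<^sub>E z)) = \<zero>\<^sub>E"
      using ck z ec by (subst cz) (simp_all add: E.M.minus_eq E.M.r_neg)
  qed (use a sumz in auto)
  then have e1: "e \<odot>\<^sub>E z = z" if z: "z \<in> carrier E" for z
  proof -
    have "z = c \<odot>\<^sub>E z \<oplus>\<^sub>E e \<odot>\<^sub>E z"
      using z ec by (simp add: cz E.M.minus_eq E.M.a_assoc E.M.l_neg)
    then show ?thesis using that z ec \<open>\<And>z. z \<in> carrier E \<Longrightarrow> c \<odot>\<^bsub>E\<^esub> z = \<zero>\<^bsub>E\<^esub>\<close> by simp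
  qed
  have sym: "\<psi> z \<odot>\<^sub>E y = \<psi> y \<odot>\<^sub>E z"
    if p: "\<psi> \<in> functionals R E" and y: "y \<in> carrier E" and z: "z \<in> carrier E" for \<psi> y z
  proof -
    obtain r where r: "r \<in> carrier R" "\<forall>z\<in>carrier E. \<psi> z \<odot>\<^sub>E y = r \<odot>\<^sub>E z" using scal2[OF p y] by blast
    have "\<psi> y = r \<otimes> e" using r by (intro trace[OF p y]) auto
    then show ?thesis using r z e1 ec by (simp add: E.smult_assoc1)
  qed
  have "finsum R (\<lambda>k. \<phi> k (x k)) {..<m} \<in> additive_span R (evaluations R E)" if "m \<le> n" for m
    using that
  proof (induction m)
    case 0
    have "(\<lambda>x. \<zero>) \<in> functionals R E" by (intro mod_homI) auto
    then have "\<zero> \<in> evaluations R E" using evaluationsI[of "\<lambda>x. \<zero>" R E "\<zero>\<^sub>E"] by simp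
    then show ?case by (simp add: additive_span.gen)
  next
    case (Suc m)
    have "finsum R (\<lambda>k. \<phi> k (x k)) {..<Suc m} = \<phi> m (x m) \<oplus> finsum R (\<lambda>k. \<phi> k (x k)) {..<m}"
      unfolding lessThan_Suc using x functionalD(1)[OF \<phi>] Suc.prems by (intro finsum_insert) auto
    then show ?case using Suc \<phi> x by (auto intro!: additive_span.add[OF additive_span.gen] evaluationsI)
  qed
  then have "e \<in> additive_span R (evaluations R E)" by (simp add: e_def)
  then have "rank_one R E e" unfolding rank_one_def using M ec e1 sym by auto
  then show ?thesis by blast
qed

end

section \<open>The monoid of isomorphism classes\<close>

definition line_classes :: "('a, 'r) ring_scheme \<Rightarrow> 'a \<Rightarrow> 'a small_module set set" where
  "line_classes R e = {iso_class R E | E :: 'a small_module. rank_one R E e}"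

definition ideal_class :: "('a, 'r) ring_scheme \<Rightarrow> 'a \<Rightarrow> 'a small_module set" where
  "ideal_class R e = iso_class R (ideal_module R (PIdl\<^bsub>R\<^esub> e))"

context cring
begin

abbreviation class_mult (infixl \<open>\<otimes>\<^sub>P\<close> 70) where "c \<otimes>\<^sub>P d \<equiv> c \<otimes>\<^bsub>PicS R\<^esub> d"

lemma tensor_central_rsmult:
  assumes "module R E" "module R F" "t \<in> carrier (tensor R (central E) (central F))" "r \<in> carrier R"
  shows "rsmult (tensor R (central E) (central F)) t r = r \<odot>\<^bsub>tensor R (central E) (central F)\<^esub> t"
proof -
  interpret T: tensor_product R "central E" "central F" using assms by (intro tensor_central)
  show ?thesis using assms(3)
    by (induction rule: T.tensor_induct)
      (use assms(4) T.pt_balanced in \<open>simp_all add: T.rsmult_pt T.smult_pt T.rsmult_add T.smult_add\<close>)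
qed

lemma tensor_central_iso:
  assumes "module R E" "module R F" "f \<in> mod_iso R (tensor R (central E) (central F)) S"
  shows "f \<in> bimod_iso R (tensor R (central E) (central F)) (central S)"
  using assms tensor_central_rsmult[OF assms(1,2)]
  by (auto simp: bimod_iso_def mod_iso_def mod_hom_def)

lemma iso_class_line: "rank_one R E e \<Longrightarrow> iso_class R E \<in> line_classes R e"
proof -
  assume E: "rank_one R E e"
  obtain S :: "'a small_module" where S: "S \<in> iso_class R E" "rank_one R S e" by (rule iso_class_nonempty[OF E])
  obtain f where "f \<in> mod_iso R E S" using S(1) by (rule iso_classD)
  then have "iso_class R E = iso_class R S"
    using rank_one_module[OF E] by (rule iso_class_cong)
  then show ?thesis using S by (auto simp: line_classes_def)
qed

lemma line_classesE:
  assumes "c \<in> line_classes R e"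
  obtains E :: "'a small_module" where "rank_one R E e" "c = iso_class R E" "E \<in> c"
  using assms by (auto simp: line_classes_def intro: iso_class_self rank_one_module)

lemma line_class_member:
  assumes "c \<in> line_classes R e" "E \<in> c"
  shows "rank_one R E e" "c = iso_class R E"
proof -
  obtain F :: "'a small_module" where F: "rank_one R F e" "c = iso_class R F" using assms by (auto elim: line_classesE)
  then obtain f where f: "module R E" "f \<in> mod_iso R F E" using assms(2) by (auto elim: iso_classD)
  show "rank_one R E e" using rank_one_iso[OF F(1) f(2,1)] .
  show "c = iso_class R E" using iso_class_cong[OF f(2) rank_one_module[OF F(1)]] F by simp
qed

lemma line_class_support_unique:
  assumes "c \<in> line_classes R e" "c \<in> line_classes R f"
  shows "e = f"
proof -
  obtain E :: "'a small_module" where "rank_one R E e" "E \<in> c" using assms by (auto elim: line_classesE)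
  then show ?thesis using rank_one_support_unique line_class_member assms(2) by blast
qed

lemma PicS_carrier_iff: "c \<in> carrier (PicS R) \<longleftrightarrow> (\<exists>e. c \<in> line_classes R e)"
  using picS_module_rank_one rank_one_picS_module by (fastforce simp: PicS_def line_classes_def)

lemma tensor_iso_cong:
  assumes "module R E" "module R F" "module R E'" "module R F'"
    and f: "f \<in> mod_iso R E E'" and g: "g \<in> mod_iso R F F'"
  obtains h where "h \<in> mod_iso R (tensor R (central E) (central F)) (tensor R (central E') (central F'))"
  using tensor_map_iso[OF _ _ _ _ central_iso[OF f] central_iso[OF g]] assms
  by (auto simp: is_bimodule_central bimod_iso_def)

text \<open>
  The product of classes is defined as a union over all representatives. All the sets in this union are equal
  because isomorphisms of the factors induce isomorphisms of the tensor products.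
\<close>

lemma PicS_mult:
  assumes E: "rank_one R E e" and F: "rank_one R F f"
  shows "iso_class R E \<otimes>\<^sub>P iso_class R F = iso_class R (tensor R (central E) (central F))"
proof -
  note M = rank_one_module[OF E] rank_one_module[OF F]
  have *: "iso_class R (tensor R (central E') (central F')) = iso_class R (tensor R (central E) (central F))"
    if mem: "E' \<in> iso_class R E" "F' \<in> iso_class R F" for E' F'
  proof -
    obtain f where f: "module R E'" "f \<in> mod_iso R E E'" using mem(1) by (rule iso_classD)
    obtain g where g: "module R F'" "g \<in> mod_iso R F F'" using mem(2) by (rule iso_classD)
    obtain h where "h \<in> mod_iso R (tensor R (central E) (central F)) (tensor R (central E') (central F'))"
      by (rule tensor_iso_cong[OF M f(1) g(1) f(2) g(2)])
    then show ?thesis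
      using iso_class_cong tensor_product.tensor_module[OF tensor_central[OF M]] by blast
  qed
  moreover obtain S T where "S \<in> iso_class R E" "T \<in> iso_class R F"
    using iso_class_nonempty[OF E] iso_class_nonempty[OF F] by metis
  ultimately show ?thesis by (simp add: PicS_def) blast
qed

lemma PicS_mult_pairing:
  fixes E :: "('a, 'm) module" and F :: "('a, 'n) module"
  assumes E: "rank_one R E e" and F: "rank_one R F f" and L: "rank_one R L (e \<otimes> f)"
    and b: "perfect_pairing R E F L b"
  shows "iso_class R E \<otimes>\<^sub>P iso_class R F = iso_class R L"
proof -
  obtain \<theta> where "\<theta> \<in> mod_iso R (tensor R (central E) (central F)) L"
    using tensor_iso_of_pairing[OF assms] by metis
  then show ?thesis
    unfolding PicS_mult[OF E F]
    using iso_class_cong tensor_product.tensor_module[OF tensor_central[OF rank_one_module[OF E] rank_one_module[OF F]]]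
    by blast
qed

lemma line_mult_closed:
  assumes "c \<in> line_classes R e" "d \<in> line_classes R f"
  shows "c \<otimes>\<^sub>P d \<in> line_classes R (e \<otimes> f)"
  using assms by (auto simp: line_classes_def PicS_mult intro!: iso_class_line[unfolded line_classes_def, simplified] rank_one_tensor)

lemma line_mult_comm:
  assumes "c \<in> line_classes R e" "d \<in> line_classes R f"
  shows "c \<otimes>\<^sub>P d = d \<otimes>\<^sub>P c"
proof -
  obtain E :: "'a small_module" where E: "rank_one R E e" "c = iso_class R E" using assms by (auto elim: line_classesE)
  obtain F :: "'a small_module" where F: "rank_one R F f" "d = iso_class R F" using assms by (auto elim: line_classesE)
  interpret T: tensor_product R "central F" "central E"
    using E F by (intro tensor_central rank_one_module)
  have bal: "r \<odot>\<^bsub>T.T\<^esub> T.pt x y = T.pt x (r \<odot>\<^sub>E y)"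
    if "r \<in> carrier R" "x \<in> carrier F" "y \<in> carrier E" for r x y
    using that T.pt_balanced[of x r y] T.smult_pt[of r x y] by simp
  have bl: "bilinear_map R (\<lambda>r. r) E F T.T (\<lambda>x y. T.pt y x)"
    using T.pt_add_left T.pt_add_right T.smult_pt by (intro bilinear_mapI) (simp_all add: bal)
  have "t \<in> additive_span T.T (values_of E F (\<lambda>x y. T.pt y x))" if "t \<in> carrier T.T" for t
    using that by (induction rule: T.tensor_induct)
      (auto intro: additive_span.intros values_ofI[where b = "\<lambda>x y. T.pt y x"])
  then have "perfect_pairing R E F T.T (\<lambda>x y. T.pt y x)" using bl by (auto simp: perfect_pairing_def)
  moreover have "rank_one R T.T (e \<otimes> f)"
    using rank_one_tensor[OF F(1) E(1)] E F by (simp add: m_comm)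
  ultimately show ?thesis
    using PicS_mult_pairing[OF E(1) F(1)] PicS_mult[OF F(1) E(1)] E F by simp
qed

text \<open>
  Members \<open>S\<close> and \<open>U\<close> of the classes of \<open>E \<otimes> F\<close> and \<open>F
  \<otimes> K\<close> replace these tensor products, whose elements have another type; the associativity isomorphism
  then compares the two sides.
\<close>

lemma line_mult_assoc:
  assumes "c \<in> line_classes R e" "d \<in> line_classes R f" "k \<in> line_classes R g"
  shows "(c \<otimes>\<^sub>P d) \<otimes>\<^sub>P k = c \<otimes>\<^sub>P (d \<otimes>\<^sub>P k)"
proof -
  obtain E :: "'a small_module" where E: "rank_one R E e" "c = iso_class R E" using assms by (auto elim: line_classesE)
  obtain F :: "'a small_module" where F: "rank_one R F f" "d = iso_class R F" using assms by (auto elim: line_classesE)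
  obtain K :: "'a small_module" where K: "rank_one R K g" "k = iso_class R K" using assms by (auto elim: line_classesE)
  note M = rank_one_module[OF E(1)] rank_one_module[OF F(1)] rank_one_module[OF K(1)]
  note C = M[THEN is_bimodule_central]
  interpret T: tensor_triple R "central E" "central F" "central K" using C by unfold_locales
  note EF = rank_one_tensor[OF E(1) F(1)] and FK = rank_one_tensor[OF F(1) K(1)]
  obtain S :: "'a small_module" where S: "S \<in> iso_class R (tensor R (central E) (central F))" "rank_one R S (e \<otimes> f)"
    by (rule iso_class_nonempty[OF EF])
  obtain s where s: "s \<in> mod_iso R (tensor R (central E) (central F)) S" using S(1) by (auto elim: iso_classD)
  obtain U :: "'a small_module" where U: "U \<in> iso_class R (tensor R (central F) (central K))" "rank_one R U (f \<otimes> g)"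
    by (rule iso_class_nonempty[OF FK])
  obtain u where u: "u \<in> mod_iso R (tensor R (central F) (central K)) U" using U(1) by (auto elim: iso_classD)
  note CS = is_bimodule_central[OF rank_one_module[OF S(2)]] and CU = is_bimodule_central[OF rank_one_module[OF U(2)]]
  have "c \<otimes>\<^sub>P d = iso_class R S"
    using PicS_mult[OF E(1) F(1)] iso_class_cong[OF s rank_one_module[OF EF]] E F by simp
  then have 1: "(c \<otimes>\<^sub>P d) \<otimes>\<^sub>P k = iso_class R (tensor R (central S) (central K))"
    using PicS_mult[OF S(2) K(1)] K by simp
  have "tensor_map R (tensor R (central E) (central F)) (central K) (central S) (central K) s id \<in>
      bimod_iso R (tensor R (tensor R (central E) (central F)) (central K)) (tensor R (central S) (central K))"
    by (rule tensor_map_iso[OF T.AB.tensor_bimodule C(3) CS C(3) tensor_central_iso[OF M(1,2) s] bimod_iso_id])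
  then have 2: "iso_class R (tensor R (tensor R (central E) (central F)) (central K)) = iso_class R (tensor R (central S) (central K))"
    by (intro iso_class_cong[OF _ T.L.tensor_module]) (auto simp: bimod_iso_def)
  have "d \<otimes>\<^sub>P k = iso_class R U"
    using PicS_mult[OF F(1) K(1)] iso_class_cong[OF u rank_one_module[OF FK]] F K by simp
  then have 3: "c \<otimes>\<^sub>P (d \<otimes>\<^sub>P k) = iso_class R (tensor R (central E) (central U))"
    using PicS_mult[OF E(1) U(2)] E by simp
  have "tensor_map R (central E) (tensor R (central F) (central K)) (central E) (central U) id u \<in>
      bimod_iso R (tensor R (central E) (tensor R (central F) (central K))) (tensor R (central E) (central U))"
    by (rule tensor_map_iso[OF C(1) T.BC.tensor_bimodule C(1) CU bimod_iso_id tensor_central_iso[OF M(2,3) u]])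
  then have 4: "iso_class R (tensor R (central E) (tensor R (central F) (central K))) = iso_class R (tensor R (central E) (central U))"
    by (intro iso_class_cong[OF _ T.U.tensor_module]) (auto simp: bimod_iso_def)
  have "iso_class R (tensor R (tensor R (central E) (central F)) (central K)) =
    iso_class R (tensor R (central E) (tensor R (central F) (central K)))"
    using T.assoc_iso by (intro iso_class_cong[OF _ T.L.tensor_module]) (auto simp: bimod_iso_def)
  then show ?thesis using 1 2 3 4 by simp
qed

lemma ideal_class_line: "e \<in> carrier R \<Longrightarrow> e \<otimes> e = e \<Longrightarrow> ideal_class R e \<in> line_classes R e"
  unfolding ideal_class_def by (intro iso_class_line rank_one_ideal)

lemma ideal_class_mult_line:
  assumes e: "e \<in> carrier R" "e \<otimes> e = e" and c: "c \<in> line_classes R f" and ef: "e \<otimes> f = f"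
  shows "ideal_class R e \<otimes>\<^sub>P c = c"
proof -
  obtain E :: "'a small_module" where E: "rank_one R E f" "c = iso_class R E" using c by (auto elim: line_classesE)
  interpret E: module R E using E by (auto intro: rank_one_module)
  have bl: "bilinear_map R (\<lambda>r. r) (ideal_module R (PIdl e)) E E (\<lambda>x y. x \<odot>\<^sub>E y)"
    by (intro bilinear_mapI) (auto simp: PIdl_iff[OF e] E.smult_l_distr E.smult_r_distr m_comm simp flip: E.smult_assoc1)
  have "y \<in> values_of (ideal_module R (PIdl e)) E (\<lambda>x y. x \<odot>\<^sub>E y)" if y: "y \<in> carrier E" for y
  proof -
    have "e \<odot>\<^sub>E y = y" using rank_one_support[OF E(1) y] y E.smult_assoc1[of e f y] e ef E(1) by simp
    then show ?thesis using values_ofI[of e "ideal_module R (PIdl e)" y E "\<lambda>x y. x \<odot>\<^sub>E y"] e y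
      by (simp add: PIdl_iff)
  qed
  then have "perfect_pairing R (ideal_module R (PIdl e)) E E (\<lambda>x y. x \<odot>\<^sub>E y)"
    using bl by (auto simp: perfect_pairing_def intro: additive_span.gen)
  moreover have "rank_one R E (e \<otimes> f)" using ef E by simp
  ultimately show ?thesis unfolding ideal_class_def E(2)
    using PicS_mult_pairing[OF rank_one_ideal[OF e] E(1)] by blast
qed

text \<open>
  Evaluation is a perfect pairing of \<open>E\<close> and its dual with values in \<open>R e\<close>.
\<close>

lemma dual_class:
  fixes E :: "('a, 'm) module"
  assumes E: "rank_one R E e"
  shows "iso_class R E \<otimes>\<^sub>P iso_class R (dual_module R E) = ideal_class R e"
proof -
  have "rank_one R (ideal_module R (PIdl e)) (e \<otimes> e)"
    using E rank_one_idem[OF E] rank_one_ideal[of e] by auto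
  then show ?thesis
    unfolding ideal_class_def using PicS_mult_pairing[OF E rank_one_dual[OF E]] dual_pairing[OF E] by blast
qed

lemma line_inverse:
  assumes "c \<in> line_classes R e"
  obtains d where "d \<in> line_classes R e" "c \<otimes>\<^sub>P d = ideal_class R e"
proof -
  obtain E :: "'a small_module" where E: "rank_one R E e" "c = iso_class R E" using assms by (auto elim: line_classesE)
  show ?thesis
    using that[of "iso_class R (dual_module R E)"] dual_class[OF E(1)] iso_class_line[OF rank_one_dual[OF E(1)]] E by simp
qed

lemma line_classes_closed: "c \<in> line_classes R e \<Longrightarrow> e \<in> carrier R" "c \<in> line_classes R e \<Longrightarrow> e \<otimes> e = e"
  by (auto simp: line_classes_def rank_one_idem)

lemma line_cancel:
  assumes c: "c \<in> line_classes R e" and d: "d \<in> line_classes R e" "d' \<in> line_classes R e"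
    and eq: "c \<otimes>\<^sub>P d = c \<otimes>\<^sub>P d'"
  shows "d = d'"
proof -
  note e = line_classes_closed[OF c]
  obtain k where k: "k \<in> line_classes R e" "c \<otimes>\<^sub>P k = ideal_class R e" by (rule line_inverse[OF c])
  have kc: "k \<otimes>\<^sub>P c = ideal_class R e" using line_mult_comm[OF c k(1)] k(2) by simp
  have "d = (k \<otimes>\<^sub>P c) \<otimes>\<^sub>P d" "d' = (k \<otimes>\<^sub>P c) \<otimes>\<^sub>P d'"
    using ideal_class_mult_line[OF e] d e unfolding kc by auto
  then show ?thesis using line_mult_assoc[OF k(1) c d(1)] line_mult_assoc[OF k(1) c d(2)] eq by simp
qed

lemma PicS_one: "\<one>\<^bsub>PicS R\<^esub> = ideal_class R \<one>"
  by (simp add: PicS_def ideal_class_def PIdl_one)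

end

section \<open>Transport along isomorphisms between corners of the ring\<close>

text \<open>
  Two instances matter. With \<open>u = 1\<^bsub>g\<^sup>-\<^sup>1\<^esub>\<close> and \<open>\<tau> r =
  \<alpha>\<^bsub>g\<^sup>-\<^sup>1\<^esub>(r1\<^sub>g)\<close> this is the restriction of \<open>E\<close> to
  \<open>D\<^bsub>g\<^sup>-\<^sup>1\<^esub>\<close>, twisted by \<open>\<alpha>\<^sub>g\<close>; with \<open>\<tau>
  r = u r\<close> it is the submodule \<open>u E\<close>.
\<close>

definition transport_module ::
  "'a \<Rightarrow> ('a \<Rightarrow> 'a) \<Rightarrow> ('a, 'm, 'x) module_scheme \<Rightarrow> ('a, 'm, 'x) module_scheme" where
  "transport_module u \<tau> E = E\<lparr>carrier := {x \<in> carrier E. u \<odot>\<^sub>E x = x}, smult := (\<lambda>r x. \<tau> r \<odot>\<^sub>E x)\<rparr>"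

lemma transport_module_simps [simp]:
  "carrier (transport_module u \<tau> E) = {x \<in> carrier E. u \<odot>\<^sub>E x = x}"
  "x \<oplus>\<^bsub>transport_module u \<tau> E\<^esub> y = x \<oplus>\<^sub>E y"
  "r \<odot>\<^bsub>transport_module u \<tau> E\<^esub> x = \<tau> r \<odot>\<^sub>E x"
  "\<zero>\<^bsub>transport_module u \<tau> E\<^esub> = \<zero>\<^sub>E"
  by (simp_all add: transport_module_def)

text \<open>
  An isomorphism from \<open>R u\<close> onto \<open>R v\<close> and its inverse, both extended to the whole ring by
  precomposing with the multiplication by \<open>u\<close> or \<open>v\<close>.
\<close>

locale corner_iso = cring +
  fixes u v :: 'a and \<sigma> \<tau> :: "'a \<Rightarrow> 'a"
  assumes u: "u \<in> carrier R" and v: "v \<in> carrier R"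
    and \<sigma>_closed [simp]: "\<And>r. r \<in> carrier R \<Longrightarrow> \<sigma> r \<in> carrier R"
    and \<tau>_closed [simp]: "\<And>r. r \<in> carrier R \<Longrightarrow> \<tau> r \<in> carrier R"
    and \<sigma>_add: "\<And>r s. r \<in> carrier R \<Longrightarrow> s \<in> carrier R \<Longrightarrow> \<sigma> (r \<oplus> s) = \<sigma> r \<oplus> \<sigma> s"
    and \<tau>_add: "\<And>r s. r \<in> carrier R \<Longrightarrow> s \<in> carrier R \<Longrightarrow> \<tau> (r \<oplus> s) = \<tau> r \<oplus> \<tau> s"
    and \<sigma>_mult: "\<And>r s. r \<in> carrier R \<Longrightarrow> s \<in> carrier R \<Longrightarrow> \<sigma> (r \<otimes> s) = \<sigma> r \<otimes> \<sigma> s"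
    and \<tau>_mult: "\<And>r s. r \<in> carrier R \<Longrightarrow> s \<in> carrier R \<Longrightarrow> \<tau> (r \<otimes> s) = \<tau> r \<otimes> \<tau> s"
    and \<sigma>_one: "\<sigma> \<one> = v" and \<tau>_one: "\<tau> \<one> = u"
    and \<sigma>\<tau>: "\<And>r. r \<in> carrier R \<Longrightarrow> \<sigma> (\<tau> r) = v \<otimes> r"
    and \<tau>\<sigma>: "\<And>r. r \<in> carrier R \<Longrightarrow> \<tau> (\<sigma> r) = u \<otimes> r"
begin

lemma idem: "u \<otimes> u = u" "v \<otimes> v = v"
  using \<tau>_mult[of \<one> \<one>] \<sigma>_mult[of \<one> \<one>] by (simp_all add: \<tau>_one \<sigma>_one)

lemma absorb: "r \<in> carrier R \<Longrightarrow> u \<otimes> \<tau> r = \<tau> r" "r \<in> carrier R \<Longrightarrow> v \<otimes> \<sigma> r = \<sigma> r"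
  using \<tau>_mult[of \<one> r] \<sigma>_mult[of \<one> r] by (simp_all add: \<tau>_one \<sigma>_one)

lemma \<sigma>_u: "r \<in> carrier R \<Longrightarrow> \<sigma> (u \<otimes> r) = \<sigma> r"
  using \<sigma>\<tau>[of "\<sigma> r"] \<tau>\<sigma>[of r] by (simp add: absorb)

lemma transport_module_module:
  assumes E: "module R E" shows "module R (transport_module u \<tau> E)" (is "module R ?T")
proof -
  interpret E: module R E by (rule E)
  show ?thesis
  proof (rule moduleI[OF is_cring])
    show "abelian_group ?T"
    proof (rule abelian_groupI)
      fix x assume x: "x \<in> carrier ?T"
      then have "\<ominus>\<^sub>E x \<in> carrier ?T" using u by (simp add: E.smult_r_minus)
      then show "\<exists>y\<in>carrier ?T. y \<oplus>\<^bsub>?T\<^esub> x = \<zero>\<^bsub>?T\<^esub>" using x by (auto simp: E.M.l_neg intro!: bexI[of _ "\<ominus>\<^sub>E x"])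
    qed (use u in \<open>auto simp: E.smult_r_distr E.M.a_ac\<close>)
  next
    fix r x assume "r \<in> carrier R" "x \<in> carrier ?T"
    then show "r \<odot>\<^bsub>?T\<^esub> x \<in> carrier ?T" using u absorb(1)[of r] by (simp flip: E.smult_assoc1)
  qed (use u in \<open>auto simp: \<tau>_one \<tau>_add \<tau>_mult E.smult_l_distr E.smult_r_distr E.smult_assoc1\<close>)
qed

text \<open>
  Functionals on \<open>E\<close> and on the transported module correspond to each other by composing with
  \<open>\<sigma>\<close> and \<open>\<tau>\<close>.
\<close>

lemma rank_one_transport:
  assumes E: "rank_one R E e" shows "rank_one R (transport_module u \<tau> E) (\<sigma> e)" (is "rank_one R ?T _")
proof -
  interpret E: module R E using E by (rule rank_one_module)
  have ec: "e \<in> carrier R" using E by simp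
  have ux: "u \<odot>\<^sub>E x \<in> carrier ?T" if "x \<in> carrier E" for x
    using that u idem by (simp flip: E.smult_assoc1)
  have T: "module R ?T" by (rule transport_module_module) (rule rank_one_module[OF E])
  have sym: "\<phi> x \<odot>\<^bsub>?T\<^esub> y = \<phi> y \<odot>\<^bsub>?T\<^esub> x"
    if p: "\<phi> \<in> functionals R ?T" and xy: "x \<in> carrier ?T" "y \<in> carrier ?T" for \<phi> x y
  proof -
    note P = functionalD[OF p]
    have "(\<lambda>x. \<tau> (\<phi> (u \<odot>\<^sub>E x))) \<in> functionals R E"
    proof (rule mod_homI)
      fix x assume x: "x \<in> carrier E"
      show "\<tau> (\<phi> (u \<odot>\<^sub>E x)) \<in> carrier (ideal_module R (carrier R))" using P(1)[OF ux[OF x]] by simp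
    next
      fix x y assume x: "x \<in> carrier E" "y \<in> carrier E"
      show "\<tau> (\<phi> (u \<odot>\<^sub>E (x \<oplus>\<^sub>E y))) = \<tau> (\<phi> (u \<odot>\<^sub>E x)) \<oplus>\<^bsub>ideal_module R (carrier R)\<^esub> \<tau> (\<phi> (u \<odot>\<^sub>E y))"
        using x u P(1)[OF ux] P(2)[OF ux ux, of x y] by (simp add: E.smult_r_distr \<tau>_add)
    next
      fix r x assume r: "r \<in> carrier R" and x: "x \<in> carrier E"
      have "u \<odot>\<^sub>E (r \<odot>\<^sub>E x) = \<tau> (\<sigma> r) \<odot>\<^sub>E (u \<odot>\<^sub>E x)"
        using r x u idem by (simp add: \<tau>\<sigma> m_ac flip: E.smult_assoc1)
      then have "\<phi> (u \<odot>\<^sub>E (r \<odot>\<^sub>E x)) = \<sigma> r \<otimes> \<phi> (u \<odot>\<^sub>E x)"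
        using P(3)[OF \<sigma>_closed[OF r] ux[OF x]] by simp
      then have "\<tau> (\<phi> (u \<odot>\<^sub>E (r \<odot>\<^sub>E x))) = (u \<otimes> r) \<otimes> \<tau> (\<phi> (u \<odot>\<^sub>E x))"
        using r P(1)[OF ux[OF x]] by (simp add: \<tau>_mult \<tau>\<sigma>)
      also have "\<dots> = r \<otimes> (u \<otimes> \<tau> (\<phi> (u \<odot>\<^sub>E x)))" using r u P(1)[OF ux[OF x]] by (simp add: m_ac)
      finally show "\<tau> (\<phi> (u \<odot>\<^sub>E (r \<odot>\<^sub>E x))) = r \<odot>\<^bsub>ideal_module R (carrier R)\<^esub> \<tau> (\<phi> (u \<odot>\<^sub>E x))"
        using r P(1)[OF ux[OF x]] by (simp add: absorb)
    qed
    from rank_one_sym[OF E this, of x y] show ?thesis using xy by simp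
  qed
  have ev: "\<sigma> (\<phi> x) \<in> evaluations R ?T" if p: "\<phi> \<in> functionals R E" and x: "x \<in> carrier E" for \<phi> x
  proof -
    note P = functionalD[OF p]
    have "(\<lambda>x. \<sigma> (\<phi> x)) \<in> functionals R ?T"
    proof (rule mod_homI)
      fix r x assume "r \<in> carrier R" "x \<in> carrier ?T"
      then show "\<sigma> (\<phi> (r \<odot>\<^bsub>?T\<^esub> x)) = r \<odot>\<^bsub>ideal_module R (carrier R)\<^esub> \<sigma> (\<phi> x)"
        using v m_comm[of v r] by (simp add: P \<sigma>_mult \<sigma>\<tau> m_assoc absorb)
    qed (auto simp: P \<sigma>_add)
    moreover have "\<sigma> (\<phi> (u \<odot>\<^sub>E x)) = \<sigma> (\<phi> x)" using x u by (simp add: P \<sigma>_u)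
    ultimately show ?thesis using evaluationsI[of "\<lambda>x. \<sigma> (\<phi> x)" R ?T "u \<odot>\<^sub>E x"] ux[OF x] by simp
  qed
  have "\<sigma> e \<in> additive_span R (evaluations R ?T)"
    using E
  proof (induction rule: rank_one_induct)
    case (add r s)
    then show ?case by (simp add: \<sigma>_add additive_span.add)
  qed (auto intro: additive_span.gen ev)
  moreover have "\<sigma> e \<odot>\<^bsub>?T\<^esub> x = x" if "x \<in> carrier ?T" for x
    using that u ec rank_one_support[OF E, of x] by (simp add: \<tau>\<sigma> E.smult_assoc1)
  ultimately show ?thesis unfolding rank_one_def using T ec sym by auto
qed

lemma transport_pairing:
  assumes E: "module R E" and F: "module R F" and L: "module R L" and b: "perfect_pairing R E F L b"
  shows "perfect_pairing R (transport_module u \<tau> E) (transport_module u \<tau> F) (transport_module u \<tau> L) b"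
    (is "perfect_pairing R ?E ?F ?L b")
proof -
  interpret E: module R E by (rule E)
  interpret F: module R F by (rule F)
  interpret L: module R L by (rule L)
  have bl: "bilinear_map R (\<lambda>r. r) E F L b" and sp: "carrier L \<subseteq> additive_span L (values_of E F b)"
    using b by (auto simp: perfect_pairing_def)
  note B = bilinear_mapD[OF bl]
  have cl: "b x y \<in> carrier ?L" if "x \<in> carrier ?E" "y \<in> carrier ?F" for x y
    using that u B(4)[of u x y] by (simp add: B)
  have bl': "bilinear_map R (\<lambda>r. r) ?E ?F ?L b"
  proof (rule bilinear_mapI[OF cl])
  qed (auto simp: B)
  have *: "u \<odot>\<^sub>L z \<in> additive_span ?L (values_of ?E ?F b)" if "z \<in> additive_span L (values_of E F b)" for z
    using that
  proof (induction rule: additive_span.induct)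
    case (gen z)
    then obtain x y where xy: "z = b x y" "x \<in> carrier E" "y \<in> carrier F" by (auto simp: values_of_def)
    have "u \<odot>\<^sub>L z = b (u \<odot>\<^sub>E x) (u \<odot>\<^sub>F y)"
      using xy u idem by (simp add: B flip: L.smult_assoc1)
    moreover have "u \<odot>\<^sub>E x \<in> carrier ?E" "u \<odot>\<^sub>F y \<in> carrier ?F"
      using xy u idem by (simp_all flip: E.smult_assoc1 F.smult_assoc1)
    ultimately show ?case using values_ofI[of "u \<odot>\<^sub>E x" ?E "u \<odot>\<^sub>F y" ?F b] by (simp add: additive_span.gen)
  next
    case (add x y)
    then have "x \<in> carrier L" "y \<in> carrier L"
      using additive_span_closed[OF module_abelian[OF L] values_of_closed[OF bl]] by auto
    then show ?case using u additive_span.add[OF add.IH] by (simp add: L.smult_r_distr)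
  qed
  have "carrier ?L \<subseteq> additive_span ?L (values_of ?E ?F b)" using sp * by force
  then show ?thesis using bl' by (simp add: perfect_pairing_def)
qed

end

context cring
begin

lemma corner_iso_mult: "u \<in> carrier R \<Longrightarrow> u \<otimes> u = u \<Longrightarrow> corner_iso R u u (\<lambda>r. u \<otimes> r) (\<lambda>r. u \<otimes> r)"
proof -
  assume u: "u \<in> carrier R" "u \<otimes> u = u"
  have 1: "u \<otimes> (u \<otimes> r) = u \<otimes> r" if "r \<in> carrier R" for r
    using that u m_assoc[of u u r] by simp
  have 2: "u \<otimes> (r \<otimes> s) = (u \<otimes> r) \<otimes> (u \<otimes> s)" if "r \<in> carrier R" "s \<in> carrier R" for r s
    using that u(1) 1[of "r \<otimes> s"] by (simp add: m_assoc m_lcomm[of r u s])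
  show ?thesis
    by (intro corner_iso.intro is_cring corner_iso_axioms.intro) (use u 1 in \<open>auto simp: r_distr intro: 2\<close>)
qed

text \<open>
  The scalar multiplication is a perfect pairing of \<open>E\<close> and \<open>R u\<close> with values in \<open>u
  E\<close>.
\<close>

lemma ideal_class_mult_restrict:
  fixes E :: "('a, 'm) module"
  assumes u: "u \<in> carrier R" "u \<otimes> u = u" and E: "rank_one R E e"
  shows "iso_class R E \<otimes>\<^sub>P ideal_class R u = iso_class R (transport_module u (\<lambda>r. u \<otimes> r) E)"
    (is "_ = iso_class R ?T")
proof -
  interpret E: module R E using E by (rule rank_one_module)
  interpret C: corner_iso R u u "\<lambda>r. u \<otimes> r" "\<lambda>r. u \<otimes> r" by (rule corner_iso_mult[OF u])
  have cl: "x \<odot>\<^sub>E y \<in> carrier ?T" if "x \<in> PIdl u" "y \<in> carrier E" for x y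
    using that u E.smult_assoc1[of u x y] by (auto simp: PIdl_iff[OF u])
  have m: "(r \<otimes> x) \<odot>\<^sub>E y = (u \<otimes> r) \<odot>\<^sub>E (x \<odot>\<^sub>E y)" "x \<odot>\<^sub>E (r \<odot>\<^sub>E y) = (u \<otimes> r) \<odot>\<^sub>E (x \<odot>\<^sub>E y)"
    if "x \<in> PIdl u" "y \<in> carrier E" "r \<in> carrier R" for x y r
  proof -
    have x: "x \<in> carrier R" "u \<otimes> x = x" using that by (auto simp: PIdl_iff[OF u])
    have "u \<otimes> r \<otimes> x = r \<otimes> (u \<otimes> x)" using x(1) u that by (simp add: m_ac)
    then have "u \<otimes> r \<otimes> x = r \<otimes> x" using x by simp
    then show "(r \<otimes> x) \<odot>\<^sub>E y = (u \<otimes> r) \<odot>\<^sub>E (x \<odot>\<^sub>E y)" "x \<odot>\<^sub>E (r \<odot>\<^sub>E y) = (u \<otimes> r) \<odot>\<^sub>E (x \<odot>\<^sub>E y)"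
      using x(1) u that by (simp_all add: m_comm[of x r] flip: E.smult_assoc1)
  qed
  have bl: "bilinear_map R (\<lambda>r. r) E (ideal_module R (PIdl u)) ?T (\<lambda>y x. x \<odot>\<^sub>E y)"
    using cl by (intro bilinear_mapI) (auto simp: m E.smult_l_distr E.smult_r_distr PIdl_iff[OF u])
  have "y \<in> values_of E (ideal_module R (PIdl u)) (\<lambda>y x. x \<odot>\<^sub>E y)" if "y \<in> carrier ?T" for y
    using that values_ofI[of y E u "ideal_module R (PIdl u)" "\<lambda>y x. x \<odot>\<^sub>E y"] u by (simp add: PIdl_iff[OF u])
  then have "perfect_pairing R E (ideal_module R (PIdl u)) ?T (\<lambda>y x. x \<odot>\<^sub>E y)"
    using bl by (auto simp: perfect_pairing_def intro: additive_span.gen)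
  moreover have "rank_one R ?T (e \<otimes> u)" using C.rank_one_transport[OF E] u E by (simp add: m_comm)
  ultimately show ?thesis unfolding ideal_class_def
    using PicS_mult_pairing[OF E rank_one_ideal[OF u]] by blast
qed

text \<open>
  Equality of the classes gives an isomorphism of \<open>E \<otimes> F\<close> with \<open>L\<close>; the pairing is
  its restriction to pure tensors.
\<close>

lemma pairing_of_classes:
  fixes E :: "('a, 'm) module" and F :: "('a, 'n) module"
  assumes E: "rank_one R E e" and F: "rank_one R F f" and L: "module R L"
    and eq: "iso_class R E \<otimes>\<^sub>P iso_class R F = iso_class R L"
  obtains b where "perfect_pairing R E F L b"
proof -
  let ?T = "tensor R (central E) (central F)"
  obtain S where "S \<in> iso_class R ?T" using iso_class_nonempty[OF rank_one_tensor[OF E F]] by blast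
  then obtain \<theta> where \<theta>: "\<theta> \<in> mod_iso R ?T L"
    using iso_class_eqD[of R ?T L] eq L PicS_mult[OF E F] by metis
  interpret T: tensor_product R "central E" "central F" by (rule tensor_central[OF rank_one_module[OF E] rank_one_module[OF F]])
  note H = mod_homD[OF mod_iso_imp_hom[OF \<theta>]]
  let ?b = "\<lambda>x y. \<theta> (T.pt x y)"
  have bal: "T.pt x (r \<odot>\<^sub>F y) = T.pt (r \<odot>\<^sub>E x) y" if "x \<in> carrier E" "r \<in> carrier R" "y \<in> carrier F" for x r y
    using T.pt_balanced[of x r y] that by simp
  have "bilinear_map R (\<lambda>r. r) E F L ?b"
  proof (rule bilinear_mapI)
    fix r x y assume "r \<in> carrier R" "x \<in> carrier E" "y \<in> carrier F"
    then show "?b (r \<odot>\<^sub>E x) y = r \<odot>\<^sub>L ?b x y" "?b x (r \<odot>\<^sub>F y) = r \<odot>\<^sub>L ?b x y"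
      using T.smult_pt[of r x y] H(3)[of r "T.pt x y"] bal by simp_all
  qed (use T.pt_add_left T.pt_add_right in \<open>auto simp: H\<close>)
  moreover have "\<theta> t \<in> additive_span L (values_of E F ?b)" if "t \<in> carrier T.T" for t
    using that
  proof (induction rule: T.tensor_induct)
    case (pt x y)
    then show ?case by (intro additive_span.gen) (auto simp: values_of_def)
  qed (simp add: H additive_span.add)
  moreover have "carrier L = \<theta> ` carrier T.T" using \<theta> by (simp add: mod_iso_def bij_betw_def)
  ultimately have "perfect_pairing R E F L ?b" unfolding perfect_pairing_def by auto
  then show ?thesis by (rule that)
qed

lemma small_tensor:
  fixes E :: "('a, 'm) module" and F :: "('a, 'n) module"
  assumes E: "rank_one R E e" and F: "rank_one R F f"
  obtains L :: "'a small_module" and b where "rank_one R L (e \<otimes> f)" "perfect_pairing R E F L b"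
    "L \<in> iso_class R E \<otimes>\<^sub>P iso_class R F"
proof -
  obtain L :: "'a small_module" where L: "L \<in> iso_class R (tensor R (central E) (central F))" "rank_one R L (e \<otimes> f)"
    by (rule iso_class_nonempty[OF rank_one_tensor[OF E F]])
  obtain h where "h \<in> mod_iso R (tensor R (central E) (central F)) L" using L(1) by (rule iso_classD)
  then have "iso_class R E \<otimes>\<^sub>P iso_class R F = iso_class R L"
    using PicS_mult[OF E F] iso_class_cong rank_one_module[OF rank_one_tensor[OF E F]] by metis
  then obtain b where "perfect_pairing R E F L b" using pairing_of_classes[OF E F rank_one_module[OF L(2)]] by blast
  then show ?thesis using that L PicS_mult[OF E F] by blast
qed

end

section \<open>Partial actions as maps of the whole ring\<close>

context unital_partial_action
begin

abbreviation ring_mult (infixl \<open>\<star>\<close> 70) where "r \<star> s \<equiv> r \<otimes>\<^sub>R s"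

abbreviation group_mult (infixl \<open>\<bullet>\<close> 70) where "g \<bullet> h \<equiv> g \<otimes>\<^sub>G h"

abbreviation group_inverse (\<open>_\<^sup>-\<close> [1000] 1000) where "g\<^sup>- \<equiv> inv\<^bsub>G\<^esub> g"

text \<open>
  The map \<open>\<alpha>\<^sub>g\<close> extended to all of \<open>R\<close>. It is additive and multiplicative but
  sends \<open>1\<close> to \<open>1\<^sub>g\<close>, and the laws of a partial action become equations without
  membership conditions.
\<close>

definition act :: "'g \<Rightarrow> 'a \<Rightarrow> 'a" where
  "act g r = \<alpha> g (r \<star> \<epsilon> g\<^sup>-)"

lemma ideal_prod_PIdl:
  assumes "a \<in> carrier R" "b \<in> carrier R"
  shows "(PIdl\<^bsub>R\<^esub> a) \<cdot>\<^sub>R (PIdl\<^bsub>R\<^esub> b) = PIdl\<^bsub>R\<^esub> (a \<star> b)"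
proof (intro equalityI subsetI)
  interpret I: ideal "PIdl\<^bsub>R\<^esub> (a \<star> b)" R using assms by (intro R.cgenideal_ideal) auto
  fix x assume "x \<in> (PIdl\<^bsub>R\<^esub> a) \<cdot>\<^sub>R (PIdl\<^bsub>R\<^esub> b)"
  then show "x \<in> PIdl\<^bsub>R\<^esub> (a \<star> b)"
  proof (induction rule: ideal_prod.induct)
    case (prod i j)
    then obtain r s where rs: "r \<in> carrier R" "s \<in> carrier R" "i = r \<star> a" "j = s \<star> b"
      unfolding cgenideal_def by blast
    then have "i \<star> j = (r \<star> s) \<star> (a \<star> b)" using assms by (simp add: R.m_ac)
    then show ?case unfolding cgenideal_def using R.m_closed[OF rs(1,2)] by blast
  qed auto
next
  fix x assume "x \<in> PIdl\<^bsub>R\<^esub> (a \<star> b)"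
  then obtain r where r: "r \<in> carrier R" "x = r \<star> (a \<star> b)" by (auto simp: cgenideal_def)
  then have "x = (r \<star> a) \<star> (\<one>\<^sub>R \<star> b)" using assms by (simp add: R.m_ac)
  then show "x \<in> (PIdl\<^bsub>R\<^esub> a) \<cdot>\<^sub>R (PIdl\<^bsub>R\<^esub> b)"
    using r by (auto simp: cgenideal_def intro!: ideal_prod.prod)
qed

lemmas eps = eps_closed eps_idem

lemma eps_D: "g \<in> carrier G \<Longrightarrow> x \<in> PIdl\<^bsub>R\<^esub> (\<epsilon> g) \<longleftrightarrow> x \<in> carrier R \<and> \<epsilon> g \<star> x = x"
  by (rule R.PIdl_iff) (auto intro: eps)

lemma alpha_hom:
  assumes "g \<in> carrier G"
  shows "\<And>x. x \<in> PIdl\<^bsub>R\<^esub> (\<epsilon> g\<^sup>-) \<Longrightarrow> \<alpha> g x \<in> PIdl\<^bsub>R\<^esub> (\<epsilon> g)"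
    "\<And>x y. x \<in> PIdl\<^bsub>R\<^esub> (\<epsilon> g\<^sup>-) \<Longrightarrow> y \<in> PIdl\<^bsub>R\<^esub> (\<epsilon> g\<^sup>-) \<Longrightarrow> \<alpha> g (x \<oplus>\<^sub>R y) = \<alpha> g x \<oplus>\<^sub>R \<alpha> g y"
    "\<And>x y. x \<in> PIdl\<^bsub>R\<^esub> (\<epsilon> g\<^sup>-) \<Longrightarrow> y \<in> PIdl\<^bsub>R\<^esub> (\<epsilon> g\<^sup>-) \<Longrightarrow> \<alpha> g (x \<star> y) = \<alpha> g x \<star> \<alpha> g y"
    "\<alpha> g (\<epsilon> g\<^sup>-) = \<epsilon> g"
  using alpha_iso[OF assms] by (auto simp: ring_iso_def ring_hom_def corner_def)

lemma eps_mult_D: "g \<in> carrier G \<Longrightarrow> r \<in> carrier R \<Longrightarrow> r \<star> \<epsilon> g \<in> PIdl\<^bsub>R\<^esub> (\<epsilon> g)"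
  by (auto simp: cgenideal_def)

lemma act_D: "g \<in> carrier G \<Longrightarrow> r \<in> carrier R \<Longrightarrow> act g r \<in> PIdl\<^bsub>R\<^esub> (\<epsilon> g)"
  by (simp add: act_def alpha_hom eps_mult_D)

lemma act_closed [simp]: "g \<in> carrier G \<Longrightarrow> r \<in> carrier R \<Longrightarrow> act g r \<in> carrier R"
  using act_D eps_D by blast

lemma eps_act: "g \<in> carrier G \<Longrightarrow> r \<in> carrier R \<Longrightarrow> \<epsilon> g \<star> act g r = act g r"
  using act_D eps_D by blast

lemma act_add: "g \<in> carrier G \<Longrightarrow> r \<in> carrier R \<Longrightarrow> s \<in> carrier R \<Longrightarrow>
    act g (r \<oplus>\<^sub>R s) = act g r \<oplus>\<^sub>R act g s"
  by (simp add: act_def R.l_distr eps alpha_hom eps_mult_D)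

lemma act_mult:
  assumes "g \<in> carrier G" "r \<in> carrier R" "s \<in> carrier R"
  shows "act g (r \<star> s) = act g r \<star> act g s"
proof -
  let ?e = "\<epsilon> g\<^sup>-"
  have e: "?e \<in> carrier R" "?e \<star> ?e = ?e" using assms by (auto intro: eps)
  have "(r \<star> ?e) \<star> (s \<star> ?e) = (r \<star> s) \<star> (?e \<star> ?e)" using assms e(1) by (simp add: R.m_ac)
  then show ?thesis using assms e alpha_hom(3)[OF assms(1), of "r \<star> ?e" "s \<star> ?e"]
    by (simp add: act_def eps_mult_D)
qed

lemma act_one: "g \<in> carrier G \<Longrightarrow> act g \<one>\<^sub>R = \<epsilon> g"
  by (simp add: act_def eps alpha_hom)

text \<open>
  By the axiom on images, \<open>\<alpha>\<^sub>g\<close> maps the ideal generated by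
  \<open>1\<^bsub>g\<^sup>-\<^sup>1\<^esub> 1\<^sub>h\<close> onto the one generated by \<open>1\<^sub>g
  1\<^bsub>gh\<^esub>\<close>. A ring isomorphism maps identity elements to identity elements.
\<close>

lemma act_eps:
  assumes "g \<in> carrier G" "h \<in> carrier G"
  shows "act g (\<epsilon> h) = \<epsilon> g \<star> \<epsilon> (g \<bullet> h)"
proof -
  let ?i = "\<epsilon> g\<^sup>-" and ?u = "\<epsilon> g \<star> \<epsilon> (g \<bullet> h)"
  have e: "?i \<in> carrier R" "?i \<star> ?i = ?i" "\<epsilon> h \<in> carrier R" "\<epsilon> h \<star> \<epsilon> h = \<epsilon> h" 
    "\<epsilon> g \<in> carrier R" "\<epsilon> g \<star> \<epsilon> g = \<epsilon> g" "\<epsilon> (g \<bullet> h) \<in> carrier R"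
    "\<epsilon> (g \<bullet> h) \<star> \<epsilon> (g \<bullet> h) = \<epsilon> (g \<bullet> h)" using assms by (auto intro: eps)
  have im: "\<alpha> g ` (PIdl\<^bsub>R\<^esub> (?i \<star> \<epsilon> h)) = PIdl\<^bsub>R\<^esub> ?u"
    using alpha_image[OF assms] e by (simp add: ideal_prod_PIdl)
  have pr: "(a \<star> b) \<star> (a \<star> b) = a \<star> b" 
    if "a \<in> carrier R" "b \<in> carrier R" "a \<star> a = a" "b \<star> b = b" for a b
    using that R.m_assoc[of a b "a \<star> b"] R.m_lcomm[of b a b] R.m_assoc[of a a b] by simp
  have i2: "(?i \<star> \<epsilon> h) \<star> (?i \<star> \<epsilon> h) = ?i \<star> \<epsilon> h" "?u \<star> ?u = ?u"
    using e by (auto intro: pr)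
  have I: "x \<in> PIdl\<^bsub>R\<^esub> (?i \<star> \<epsilon> h) \<longleftrightarrow> x \<in> carrier R \<and> (?i \<star> \<epsilon> h) \<star> x = x" for x
    using e i2 by (intro R.PIdl_iff) auto
  have U: "x \<in> PIdl\<^bsub>R\<^esub> ?u \<longleftrightarrow> x \<in> carrier R \<and> ?u \<star> x = x" for x
    using e i2 by (intro R.PIdl_iff) auto
  have sub: "x \<in> PIdl\<^bsub>R\<^esub> ?i" if "x \<in> PIdl\<^bsub>R\<^esub> (?i \<star> \<epsilon> h)" for x
  proof -
    have x: "x \<in> carrier R" "(?i \<star> \<epsilon> h) \<star> x = x" using that I by auto
    have "?i \<star> ((?i \<star> \<epsilon> h) \<star> x) = (?i \<star> ?i) \<star> \<epsilon> h \<star> x" 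
      using x(1) e(1,3) by (simp add: R.m_assoc)
    then show ?thesis using x e assms by (simp add: eps_D)
  qed
  have m: "?i \<star> \<epsilon> h \<in> PIdl\<^bsub>R\<^esub> (?i \<star> \<epsilon> h)" using I e i2 by auto
  have a: "act g (\<epsilon> h) = \<alpha> g (?i \<star> \<epsilon> h)" using e by (simp add: act_def R.m_comm)
  have "act g (\<epsilon> h) \<in> PIdl\<^bsub>R\<^esub> ?u" unfolding a using im m by blast
  then have 1: "?u \<star> act g (\<epsilon> h) = act g (\<epsilon> h)" using U by simp
  have "?u \<in> PIdl\<^bsub>R\<^esub> ?u" using U e i2 by simp
  then obtain z where z: "z \<in> PIdl\<^bsub>R\<^esub> (?i \<star> \<epsilon> h)" "?u = \<alpha> g z" unfolding im[symmetric] by auto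
  have "\<alpha> g (z \<star> (?i \<star> \<epsilon> h)) = \<alpha> g z \<star> \<alpha> g (?i \<star> \<epsilon> h)"
    using sub[OF z(1)] sub[OF m] by (rule alpha_hom(3)[OF assms(1)])
  moreover have "z \<star> (?i \<star> \<epsilon> h) = z" using z(1) e I by (simp add: R.m_comm[of z])
  ultimately show ?thesis using 1 a z(2) by simp
qed

lemma eps_one: "\<epsilon> \<one>\<^sub>G = \<one>\<^sub>R"
proof -
  have "\<one>\<^sub>R \<in> PIdl\<^bsub>R\<^esub> (\<epsilon> \<one>\<^sub>G)" using D_one by simp
  then show ?thesis by (simp add: eps_D eps)
qed

lemma act_group_one: "r \<in> carrier R \<Longrightarrow> act \<one>\<^sub>G r = r"
  by (simp add: act_def eps_one alpha_one)

text \<open>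
  Both sides only see the part of \<open>r\<close> in \<open>D\<^bsub>h\<^sup>-\<^sup>1\<^esub>
  D\<^bsub>(gh)\<^sup>-\<^sup>1\<^esub>\<close>, where the composition axiom applies.
\<close>

lemma act_act:
  assumes gh: "g \<in> carrier G" "h \<in> carrier G" and r: "r \<in> carrier R"
  shows "act g (act h r) = \<epsilon> g \<star> act (g \<bullet> h) r"
proof -
  let ?k = "(g \<bullet> h)\<^sup>-"
  have c: "\<epsilon> g\<^sup>- \<in> carrier R" "\<epsilon> h\<^sup>- \<in> carrier R" "\<epsilon> ?k \<in> carrier R" "\<epsilon> h \<in> carrier R" "\<epsilon> g \<in> carrier R"
    "\<epsilon> (g \<bullet> h) \<in> carrier R"
    using gh by (auto intro: eps)
  have k: "h \<bullet> ?k = g\<^sup>-" using gh by (simp add: G.inv_mult_group G.m_assoc[symmetric])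
  have hk: "g \<bullet> h \<bullet> h\<^sup>- = g" using gh by (simp add: G.m_assoc)
  have 1: "act h r \<star> \<epsilon> g\<^sup>- = act h (r \<star> \<epsilon> ?k)"
  proof -
    have "act h (r \<star> \<epsilon> ?k) = act h r \<star> (\<epsilon> h \<star> \<epsilon> g\<^sup>-)"
      using gh r c by (simp add: act_mult act_eps k)
    also have "\<dots> = (\<epsilon> h \<star> act h r) \<star> \<epsilon> g\<^sup>-" using gh r c by (simp add: R.m_ac)
    finally show ?thesis using gh r by (simp add: eps_act)
  qed
  have "(r \<star> \<epsilon> ?k) \<star> \<epsilon> h\<^sup>- \<in> PIdl\<^bsub>R\<^esub> (\<epsilon> h\<^sup>- \<star> \<epsilon> ?k)"
    using r c by (auto simp: cgenideal_def R.m_ac)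
  then have 2: "\<alpha> g (\<alpha> h ((r \<star> \<epsilon> ?k) \<star> \<epsilon> h\<^sup>-)) = \<alpha> (g \<bullet> h) ((r \<star> \<epsilon> ?k) \<star> \<epsilon> h\<^sup>-)"
    using gh c by (intro alpha_comp) (simp_all add: ideal_prod_PIdl)
  have "(r \<star> \<epsilon> ?k) \<star> \<epsilon> h\<^sup>- = (r \<star> \<epsilon> h\<^sup>-) \<star> \<epsilon> ?k" using r c by (simp add: R.m_ac)
  then have "act g (act h r) = act (g \<bullet> h) (r \<star> \<epsilon> h\<^sup>-)"
    using 1 2 by (simp add: act_def)
  also have "\<dots> = act (g \<bullet> h) r \<star> (\<epsilon> (g \<bullet> h) \<star> \<epsilon> g)"
    using gh r c by (simp add: act_mult act_eps hk)
  also have "\<dots> = \<epsilon> g \<star> (\<epsilon> (g \<bullet> h) \<star> act (g \<bullet> h) r)" using gh r c by (simp add: R.m_ac)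
  finally show ?thesis using gh r by (simp add: eps_act)
qed

lemma act_act_inv: "g \<in> carrier G \<Longrightarrow> r \<in> carrier R \<Longrightarrow> act g (act g\<^sup>- r) = \<epsilon> g \<star> r"
  by (simp add: act_act act_group_one)

lemma act_inv_act: "g \<in> carrier G \<Longrightarrow> r \<in> carrier R \<Longrightarrow> act g\<^sup>- (act g r) = \<epsilon> g\<^sup>- \<star> r"
  by (simp add: act_act act_group_one)

lemma corner_iso_act: "g \<in> carrier G \<Longrightarrow> corner_iso R (\<epsilon> g\<^sup>-) (\<epsilon> g) (act g) (act g\<^sup>-)"
  by unfold_locales (simp_all add: eps act_add act_mult act_one act_act_inv act_inv_act)

section \<open>The partial action on classes and the first cohomology group\<close>

abbreviation tw :: "'g \<Rightarrow> ('a, 'm, 'x) module_scheme \<Rightarrow> ('a, 'm, 'x) module_scheme" where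
  "tw g E \<equiv> transport_module (\<epsilon> g\<^sup>-) (act g\<^sup>-) E"

text \<open>
  The partial map \<open>\<alpha>\<^sub>g\<^sup>*\<close> extended to all classes, in the same way as
  \<open>act\<close> extends \<open>\<alpha>\<^sub>g\<close>.
\<close>

definition translate :: "'g \<Rightarrow> 'a small_module set \<Rightarrow> 'a small_module set" where
  "translate g c = alpha_star g (c \<otimes>\<^sub>P D_class g\<^sup>-)"

lemma D_class_ideal_class: "D_class g = ideal_class R (\<epsilon> g)"
  by (simp add: D_class_def D_def ideal_class_def)

lemma twist_smult: "g \<in> carrier G \<Longrightarrow> r \<odot>\<^bsub>twist g E\<^esub> x = act g\<^sup>- r \<odot>\<^sub>E x"
  by (simp add: twist_def act_def)

lemma translate_iso_class:
  fixes E :: "('a, 'm) module"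
  assumes g: "g \<in> carrier G" and E: "rank_one R E e"
  shows "translate g (iso_class R E) = iso_class R (tw g E)"
proof -
  let ?u = "\<epsilon> g\<^sup>-"
  have u: "?u \<in> carrier R" "?u \<star> ?u = ?u" using g by (auto intro: eps)
  interpret C: corner_iso R ?u "\<epsilon> g" "act g" "act g\<^sup>-" by (rule corner_iso_act[OF g])
  interpret U: corner_iso R ?u ?u "\<lambda>r. ?u \<star> r" "\<lambda>r. ?u \<star> r" by (rule R.corner_iso_mult[OF u])
  let ?r = "transport_module ?u (\<lambda>r. ?u \<star> r) E"
  note rk = U.rank_one_transport[OF E]
  have c: "iso_class R E \<otimes>\<^sub>P D_class g\<^sup>- = iso_class R ?r"
    unfolding D_class_ideal_class by (rule R.ideal_class_mult_restrict[OF u E])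
  have *: "iso_class R (twist g S) = iso_class R (tw g E)" if S: "S \<in> iso_class R ?r" for S
  proof -
    obtain f where f: "module R S" "f \<in> mod_iso R ?r S" using S by (rule iso_classD)
    note F = mod_homD[OF mod_iso_imp_hom[OF f(2)]]
    have "f \<in> mod_iso R (tw g E) (twist g S)"
    proof -
      have "f \<in> mod_hom R (tw g E) (twist g S)"
      proof (rule mod_homI)
        fix r x assume r: "r \<in> carrier R" and x: "x \<in> carrier (tw g E)"
        show "f (r \<odot>\<^bsub>tw g E\<^esub> x) = r \<odot>\<^bsub>twist g S\<^esub> f x"
          using F(3)[of "act g\<^sup>- r" x] r x g by (simp add: twist_smult eps_act)
      qed (use F(1,2) in \<open>auto simp: twist_def\<close>)
      then show ?thesis using f(2) by (simp add: mod_iso_def twist_def)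
    qed
    then show ?thesis using iso_class_cong C.transport_module_module[OF R.rank_one_module[OF E]] by metis
  qed
  obtain S where "S \<in> iso_class R ?r" using R.iso_class_nonempty[OF rk] by metis
  with * have "(\<Union>S\<in>iso_class R ?r. iso_class R (twist g S)) = iso_class R (tw g E)" by blast
  then show ?thesis by (simp add: translate_def alpha_star_def c)
qed

lemma translate_line:
  assumes g: "g \<in> carrier G" and c: "c \<in> line_classes R e"
  shows "translate g c \<in> line_classes R (act g e)"
proof -
  obtain E :: "'a small_module" where E: "rank_one R E e" "c = iso_class R E" using c by (auto elim: R.line_classesE)
  interpret C: corner_iso R "\<epsilon> g\<^sup>-" "\<epsilon> g" "act g" "act g\<^sup>-" by (rule corner_iso_act[OF g])
  show ?thesis unfolding E(2) translate_iso_class[OF g E(1)]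
    by (rule R.iso_class_line[OF C.rank_one_transport[OF E(1)]])
qed

lemma translate_mult:
  assumes g: "g \<in> carrier G" and c: "c \<in> line_classes R e" and d: "d \<in> line_classes R f"
  shows "translate g (c \<otimes>\<^sub>P d) = translate g c \<otimes>\<^sub>P translate g d"
proof -
  obtain E :: "'a small_module" where E: "rank_one R E e" "c = iso_class R E" using c by (auto elim: R.line_classesE)
  obtain F :: "'a small_module" where F: "rank_one R F f" "d = iso_class R F" using d by (auto elim: R.line_classesE)
  interpret C: corner_iso R "\<epsilon> g\<^sup>-" "\<epsilon> g" "act g" "act g\<^sup>-" by (rule corner_iso_act[OF g])
  obtain L :: "'a small_module" and b where L: "rank_one R L (e \<star> f)" "perfect_pairing R E F L b"
    by (rule R.small_tensor[OF E(1) F(1)])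
  have ef: "e \<in> carrier R" "f \<in> carrier R" using E F by auto
  have "rank_one R (tw g L) (act g e \<star> act g f)"
    using C.rank_one_transport[OF L(1)] g ef by (simp add: act_mult)
  then have "iso_class R (tw g E) \<otimes>\<^sub>P iso_class R (tw g F) = iso_class R (tw g L)"
    by (rule R.PicS_mult_pairing[OF C.rank_one_transport[OF E(1)] C.rank_one_transport[OF F(1)]])
      (rule C.transport_pairing[OF R.rank_one_module[OF E(1)] R.rank_one_module[OF F(1)] R.rank_one_module[OF L(1)] L(2)])
  moreover have "c \<otimes>\<^sub>P d = iso_class R L"
    using R.PicS_mult_pairing[OF E(1) F(1) L] E F by simp
  ultimately show ?thesis
    using translate_iso_class[OF g E(1)] translate_iso_class[OF g F(1)] translate_iso_class[OF g L(1)] E F by simp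
qed

lemma translate_translate:
  assumes g: "g \<in> carrier G" and h: "h \<in> carrier G" and c: "c \<in> line_classes R e"
  shows "translate g (translate h c) = translate (g \<bullet> h) c \<otimes>\<^sub>P D_class g"
proof -
  obtain E :: "'a small_module" where E: "rank_one R E e" "c = iso_class R E" using c by (auto elim: R.line_classesE)
  interpret E: module R E using E by (auto intro: R.rank_one_module)
  let ?gh = "g \<bullet> h"
  have gh: "?gh \<in> carrier G" "?gh\<^sup>- = h\<^sup>- \<bullet> g\<^sup>-" using g h by (auto simp: G.inv_mult_group)
  interpret Ch: corner_iso R "\<epsilon> h\<^sup>-" "\<epsilon> h" "act h" "act h\<^sup>-" by (rule corner_iso_act[OF h])
  interpret Cg: corner_iso R "\<epsilon> g\<^sup>-" "\<epsilon> g" "act g" "act g\<^sup>-" by (rule corner_iso_act[OF g])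
  interpret Cgh: corner_iso R "\<epsilon> ?gh\<^sup>-" "\<epsilon> ?gh" "act ?gh" "act ?gh\<^sup>-" by (rule corner_iso_act[OF gh(1)])
  have e: "\<epsilon> g \<in> carrier R" "\<epsilon> g \<star> \<epsilon> g = \<epsilon> g" "\<epsilon> h\<^sup>- \<in> carrier R" "\<epsilon> ?gh\<^sup>- \<in> carrier R"
    "\<epsilon> g\<^sup>- \<in> carrier R"
    using g h by (auto intro: eps)
  have r1: "rank_one R (tw h E) (act h e)" and r2: "rank_one R (tw ?gh E) (act ?gh e)"
    using Ch.rank_one_transport[OF E(1)] Cgh.rank_one_transport[OF E(1)] .
  let ?L = "tw g (tw h E)" and ?R = "transport_module (\<epsilon> g) (\<lambda>r. \<epsilon> g \<star> r) (tw ?gh E)"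
  have L: "translate g (translate h c) = iso_class R ?L"
    unfolding E(2) translate_iso_class[OF h E(1)] by (rule translate_iso_class[OF g r1])
  have Rr: "translate ?gh c \<otimes>\<^sub>P D_class g = iso_class R ?R"
    unfolding E(2) translate_iso_class[OF gh(1) E(1)] D_class_ideal_class
    by (rule R.ideal_class_mult_restrict[OF e(1,2) r2])
  have hk: "?gh\<^sup>- \<bullet> g = h\<^sup>-" using g h by (simp add: gh(2) G.m_assoc)
  have a1: "act h\<^sup>- (\<epsilon> g\<^sup>-) = \<epsilon> h\<^sup>- \<star> \<epsilon> ?gh\<^sup>-"
    using g h by (simp add: act_eps gh(2))
  have a2: "act ?gh\<^sup>- (\<epsilon> g) = \<epsilon> ?gh\<^sup>- \<star> \<epsilon> h\<^sup>-"
    using g h gh(1) by (simp add: act_eps hk)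
  have supp: "(\<epsilon> h\<^sup>- \<odot>\<^sub>E x = x \<and> act h\<^sup>- (\<epsilon> g\<^sup>-) \<odot>\<^sub>E x = x) \<longleftrightarrow>
      (\<epsilon> ?gh\<^sup>- \<odot>\<^sub>E x = x \<and> act ?gh\<^sup>- (\<epsilon> g) \<odot>\<^sub>E x = x)" if x: "x \<in> carrier E" for x
  proof -
    have ab: "(\<epsilon> h\<^sup>- \<star> \<epsilon> ?gh\<^sup>-) \<odot>\<^sub>E x = \<epsilon> h\<^sup>- \<odot>\<^sub>E (\<epsilon> ?gh\<^sup>- \<odot>\<^sub>E x)"
      "(\<epsilon> ?gh\<^sup>- \<star> \<epsilon> h\<^sup>-) \<odot>\<^sub>E x = \<epsilon> ?gh\<^sup>- \<odot>\<^sub>E (\<epsilon> h\<^sup>- \<odot>\<^sub>E x)"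
      using e x by (auto intro: E.smult_assoc1)
    have comm: "\<epsilon> ?gh\<^sup>- \<star> \<epsilon> h\<^sup>- = \<epsilon> h\<^sup>- \<star> \<epsilon> ?gh\<^sup>-" using e by (rule_tac R.m_comm)
    show ?thesis unfolding a1 a2 using ab comm by metis
  qed
  have "(\<lambda>x. x) \<in> mod_hom R ?L ?R"
  proof (rule mod_homI)
    fix x assume "x \<in> carrier ?L"
    then show "x \<in> carrier ?R" using supp by auto
  next
    fix r x assume r: "r \<in> carrier R" and x: "x \<in> carrier ?L"
    have "act h\<^sup>- (act g\<^sup>- r) = \<epsilon> h\<^sup>- \<star> act ?gh\<^sup>- r"
      using g h r by (simp add: act_act gh(2))
    also have "\<dots> = \<epsilon> h\<^sup>- \<star> (\<epsilon> ?gh\<^sup>- \<star> act ?gh\<^sup>- r)"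
      using gh(1) r by (simp add: eps_act)
    also have "\<dots> = act ?gh\<^sup>- (\<epsilon> g \<star> r)"
      using gh(1) r e by (simp add: act_mult a2 R.m_ac)
    finally show "r \<odot>\<^bsub>?L\<^esub> x = r \<odot>\<^bsub>?R\<^esub> x" by simp
  qed simp
  moreover have "carrier ?L = carrier ?R" using supp by auto
  ultimately have "(\<lambda>x. x) \<in> mod_iso R ?L ?R" by (auto simp: mod_iso_def bij_betw_def)
  then have "iso_class R ?L = iso_class R ?R"
    by (rule iso_class_cong) (intro Cg.transport_module_module R.rank_one_module[OF r1])
  then show ?thesis using L Rr by simp
qed

lemma translate_one:
  assumes g: "g \<in> carrier G"
  shows "translate g (ideal_class R \<one>\<^sub>R) = D_class g"
proof -
  interpret C: corner_iso R "\<epsilon> g\<^sup>-" "\<epsilon> g" "act g" "act g\<^sup>-" by (rule corner_iso_act[OF g])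
  let ?I = "ideal_module R (PIdl\<^bsub>R\<^esub> \<one>\<^sub>R)"
  have I: "rank_one R ?I \<one>\<^sub>R" by (rule R.rank_one_ideal) auto
  have e: "\<epsilon> g \<in> carrier R" "\<epsilon> g \<star> \<epsilon> g = \<epsilon> g" "\<epsilon> g\<^sup>- \<in> carrier R" using g by (auto intro: eps)
  have "act g \<in> mod_hom R (tw g ?I) (ideal_module R (PIdl\<^bsub>R\<^esub> (\<epsilon> g)))"
  proof (rule mod_homI)
    fix r x assume "r \<in> carrier R" "x \<in> carrier (tw g ?I)"
    then have rx: "r \<in> carrier R" "x \<in> carrier R" by (simp_all add: R.PIdl_one)
    have "act g (act g\<^sup>- r \<star> x) = r \<star> (\<epsilon> g \<star> act g x)"
      using rx g e by (simp add: act_mult act_act_inv R.m_ac)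
    then show "act g (r \<odot>\<^bsub>tw g ?I\<^esub> x) = r \<odot>\<^bsub>ideal_module R (PIdl\<^bsub>R\<^esub> (\<epsilon> g))\<^esub> act g x"
      using rx g by (simp add: eps_act)
  qed (use g in \<open>auto simp: R.PIdl_one act_D act_add\<close>)
  moreover have "bij_betw (act g) (carrier (tw g ?I)) (carrier (ideal_module R (PIdl\<^bsub>R\<^esub> (\<epsilon> g))))"
    using g by (intro bij_betw_byWitness[where f' = "act g\<^sup>-"])
      (auto simp: R.PIdl_one eps_D act_act_inv act_inv_act eps_act)
  ultimately have "act g \<in> mod_iso R (tw g ?I) (ideal_module R (PIdl\<^bsub>R\<^esub> (\<epsilon> g)))" by (simp add: mod_iso_def)
  then have "iso_class R (tw g ?I) = D_class g"
    unfolding D_class_def D_def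
    by (rule iso_class_cong) (intro C.transport_module_module R.rank_one_module[OF I])
  then show ?thesis using translate_iso_class[OF g I] by (simp add: ideal_class_def)
qed

lemma D_class_line: "g \<in> carrier G \<Longrightarrow> D_class g \<in> line_classes R (\<epsilon> g)"
  unfolding D_class_ideal_class by (rule R.ideal_class_line) (auto intro: eps)

lemma D_class_mult:
  "g \<in> carrier G \<Longrightarrow> c \<in> line_classes R f \<Longrightarrow> \<epsilon> g \<star> f = f \<Longrightarrow> D_class g \<otimes>\<^sub>P c = c"
  unfolding D_class_ideal_class by (rule R.ideal_class_mult_line) (auto intro: eps)

lemma PicS_comm_monoid: "comm_monoid (PicS R)"
proof (rule comm_monoidI)
  fix x y assume "x \<in> carrier (PicS R)" "y \<in> carrier (PicS R)"
  then obtain e f where ef: "x \<in> line_classes R e" "y \<in> line_classes R f" by (auto simp: R.PicS_carrier_iff)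
  show "x \<otimes>\<^sub>P y \<in> carrier (PicS R)"
    using R.line_mult_closed[OF ef] unfolding R.PicS_carrier_iff by blast
  show "x \<otimes>\<^sub>P y = y \<otimes>\<^sub>P x" by (rule R.line_mult_comm[OF ef])
next
  show "\<one>\<^bsub>PicS R\<^esub> \<in> carrier (PicS R)"
    using R.ideal_class_line[of "\<one>\<^sub>R"] by (auto simp: R.PicS_carrier_iff R.PicS_one)
next
  fix x y z assume "x \<in> carrier (PicS R)" "y \<in> carrier (PicS R)" "z \<in> carrier (PicS R)"
  then show "x \<otimes>\<^sub>P y \<otimes>\<^sub>P z = x \<otimes>\<^sub>P (y \<otimes>\<^sub>P z)"
    using R.line_mult_assoc by (auto simp: R.PicS_carrier_iff)
next
  fix x assume "x \<in> carrier (PicS R)"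
  then obtain e where e: "x \<in> line_classes R e" by (auto simp: R.PicS_carrier_iff)
  then show "\<one>\<^bsub>PicS R\<^esub> \<otimes>\<^sub>P x = x"
    using R.line_classes_closed[OF e] unfolding R.PicS_one by (intro R.ideal_class_mult_line[OF _ _ e]) auto
qed

sublocale P: comm_monoid "PicS R" by (rule PicS_comm_monoid)

lemma line_carrier: "c \<in> line_classes R e \<Longrightarrow> c \<in> carrier (PicS R)"
  by (auto simp: R.PicS_carrier_iff)

text \<open>
  If \<open>c d = [D\<^sub>g]\<close> for \<open>c, d \<in> X\<^sub>g\<close>, comparing supports shows that
  \<open>c\<close> has support \<open>1\<^sub>g\<close>. Conversely, a class with this support is inverted by its
  dual.
\<close>

lemma Units_X_ideal:
  assumes g: "g \<in> carrier G"
  shows "Units (X_ideal g) = line_classes R (\<epsilon> g)"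
proof (intro equalityI subsetI)
  have e: "\<epsilon> g \<in> carrier R" "\<epsilon> g \<star> \<epsilon> g = \<epsilon> g" using g by (auto intro: eps)
  have car: "\<exists>k\<in>carrier R. c \<in> line_classes R (\<epsilon> g \<star> k)" if "c \<in> carrier (X_ideal g)" for c
    using that R.line_mult_closed[OF D_class_line[OF g]] R.line_classes_closed
    by (fastforce simp: X_ideal_def R.PicS_carrier_iff)
  {
    fix c assume "c \<in> Units (X_ideal g)"
    then obtain d where c: "c \<in> carrier (X_ideal g)" and d: "d \<in> carrier (X_ideal g)"
      and cd: "d \<otimes>\<^sub>P c = D_class g" by (auto simp: Units_def X_ideal_def)
    obtain k where k: "k \<in> carrier R" "c \<in> line_classes R (\<epsilon> g \<star> k)" using car[OF c] by auto
    obtain m where m: "m \<in> carrier R" "d \<in> line_classes R (\<epsilon> g \<star> m)" using car[OF d] by auto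
    have "D_class g \<in> line_classes R ((\<epsilon> g \<star> m) \<star> (\<epsilon> g \<star> k))"
      using R.line_mult_closed[OF m(2) k(2)] cd by simp
    then have eq: "(\<epsilon> g \<star> m) \<star> (\<epsilon> g \<star> k) = \<epsilon> g"
      using R.line_class_support_unique D_class_line[OF g] by blast
    have i: "(\<epsilon> g \<star> k) \<star> (\<epsilon> g \<star> k) = \<epsilon> g \<star> k"
      using R.line_classes_closed[OF k(2)] by simp
    have "\<epsilon> g \<star> (\<epsilon> g \<star> k) = (\<epsilon> g \<star> m) \<star> (\<epsilon> g \<star> k)"
      using arg_cong[OF eq, of "\<lambda>x. x \<star> (\<epsilon> g \<star> k)"] i e m(1) k(1)
        R.m_assoc[of "\<epsilon> g \<star> m" "\<epsilon> g \<star> k" "\<epsilon> g \<star> k"] by simp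
    then have "\<epsilon> g \<star> k = \<epsilon> g" using eq e k(1) R.m_assoc[of "\<epsilon> g" "\<epsilon> g" k] by simp
    then show "c \<in> line_classes R (\<epsilon> g)" using k by simp
  next
    fix c assume c: "c \<in> line_classes R (\<epsilon> g)"
    have mem: "x \<in> carrier (X_ideal g)" if "x \<in> line_classes R (\<epsilon> g)" for x
      unfolding X_ideal_def using D_class_mult[OF g that] e line_carrier[OF that]
      by (auto intro!: image_eqI[of _ _ x])
    obtain d where d: "d \<in> line_classes R (\<epsilon> g)" "c \<otimes>\<^sub>P d = D_class g"
      using R.line_inverse[OF c] D_class_ideal_class by metis
    then have "d \<otimes>\<^sub>P c = D_class g" using R.line_mult_comm[OF c d(1)] by simp
    then have "\<one>\<^bsub>X_ideal g\<^esub> = D_class g" "d \<otimes>\<^bsub>X_ideal g\<^esub> c = D_class g" "c \<otimes>\<^bsub>X_ideal g\<^esub> d = D_class g"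
      using d by (simp_all add: X_ideal_def)
    then show "c \<in> Units (X_ideal g)" unfolding Units_def using mem[OF c] mem[OF d(1)] by auto
  }
qed

lemma Z1_iff:
  "f \<in> carrier Z1 \<longleftrightarrow> f \<in> extensional (carrier G) \<and> (\<forall>g\<in>carrier G. f g \<in> line_classes R (\<epsilon> g)) \<and>
     (\<forall>g\<in>carrier G. \<forall>h\<in>carrier G. f (g \<bullet> h) \<otimes>\<^sub>P D_class g = f g \<otimes>\<^sub>P translate g (f h))"
  by (simp add: Z1_def Units_X_ideal translate_def)

lemma D_class_idem: "g \<in> carrier G \<Longrightarrow> D_class g \<otimes>\<^sub>P D_class g = D_class g"
  by (rule D_class_mult[OF _ D_class_line]) (auto intro: eps)

lemma translate_D_class:
  assumes "g \<in> carrier G" "h \<in> carrier G"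
  shows "translate g (D_class h) = D_class (g \<bullet> h) \<otimes>\<^sub>P D_class g"
  using translate_translate[OF assms R.ideal_class_line[of "\<one>\<^sub>R"]] assms by (simp add: translate_one)

lemma Z1_comm_group: "comm_group Z1"
proof (rule comm_groupI)
  have mult: "f \<otimes>\<^bsub>Z1\<^esub> f' = (\<lambda>g\<in>carrier G. f g \<otimes>\<^sub>P f' g)" for f f' by (simp add: Z1_def)
  have one: "\<one>\<^bsub>Z1\<^esub> = (\<lambda>g\<in>carrier G. D_class g)" by (simp add: Z1_def)
  have sq: "f g \<otimes>\<^sub>P f' g \<in> line_classes R (\<epsilon> g)"
    if "g \<in> carrier G" "f g \<in> line_classes R (\<epsilon> g)" "f' g \<in> line_classes R (\<epsilon> g)" for f f' :: "'g \<Rightarrow> 'a small_module set" and g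
    using R.line_mult_closed[OF that(2,3)] that(1) by (simp add: eps)
  have tc: "translate g (f h) \<in> carrier (PicS R)" if "f \<in> carrier Z1" "g \<in> carrier G" "h \<in> carrier G" for f g h
    using that translate_line[of g "f h"] line_carrier by (auto simp: Z1_iff)
  have fc: "f g \<in> carrier (PicS R)" if "f \<in> carrier Z1" "g \<in> carrier G" for f g
    using that line_carrier by (auto simp: Z1_iff)
  have dc: "D_class g \<in> carrier (PicS R)" if "g \<in> carrier G" for g using that D_class_line line_carrier by blast
  have ext: "f = f'" if "f \<in> carrier Z1" "f' \<in> carrier Z1" "\<And>g. g \<in> carrier G \<Longrightarrow> f g = f' g" for f f'
    using that by (auto simp: Z1_iff intro: extensionalityI)
  show cl: "f \<otimes>\<^bsub>Z1\<^esub> f' \<in> carrier Z1" if f: "f \<in> carrier Z1" "f' \<in> carrier Z1" for f f'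
    unfolding Z1_iff
  proof (intro conjI ballI)
    fix g h assume g: "g \<in> carrier G" and h: "h \<in> carrier G"
    have gh: "g \<bullet> h \<in> carrier G" using g h by simp
    let ?a = "f (g \<bullet> h)" and ?b = "f' (g \<bullet> h)"
    have "?a \<otimes>\<^sub>P ?b \<otimes>\<^sub>P D_class g = (?a \<otimes>\<^sub>P D_class g) \<otimes>\<^sub>P (?b \<otimes>\<^sub>P D_class g)"
      using fc[OF f(1) gh] fc[OF f(2) gh] dc[OF g] D_class_idem[OF g]
        P.m_assoc[of "D_class g" "D_class g" "?b \<otimes>\<^sub>P ?a"] by (simp add: P.m_ac)
    also have "\<dots> = (f g \<otimes>\<^sub>P translate g (f h)) \<otimes>\<^sub>P (f' g \<otimes>\<^sub>P translate g (f' h))"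
      using f g h by (simp add: Z1_iff)
    also have "\<dots> = (f g \<otimes>\<^sub>P f' g) \<otimes>\<^sub>P (translate g (f h) \<otimes>\<^sub>P translate g (f' h))"
      using fc[OF f(1) g] fc[OF f(2) g] tc[OF f(1) g h] tc[OF f(2) g h] by (simp add: P.m_ac)
    also have "translate g (f h) \<otimes>\<^sub>P translate g (f' h) = translate g (f h \<otimes>\<^sub>P f' h)"
      using f h by (intro translate_mult[symmetric] g) (auto simp: Z1_iff)
    finally show "(f \<otimes>\<^bsub>Z1\<^esub> f') (g \<bullet> h) \<otimes>\<^sub>P D_class g = (f \<otimes>\<^bsub>Z1\<^esub> f') g \<otimes>\<^sub>P translate g ((f \<otimes>\<^bsub>Z1\<^esub> f') h)"
      using g h gh by (simp add: mult)
  qed (use f sq in \<open>auto simp: mult Z1_iff\<close>)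
  show onec: "\<one>\<^bsub>Z1\<^esub> \<in> carrier Z1"
    unfolding Z1_iff one
  proof (intro conjI ballI)
    fix g h assume g: "g \<in> carrier G" and h: "h \<in> carrier G"
    have gh: "g \<bullet> h \<in> carrier G" using g h by simp
    have "D_class g \<otimes>\<^sub>P translate g (D_class h) = D_class (g \<bullet> h) \<otimes>\<^sub>P (D_class g \<otimes>\<^sub>P D_class g)"
      using dc[OF g] dc[OF gh] g h by (simp only: translate_D_class P.m_ac P.m_closed)
    then show "(\<lambda>g\<in>carrier G. D_class g) (g \<bullet> h) \<otimes>\<^sub>P D_class g =
      (\<lambda>g\<in>carrier G. D_class g) g \<otimes>\<^sub>P translate g ((\<lambda>g\<in>carrier G. D_class g) h)"
      using g h gh by (simp add: D_class_idem)
  qed (auto simp: D_class_line)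
  show "f \<otimes>\<^bsub>Z1\<^esub> f' \<otimes>\<^bsub>Z1\<^esub> f'' = f \<otimes>\<^bsub>Z1\<^esub> (f' \<otimes>\<^bsub>Z1\<^esub> f'')"
    if "f \<in> carrier Z1" "f' \<in> carrier Z1" "f'' \<in> carrier Z1" for f f' f''
    by (rule ext[OF cl[OF cl[OF that(1,2)] that(3)] cl[OF that(1) cl[OF that(2,3)]]])
      (use that in \<open>simp add: mult fc P.m_assoc\<close>)
  show "f \<otimes>\<^bsub>Z1\<^esub> f' = f' \<otimes>\<^bsub>Z1\<^esub> f" if "f \<in> carrier Z1" "f' \<in> carrier Z1" for f f'
    by (rule ext[OF cl[OF that] cl[OF that(2,1)]]) (use that in \<open>simp add: mult fc P.m_comm\<close>)
  show "\<one>\<^bsub>Z1\<^esub> \<otimes>\<^bsub>Z1\<^esub> f = f" if "f \<in> carrier Z1" for f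
  proof (rule ext[OF cl[OF onec that] that])
    fix g assume g: "g \<in> carrier G"
    then show "(\<one>\<^bsub>Z1\<^esub> \<otimes>\<^bsub>Z1\<^esub> f) g = f g"
      using that D_class_mult[of g "f g" "\<epsilon> g"] by (simp add: mult one Z1_iff eps)
  qed
  show "\<exists>k\<in>carrier Z1. k \<otimes>\<^bsub>Z1\<^esub> f = \<one>\<^bsub>Z1\<^esub>" if f: "f \<in> carrier Z1" for f
  proof -
    have "\<exists>d. d \<in> line_classes R (\<epsilon> g) \<and> d \<otimes>\<^sub>P f g = D_class g" if g: "g \<in> carrier G" for g
    proof -
      have fg: "f g \<in> line_classes R (\<epsilon> g)" using f g by (auto simp: Z1_iff)
      obtain d where "d \<in> line_classes R (\<epsilon> g)" "f g \<otimes>\<^sub>P d = D_class g"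
        using R.line_inverse[OF fg] D_class_ideal_class by metis
      then show ?thesis using R.line_mult_comm[OF fg] by metis
    qed
    then obtain k0 where k0: "\<And>g. g \<in> carrier G \<Longrightarrow> k0 g \<in> line_classes R (\<epsilon> g)"
      "\<And>g. g \<in> carrier G \<Longrightarrow> k0 g \<otimes>\<^sub>P f g = D_class g" by metis
    define k where "k = restrict k0 (carrier G)"
    have k: "k g \<in> line_classes R (\<epsilon> g)" "k g \<otimes>\<^sub>P f g = D_class g" "k g \<in> carrier (PicS R)"
      if "g \<in> carrier G" for g using that k0[OF that] line_carrier[OF k0(1)[OF that]] by (auto simp: k_def)
    have "k \<in> carrier Z1"
      unfolding Z1_iff
    proof (intro conjI ballI)
      fix g h assume g: "g \<in> carrier G" and h: "h \<in> carrier G"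
      have gh: "g \<bullet> h \<in> carrier G" using g h by simp
      let ?e = "\<epsilon> (g \<bullet> h) \<star> \<epsilon> g"
      have tk: "translate g (k h) \<in> line_classes R (\<epsilon> g \<star> \<epsilon> (g \<bullet> h))"
        using translate_line[OF g k(1)[OF h]] g h by (simp add: act_eps)
      have "\<epsilon> g \<star> (\<epsilon> g \<star> \<epsilon> (g \<bullet> h)) = ?e"
        using g gh R.m_assoc[of "\<epsilon> g" "\<epsilon> g" "\<epsilon> (g \<bullet> h)"] by (simp add: eps R.m_comm)
      then have l: "k g \<otimes>\<^sub>P translate g (k h) \<in> line_classes R ?e"
        using R.line_mult_closed[OF k(1)[OF g] tk] by simp
      have l': "k (g \<bullet> h) \<otimes>\<^sub>P D_class g \<in> line_classes R ?e"
        "f (g \<bullet> h) \<otimes>\<^sub>P D_class g \<in> line_classes R ?e"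
        using k(1)[OF gh] f gh D_class_line[OF g] by (auto simp: Z1_iff intro!: R.line_mult_closed)
      have fk: "f g \<in> carrier (PicS R)" "k g \<in> carrier (PicS R)" "f (g \<bullet> h) \<in> carrier (PicS R)"
        "k (g \<bullet> h) \<in> carrier (PicS R)" "translate g (f h) \<in> carrier (PicS R)" "translate g (k h) \<in> carrier (PicS R)"
        "D_class g \<in> carrier (PicS R)" "D_class (g \<bullet> h) \<in> carrier (PicS R)"
        using f g h gh fc tc k dc line_carrier[OF tk] by auto
      have "(f (g \<bullet> h) \<otimes>\<^sub>P D_class g) \<otimes>\<^sub>P (k (g \<bullet> h) \<otimes>\<^sub>P D_class g) =
        (k (g \<bullet> h) \<otimes>\<^sub>P f (g \<bullet> h)) \<otimes>\<^sub>P (D_class g \<otimes>\<^sub>P D_class g)"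
        using fk by (simp add: P.m_ac)
      also have "\<dots> = D_class (g \<bullet> h) \<otimes>\<^sub>P D_class g"
        using k(2)[OF gh] D_class_idem[OF g] by simp
      also have "\<dots> = D_class g \<otimes>\<^sub>P translate g (D_class h)"
        using fk D_class_idem[OF g] g h P.m_assoc[of "D_class g" "D_class g" "D_class (g \<bullet> h)"]
        by (simp add: translate_D_class P.m_comm)
      also have "D_class h = k h \<otimes>\<^sub>P f h" using k(2)[OF h] by simp
      also have "translate g (k h \<otimes>\<^sub>P f h) = translate g (k h) \<otimes>\<^sub>P translate g (f h)"
        using f h k(1) by (intro translate_mult g) (auto simp: Z1_iff)
      also have "D_class g = k g \<otimes>\<^sub>P f g" using k(2)[OF g] by simp
      also have "(k g \<otimes>\<^sub>P f g) \<otimes>\<^sub>P (translate g (k h) \<otimes>\<^sub>P translate g (f h)) =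
        (f g \<otimes>\<^sub>P translate g (f h)) \<otimes>\<^sub>P (k g \<otimes>\<^sub>P translate g (k h))"
        using fk by (simp add: P.m_ac)
      also have "f g \<otimes>\<^sub>P translate g (f h) = f (g \<bullet> h) \<otimes>\<^sub>P D_class g"
        using f g h by (simp add: Z1_iff)
      finally have eq: "(f (g \<bullet> h) \<otimes>\<^sub>P D_class g) \<otimes>\<^sub>P (k (g \<bullet> h) \<otimes>\<^sub>P D_class g) =
        (f (g \<bullet> h) \<otimes>\<^sub>P D_class g) \<otimes>\<^sub>P (k g \<otimes>\<^sub>P translate g (k h))"
        using k(2)[OF g] by simp
      show "k (g \<bullet> h) \<otimes>\<^sub>P D_class g = k g \<otimes>\<^sub>P translate g (k h)"
        by (rule R.line_cancel[OF l'(2) l'(1) l eq])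
    qed (use k in \<open>auto simp: k_def\<close>)
    moreover have "k \<otimes>\<^bsub>Z1\<^esub> f = \<one>\<^bsub>Z1\<^esub>" using k by (auto simp: mult one fun_eq_iff)
    ultimately show ?thesis by blast
  qed
qed

text \<open>
  Here \<open>d\<close> is meant to be the inverse of \<open>c\<close>. Keeping it as a separate argument avoids the
  dual module, whose elements have a different type.
\<close>

definition coboundary1 :: "'a small_module set \<Rightarrow> 'a small_module set \<Rightarrow> 'g \<Rightarrow> 'a small_module set" where
  "coboundary1 c d = (\<lambda>g\<in>carrier G. translate g c \<otimes>\<^sub>P d)"

lemma ideal_class_one_mult: "c \<in> line_classes R e \<Longrightarrow> ideal_class R \<one>\<^sub>R \<otimes>\<^sub>P c = c"
  using P.l_one line_carrier by (simp flip: R.PicS_one)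

lemma B1_iff:
  "f \<in> B1 \<longleftrightarrow> (\<exists>c\<in>line_classes R \<one>\<^sub>R. \<exists>d\<in>line_classes R \<one>\<^sub>R. c \<otimes>\<^sub>P d = ideal_class R \<one>\<^sub>R \<and> f = coboundary1 c d)"
proof
  assume "f \<in> B1"
  then obtain E :: "'a small_module" where E: "picS_module R E" "iso_class R E \<in> Units (PicS R)"
    "f = coboundary1 (iso_class R E) (iso_class R (dual_module R E))"
    by (auto simp: B1_def coboundary1_def translate_def)
  obtain e where e: "rank_one R E e" using R.picS_module_rank_one[OF E(1)] by auto
  then have ec: "e \<in> carrier R" "e \<star> e = e" using R.rank_one_idem by auto
  obtain d k where d: "d \<in> line_classes R k" "iso_class R E \<otimes>\<^sub>P d = ideal_class R \<one>\<^sub>R"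
    using E(2) by (auto simp: Units_def R.PicS_carrier_iff R.PicS_one)
  have "ideal_class R \<one>\<^sub>R \<in> line_classes R (e \<star> k)"
    using R.line_mult_closed[OF R.iso_class_line[OF e] d(1)] d(2) by simp
  then have ek: "e \<star> k = \<one>\<^sub>R"
    using R.line_class_support_unique[OF _ R.ideal_class_line[of "\<one>\<^sub>R"]] by simp
  have "e = \<one>\<^sub>R"
    using ek ec R.line_classes_closed(1)[OF d(1)] R.m_assoc[of e e k] by simp
  then show "\<exists>c\<in>line_classes R \<one>\<^sub>R. \<exists>d\<in>line_classes R \<one>\<^sub>R. c \<otimes>\<^sub>P d = ideal_class R \<one>\<^sub>R \<and> f = coboundary1 c d"
    using E(3) R.dual_class[OF e] R.iso_class_line[OF e] R.iso_class_line[OF R.rank_one_dual[OF e]] by blast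
next
  assume "\<exists>c\<in>line_classes R \<one>\<^sub>R. \<exists>d\<in>line_classes R \<one>\<^sub>R. c \<otimes>\<^sub>P d = ideal_class R \<one>\<^sub>R \<and> f = coboundary1 c d"
  then obtain c d where c: "c \<in> line_classes R \<one>\<^sub>R" "d \<in> line_classes R \<one>\<^sub>R" "c \<otimes>\<^sub>P d = ideal_class R \<one>\<^sub>R"
    "f = coboundary1 c d" by blast
  obtain E :: "'a small_module" where E: "rank_one R E \<one>\<^sub>R" "c = iso_class R E" using c(1) by (auto elim: R.line_classesE)
  have "d = iso_class R (dual_module R E)"
    by (rule R.line_cancel[OF c(1,2) R.iso_class_line[OF R.rank_one_dual[OF E(1)]]])
      (use c(3) R.dual_class[OF E(1)] E in simp)
  moreover have "c \<in> Units (PicS R)"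
  proof -
    have "c \<otimes>\<^sub>P d = \<one>\<^bsub>PicS R\<^esub>" "d \<otimes>\<^sub>P c = \<one>\<^bsub>PicS R\<^esub>"
      using c(3) R.line_mult_comm[OF c(1,2)] by (simp_all add: R.PicS_one)
    then show ?thesis unfolding Units_def using line_carrier[OF c(1)] line_carrier[OF c(2)] by blast
  qed
  ultimately show "f \<in> B1"
    using c(4) E R.rank_one_picS_module[OF E(1)] by (auto simp: B1_def coboundary1_def translate_def intro!: exI[of _ E])
qed

lemma coboundary1_Z1:
  assumes c: "c \<in> line_classes R \<one>\<^sub>R" and d: "d \<in> line_classes R \<one>\<^sub>R" and cd: "c \<otimes>\<^sub>P d = ideal_class R \<one>\<^sub>R"
  shows "coboundary1 c d \<in> carrier Z1"
  unfolding Z1_iff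
proof (intro conjI ballI)
  show "coboundary1 c d \<in> extensional (carrier G)" by (simp add: coboundary1_def)
  have tl: "translate g c \<in> line_classes R (\<epsilon> g)" "translate g d \<in> line_classes R (\<epsilon> g)" if "g \<in> carrier G" for g
    using translate_line[OF that c] translate_line[OF that d] that by (auto simp: act_one)
  show tld: "coboundary1 c d g \<in> line_classes R (\<epsilon> g)" if g: "g \<in> carrier G" for g
    using R.line_mult_closed[OF tl(1)[OF g] d] g by (simp add: coboundary1_def eps)
  fix g h assume g: "g \<in> carrier G" and h: "h \<in> carrier G"
  have gh: "g \<bullet> h \<in> carrier G" using g h by simp
  have cl: "translate g c \<in> carrier (PicS R)" "translate g d \<in> carrier (PicS R)" "d \<in> carrier (PicS R)"
    "translate (g \<bullet> h) c \<in> carrier (PicS R)" "D_class g \<in> carrier (PicS R)"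
    using line_carrier[OF tl(1)[OF g]] line_carrier[OF tl(2)[OF g]] line_carrier[OF tl(1)[OF gh]] line_carrier[OF d]
      line_carrier[OF D_class_line[OF g]] by auto
  have "coboundary1 c d g \<otimes>\<^sub>P translate g (coboundary1 c d h) =
    (translate g c \<otimes>\<^sub>P d) \<otimes>\<^sub>P (translate g (translate h c) \<otimes>\<^sub>P translate g d)"
    using g h translate_mult[OF g tl(1)[OF h] d] by (simp add: coboundary1_def)
  also have "translate g (translate h c) = translate (g \<bullet> h) c \<otimes>\<^sub>P D_class g"
    by (rule translate_translate[OF g h c])
  also have "(translate g c \<otimes>\<^sub>P d) \<otimes>\<^sub>P ((translate (g \<bullet> h) c \<otimes>\<^sub>P D_class g) \<otimes>\<^sub>P translate g d) =
    (translate (g \<bullet> h) c \<otimes>\<^sub>P d) \<otimes>\<^sub>P (D_class g \<otimes>\<^sub>P (translate g c \<otimes>\<^sub>P translate g d))"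
    using cl by (simp add: P.m_ac)
  also have "translate g c \<otimes>\<^sub>P translate g d = D_class g"
    using translate_mult[OF g c d] cd translate_one[OF g] by simp
  finally show "coboundary1 c d (g \<bullet> h) \<otimes>\<^sub>P D_class g = coboundary1 c d g \<otimes>\<^sub>P translate g (coboundary1 c d h)"
    using gh by (simp add: coboundary1_def D_class_idem[OF g])
qed

lemma B1_subgroup: "subgroup B1 Z1"
proof -
  interpret Z: comm_group Z1 by (rule Z1_comm_group)
  have mult: "f \<otimes>\<^bsub>Z1\<^esub> f' = (\<lambda>g\<in>carrier G. f g \<otimes>\<^sub>P f' g)" for f f' by (simp add: Z1_def)
  have one: "\<one>\<^bsub>Z1\<^esub> = (\<lambda>g\<in>carrier G. D_class g)" by (simp add: Z1_def)
  have cbm: "coboundary1 c d \<otimes>\<^bsub>Z1\<^esub> coboundary1 c' d' = coboundary1 (c \<otimes>\<^sub>P c') (d \<otimes>\<^sub>P d')"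
    if l: "c \<in> line_classes R \<one>\<^sub>R" "d \<in> line_classes R \<one>\<^sub>R" "c' \<in> line_classes R \<one>\<^sub>R" "d' \<in> line_classes R \<one>\<^sub>R" for c d c' d'
  proof -
    have "(translate g c \<otimes>\<^sub>P d) \<otimes>\<^sub>P (translate g c' \<otimes>\<^sub>P d') =
        translate g (c \<otimes>\<^sub>P c') \<otimes>\<^sub>P (d \<otimes>\<^sub>P d')" if g: "g \<in> carrier G" for g
      using translate_line[OF g l(1), THEN line_carrier] translate_line[OF g l(3), THEN line_carrier]
        line_carrier[OF l(2)] line_carrier[OF l(4)] by (simp add: translate_mult[OF g l(1,3)] P.m_ac)
    then show ?thesis by (auto simp: fun_eq_iff mult coboundary1_def)
  qed
  have lm: "c \<otimes>\<^sub>P c' \<in> line_classes R \<one>\<^sub>R" if "c \<in> line_classes R \<one>\<^sub>R" "c' \<in> line_classes R \<one>\<^sub>R" for c c'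
    using R.line_mult_closed[OF that] by simp
  have one_line: "ideal_class R \<one>\<^sub>R \<in> line_classes R \<one>\<^sub>R" by (rule R.ideal_class_line) auto
  show ?thesis
  proof (rule Z.subgroupI)
    show sub: "B1 \<subseteq> carrier Z1" using coboundary1_Z1 by (auto simp: B1_iff)
    have "ideal_class R \<one>\<^sub>R \<otimes>\<^sub>P ideal_class R \<one>\<^sub>R = ideal_class R \<one>\<^sub>R"
      by (rule ideal_class_one_mult[OF one_line])
    then show "B1 \<noteq> {}" using one_line B1_iff by blast
    fix f assume f: "f \<in> B1"
    then obtain c d where c: "c \<in> line_classes R \<one>\<^sub>R" "d \<in> line_classes R \<one>\<^sub>R" "c \<otimes>\<^sub>P d = ideal_class R \<one>\<^sub>R"
      "f = coboundary1 c d" by (auto simp: B1_iff)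
    have dc: "d \<otimes>\<^sub>P c = ideal_class R \<one>\<^sub>R" using R.line_mult_comm[OF c(1,2)] c(3) by simp
    have "coboundary1 (ideal_class R \<one>\<^sub>R) (ideal_class R \<one>\<^sub>R) = \<one>\<^bsub>Z1\<^esub>"
      unfolding one coboundary1_def using translate_one P.r_one line_carrier[OF D_class_line]
      by (auto simp: R.PicS_one fun_eq_iff)
    then have "coboundary1 d c \<otimes>\<^bsub>Z1\<^esub> f = \<one>\<^bsub>Z1\<^esub>" unfolding c(4) using cbm[OF c(2,1,1,2)] dc c(3) by simp
    moreover have "coboundary1 d c \<in> B1" using c dc B1_iff by blast
    ultimately have "inv\<^bsub>Z1\<^esub> f = coboundary1 d c" using f sub by (intro Z.inv_equality) auto
    then show "inv\<^bsub>Z1\<^esub> f \<in> B1" using \<open>coboundary1 d c \<in> B1\<close> by simp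
    fix f' assume f': "f' \<in> B1"
    then obtain c' d' where c': "c' \<in> line_classes R \<one>\<^sub>R" "d' \<in> line_classes R \<one>\<^sub>R" "c' \<otimes>\<^sub>P d' = ideal_class R \<one>\<^sub>R"
      "f' = coboundary1 c' d'" by (auto simp: B1_iff)
    have "(c \<otimes>\<^sub>P c') \<otimes>\<^sub>P (d \<otimes>\<^sub>P d') = (c \<otimes>\<^sub>P d) \<otimes>\<^sub>P (c' \<otimes>\<^sub>P d')"
      using line_carrier[OF c(1)] line_carrier[OF c(2)] line_carrier[OF c'(1)] line_carrier[OF c'(2)]
      by (simp only: P.m_ac P.m_closed)
    then have "(c \<otimes>\<^sub>P c') \<otimes>\<^sub>P (d \<otimes>\<^sub>P d') = ideal_class R \<one>\<^sub>R"
      using c(3) c'(3) ideal_class_one_mult[OF one_line] by simp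
    then show "f \<otimes>\<^bsub>Z1\<^esub> f' \<in> B1"
      unfolding c(4) c'(4) cbm[OF c(1,2) c'(1,2)] B1_iff using lm c c' by blast
  qed
qed

lemma H1_group: "group H1"
  unfolding H1_def
  using comm_group.normal_iff_subgroup[OF Z1_comm_group] B1_subgroup normal.factorgroup_is_group by blast

end

section \<open>Cochains and the third cohomology group\<close>

context cring
begin

lemma corner_simps:
  "carrier (corner R u) = PIdl u" "x \<otimes>\<^bsub>corner R u\<^esub> y = x \<otimes> y" "\<one>\<^bsub>corner R u\<^esub> = u"
  by (simp_all add: corner_def)

lemma corner_comm_monoid:
  assumes u: "u \<in> carrier R" "u \<otimes> u = u"
  shows "comm_monoid (corner R u)"
proof (rule comm_monoidI)
  fix x y assume xy: "x \<in> carrier (corner R u)" "y \<in> carrier (corner R u)"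
  then show "x \<otimes>\<^bsub>corner R u\<^esub> y \<in> carrier (corner R u)"
    using u m_assoc[of u x y] by (simp add: corner_simps PIdl_iff[OF u])
  show "x \<otimes>\<^bsub>corner R u\<^esub> y = y \<otimes>\<^bsub>corner R u\<^esub> x"
    using xy u by (simp add: corner_simps PIdl_iff[OF u] m_comm)
qed (use u in \<open>auto simp: corner_simps PIdl_iff[OF u] m_assoc\<close>)

lemma Units_corner_iff:
  assumes u: "u \<in> carrier R" "u \<otimes> u = u"
  shows "w \<in> Units (corner R u) \<longleftrightarrow> w \<in> carrier R \<and> u \<otimes> w = w \<and> (\<exists>v\<in>carrier R. w \<otimes> v = u)"
proof
  assume "w \<in> Units (corner R u)"
  then obtain v where "w \<in> PIdl u" "v \<in> PIdl u" "w \<otimes> v = u"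
    unfolding Units_def corner_simps by blast
  then show "w \<in> carrier R \<and> u \<otimes> w = w \<and> (\<exists>v\<in>carrier R. w \<otimes> v = u)"
    unfolding PIdl_iff[OF u] by blast
next
  assume w: "w \<in> carrier R \<and> u \<otimes> w = w \<and> (\<exists>v\<in>carrier R. w \<otimes> v = u)"
  then obtain v where v: "v \<in> carrier R" "w \<otimes> v = u" by blast
  have "u \<otimes> (u \<otimes> v) = u \<otimes> v" using u v m_assoc[of u u v] by simp
  moreover have "w \<otimes> (u \<otimes> v) = u" using w v u m_lcomm[of w u v] by simp
  moreover have "(u \<otimes> v) \<otimes> w = u" using w v u m_comm[of "u \<otimes> v" w] calculation by simp
  ultimately show "w \<in> Units (corner R u)"
  proof -
    have "w \<in> PIdl u" "u \<otimes> v \<in> PIdl u"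
      using \<open>u \<otimes> (u \<otimes> v) = u \<otimes> v\<close> w u v by (simp_all add: PIdl_iff[OF u])
    then show ?thesis
      using \<open>w \<otimes> (u \<otimes> v) = u\<close> \<open>(u \<otimes> v) \<otimes> w = u\<close> unfolding Units_def corner_simps by blast
  qed
qed

lemma corner_inv:
  assumes u: "u \<in> carrier R" "u \<otimes> u = u" and w: "w \<in> Units (corner R u)"
  shows "inv\<^bsub>corner R u\<^esub> w \<in> carrier R" "u \<otimes> inv\<^bsub>corner R u\<^esub> w = inv\<^bsub>corner R u\<^esub> w"
    "w \<otimes> inv\<^bsub>corner R u\<^esub> w = u" "inv\<^bsub>corner R u\<^esub> w \<in> Units (corner R u)"
proof -
  interpret C: comm_monoid "corner R u" by (rule corner_comm_monoid[OF u])
  have "inv\<^bsub>corner R u\<^esub> w \<in> carrier (corner R u)" using w by (rule C.Units_inv_closed)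
  then show "inv\<^bsub>corner R u\<^esub> w \<in> carrier R" "u \<otimes> inv\<^bsub>corner R u\<^esub> w = inv\<^bsub>corner R u\<^esub> w"
    by (auto simp: corner_simps PIdl_iff[OF u])
  show "w \<otimes> inv\<^bsub>corner R u\<^esub> w = u" using C.Units_r_inv[OF w] by (simp add: corner_simps)
  show "inv\<^bsub>corner R u\<^esub> w \<in> Units (corner R u)" using w by (rule C.Units_inv_Units)
qed

lemma idem_mult:
  assumes "a \<in> carrier R" "b \<in> carrier R" "a \<otimes> a = a" "b \<otimes> b = b"
  shows "(a \<otimes> b) \<otimes> (a \<otimes> b) = a \<otimes> b"
  using assms m_assoc[of a b "a \<otimes> b"] m_lcomm[of b a b] m_assoc[of a a b] by simp

end

context unital_partial_action
begin

lemma tuples_prod_closed: "set gs \<subseteq> carrier G \<Longrightarrow> foldr (\<bullet>) gs \<one>\<^sub>G \<in> carrier G"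
  by (induction gs) auto

lemma eps_tuple_closed:
  assumes "gs \<in> tuples n"
  shows "eps_tuple gs \<in> carrier R" "eps_tuple gs \<star> eps_tuple gs = eps_tuple gs"
proof -
  let ?f = "\<lambda>i. \<epsilon> (foldr (\<bullet>) (take i gs) \<one>\<^sub>G)"
  have f: "?f i \<in> carrier R" "?f i \<star> ?f i = ?f i" for i
    using assms by (auto simp: tuples_def intro!: eps tuples_prod_closed dest: in_set_takeD)
  show "eps_tuple gs \<in> carrier R" unfolding eps_tuple_def using f by (intro R.finprod_closed) auto
  have "eps_tuple gs \<star> eps_tuple gs = finprod R (\<lambda>i. ?f i \<star> ?f i) {1..length gs}"
    unfolding eps_tuple_def using f by (intro R.finprod_multf[symmetric]) auto
  then show "eps_tuple gs \<star> eps_tuple gs = eps_tuple gs" by (simp add: f eps_tuple_def)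
qed

lemma tuples_iff [simp]:
  "[g, h] \<in> tuples 2 \<longleftrightarrow> g \<in> carrier G \<and> h \<in> carrier G"
  "[g, h, l] \<in> tuples 3 \<longleftrightarrow> g \<in> carrier G \<and> h \<in> carrier G \<and> l \<in> carrier G"
  "[g, h, l, t] \<in> tuples 4 \<longleftrightarrow> g \<in> carrier G \<and> h \<in> carrier G \<and> l \<in> carrier G \<and> t \<in> carrier G"
  by (auto simp: tuples_def)

lemma tuplesE:
  "gs \<in> tuples 2 \<Longrightarrow> (\<And>g h. gs = [g, h] \<Longrightarrow> g \<in> carrier G \<Longrightarrow> h \<in> carrier G \<Longrightarrow> P) \<Longrightarrow> P"
  "gs \<in> tuples 3 \<Longrightarrow> (\<And>g h l. gs = [g, h, l] \<Longrightarrow> g \<in> carrier G \<Longrightarrow> h \<in> carrier G \<Longrightarrow> l \<in> carrier G \<Longrightarrow> P) \<Longrightarrow> P"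
  "gs \<in> tuples 4 \<Longrightarrow> (\<And>g h l t. gs = [g, h, l, t] \<Longrightarrow> g \<in> carrier G \<Longrightarrow> h \<in> carrier G \<Longrightarrow> l \<in> carrier G \<Longrightarrow> t \<in> carrier G \<Longrightarrow> P) \<Longrightarrow> P"
  by (auto simp: tuples_def numeral_eq_Suc length_Suc_conv)

lemma eps_tuple_simps:
  "g \<in> carrier G \<Longrightarrow> h \<in> carrier G \<Longrightarrow> eps_tuple [g, h] = \<epsilon> g \<star> \<epsilon> (g \<bullet> h)"
  "g \<in> carrier G \<Longrightarrow> h \<in> carrier G \<Longrightarrow> l \<in> carrier G \<Longrightarrow>
    eps_tuple [g, h, l] = \<epsilon> g \<star> (\<epsilon> (g \<bullet> h) \<star> \<epsilon> (g \<bullet> (h \<bullet> l)))"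
  "g \<in> carrier G \<Longrightarrow> h \<in> carrier G \<Longrightarrow> l \<in> carrier G \<Longrightarrow> t \<in> carrier G \<Longrightarrow>
    eps_tuple [g, h, l, t] = \<epsilon> g \<star> (\<epsilon> (g \<bullet> h) \<star> (\<epsilon> (g \<bullet> (h \<bullet> l)) \<star> \<epsilon> (g \<bullet> (h \<bullet> (l \<bullet> t)))))"
proof -
  have s: "{Suc 0..Suc (Suc 0)} = {Suc 0, Suc (Suc 0)}"
    "{Suc 0..Suc (Suc (Suc 0))} = {Suc 0, Suc (Suc 0), Suc (Suc (Suc 0))}"
    "{Suc 0..Suc (Suc (Suc (Suc 0)))} = {Suc 0, Suc (Suc 0), Suc (Suc (Suc 0)), Suc (Suc (Suc (Suc 0)))}" by auto
  show "g \<in> carrier G \<Longrightarrow> h \<in> carrier G \<Longrightarrow> eps_tuple [g, h] = \<epsilon> g \<star> \<epsilon> (g \<bullet> h)"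
    by (simp add: eps_tuple_def s eps)
  show "g \<in> carrier G \<Longrightarrow> h \<in> carrier G \<Longrightarrow> l \<in> carrier G \<Longrightarrow>
    eps_tuple [g, h, l] = \<epsilon> g \<star> (\<epsilon> (g \<bullet> h) \<star> \<epsilon> (g \<bullet> (h \<bullet> l)))"
    by (simp add: eps_tuple_def s eps)
  show "g \<in> carrier G \<Longrightarrow> h \<in> carrier G \<Longrightarrow> l \<in> carrier G \<Longrightarrow> t \<in> carrier G \<Longrightarrow>
    eps_tuple [g, h, l, t] = \<epsilon> g \<star> (\<epsilon> (g \<bullet> h) \<star> (\<epsilon> (g \<bullet> (h \<bullet> l)) \<star> \<epsilon> (g \<bullet> (h \<bullet> (l \<bullet> t)))))"
    by (simp add: eps_tuple_def s eps)
qed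

lemma cochains_iff:
  "w \<in> carrier (cochains n) \<longleftrightarrow> w \<in> extensional (tuples n) \<and> (\<forall>gs\<in>tuples n. w gs \<in> Units (corner R (eps_tuple gs)))"
  by (simp add: cochains_def)

text \<open>
  A cochain value is a unit of \<open>R u\<close> with \<open>u\<close> the idempotent of the tuple;
  \<^const>\<open>cinv\<close> is its inverse there. In \<open>R\<close> itself this amounts to equations with
  \<open>u\<close>.
\<close>

lemma cochainD:
  assumes w: "w \<in> carrier (cochains n)" and gs: "gs \<in> tuples n"
  shows "w gs \<in> carrier R" "eps_tuple gs \<star> w gs = w gs" "cinv w gs \<in> carrier R"
    "eps_tuple gs \<star> cinv w gs = cinv w gs" "w gs \<star> cinv w gs = eps_tuple gs"
    "cinv w gs \<in> Units (corner R (eps_tuple gs))"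
proof -
  note e = eps_tuple_closed[OF gs]
  have u: "w gs \<in> Units (corner R (eps_tuple gs))" using w gs by (simp add: cochains_iff)
  then show "w gs \<in> carrier R" "eps_tuple gs \<star> w gs = w gs"
    by (auto simp: R.Units_corner_iff[OF e])
  show "cinv w gs \<in> carrier R" "eps_tuple gs \<star> cinv w gs = cinv w gs"
    "w gs \<star> cinv w gs = eps_tuple gs" "cinv w gs \<in> Units (corner R (eps_tuple gs))"
    unfolding cinv_def using R.corner_inv[OF e u] by auto
qed

lemma cochainI:
  assumes "w \<in> extensional (tuples n)" "\<And>gs. gs \<in> tuples n \<Longrightarrow> w gs \<in> carrier R"
    "\<And>gs. gs \<in> tuples n \<Longrightarrow> eps_tuple gs \<star> w gs = w gs"
    "\<And>gs. gs \<in> tuples n \<Longrightarrow> \<exists>v\<in>carrier R. w gs \<star> v = eps_tuple gs"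
  shows "w \<in> carrier (cochains n)"
  unfolding cochains_iff using assms by (auto simp: R.Units_corner_iff eps_tuple_closed)

lemma cochains_mult: "w \<otimes>\<^bsub>cochains n\<^esub> w' = (\<lambda>gs\<in>tuples n. w gs \<star> w' gs)"
  and cochains_one: "\<one>\<^bsub>cochains n\<^esub> = (\<lambda>gs\<in>tuples n. eps_tuple gs)"
  by (simp_all add: cochains_def)

abbreviation cochain_mult (infixl \<open>\<otimes>\<^sub>C\<close> 70) where "w \<otimes>\<^sub>C w' \<equiv> w \<otimes>\<^bsub>cochains 3\<^esub> w'"

lemma cochains_comm_group: "comm_group (cochains n)"
proof (rule comm_groupI)
  show cl: "w \<otimes>\<^bsub>cochains n\<^esub> w' \<in> carrier (cochains n)"
    if w: "w \<in> carrier (cochains n)" "w' \<in> carrier (cochains n)" for w w'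
  proof (rule cochainI)
    fix gs assume gs: "gs \<in> tuples n"
    note e = eps_tuple_closed[OF gs] and d = cochainD[OF w(1) gs] and d' = cochainD[OF w(2) gs]
    show "(w \<otimes>\<^bsub>cochains n\<^esub> w') gs \<in> carrier R" using gs d d' by (simp add: cochains_mult)
    show "eps_tuple gs \<star> (w \<otimes>\<^bsub>cochains n\<^esub> w') gs = (w \<otimes>\<^bsub>cochains n\<^esub> w') gs"
      using gs d d' e R.m_assoc[of "eps_tuple gs" "w gs" "w' gs"] by (simp add: cochains_mult)
    have "(w gs \<star> w' gs) \<star> (cinv w gs \<star> cinv w' gs) =
      (w gs \<star> cinv w gs) \<star> (w' gs \<star> cinv w' gs)" using d(1,3) d'(1,3) by (simp add: R.m_ac)
    then show "\<exists>v\<in>carrier R. (w \<otimes>\<^bsub>cochains n\<^esub> w') gs \<star> v = eps_tuple gs"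
      using gs d d' e by (intro bexI[of _ "cinv w gs \<star> cinv w' gs"]) (auto simp: cochains_mult)
  qed (simp add: cochains_mult)
  have ext: "w = w'" if "w \<in> carrier (cochains n)" "w' \<in> carrier (cochains n)" 
    "\<And>gs. gs \<in> tuples n \<Longrightarrow> w gs = w' gs" for w w'
    using that by (auto simp: cochains_iff intro: extensionalityI)
  show one: "\<one>\<^bsub>cochains n\<^esub> \<in> carrier (cochains n)"
  proof (rule cochainI)
    fix gs assume "gs \<in> tuples n"
    then show "\<exists>v\<in>carrier R. \<one>\<^bsub>cochains n\<^esub> gs \<star> v = eps_tuple gs"
      by (intro bexI[of _ "eps_tuple gs"]) (auto simp: cochains_one eps_tuple_closed)
  qed (auto simp: cochains_one eps_tuple_closed)
  show "w \<otimes>\<^bsub>cochains n\<^esub> w' \<otimes>\<^bsub>cochains n\<^esub> w'' = w \<otimes>\<^bsub>cochains n\<^esub> (w' \<otimes>\<^bsub>cochains n\<^esub> w'')"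
    if w: "w \<in> carrier (cochains n)" "w' \<in> carrier (cochains n)" "w'' \<in> carrier (cochains n)" for w w' w''
    using cochainD(1)[OF w(1)] cochainD(1)[OF w(2)] cochainD(1)[OF w(3)]
    by (auto simp: cochains_mult fun_eq_iff R.m_assoc)
  show "w \<otimes>\<^bsub>cochains n\<^esub> w' = w' \<otimes>\<^bsub>cochains n\<^esub> w"
    if w: "w \<in> carrier (cochains n)" "w' \<in> carrier (cochains n)" for w w'
    using cochainD(1)[OF w(1)] cochainD(1)[OF w(2)] by (auto simp: cochains_mult fun_eq_iff R.m_comm)
  show "\<one>\<^bsub>cochains n\<^esub> \<otimes>\<^bsub>cochains n\<^esub> w = w" if "w \<in> carrier (cochains n)" for w
    by (rule ext[OF cl[OF one that] that]) (use cochainD(2)[OF that] in \<open>simp add: cochains_mult cochains_one\<close>)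
  show "\<exists>v\<in>carrier (cochains n). v \<otimes>\<^bsub>cochains n\<^esub> w = \<one>\<^bsub>cochains n\<^esub>" if w: "w \<in> carrier (cochains n)" for w
  proof -
    let ?v = "\<lambda>gs\<in>tuples n. cinv w gs"
    have "?v \<in> carrier (cochains n)" unfolding cochains_iff using cochainD(6)[OF w] by auto
    moreover have "?v \<otimes>\<^bsub>cochains n\<^esub> w = \<one>\<^bsub>cochains n\<^esub>"
      using cochainD(1,3,5)[OF w] by (auto simp: cochains_mult cochains_one fun_eq_iff R.m_comm)
    ultimately show ?thesis by blast
  qed
qed

lemma cochain_eqI: "w \<in> carrier (cochains n) \<Longrightarrow> w' \<in> carrier (cochains n) \<Longrightarrow>
    (\<And>gs. gs \<in> tuples n \<Longrightarrow> w gs = w' gs) \<Longrightarrow> w = w'"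
  by (auto simp: cochains_iff intro: extensionalityI)

lemma eps_support:
  assumes "g \<in> carrier G" "r \<in> carrier R"
  shows "\<epsilon> g \<star> (\<epsilon> g \<star> r) = \<epsilon> g \<star> r"
  using assms R.m_assoc[of "\<epsilon> g" "\<epsilon> g" r] by (simp add: eps)

lemma eps_absorb:
  assumes e: "e \<in> carrier R" and f: "f \<in> carrier R" and r: "r \<in> carrier R"
    and ef: "f \<star> e = e" and er: "e \<star> r = r"
  shows "f \<star> r = r"
  using R.m_assoc[OF f e r] ef er by simp

lemma support_mult:
  assumes "e \<in> carrier R" "f \<in> carrier R" "r \<in> carrier R" "s \<in> carrier R" "e \<star> r = r" "f \<star> s = s"
  shows "(e \<star> f) \<star> (r \<star> s) = r \<star> s"
proof -
  have "(e \<star> f) \<star> (r \<star> s) = (e \<star> r) \<star> (f \<star> s)" using assms(1-4) by (simp add: R.m_ac)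
  then show ?thesis using assms by simp
qed

lemma act_support:
  assumes "g \<in> carrier G" "e \<in> carrier R" "r \<in> carrier R" "e \<star> r = r"
  shows "act g e \<star> act g r = act g r"
  using assms by (simp flip: act_mult)

lemma act_eps_tuple:
  assumes g: "g \<in> carrier G" and h: "h \<in> carrier G" and l: "l \<in> carrier G"
  shows "act g (eps_tuple [h, l]) = eps_tuple [g, h, l]"
    "t \<in> carrier G \<Longrightarrow> act g (eps_tuple [h, l, t]) = eps_tuple [g, h, l, t]"
proof -
  have e: "\<epsilon> g \<star> x \<star> (\<epsilon> g \<star> y) = \<epsilon> g \<star> (x \<star> y)" if "x \<in> carrier R" "y \<in> carrier R" for x y
  proof -
    have "\<epsilon> g \<star> x \<star> (\<epsilon> g \<star> y) = (\<epsilon> g \<star> \<epsilon> g) \<star> (x \<star> y)"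
      using that eps_closed[OF g] by (simp add: R.m_ac)
    then show ?thesis using g by (simp add: eps)
  qed
  show "act g (eps_tuple [h, l]) = eps_tuple [g, h, l]"
    using assms by (simp add: eps_tuple_simps act_mult act_eps eps e G.m_assoc)
  show "t \<in> carrier G \<Longrightarrow> act g (eps_tuple [h, l, t]) = eps_tuple [g, h, l, t]"
    using assms by (simp add: eps_tuple_simps act_mult act_eps eps e G.m_assoc)
qed

text \<open>
  The idempotents of the tuples that occur in the coboundary formulas multiply to the idempotent of the full tuple,
  which is what makes the inverses in these formulas cancel.
\<close>

lemma eps_tuple_products:
  assumes g: "g \<in> carrier G" and h: "h \<in> carrier G" and l: "l \<in> carrier G"
  shows "eps_tuple [g \<bullet> h, l] \<star> eps_tuple [g, h] = eps_tuple [g, h, l]"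
    "eps_tuple [g, h, l] \<star> eps_tuple [g, h \<bullet> l] = eps_tuple [g, h, l]"
    "t \<in> carrier G \<Longrightarrow> eps_tuple [g \<bullet> h, l, t] \<star> eps_tuple [g, h, l \<bullet> t] = eps_tuple [g, h, l, t]"
    "t \<in> carrier G \<Longrightarrow> eps_tuple [g, h, l, t] \<star> (eps_tuple [g, h \<bullet> l, t] \<star> eps_tuple [g, h, l]) = eps_tuple [g, h, l, t]"
proof -
  have c: "\<epsilon> g \<in> carrier R" "\<epsilon> (g \<bullet> h) \<in> carrier R" "\<epsilon> (g \<bullet> (h \<bullet> l)) \<in> carrier R"
    using g h l by (auto intro: eps)
  have i: "\<epsilon> x \<star> (\<epsilon> x \<star> r) = \<epsilon> x \<star> r" if "x \<in> carrier G" "r \<in> carrier R" for x r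
    using eps_support that by blast
  note s = eps_tuple_simps G.m_assoc R.m_ac i eps
  show "eps_tuple [g \<bullet> h, l] \<star> eps_tuple [g, h] = eps_tuple [g, h, l]"
    "eps_tuple [g, h, l] \<star> eps_tuple [g, h \<bullet> l] = eps_tuple [g, h, l]"
    "t \<in> carrier G \<Longrightarrow> eps_tuple [g \<bullet> h, l, t] \<star> eps_tuple [g, h, l \<bullet> t] = eps_tuple [g, h, l, t]"
    "t \<in> carrier G \<Longrightarrow> eps_tuple [g, h, l, t] \<star> (eps_tuple [g, h \<bullet> l, t] \<star> eps_tuple [g, h, l]) = eps_tuple [g, h, l, t]"
    using g h l c by (simp_all add: s)
qed

lemma eps_tuple_act_closed [simp]:
  "g \<in> carrier G \<Longrightarrow> h \<in> carrier G \<Longrightarrow> eps_tuple [g, h] \<in> carrier R"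
  "g \<in> carrier G \<Longrightarrow> h \<in> carrier G \<Longrightarrow> l \<in> carrier G \<Longrightarrow> eps_tuple [g, h, l] \<in> carrier R"
  "g \<in> carrier G \<Longrightarrow> h \<in> carrier G \<Longrightarrow> l \<in> carrier G \<Longrightarrow> t \<in> carrier G \<Longrightarrow> eps_tuple [g, h, l, t] \<in> carrier R"
  using eps_tuple_closed(1)[of _ 2] eps_tuple_closed(1)[of _ 3] eps_tuple_closed(1)[of _ 4] by auto

text \<open>
  The inverses in \<open>\<delta>\<^sup>3\<close> belong to different ideals. Moving the inverted factors to the
  other side gives an equation in \<open>R\<close> without inverses.
\<close>

lemma delta3_trivial_iff:
  assumes w: "w \<in> carrier (cochains 3)"
  shows "delta3 w = \<one>\<^bsub>cochains 4\<^esub> \<longleftrightarrow>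
    (\<forall>g\<in>carrier G. \<forall>h\<in>carrier G. \<forall>l\<in>carrier G. \<forall>t\<in>carrier G.
       act g (w [h, l, t]) \<star> w [g, h \<bullet> l, t] \<star> w [g, h, l] = w [g \<bullet> h, l, t] \<star> w [g, h, l \<bullet> t])"
proof -
  have "delta3 w [g, h, l, t] = eps_tuple [g, h, l, t] \<longleftrightarrow>
      act g (w [h, l, t]) \<star> w [g, h \<bullet> l, t] \<star> w [g, h, l] = w [g \<bullet> h, l, t] \<star> w [g, h, l \<bullet> t]"
    if g: "g \<in> carrier G" and h: "h \<in> carrier G" and l: "l \<in> carrier G" and t: "t \<in> carrier G" for g h l t
  proof -
    let ?a = "act g (w [h, l, t])" and ?b = "w [g \<bullet> h, l, t]" and ?c = "w [g, h \<bullet> l, t]" and ?d = "w [g, h, l \<bullet> t]" and ?e = "w [g, h, l]"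
    let ?b' = "cinv w [g \<bullet> h, l, t]" and ?d' = "cinv w [g, h, l \<bullet> t]" and ?i = "eps_tuple [g, h, l, t]"
    have W: "w [h, l, t] \<in> carrier R" "eps_tuple [h, l, t] \<star> w [h, l, t] = w [h, l, t]"
      using cochainD(1,2)[OF w, of "[h, l, t]"] h l t by auto
    have c: "?a \<in> carrier R" "?b \<in> carrier R" "?c \<in> carrier R" "?d \<in> carrier R" "?e \<in> carrier R" "?b' \<in> carrier R" "?d' \<in> carrier R" "?i \<in> carrier R"
      using cochainD(1,3)[OF w] W g h l t by auto
    have s: "?i \<star> ?a = ?a" "eps_tuple [g \<bullet> h, l, t] \<star> ?b = ?b" "eps_tuple [g, h, l \<bullet> t] \<star> ?d = ?d"
      "?b \<star> ?b' = eps_tuple [g \<bullet> h, l, t]" "?d \<star> ?d' = eps_tuple [g, h, l \<bullet> t]"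
      using cochainD(2,5)[OF w] act_support[OF g _ W(1) W(2)] g h l t by (auto simp: act_eps_tuple)
    have bd: "(?b \<star> ?b') \<star> (?d \<star> ?d') = ?i" using s eps_tuple_products(3)[OF g h l t] by simp
    have ibd: "?i \<star> (?b \<star> ?d) = ?b \<star> ?d"
      unfolding eps_tuple_products(3)[OF g h l t, symmetric] using s c g h l t by (intro support_mult) auto
    have eq: "delta3 w [g, h, l, t] = ?a \<star> ?b' \<star> ?c \<star> ?d' \<star> ?e"
      using g h l t by (simp add: delta3_def Let_def act_def)
    show ?thesis unfolding eq
    proof
      assume a: "?a \<star> ?b' \<star> ?c \<star> ?d' \<star> ?e = ?i"
      have "?a \<star> ?c \<star> ?e = (?i \<star> ?a) \<star> ?c \<star> ?e" using s by simp
      also have "\<dots> = (((?b \<star> ?b') \<star> (?d \<star> ?d')) \<star> ?a) \<star> ?c \<star> ?e" using bd by simp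
      also have "\<dots> = (?a \<star> ?b' \<star> ?c \<star> ?d' \<star> ?e) \<star> (?b \<star> ?d)" using c by (simp add: R.m_ac)
      also have "\<dots> = ?b \<star> ?d" unfolding a by (rule ibd)
      finally show "?a \<star> ?c \<star> ?e = ?b \<star> ?d" .
    next
      assume a: "?a \<star> ?c \<star> ?e = ?b \<star> ?d"
      have "?a \<star> ?b' \<star> ?c \<star> ?d' \<star> ?e = (?a \<star> ?c \<star> ?e) \<star> (?b' \<star> ?d')" using c by (simp add: R.m_ac)
      also have "\<dots> = (?b \<star> ?b') \<star> (?d \<star> ?d')" unfolding a using c by (simp add: R.m_ac)
      finally show "?a \<star> ?b' \<star> ?c \<star> ?d' \<star> ?e = ?i" using bd by simp
    qed
  qed
  moreover have "delta3 w = \<one>\<^bsub>cochains 4\<^esub> \<longleftrightarrow>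
    (\<forall>g\<in>carrier G. \<forall>h\<in>carrier G. \<forall>l\<in>carrier G. \<forall>t\<in>carrier G. delta3 w [g, h, l, t] = eps_tuple [g, h, l, t])"
  proof
    assume "delta3 w = \<one>\<^bsub>cochains 4\<^esub>"
    then show "\<forall>g\<in>carrier G. \<forall>h\<in>carrier G. \<forall>l\<in>carrier G. \<forall>t\<in>carrier G. delta3 w [g, h, l, t] = eps_tuple [g, h, l, t]"
      by (simp add: cochains_one)
  next
    assume a: "\<forall>g\<in>carrier G. \<forall>h\<in>carrier G. \<forall>l\<in>carrier G. \<forall>t\<in>carrier G. delta3 w [g, h, l, t] = eps_tuple [g, h, l, t]"
    show "delta3 w = \<one>\<^bsub>cochains 4\<^esub>"
    proof (rule extensionalityI[of _ "tuples 4"])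
      show "delta3 w \<in> extensional (tuples 4)" "\<one>\<^bsub>cochains 4\<^esub> \<in> extensional (tuples 4)"
        by (simp_all add: delta3_def cochains_one)
      fix gs assume "gs \<in> tuples 4"
      then show "delta3 w gs = \<one>\<^bsub>cochains 4\<^esub> gs"
        by (rule tuplesE(3)) (use a in \<open>simp add: cochains_one\<close>)
    qed
  qed
  ultimately show ?thesis by simp
qed

text \<open>
  The inverses in \<open>\<delta>\<^sup>2\<close> are eliminated: \<open>\<delta>\<^sup>2\<rho>\<close> is
  characterised by the third equation together with its support, and the last statement is the corresponding
  uniqueness.
\<close>

lemma delta2_eq:
  assumes \<rho>: "\<rho> \<in> carrier (cochains 2)" and g: "g \<in> carrier G" and h: "h \<in> carrier G" and l: "l \<in> carrier G"
  shows "delta2 \<rho> [g, h, l] \<in> carrier R" "eps_tuple [g, h, l] \<star> delta2 \<rho> [g, h, l] = delta2 \<rho> [g, h, l]"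
    "delta2 \<rho> [g, h, l] \<star> (\<rho> [g \<bullet> h, l] \<star> \<rho> [g, h]) = act g (\<rho> [h, l]) \<star> \<rho> [g, h \<bullet> l]"
    "\<exists>v\<in>carrier R. delta2 \<rho> [g, h, l] \<star> v = eps_tuple [g, h, l]"
    "\<And>x y. x \<in> carrier R \<Longrightarrow> y \<in> carrier R \<Longrightarrow> eps_tuple [g, h, l] \<star> x = x \<Longrightarrow> eps_tuple [g, h, l] \<star> y = y \<Longrightarrow>
        x \<star> (\<rho> [g \<bullet> h, l] \<star> \<rho> [g, h]) = y \<star> (act g (\<rho> [h, l]) \<star> \<rho> [g, h \<bullet> l]) \<Longrightarrow> x = y \<star> delta2 \<rho> [g, h, l]"
proof -
  let ?a = "act g (\<rho> [h, l])" and ?b = "\<rho> [g \<bullet> h, l]" and ?c = "\<rho> [g, h \<bullet> l]" and ?d = "\<rho> [g, h]"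
  let ?a' = "act g (cinv \<rho> [h, l])" and ?b' = "cinv \<rho> [g \<bullet> h, l]" and ?c' = "cinv \<rho> [g, h \<bullet> l]" and ?d' = "cinv \<rho> [g, h]" and ?i = "eps_tuple [g, h, l]"
  have W: "\<rho> [h, l] \<in> carrier R" "eps_tuple [h, l] \<star> \<rho> [h, l] = \<rho> [h, l]" "cinv \<rho> [h, l] \<in> carrier R"
    "\<rho> [h, l] \<star> cinv \<rho> [h, l] = eps_tuple [h, l]"
    using cochainD(1,2,3,5)[OF \<rho>, of "[h, l]"] h l by auto
  have c: "?a \<in> carrier R" "?b \<in> carrier R" "?c \<in> carrier R" "?d \<in> carrier R" "?b' \<in> carrier R" "?d' \<in> carrier R" "?i \<in> carrier R"
    "?a' \<in> carrier R" "?c' \<in> carrier R"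
    using cochainD(1,3)[OF \<rho>] W g h l by auto
  have s: "?i \<star> ?a = ?a" "?b \<star> ?b' = eps_tuple [g \<bullet> h, l]" "?d \<star> ?d' = eps_tuple [g, h]"
      "?c \<star> ?c' = eps_tuple [g, h \<bullet> l]"
    using cochainD(2,5)[OF \<rho>] act_support[OF g _ W(1) W(2)] g h l by (auto simp: act_eps_tuple)
  have aa: "?a \<star> ?a' = ?i" using act_mult[OF g W(1,3)] W(4) act_eps_tuple(1)[OF g h l] by simp
  have bd: "(?b \<star> ?b') \<star> (?d \<star> ?d') = ?i" using s eps_tuple_products(1)[OF g h l] by simp
  have ac: "(?a \<star> ?a') \<star> (?c \<star> ?c') = ?i" using s aa eps_tuple_products(2)[OF g h l] by simp
  have eq: "delta2 \<rho> [g, h, l] = ?a \<star> ?b' \<star> ?c \<star> ?d'"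
    using g h l by (simp add: delta2_def Let_def act_def)
  show "delta2 \<rho> [g, h, l] \<in> carrier R" using c by (simp add: eq)
  have ii: "?i \<star> ?i = ?i" using eps_tuple_closed(2)[of "[g, h, l]" 3] g h l by simp
  have ia: "?i \<star> (?a \<star> r) = ?a \<star> r" if "r \<in> carrier R" for r
    using s(1) c that R.m_assoc[of ?i ?a r] by simp
  show "?i \<star> delta2 \<rho> [g, h, l] = delta2 \<rho> [g, h, l]"
    using c ia by (simp add: eq R.m_assoc)
  have "delta2 \<rho> [g, h, l] \<star> (?b \<star> ?d) = ((?b \<star> ?b') \<star> (?d \<star> ?d')) \<star> (?a \<star> ?c)"
    unfolding eq using c by (simp add: R.m_ac)
  then show "delta2 \<rho> [g, h, l] \<star> (?b \<star> ?d) = ?a \<star> ?c" unfolding bd using ia c by simp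
  have "delta2 \<rho> [g, h, l] \<star> (?a' \<star> ?b \<star> ?c' \<star> ?d) =
    ((?b \<star> ?b') \<star> (?d \<star> ?d')) \<star> ((?a \<star> ?a') \<star> (?c \<star> ?c'))"
    unfolding eq using c by (simp add: R.m_ac)
  then show "\<exists>v\<in>carrier R. delta2 \<rho> [g, h, l] \<star> v = ?i"
    unfolding bd ac using ii c by (intro bexI[of _ "?a' \<star> ?b \<star> ?c' \<star> ?d"]) auto
  fix x y assume x: "x \<in> carrier R" "?i \<star> x = x" and y: "y \<in> carrier R" "?i \<star> y = y"
    and xy: "x \<star> (?b \<star> ?d) = y \<star> (?a \<star> ?c)"
  have "x = ((?b \<star> ?b') \<star> (?d \<star> ?d')) \<star> x" unfolding bd using x by simp
  also have "\<dots> = (x \<star> (?b \<star> ?d)) \<star> (?b' \<star> ?d')" using x(1) c by (simp add: R.m_ac)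
  also have "\<dots> = y \<star> delta2 \<rho> [g, h, l]" unfolding xy eq using y(1) c by (simp add: R.m_ac)
  finally show "x = y \<star> delta2 \<rho> [g, h, l]" .
qed

lemma delta2_closed:
  assumes \<rho>: "\<rho> \<in> carrier (cochains 2)" shows "delta2 \<rho> \<in> carrier (cochains 3)"
proof (rule cochainI)
  show "delta2 \<rho> \<in> extensional (tuples 3)" by (simp add: delta2_def)
qed (auto elim!: tuplesE(2) simp: delta2_eq[OF \<rho>])

lemma Z3_iff:
  "w \<in> carrier Z3 \<longleftrightarrow> w \<in> carrier (cochains 3) \<and>
    (\<forall>g\<in>carrier G. \<forall>h\<in>carrier G. \<forall>l\<in>carrier G. \<forall>t\<in>carrier G.
       act g (w [h, l, t]) \<star> w [g, h \<bullet> l, t] \<star> w [g, h, l] = w [g \<bullet> h, l, t] \<star> w [g, h, l \<bullet> t])"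
  using delta3_trivial_iff by (auto simp: Z3_def)

lemma Z3_subgroup: "subgroup (carrier Z3) (cochains 3)"
proof -
  interpret C: comm_group "cochains 3" by (rule cochains_comm_group)
  show ?thesis
  proof (rule C.subgroupI)
    show sub: "carrier Z3 \<subseteq> carrier (cochains 3)" by (auto simp: Z3_iff)
    have "\<one>\<^bsub>cochains 3\<^esub> \<in> carrier Z3"
      unfolding Z3_iff
    proof (intro conjI ballI)
      fix g h l t assume g: "g \<in> carrier G" and h: "h \<in> carrier G" and l: "l \<in> carrier G" and t: "t \<in> carrier G"
      let ?e = eps_tuple
      have "?e [g, h, l, t] \<star> ?e [g, h \<bullet> l, t] \<star> ?e [g, h, l] = ?e [g \<bullet> h, l, t] \<star> ?e [g, h, l \<bullet> t]"
        using eps_tuple_products(3,4)[OF g h l t] g h l t by (simp add: R.m_assoc)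
      then show "act g (\<one>\<^bsub>cochains 3\<^esub> [h, l, t]) \<star> \<one>\<^bsub>cochains 3\<^esub> [g, h \<bullet> l, t] \<star> \<one>\<^bsub>cochains 3\<^esub> [g, h, l] =
          \<one>\<^bsub>cochains 3\<^esub> [g \<bullet> h, l, t] \<star> \<one>\<^bsub>cochains 3\<^esub> [g, h, l \<bullet> t]"
        using g h l t by (simp add: cochains_one act_eps_tuple)
    qed simp
    then show "carrier Z3 \<noteq> {}" by blast
    show cl: "w \<otimes>\<^sub>C w' \<in> carrier Z3" if w: "w \<in> carrier Z3" "w' \<in> carrier Z3" for w w'
      unfolding Z3_iff
    proof (intro conjI ballI)
      show "w \<otimes>\<^sub>C w' \<in> carrier (cochains 3)" using w sub by auto
      fix g h l t assume g: "g \<in> carrier G" and h: "h \<in> carrier G" and l: "l \<in> carrier G" and t: "t \<in> carrier G"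
      have c: "w [a, b, c] \<in> carrier R" "w' [a, b, c] \<in> carrier R" if "a \<in> carrier G" "b \<in> carrier G" "c \<in> carrier G" for a b c
        using w cochainD(1)[of _ 3 "[a, b, c]"] that by (auto simp: Z3_iff)
      have "act g (w [h, l, t] \<star> w' [h, l, t]) \<star> (w [g, h \<bullet> l, t] \<star> w' [g, h \<bullet> l, t]) \<star> (w [g, h, l] \<star> w' [g, h, l])
        = (act g (w [h, l, t]) \<star> w [g, h \<bullet> l, t] \<star> w [g, h, l]) \<star> (act g (w' [h, l, t]) \<star> w' [g, h \<bullet> l, t] \<star> w' [g, h, l])"
        using c g h l t by (simp add: act_mult R.m_ac)
      also have "\<dots> = (w [g \<bullet> h, l, t] \<star> w [g, h, l \<bullet> t]) \<star> (w' [g \<bullet> h, l, t] \<star> w' [g, h, l \<bullet> t])"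
        using w g h l t by (simp add: Z3_iff)
      also have "\<dots> = (w [g \<bullet> h, l, t] \<star> w' [g \<bullet> h, l, t]) \<star> (w [g, h, l \<bullet> t] \<star> w' [g, h, l \<bullet> t])"
        using c g h l t by (simp add: R.m_ac)
      finally show "act g ((w \<otimes>\<^sub>C w') [h, l, t]) \<star> (w \<otimes>\<^sub>C w') [g, h \<bullet> l, t] \<star> (w \<otimes>\<^sub>C w') [g, h, l] =
          (w \<otimes>\<^sub>C w') [g \<bullet> h, l, t] \<star> (w \<otimes>\<^sub>C w') [g, h, l \<bullet> t]"
        using g h l t by (simp add: cochains_mult)
    qed
    show "inv\<^bsub>cochains 3\<^esub> w \<in> carrier Z3" if w: "w \<in> carrier Z3" for w
      unfolding Z3_iff
    proof (intro conjI ballI)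
      let ?v = "inv\<^bsub>cochains 3\<^esub> w"
      have wc: "w \<in> carrier (cochains 3)" using w sub by auto
      show v: "?v \<in> carrier (cochains 3)" using wc by simp
      fix g h l t assume g: "g \<in> carrier G" and h: "h \<in> carrier G" and l: "l \<in> carrier G" and t: "t \<in> carrier G"
      have c: "w [a, b, c] \<in> carrier R" "?v [a, b, c] \<in> carrier R" "w [a, b, c] \<star> ?v [a, b, c] = eps_tuple [a, b, c]"
        "eps_tuple [a, b, c] \<star> ?v [a, b, c] = ?v [a, b, c]"
        if "a \<in> carrier G" "b \<in> carrier G" "c \<in> carrier G" for a b c
        using cochainD(1)[OF wc, of "[a, b, c]"] cochainD(1,2)[OF v, of "[a, b, c]"] that
          fun_cong[OF C.r_inv[OF wc], of "[a, b, c]"] by (auto simp: cochains_mult cochains_one)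
      let ?a = "act g (w [h, l, t])" and ?b = "w [g \<bullet> h, l, t]" and ?c = "w [g, h \<bullet> l, t]" and ?d = "w [g, h, l \<bullet> t]" and ?e = "w [g, h, l]"
      let ?a' = "act g (?v [h, l, t])" and ?b' = "?v [g \<bullet> h, l, t]" and ?c' = "?v [g, h \<bullet> l, t]" and ?d' = "?v [g, h, l \<bullet> t]" and ?e' = "?v [g, h, l]"
      let ?i = "eps_tuple [g, h, l, t]"
      have cc: "?a \<in> carrier R" "?b \<in> carrier R" "?c \<in> carrier R" "?d \<in> carrier R" "?e \<in> carrier R"
        "?a' \<in> carrier R" "?b' \<in> carrier R" "?c' \<in> carrier R" "?d' \<in> carrier R" "?e' \<in> carrier R" "?i \<in> carrier R"
        using c g h l t by auto
      have "?a \<star> ?a' = ?i" using c(3)[OF h l t] c(1,2)[OF h l t] g h l t by (simp add: act_eps_tuple flip: act_mult)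
      then have ace: "(?a \<star> ?a') \<star> ((?c \<star> ?c') \<star> (?e \<star> ?e')) = ?i"
        using c(3) g h l t eps_tuple_products(4)[OF g h l t] by simp
      have bd: "(?b \<star> ?b') \<star> (?d \<star> ?d') = ?i"
        using c(3) g h l t eps_tuple_products(3)[OF g h l t] by simp
      have eq: "?a \<star> ?c \<star> ?e = ?b \<star> ?d" using w g h l t by (simp add: Z3_iff)
      have ia: "?i \<star> ?a' = ?a'"
        using act_support[OF g _ c(2)[OF h l t] c(4)[OF h l t]] g h l t by (simp add: act_eps_tuple)
      have ibd: "?i \<star> (?b' \<star> ?d') = ?b' \<star> ?d'"
        unfolding eps_tuple_products(3)[OF g h l t, symmetric] using c(4) cc g h l t by (intro support_mult) auto
      have "?a' \<star> ?c' \<star> ?e' = ((?b \<star> ?b') \<star> (?d \<star> ?d')) \<star> ?a' \<star> ?c' \<star> ?e'"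
        unfolding bd using ia by simp
      also have "\<dots> = (?b \<star> ?d) \<star> ((?b' \<star> ?d') \<star> (?a' \<star> ?c' \<star> ?e'))"
        using cc by (simp add: R.m_ac)
      also have "\<dots> = ((?a \<star> ?a') \<star> ((?c \<star> ?c') \<star> (?e \<star> ?e'))) \<star> (?b' \<star> ?d')"
        unfolding eq[symmetric] using cc by (simp add: R.m_ac)
      also have "\<dots> = ?b' \<star> ?d'" unfolding ace by (rule ibd)
      finally show "?a' \<star> ?c' \<star> ?e' = ?b' \<star> ?d'" .
    qed
  qed
qed

lemma Z3_comm_group: "comm_group Z3"
proof -
  interpret C: comm_group "cochains 3" by (rule cochains_comm_group)
  have "Z3 = (cochains 3)\<lparr>carrier := carrier Z3\<rparr>" by (simp add: Z3_def)
  moreover have "group ((cochains 3)\<lparr>carrier := carrier Z3\<rparr>)" by (rule C.subgroup_imp_group[OF Z3_subgroup])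
  moreover have "x \<otimes>\<^bsub>Z3\<^esub> y = y \<otimes>\<^bsub>Z3\<^esub> x" if "x \<in> carrier Z3" "y \<in> carrier Z3" for x y
    using that C.m_comm[of x y] by (simp add: Z3_def)
  ultimately show ?thesis by (metis group.group_comm_groupI)
qed

lemma Z3_mult: "w \<otimes>\<^bsub>Z3\<^esub> w' = w \<otimes>\<^sub>C w'" and Z3_one: "\<one>\<^bsub>Z3\<^esub> = \<one>\<^bsub>cochains 3\<^esub>"
  by (simp_all add: Z3_def)

lemma delta2_mult:
  assumes \<rho>: "\<rho> \<in> carrier (cochains 2)" and \<rho>': "\<rho>' \<in> carrier (cochains 2)"
  shows "delta2 (\<rho> \<otimes>\<^bsub>cochains 2\<^esub> \<rho>') = delta2 \<rho> \<otimes>\<^sub>C delta2 \<rho>'"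
proof -
  interpret C2: comm_group "cochains 2" by (rule cochains_comm_group)
  interpret C3: comm_group "cochains 3" by (rule cochains_comm_group)
  have pc: "\<rho> \<otimes>\<^bsub>cochains 2\<^esub> \<rho>' \<in> carrier (cochains 2)" using assms by simp
  have dc: "delta2 \<rho> \<otimes>\<^sub>C delta2 \<rho>' \<in> carrier (cochains 3)" using assms by (simp add: delta2_closed)
  show ?thesis
  proof (rule cochain_eqI[OF delta2_closed[OF pc] dc])
    fix gs assume "gs \<in> tuples 3"
    then obtain g h l where gs: "gs = [g, h, l]" and g: "g \<in> carrier G" and h: "h \<in> carrier G" and l: "l \<in> carrier G"
      by (rule tuplesE(2))
    note D = delta2_eq[OF \<rho> g h l] and D' = delta2_eq[OF \<rho>' g h l]
    have c: "\<rho> [a, b] \<in> carrier R" "\<rho>' [a, b] \<in> carrier R" if "a \<in> carrier G" "b \<in> carrier G" for a b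
      using cochainD(1)[OF \<rho>, of "[a, b]"] cochainD(1)[OF \<rho>', of "[a, b]"] that by auto
    let ?i = "eps_tuple [g, h, l]"
    let ?x = "(delta2 \<rho> \<otimes>\<^sub>C delta2 \<rho>') [g, h, l]"
    have x: "?x = delta2 \<rho> [g, h, l] \<star> delta2 \<rho>' [g, h, l]" using g h l by (simp add: cochains_mult)
    have xc: "?x \<in> carrier R" "?i \<star> ?x = ?x" using cochainD(1,2)[OF dc, of "[g, h, l]"] g h l by auto
    have "?x \<star> ((\<rho> [g \<bullet> h, l] \<star> \<rho>' [g \<bullet> h, l]) \<star> (\<rho> [g, h] \<star> \<rho>' [g, h])) =
      (delta2 \<rho> [g, h, l] \<star> (\<rho> [g \<bullet> h, l] \<star> \<rho> [g, h])) \<star> (delta2 \<rho>' [g, h, l] \<star> (\<rho>' [g \<bullet> h, l] \<star> \<rho>' [g, h]))"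
      unfolding x using c D(1) D'(1) g h l by (simp add: R.m_ac)
    also have "\<dots> = act g (\<rho> [h, l] \<star> \<rho>' [h, l]) \<star> (\<rho> [g, h \<bullet> l] \<star> \<rho>' [g, h \<bullet> l])"
      unfolding D(3) D'(3) using c g h l by (simp add: act_mult R.m_ac)
    also have "\<dots> = ?i \<star> \<dots>"
    proof -
      have "?i \<star> act g (\<rho> [h, l]) = act g (\<rho> [h, l])"
        using act_support[OF g _ c(1)[OF h l]] cochainD(2)[OF \<rho>, of "[h, l]"] g h l by (simp flip: act_eps_tuple)
      then have "?i \<star> act g (\<rho> [h, l] \<star> \<rho>' [h, l]) = act g (\<rho> [h, l] \<star> \<rho>' [h, l])"
        using c g h l R.m_assoc[of ?i "act g (\<rho> [h, l])" "act g (\<rho>' [h, l])"] by (simp add: act_mult)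
      then show ?thesis
        using c g h l R.m_assoc[of ?i "act g (\<rho> [h, l] \<star> \<rho>' [h, l])" "\<rho> [g, h \<bullet> l] \<star> \<rho>' [g, h \<bullet> l]"] by simp
    qed
    finally have "?x = ?i \<star> delta2 (\<rho> \<otimes>\<^bsub>cochains 2\<^esub> \<rho>') [g, h, l]"
      using xc g h l eps_tuple_closed(2)[of "[g, h, l]" 3]
      by (intro delta2_eq(5)[OF pc g h l]) (simp_all add: cochains_mult)
    then show "delta2 (\<rho> \<otimes>\<^bsub>cochains 2\<^esub> \<rho>') gs = (delta2 \<rho> \<otimes>\<^sub>C delta2 \<rho>') gs"
      using delta2_eq(2)[OF pc g h l] gs by simp
  qed
qed

lemma B3_subgroup_cochains: "subgroup B3 (cochains 3)"
proof -
  interpret C2: comm_group "cochains 2" by (rule cochains_comm_group)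
  interpret C3: comm_group "cochains 3" by (rule cochains_comm_group)
  interpret h: group_hom "cochains 2" "cochains 3" delta2
    by unfold_locales (auto simp: hom_def delta2_closed delta2_mult)
  show ?thesis unfolding B3_def by (rule h.img_is_subgroup)
qed

end

section \<open>Crossed systems and their defects\<close>

lemma additive_span_bind:
  assumes L: "abelian_group L" and f: "additive_map L M f" and S: "S \<subseteq> carrier L"
    and z: "z \<in> additive_span L S" and g: "\<And>s. s \<in> S \<Longrightarrow> f s \<in> additive_span M S'"
  shows "f z \<in> additive_span M S'"
  by (rule additive_span_mono_span[OF _ additive_span_image[OF L f S z]]) (use g in auto)

definition semilinear ::
  "('a, 'r) ring_scheme \<Rightarrow> ('a \<Rightarrow> 'a) \<Rightarrow> ('a, 'm, 'x) module_scheme \<Rightarrow> ('a, 'n, 'y) module_scheme \<Rightarrow> ('m \<Rightarrow> 'n) \<Rightarrow> bool" where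
  "semilinear R \<sigma> M L f \<longleftrightarrow> additive_map M L f \<and>
     (\<forall>r\<in>carrier R. \<forall>x\<in>carrier M. f (r \<odot>\<^sub>M x) = \<sigma> r \<odot>\<^sub>L f x)"

lemma semilinearI:
  assumes "\<And>x. x \<in> carrier M \<Longrightarrow> f x \<in> carrier L"
    "\<And>x y. x \<in> carrier M \<Longrightarrow> y \<in> carrier M \<Longrightarrow> f (x \<oplus>\<^sub>M y) = f x \<oplus>\<^sub>L f y"
    "\<And>r x. r \<in> carrier R \<Longrightarrow> x \<in> carrier M \<Longrightarrow> f (r \<odot>\<^sub>M x) = \<sigma> r \<odot>\<^sub>L f x"
  shows "semilinear R \<sigma> M L f"
  using assms by (simp add: semilinear_def additive_map_def)

lemma semilinearD:
  assumes "semilinear R \<sigma> M L f"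
  shows "\<And>x. x \<in> carrier M \<Longrightarrow> f x \<in> carrier L"
    "\<And>x y. x \<in> carrier M \<Longrightarrow> y \<in> carrier M \<Longrightarrow> f (x \<oplus>\<^sub>M y) = f x \<oplus>\<^sub>L f y"
    "\<And>r x. r \<in> carrier R \<Longrightarrow> x \<in> carrier M \<Longrightarrow> f (r \<odot>\<^sub>M x) = \<sigma> r \<odot>\<^sub>L f x"
    "additive_map M L f"
  using assms by (auto simp: semilinear_def additive_map_def)

lemma semilinear_comp:
  assumes "semilinear R \<sigma> M N f" "semilinear R \<tau> N L g" "\<And>r. r \<in> carrier R \<Longrightarrow> \<sigma> r \<in> carrier R"
  shows "semilinear R (\<lambda>r. \<tau> (\<sigma> r)) M L (\<lambda>x. g (f x))"
  using semilinearD[OF assms(1)] semilinearD[OF assms(2)] assms(3) by (intro semilinearI) auto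

lemma bilinear_left: "bilinear_map R \<sigma> M N L b \<Longrightarrow> y \<in> carrier N \<Longrightarrow> semilinear R (\<lambda>r. r) M L (\<lambda>x. b x y)"
  by (intro semilinearI) (auto simp: bilinear_mapD)

lemma bilinear_right: "bilinear_map R \<sigma> M N L b \<Longrightarrow> x \<in> carrier M \<Longrightarrow> semilinear R \<sigma> N L (\<lambda>y. b x y)"
  by (intro semilinearI) (auto simp: bilinear_mapD)

context cring
begin

lemma semilinear_smult: "module R L \<Longrightarrow> r \<in> carrier R \<Longrightarrow> semilinear R (\<lambda>r. r) L L (\<lambda>x. r \<odot>\<^sub>L x)"
  by (intro semilinearI) (auto simp: module.smult_closed module.smult_r_distr m_comm simp flip: module.smult_assoc1)

text \<open>
  The form \<open>(x, y) \<mapsto> \<psi>(f x) g y\<close> is balanced because \<open>f\<close> and \<open>g\<close>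
  have the same twist; hence it is symmetric.
\<close>

lemma slot_exchange:
  fixes \<sigma> :: "'a \<Rightarrow> 'a"
  assumes E: "rank_one R E e" and L: "module R L" and p: "\<psi> \<in> functionals R L"
    and f: "semilinear R \<sigma> E L f" and g: "semilinear R \<sigma> E L g"
    and \<sigma>: "\<And>r. r \<in> carrier R \<Longrightarrow> \<sigma> r \<in> carrier R"
    and xy: "x \<in> carrier E" "y \<in> carrier E"
  shows "\<psi> (f x) \<odot>\<^sub>L g y = \<psi> (f y) \<odot>\<^sub>L g x"
proof -
  interpret L: module R L by (rule L)
  note F = semilinearD[OF f] and G = semilinearD[OF g] and P = functionalD[OF p]
  show ?thesis
  proof (rule balanced_form_symmetric[OF E module_abelian[OF L] xy])
    fix x y r assume "x \<in> carrier E" "y \<in> carrier E" "r \<in> carrier R"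
    then show "\<psi> (f (r \<odot>\<^sub>E x)) \<odot>\<^sub>L g y = \<psi> (f x) \<odot>\<^sub>L g (r \<odot>\<^sub>E y)"
      using \<sigma>[of r] by (simp add: F G P m_comm[of "\<sigma> r"] L.smult_assoc1)
  qed (simp_all add: F G P L.smult_l_distr L.smult_r_distr)
qed

text \<open>
  Meant for an idempotent \<open>i\<close>: the direct summand \<open>i L\<close> is the span of \<open>S\<close>.
\<close>

definition spans :: "('a, 'm, 'x) module_scheme \<Rightarrow> 'a \<Rightarrow> 'm set \<Rightarrow> bool" where
  "spans L i S \<longleftrightarrow> S \<subseteq> carrier L \<and> (\<forall>s\<in>S. i \<odot>\<^sub>L s = s) \<and> (\<forall>z\<in>carrier L. i \<odot>\<^sub>L z \<in> additive_span L S)"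

lemma spans_unique:
  assumes L: "rank_one R L e" and i: "i \<in> carrier R" and S: "spans L i S"
    and w: "w \<in> carrier R" "w' \<in> carrier R" and eq: "\<And>s. s \<in> S \<Longrightarrow> w \<odot>\<^sub>L s = w' \<odot>\<^sub>L s"
  shows "(i \<otimes> e) \<otimes> w = (i \<otimes> e) \<otimes> w'"
proof -
  interpret L: module R L using L by (rule rank_one_module)
  have ec: "e \<in> carrier R" using L by simp
  have *: "w \<odot>\<^sub>L z = w' \<odot>\<^sub>L z" if "z \<in> additive_span L S" for z
    using that
  proof (induction rule: additive_span.induct)
    case (add x y)
    then have "x \<in> carrier L" "y \<in> carrier L"
      using S additive_span_closed[OF L.M.abelian_group_axioms, of S] by (auto simp: spans_def)
    then show ?case using add w by (simp add: L.smult_r_distr)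
  qed (rule eq)
  have "(w \<otimes> i) \<otimes> e = (w' \<otimes> i) \<otimes> e"
    by (rule rank_one_faithful[OF L]) (use w i S * in \<open>auto simp: L.smult_assoc1 spans_def\<close>)
  then show ?thesis using w i ec by (simp add: m_ac)
qed

text \<open>
  Apply \<open>ratio\<close> in both directions. The two factors are inverse to each other on the support \<open>i
  e\<close>, since \<open>A\<close> and \<open>B\<close> span \<open>i L\<close>.
\<close>

lemma unit_ratio:
  assumes L: "rank_one R L e" and i: "i \<in> carrier R" "i \<otimes> i = i"
    and A: "spans L i (A ` X0)" and B: "spans L i (B ` X0)"
    and sym: "\<And>\<psi> t t'. \<psi> \<in> functionals R L \<Longrightarrow> t \<in> X0 \<Longrightarrow> t' \<in> X0 \<Longrightarrow>
       \<psi> (B t) \<odot>\<^sub>L A t' = \<psi> (B t') \<odot>\<^sub>L A t"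
  shows "\<exists>w\<in>Units (corner R (i \<otimes> e)). \<forall>t\<in>X0. B t = w \<odot>\<^sub>L A t"
proof -
  interpret L: module R L using L by (rule rank_one_module)
  have e: "e \<in> carrier R" "e \<otimes> e = e" using L rank_one_idem by auto
  have ie: "i \<otimes> e \<in> carrier R" "(i \<otimes> e) \<otimes> (i \<otimes> e) = i \<otimes> e" using i e by (auto intro: idem_mult)
  have cA: "A t \<in> carrier L" "i \<odot>\<^sub>L A t = A t" and cB: "B t \<in> carrier L" "i \<odot>\<^sub>L B t = B t" if "t \<in> X0" for t
    using A B that by (auto simp: spans_def)
  have ieA: "(i \<otimes> e) \<odot>\<^sub>L A t = A t" if "t \<in> X0" for t
    using that cA rank_one_support[OF L] i e by (simp add: L.smult_assoc1)
  have "\<exists>w\<in>carrier R. \<forall>t\<in>X0. B t = w \<odot>\<^sub>L A t"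
    using A by (intro ratio[where A = A and B = B and ?X0.0 = X0, OF L i(1) cA(1) cB(1) _ cB(2) sym]) (auto simp: spans_def)
  then obtain w where w: "w \<in> carrier R" "\<And>t. t \<in> X0 \<Longrightarrow> B t = w \<odot>\<^sub>L A t" by blast
  have sym': "\<psi> (A t) \<odot>\<^sub>L B t' = \<psi> (A t') \<odot>\<^sub>L B t" if p: "\<psi> \<in> functionals R L" "t \<in> X0" "t' \<in> X0" for \<psi> t t'
    using rank_one_sym[OF L p(1) cA(1)[OF p(2)] cB(1)[OF p(3)]] rank_one_sym[OF L p(1) cA(1)[OF p(3)] cB(1)[OF p(2)]]
      sym[OF p(1,3,2)] by simp
  have "\<exists>w\<in>carrier R. \<forall>t\<in>X0. A t = w \<odot>\<^sub>L B t"
    using B by (intro ratio[where A = B and B = A and ?X0.0 = X0, OF L i(1) cB(1) cA(1) _ cA(2) sym']) (auto simp: spans_def)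
  then obtain v where v: "v \<in> carrier R" "\<And>t. t \<in> X0 \<Longrightarrow> A t = v \<odot>\<^sub>L B t" by blast
  have "(i \<otimes> e) \<otimes> (w \<otimes> v) = (i \<otimes> e) \<otimes> \<one>"
  proof (rule spans_unique[OF L i(1) B])
    fix s assume "s \<in> B ` X0"
    then obtain t where t: "t \<in> X0" "s = B t" by auto
    then have "w \<odot>\<^sub>L (v \<odot>\<^sub>L B t) = B t"
      by (simp only: v(2)[OF t(1), symmetric] w(2)[OF t(1), symmetric])
    then show "(w \<otimes> v) \<odot>\<^sub>L s = \<one> \<odot>\<^sub>L s" using t w(1) v(1) cB(1)[OF t(1)] by (simp add: L.smult_assoc1)
  qed (use w v in auto)
  then have "((i \<otimes> e) \<otimes> w) \<otimes> v = i \<otimes> e" using w v ie by (simp add: m_assoc)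
  moreover have "(i \<otimes> e) \<otimes> ((i \<otimes> e) \<otimes> w) = (i \<otimes> e) \<otimes> w" using ie w(1) m_assoc[of "i \<otimes> e" "i \<otimes> e" w] by simp
  ultimately have "(i \<otimes> e) \<otimes> w \<in> Units (corner R (i \<otimes> e))"
    using w v ie by (auto simp: Units_corner_iff[OF ie])
  moreover have "B t = ((i \<otimes> e) \<otimes> w) \<odot>\<^sub>L A t" if "t \<in> X0" for t
    using that w ieA cA ie m_comm[of "i \<otimes> e" w] by (simp add: L.smult_assoc1[of w "i \<otimes> e"])
  ultimately show ?thesis by blast
qed

end

context unital_partial_action
begin

text \<open>
  A partial crossed product that need not be associative. As in the associative case, the products of elements of
  \<open>N\<^sub>g\<close> and \<open>N\<^sub>h\<close> only reach \<open>1\<^sub>g N\<^bsub>gh\<^esub>\<close>.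
\<close>

definition crossed_system :: "('g \<Rightarrow> ('a, 'n, 'x) module_scheme) \<Rightarrow> ('g \<Rightarrow> 'g \<Rightarrow> 'n \<Rightarrow> 'n \<Rightarrow> 'n) \<Rightarrow> bool" where
  "crossed_system N b \<longleftrightarrow> (\<forall>g\<in>carrier G. rank_one R (N g) (\<epsilon> g)) \<and>
     (\<forall>g\<in>carrier G. \<forall>h\<in>carrier G. bilinear_map R (act g) (N g) (N h) (N (g \<bullet> h)) (b g h) \<and>
        R.spans (N (g \<bullet> h)) (\<epsilon> g) (values_of (N g) (N h) (b g h)))"

definition defect :: "('g \<Rightarrow> ('a, 'n, 'x) module_scheme) \<Rightarrow> ('g \<Rightarrow> 'g \<Rightarrow> 'n \<Rightarrow> 'n \<Rightarrow> 'n) \<Rightarrow> ('g list \<Rightarrow> 'a) \<Rightarrow> bool" where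
  "defect N b w \<longleftrightarrow> w \<in> carrier (cochains 3) \<and>
     (\<forall>g\<in>carrier G. \<forall>h\<in>carrier G. \<forall>l\<in>carrier G. \<forall>x\<in>carrier (N g). \<forall>y\<in>carrier (N h). \<forall>z\<in>carrier (N l).
        b (g \<bullet> h) l (b g h x y) z = w [g, h, l] \<odot>\<^bsub>N (g \<bullet> (h \<bullet> l))\<^esub> b g (h \<bullet> l) x (b h l y z))"

lemma crossed_systemD:
  assumes "crossed_system N b"
  shows "\<And>g. g \<in> carrier G \<Longrightarrow> rank_one R (N g) (\<epsilon> g)"
    "\<And>g. g \<in> carrier G \<Longrightarrow> module R (N g)"
    "\<And>g h. g \<in> carrier G \<Longrightarrow> h \<in> carrier G \<Longrightarrow> bilinear_map R (act g) (N g) (N h) (N (g \<bullet> h)) (b g h)"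
    "\<And>g h. g \<in> carrier G \<Longrightarrow> h \<in> carrier G \<Longrightarrow> R.spans (N (g \<bullet> h)) (\<epsilon> g) (values_of (N g) (N h) (b g h))"
  using assms by (auto simp: crossed_system_def intro: R.rank_one_module)

text \<open>
  Spanning families compose; the twisted linearity turns the idempotent \<open>f'\<close> of the right factor into
  \<open>\<sigma> f'\<close>.
\<close>

lemma spans_compose:
  assumes M: "module R M" and N: "module R N" and L: "module R L"
    and b: "bilinear_map R \<sigma> M N L b" and S: "R.spans L i (values_of M N b)" and i: "i \<in> carrier R"
    and T: "R.spans M f T" "f \<in> carrier R" and T': "R.spans N f' T'" "f' \<in> carrier R"
    and \<sigma>: "\<sigma> f' \<in> carrier R"
  shows "R.spans L (f \<star> (i \<star> \<sigma> f')) {b t t' | t t'. t \<in> T \<and> t' \<in> T'}"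
proof -
  interpret L: module R L by (rule L)
  note B = bilinear_mapD[OF b]
  let ?V = "{b t t' | t t'. t \<in> T \<and> t' \<in> T'}" and ?j = "f \<star> \<sigma> f'"
  have j: "?j \<in> carrier R" "f \<star> (i \<star> \<sigma> f') = ?j \<star> i" using T i \<sigma> by (auto simp: R.m_ac)
  have Tc: "t \<in> carrier M" "f \<odot>\<^sub>M t = t" if "t \<in> T" for t using T that by (auto simp: R.spans_def)
  have Tc': "t \<in> carrier N" "f' \<odot>\<^sub>N t = t" if "t \<in> T'" for t using T' that by (auto simp: R.spans_def)
  have jb: "?j \<odot>\<^sub>L b x y = b (f \<odot>\<^sub>M x) (f' \<odot>\<^sub>N y)" if "x \<in> carrier M" "y \<in> carrier N" for x y
    using that T T' \<sigma> N by (simp add: B L.smult_assoc1 module.smult_closed)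
  \<comment> \<open>first the left argument is resolved into elements of \<open>T\<close>, then the right one into elements of \<open>T'\<close>\<close>
  have 1: "?j \<odot>\<^sub>L v \<in> additive_span L ?V" if vv: "v \<in> values_of M N b" for v
  proof -
    obtain x y where v: "v = b x y" "x \<in> carrier M" "y \<in> carrier N" using vv by (auto simp: values_of_def)
    have y: "f' \<odot>\<^sub>N y \<in> carrier N" "f' \<odot>\<^sub>N y \<in> additive_span N T'" and x: "f \<odot>\<^sub>M x \<in> additive_span M T"
      using v T T' N by (auto simp: R.spans_def module.smult_closed)
    have "b t (f' \<odot>\<^sub>N y) \<in> additive_span L ?V" if t: "t \<in> T" for t
      by (rule additive_span_bind[OF module_abelian[OF N] semilinearD(4)[OF bilinear_right[OF b Tc(1)[OF t]]] _ y(2)])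
        (use Tc' t in \<open>auto intro: additive_span.gen\<close>)
    then have "b (f \<odot>\<^sub>M x) (f' \<odot>\<^sub>N y) \<in> additive_span L ?V"
      by (intro additive_span_bind[OF module_abelian[OF M] semilinearD(4)[OF bilinear_left[OF b y(1)]] _ x]) (use Tc in auto)
    then show ?thesis using v by (simp add: jb)
  qed
  have 2: "(?j \<star> i) \<odot>\<^sub>L z \<in> additive_span L ?V" if z: "z \<in> carrier L" for z
  proof -
    have "?j \<odot>\<^sub>L (i \<odot>\<^sub>L z) \<in> additive_span L ?V"
      by (rule additive_span_bind[OF module_abelian[OF L] semilinearD(4)[OF R.semilinear_smult[OF L j(1)]] values_of_closed[OF b] _ 1])
        (use S z in \<open>auto simp: R.spans_def\<close>)
    then show ?thesis using z i j(1) by (simp add: L.smult_assoc1)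
  qed
  have 3: "(?j \<star> i) \<odot>\<^sub>L b t t' = b t t'" if tt: "t \<in> T" "t' \<in> T'" for t t'
  proof -
    have "b t t' \<in> values_of M N b" using tt Tc Tc' by (intro values_ofI)
    then have "i \<odot>\<^sub>L b t t' = b t t'" using S unfolding R.spans_def by blast
    then show ?thesis using jb[of t t'] tt Tc Tc' i j(1) by (simp add: L.smult_assoc1 B)
  qed
  show ?thesis unfolding j(2) R.spans_def using 2 3 Tc(1) Tc'(1) by (auto intro: B(1))
qed

lemma spans_carrier: "module R M \<Longrightarrow> R.spans M \<one>\<^sub>R (carrier M)"
  by (simp add: R.spans_def module.smult_one additive_span.gen)

lemma spans_compose_right:
  assumes "module R M" "module R N" "module R L" "bilinear_map R \<sigma> M N L b" "R.spans L i (values_of M N b)"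
    "i \<in> carrier R" "R.spans N f T" "f \<in> carrier R" "\<sigma> f \<in> carrier R"
  shows "R.spans L (i \<star> \<sigma> f) {b x t | x t. x \<in> carrier M \<and> t \<in> T}"
  using spans_compose[OF assms(1-6) spans_carrier[OF assms(1)] R.one_closed assms(7-9)] assms by simp

lemma crossed_spans_right:
  assumes N: "crossed_system N b" and g: "g \<in> carrier G" and h: "h \<in> carrier G" and l: "l \<in> carrier G"
    and T: "R.spans (N (h \<bullet> l)) f T" and f: "f \<in> carrier R"
  shows "R.spans (N (g \<bullet> (h \<bullet> l))) (act g f) {b g (h \<bullet> l) x t | x t. x \<in> carrier (N g) \<and> t \<in> T}"
proof -
  note D = crossed_systemD[OF N]
  have hl: "h \<bullet> l \<in> carrier G" "g \<bullet> (h \<bullet> l) \<in> carrier G" using g h l by auto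
  show ?thesis
    using spans_compose_right[OF D(2)[OF g] D(2)[OF hl(1)] D(2)[OF hl(2)] D(3)[OF g hl(1)] D(4)[OF g hl(1)] _ T f] g f
    by (simp add: eps eps_act)
qed

definition triple_products where
  "triple_products N b g h l = {b g (h \<bullet> l) x (b h l y z) | x y z. x \<in> carrier (N g) \<and> y \<in> carrier (N h) \<and> z \<in> carrier (N l)}"

lemma triple_products_span:
  assumes N: "crossed_system N b" and g: "g \<in> carrier G" and h: "h \<in> carrier G" and l: "l \<in> carrier G"
  shows "R.spans (N (g \<bullet> (h \<bullet> l))) (act g (\<epsilon> h)) (triple_products N b g h l)"
proof -
  have "triple_products N b g h l = {b g (h \<bullet> l) x t | x t. x \<in> carrier (N g) \<and> t \<in> values_of (N h) (N l) (b h l)}"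
    unfolding triple_products_def values_of_def by blast
  then show ?thesis using crossed_spans_right[OF N g h l crossed_systemD(4)[OF N h l]] h by (simp add: eps)
qed

lemma choose_cochain:
  assumes "\<And>gs. gs \<in> tuples n \<Longrightarrow> \<exists>u\<in>Units (corner R (eps_tuple gs)). P gs u"
  obtains w where "w \<in> carrier (cochains n)" "\<And>gs. gs \<in> tuples n \<Longrightarrow> P gs (w gs)"
proof -
  obtain w where w: "\<forall>gs\<in>tuples n. w gs \<in> Units (corner R (eps_tuple gs)) \<and> P gs (w gs)"
    using bchoice[of "tuples n" "\<lambda>gs u. u \<in> Units (corner R (eps_tuple gs)) \<and> P gs u"] assms by blast
  show ?thesis by (rule that[of "restrict w (tuples n)"]) (use w in \<open>auto simp: cochains_iff\<close>)
qed

lemma eps_tuple_as_product: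
  assumes "g \<in> carrier G" "h \<in> carrier G" "l \<in> carrier G"
  shows "act g (\<epsilon> h) \<star> \<epsilon> (g \<bullet> (h \<bullet> l)) = eps_tuple [g, h, l]"
  using assms by (simp add: act_eps eps_tuple_simps eps R.m_assoc)

text \<open>
  The two bracketings of a threefold product have the same linearity in each of the three variables, so
  \<open>unit_ratio\<close> applies. Different modules are allowed in all places: with members of a crossed system
  this gives the defect, and with a module in place of \<open>Z\<close>, \<open>BZ\<close> and \<open>L\<close> it
  compares the two ways of acting with a product.
\<close>

lemma associator:
  assumes g: "g \<in> carrier G" and h: "h \<in> carrier G"
    and A: "rank_one R A a" and B: "rank_one R B b" and Z: "rank_one R Z c" and L: "rank_one R L e"
    and AB: "module R AB" and BZ: "module R BZ"
    and b1: "bilinear_map R (act g) A B AB b1" and b2: "bilinear_map R (act (g \<bullet> h)) AB Z L b2"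
    and b3: "bilinear_map R (act h) B Z BZ b3" and b4: "bilinear_map R (act g) A BZ L b4"
    and S1: "R.spans AB (\<epsilon> g) (values_of A B b1)" and S2: "R.spans L (\<epsilon> (g \<bullet> h)) (values_of AB Z b2)"
    and S3: "R.spans BZ (\<epsilon> h) (values_of B Z b3)" and S4: "R.spans L (\<epsilon> g) (values_of A BZ b4)"
  shows "\<exists>w\<in>Units (corner R ((\<epsilon> g \<star> \<epsilon> (g \<bullet> h)) \<star> e)). \<forall>x\<in>carrier A. \<forall>y\<in>carrier B. \<forall>z\<in>carrier Z.
      b2 (b1 x y) z = w \<odot>\<^sub>L b4 x (b3 y z)"
proof -
  have gh: "g \<bullet> h \<in> carrier G" using g h by simp
  note m = R.rank_one_module[OF A] R.rank_one_module[OF B] R.rank_one_module[OF Z] R.rank_one_module[OF L]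
  interpret L: module R L by (rule m(4))
  let ?b = "\<lambda>x y z. b2 (b1 x y) z" and ?a = "\<lambda>x y z. b4 x (b3 y z)"
  let ?A = "\<lambda>(x, y, z). ?a x y z" and ?B = "\<lambda>(x, y, z). ?b x y z" and ?X = "carrier A \<times> carrier B \<times> carrier Z"
  let ?i = "\<epsilon> g \<star> \<epsilon> (g \<bullet> h)"
  note e = eps[OF g] eps[OF gh]
  have i: "?i \<in> carrier R" "?i \<star> ?i = ?i" using e by (auto intro: R.idem_mult)
  note cl = bilinear_mapD(1)[OF b1] bilinear_mapD(1)[OF b3]
  have "?A ` ?X = {b4 x t | x t. x \<in> carrier A \<and> t \<in> values_of B Z b3}" unfolding values_of_def by force
  moreover have "\<epsilon> g \<star> act g (\<epsilon> h) = ?i" using g h gh e by (simp add: act_eps eps_support)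
  ultimately have SA: "R.spans L ?i (?A ` ?X)"
    using spans_compose_right[OF m(1) BZ m(4) b4 S4 e(1) S3] g h by (simp add: eps)
  have "?B ` ?X = {b2 t z | t z. t \<in> values_of A B b1 \<and> z \<in> carrier Z}" unfolding values_of_def by force
  then have SB: "R.spans L ?i (?B ` ?X)"
    using spans_compose[OF AB m(3,4) b2 S2 e(3) S1 e(1) spans_carrier[OF m(3)]] gh e by (simp add: act_one)
  have "\<exists>w\<in>Units (corner R (?i \<star> e)). \<forall>t\<in>?X. ?B t = w \<odot>\<^sub>L ?A t"
  proof (rule R.unit_ratio[OF L i SA SB])
    fix \<psi> t t' assume p: "\<psi> \<in> functionals R L" and t: "t \<in> ?X" "t' \<in> ?X"
    obtain x y z x' y' z' where xyz: "t = (x, y, z)" "t' = (x', y', z')" "x \<in> carrier A" "y \<in> carrier B" "z \<in> carrier Z"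
      "x' \<in> carrier A" "y' \<in> carrier B" "z' \<in> carrier Z" using t by auto
    have 1: "\<psi> (?b x y z) \<odot>\<^sub>L ?a x' y' z' = \<psi> (?b x' y z) \<odot>\<^sub>L ?a x y' z'"
      by (rule R.slot_exchange[OF A m(4) p semilinear_comp[OF bilinear_left[OF b1 xyz(4)] bilinear_left[OF b2 xyz(5)]]
          bilinear_left[OF b4 cl(2)[OF xyz(7,8)]] _ xyz(3,6)]) auto
    have 2: "\<psi> (?b x' y z) \<odot>\<^sub>L ?a x y' z' = \<psi> (?b x' y' z) \<odot>\<^sub>L ?a x y z'"
      by (rule R.slot_exchange[OF B m(4) p semilinear_comp[OF bilinear_right[OF b1 xyz(6)] bilinear_left[OF b2 xyz(5)]]
          semilinear_comp[OF bilinear_left[OF b3 xyz(8)] bilinear_right[OF b4 xyz(3)]] _ xyz(4,7)]) (use g in auto)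
    have s: "semilinear R (\<lambda>r. act g (act h r)) Z L (\<lambda>z. ?a x y z)"
      by (rule semilinear_comp[OF bilinear_right[OF b3 xyz(4)] bilinear_right[OF b4 xyz(3)]]) (use h in auto)
    \<comment> \<open>the values of \<open>b1\<close> are fixed by \<open>\<epsilon> g\<close>, which turns the twist by \<open>gh\<close> into the composite twist\<close>
    have s': "semilinear R (\<lambda>r. act g (act h r)) Z L (\<lambda>z. ?b x' y' z)"
    proof (rule semilinearI)
      fix r z assume r: "r \<in> carrier R" and z: "z \<in> carrier Z"
      note c = bilinear_mapD[OF b2]
      have v: "b1 x' y' \<in> carrier AB" "\<epsilon> g \<odot>\<^bsub>AB\<^esub> b1 x' y' = b1 x' y'"
        using S1 values_ofI[OF xyz(6,7), of b1] cl(1)[OF xyz(6,7)] by (auto simp: R.spans_def)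
      then have "\<epsilon> g \<odot>\<^sub>L ?b x' y' z = ?b x' y' z" using c(4)[OF e(1) v(1) z] by simp
      then show "?b x' y' (r \<odot>\<^sub>Z z) = act g (act h r) \<odot>\<^sub>L ?b x' y' z"
        using c(5)[OF r v(1) z] c(1)[OF v(1) z] r g h gh e
        by (simp add: act_act R.m_comm[of "\<epsilon> g" "act (g \<bullet> h) r"] L.smult_assoc1)
    qed (use bilinear_mapD[OF b2] cl(1)[OF xyz(6,7)] in auto)
    have 3: "\<psi> (?b x' y' z) \<odot>\<^sub>L ?a x y z' = \<psi> (?b x' y' z') \<odot>\<^sub>L ?a x y z"
      by (rule R.slot_exchange[OF Z m(4) p s' s _ xyz(5,8)]) (use g h in auto)
    show "\<psi> (?B t) \<odot>\<^sub>L ?A t' = \<psi> (?B t') \<odot>\<^sub>L ?A t" unfolding xyz(1,2) using 1 2 3 by simp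
  qed
  then show ?thesis by fastforce
qed

lemma defect_exists:
  assumes N: "crossed_system N b" shows "\<exists>w. defect N b w"
proof -
  note D = crossed_systemD[OF N]
  let ?P = "\<lambda>gs u. \<forall>g h l. gs = [g, h, l] \<longrightarrow> (\<forall>x\<in>carrier (N g). \<forall>y\<in>carrier (N h). \<forall>z\<in>carrier (N l).
      b (g \<bullet> h) l (b g h x y) z = u \<odot>\<^bsub>N (g \<bullet> (h \<bullet> l))\<^esub> b g (h \<bullet> l) x (b h l y z))"
  have "\<exists>u\<in>Units (corner R (eps_tuple gs)). ?P gs u" if gs: "gs \<in> tuples 3" for gs
  proof -
    obtain g h l where eq: "gs = [g, h, l]" and g: "g \<in> carrier G" and h: "h \<in> carrier G" and l: "l \<in> carrier G"
      using gs by (rule tuplesE(2))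
    have gh: "g \<bullet> h \<in> carrier G" and hl: "h \<bullet> l \<in> carrier G" and k: "g \<bullet> (h \<bullet> l) \<in> carrier G"
      and as: "g \<bullet> h \<bullet> l = g \<bullet> (h \<bullet> l)" using g h l by (auto simp: G.m_assoc)
    have i: "(\<epsilon> g \<star> \<epsilon> (g \<bullet> h)) \<star> \<epsilon> (g \<bullet> (h \<bullet> l)) = eps_tuple gs"
      using g h l gh k unfolding eq by (simp add: eps_tuple_simps eps R.m_assoc)
    show ?thesis
      using associator[OF g h D(1)[OF g] D(1)[OF h] D(1)[OF l] D(1)[OF k] D(2)[OF gh] D(2)[OF hl] D(3)[OF g h]
        D(3)[OF gh l, unfolded as] D(3)[OF h l] D(3)[OF g hl] D(4)[OF g h] D(4)[OF gh l, unfolded as] D(4)[OF h l] D(4)[OF g hl]]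
      unfolding i by (auto simp: eq)
  qed
  then obtain w where w: "w \<in> carrier (cochains 3)" "\<And>gs. gs \<in> tuples 3 \<Longrightarrow> ?P gs (w gs)" using choose_cochain[of 3 ?P] by blast
  have "defect N b w"
    unfolding defect_def by (intro conjI ballI w(1) w(2)[THEN spec, THEN spec, THEN spec, THEN mp, THEN bspec, THEN bspec, THEN bspec]) auto
  then show ?thesis by blast
qed

lemma defectD:
  assumes "defect N b w"
  shows "w \<in> carrier (cochains 3)"
    "\<And>g h l x y z. g \<in> carrier G \<Longrightarrow> h \<in> carrier G \<Longrightarrow> l \<in> carrier G \<Longrightarrow> x \<in> carrier (N g) \<Longrightarrow> y \<in> carrier (N h) \<Longrightarrow> z \<in> carrier (N l) \<Longrightarrow>
        b (g \<bullet> h) l (b g h x y) z = w [g, h, l] \<odot>\<^bsub>N (g \<bullet> (h \<bullet> l))\<^esub> b g (h \<bullet> l) x (b h l y z)"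
  using assms by (auto simp: defect_def)

lemma cochain_closed3: "w \<in> carrier (cochains 3) \<Longrightarrow> g \<in> carrier G \<Longrightarrow> h \<in> carrier G \<Longrightarrow> l \<in> carrier G \<Longrightarrow> w [g, h, l] \<in> carrier R"
  using cochainD(1)[of w 3 "[g, h, l]"] by simp

lemma cochain_closed2: "w \<in> carrier (cochains 2) \<Longrightarrow> g \<in> carrier G \<Longrightarrow> h \<in> carrier G \<Longrightarrow> w [g, h] \<in> carrier R"
  using cochainD(1)[of w 2 "[g, h]"] by simp

text \<open>
  The two ways around the pentagon from \<open>((xy)z)u\<close> to \<open>x(y(zu))\<close> collect the two sides of
  the cocycle identity. They agree because the products \<open>x(y(zu))\<close> span
  \<open>N\<^bsub>ghlt\<^esub>\<close> up to the idempotent of the tuple.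
\<close>

lemma defect_cocycle:
  assumes N: "crossed_system N b" and w: "defect N b w"
  shows "w \<in> carrier Z3"
  unfolding Z3_iff
proof (intro conjI ballI)
  note D = crossed_systemD[OF N]
  show wc: "w \<in> carrier (cochains 3)" using w by (rule defectD)
  fix g h l t assume g: "g \<in> carrier G" and h: "h \<in> carrier G" and l: "l \<in> carrier G" and t: "t \<in> carrier G"
  have m: "g \<bullet> h \<in> carrier G" "h \<bullet> l \<in> carrier G" "l \<bullet> t \<in> carrier G" "g \<bullet> (h \<bullet> l) \<in> carrier G"
    "h \<bullet> (l \<bullet> t) \<in> carrier G" "g \<bullet> (h \<bullet> (l \<bullet> t)) \<in> carrier G" using g h l t by auto
  let ?L = "N (g \<bullet> (h \<bullet> (l \<bullet> t)))"
  interpret L: module R ?L by (rule D(2)[OF m(6)])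
  let ?T = "{b g (h \<bullet> (l \<bullet> t)) x s | x s. x \<in> carrier (N g) \<and> s \<in> triple_products N b h l t}"
  have T: "R.spans ?L (act g (act h (\<epsilon> l))) ?T"
    using crossed_spans_right[OF N g h m(3) triple_products_span[OF N h l t]] h l by (simp add: eps)
  have wcl: "w [g, h, l] \<in> carrier R" "w [g, h \<bullet> l, t] \<in> carrier R" "w [h, l, t] \<in> carrier R"
    "w [g \<bullet> h, l, t] \<in> carrier R" "w [g, h, l \<bullet> t] \<in> carrier R" "act g (w [h, l, t]) \<in> carrier R"
    using wc g h l t m by (auto intro!: cochain_closed3 act_closed)
  note assoc = G.m_assoc
  let ?lhs = "act g (w [h, l, t]) \<star> w [g, h \<bullet> l, t] \<star> w [g, h, l]"
  let ?rhs = "w [g \<bullet> h, l, t] \<star> w [g, h, l \<bullet> t]"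
  have key: "(act g (act h (\<epsilon> l)) \<star> \<epsilon> (g \<bullet> (h \<bullet> (l \<bullet> t)))) \<star> ?lhs =
      (act g (act h (\<epsilon> l)) \<star> \<epsilon> (g \<bullet> (h \<bullet> (l \<bullet> t)))) \<star> ?rhs"
  proof (rule R.spans_unique[OF D(1)[OF m(6)] _ T])
    fix s assume "s \<in> ?T"
    then obtain x y z u where s: "s = b g (h \<bullet> (l \<bullet> t)) x (b h (l \<bullet> t) y (b l t z u))"
      and c: "x \<in> carrier (N g)" "y \<in> carrier (N h)" "z \<in> carrier (N l)" "u \<in> carrier (N t)"
      by (auto simp: triple_products_def)
    note B = bilinear_mapD(1)[OF D(3)]
    have cl: "b g h x y \<in> carrier (N (g \<bullet> h))" "b h l y z \<in> carrier (N (h \<bullet> l))" "b l t z u \<in> carrier (N (l \<bullet> t))"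
      "b h (l \<bullet> t) y (b l t z u) \<in> carrier (N (h \<bullet> (l \<bullet> t)))"
      using c g h l t m by (auto intro!: B)
    have sc: "s \<in> carrier ?L" unfolding s using c cl g m by (auto intro!: B)
    \<comment> \<open>first way round the pentagon\<close>
    let ?p = "b (g \<bullet> h \<bullet> l) t (b (g \<bullet> h) l (b g h x y) z) u"
    have "?p = w [g \<bullet> h, l, t] \<odot>\<^bsub>?L\<^esub> b (g \<bullet> h) (l \<bullet> t) (b g h x y) (b l t z u)"
      using defectD(2)[OF w m(1) l t cl(1) c(3,4)] g h l t by (simp add: assoc)
    also have "b (g \<bullet> h) (l \<bullet> t) (b g h x y) (b l t z u) = w [g, h, l \<bullet> t] \<odot>\<^bsub>?L\<^esub> s"
      using defectD(2)[OF w g h m(3) c(1,2) cl(3)] unfolding s by simp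
    finally have p1: "?p = ?rhs \<odot>\<^bsub>?L\<^esub> s" using wcl sc by (simp add: L.smult_assoc1)
    have cl2: "b g (h \<bullet> l) x (b h l y z) \<in> carrier (N (g \<bullet> (h \<bullet> l)))" using c cl g m by (auto intro!: B)
    have "?p = b (g \<bullet> (h \<bullet> l)) t (w [g, h, l] \<odot>\<^bsub>N (g \<bullet> (h \<bullet> l))\<^esub> b g (h \<bullet> l) x (b h l y z)) u"
      using defectD(2)[OF w g h l c(1-3)] g h l by (simp add: assoc)
    also have "\<dots> = w [g, h, l] \<odot>\<^bsub>?L\<^esub> b (g \<bullet> (h \<bullet> l)) t (b g (h \<bullet> l) x (b h l y z)) u"
      using bilinear_mapD(4)[OF D(3)[OF m(4) t] wcl(1) cl2 c(4)] g h l t by (simp add: assoc)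
    also have "b (g \<bullet> (h \<bullet> l)) t (b g (h \<bullet> l) x (b h l y z)) u =
        w [g, h \<bullet> l, t] \<odot>\<^bsub>?L\<^esub> b g (h \<bullet> (l \<bullet> t)) x (b (h \<bullet> l) t (b h l y z) u)"
      using defectD(2)[OF w g m(2) t c(1) cl(2) c(4)] g h l t by (simp add: assoc)
    also have "b (h \<bullet> l) t (b h l y z) u = w [h, l, t] \<odot>\<^bsub>N (h \<bullet> (l \<bullet> t))\<^esub> b h (l \<bullet> t) y (b l t z u)"
      by (rule defectD(2)[OF w h l t c(2-4)])
    also have "b g (h \<bullet> (l \<bullet> t)) x \<dots> = act g (w [h, l, t]) \<odot>\<^bsub>?L\<^esub> s"
      unfolding s by (rule bilinear_mapD(5)[OF D(3)[OF g m(5)] wcl(3) c(1) cl(4)])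
    finally have p2: "?p = ?lhs \<odot>\<^bsub>?L\<^esub> s"
      using wcl sc by (simp add: R.m_ac flip: L.smult_assoc1)
    show "?lhs \<odot>\<^bsub>?L\<^esub> s = ?rhs \<odot>\<^bsub>?L\<^esub> s" using p1 p2 by simp
  qed (use g h l wcl in \<open>auto simp: eps\<close>)
  have i: "act g (act h (\<epsilon> l)) \<star> \<epsilon> (g \<bullet> (h \<bullet> (l \<bullet> t))) = eps_tuple [g, h, l, t]"
  proof -
    have "act g (eps_tuple [h, l, t]) = act g (act h (\<epsilon> l)) \<star> (\<epsilon> g \<star> \<epsilon> (g \<bullet> (h \<bullet> (l \<bullet> t))))"
      unfolding eps_tuple_as_product[OF h l t, symmetric] using g h l t m by (simp add: act_mult act_eps eps)
    also have "\<dots> = (\<epsilon> g \<star> act g (act h (\<epsilon> l))) \<star> \<epsilon> (g \<bullet> (h \<bullet> (l \<bullet> t)))"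
      using g h l t m by (simp add: eps R.m_ac)
    finally show ?thesis using g h l t act_eps_tuple(2)[OF g h l t] by (simp add: eps_act eps)
  qed
  have s: "eps_tuple [h, l, t] \<star> w [h, l, t] = w [h, l, t]" using cochainD(2)[OF wc, of "[h, l, t]"] h l t by simp
  have "eps_tuple [g, h, l, t] \<star> act g (w [h, l, t]) = act g (w [h, l, t])"
    using act_support[OF g _ wcl(3) s] g h l t by (simp add: act_eps_tuple)
  then have 1: "eps_tuple [g, h, l, t] \<star> ?lhs = ?lhs" using wcl g h l t by (simp flip: R.m_assoc)
  have 2: "eps_tuple [g, h, l, t] \<star> ?rhs = ?rhs"
    unfolding eps_tuple_products(3)[OF g h l t, symmetric] using wcl cochainD(2)[OF wc] g h l t by (intro support_mult) auto
  show "?lhs = ?rhs" using key unfolding i 1 2 .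
qed

section \<open>Coboundaries and products of crossed systems\<close>

lemma choose_cochain2:
  assumes "\<And>g h. g \<in> carrier G \<Longrightarrow> h \<in> carrier G \<Longrightarrow> \<exists>u\<in>Units (corner R (eps_tuple [g, h])). P g h u"
  obtains \<rho> where "\<rho> \<in> carrier (cochains 2)" "\<And>g h. g \<in> carrier G \<Longrightarrow> h \<in> carrier G \<Longrightarrow> P g h (\<rho> [g, h])"
proof -
  have "\<exists>u\<in>Units (corner R (eps_tuple gs)). \<forall>g h. gs = [g, h] \<longrightarrow> P g h u" if "gs \<in> tuples 2" for gs
    by (rule tuplesE(1)[OF that]) (use assms in auto)
  then obtain \<rho> where \<rho>: "\<rho> \<in> carrier (cochains 2)" "\<And>gs. gs \<in> tuples 2 \<Longrightarrow> \<forall>g h. gs = [g, h] \<longrightarrow> P g h (\<rho> gs)"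
    using choose_cochain[of 2 "\<lambda>gs u. \<forall>g h. gs = [g, h] \<longrightarrow> P g h u"] by blast
  show ?thesis
  proof (rule that[OF \<rho>(1)])
    show "P g h (\<rho> [g, h])" if "g \<in> carrier G" "h \<in> carrier G" for g h using \<rho>(2)[of "[g, h]"] that by simp
  qed
qed

lemma delta2_support:
  assumes \<rho>: "\<rho> \<in> carrier (cochains 2)" and g: "g \<in> carrier G" and h: "h \<in> carrier G" and l: "l \<in> carrier G"
  shows "eps_tuple [g, h, l] \<star> (\<rho> [g \<bullet> h, l] \<star> \<rho> [g, h]) = \<rho> [g \<bullet> h, l] \<star> \<rho> [g, h]"
  unfolding eps_tuple_products(1)[OF g h l, symmetric]
  using cochainD(1,2)[OF \<rho>] g h l by (intro support_mult) auto

text \<open>The form in which \<open>\<delta>\<^sup>2\<close> arises from comparisons of products.\<close>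

lemma delta2_compare:
  assumes \<rho>: "\<rho> \<in> carrier (cochains 2)" and w: "w \<in> carrier (cochains 3)" and v: "v \<in> carrier (cochains 3)"
    and eq: "\<And>g h l. g \<in> carrier G \<Longrightarrow> h \<in> carrier G \<Longrightarrow> l \<in> carrier G \<Longrightarrow>
      eps_tuple [g, h, l] \<star> (w [g, h, l] \<star> (\<rho> [g \<bullet> h, l] \<star> \<rho> [g, h])) =
      eps_tuple [g, h, l] \<star> (v [g, h, l] \<star> (act g (\<rho> [h, l]) \<star> \<rho> [g, h \<bullet> l]))"
  shows "w = v \<otimes>\<^sub>C delta2 \<rho>"
proof (rule cochain_eqI[OF w])
  interpret C3: comm_group "cochains 3" by (rule cochains_comm_group)
  show "v \<otimes>\<^sub>C delta2 \<rho> \<in> carrier (cochains 3)" using v delta2_closed[OF \<rho>] by simp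
  fix gs assume "gs \<in> tuples 3"
  then obtain g h l where gs: "gs = [g, h, l]" and c: "g \<in> carrier G" "h \<in> carrier G" "l \<in> carrier G" by (rule tuplesE(2))
  let ?i = "eps_tuple [g, h, l]"
  have W: "w [g, h, l] \<in> carrier R" "?i \<star> w [g, h, l] = w [g, h, l]" "v [g, h, l] \<in> carrier R" "?i \<star> v [g, h, l] = v [g, h, l]"
    using cochainD(1,2)[OF w, of "[g, h, l]"] cochainD(1,2)[OF v, of "[g, h, l]"] c by auto
  have r: "\<rho> [g \<bullet> h, l] \<in> carrier R" "\<rho> [g, h] \<in> carrier R" "act g (\<rho> [h, l]) \<in> carrier R" "\<rho> [g, h \<bullet> l] \<in> carrier R" "?i \<in> carrier R"
    using \<rho> c by (auto intro!: cochain_closed2 act_closed)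
  have "w [g, h, l] = v [g, h, l] \<star> delta2 \<rho> [g, h, l]"
  proof (rule delta2_eq(5)[OF \<rho> c W(1,3,2,4)])
    show "w [g, h, l] \<star> (\<rho> [g \<bullet> h, l] \<star> \<rho> [g, h]) = v [g, h, l] \<star> (act g (\<rho> [h, l]) \<star> \<rho> [g, h \<bullet> l])"
      using eq[OF c] W r R.m_assoc[of ?i "w [g, h, l]" "\<rho> [g \<bullet> h, l] \<star> \<rho> [g, h]"]
        R.m_assoc[of ?i "v [g, h, l]" "act g (\<rho> [h, l]) \<star> \<rho> [g, h \<bullet> l]"] by simp
  qed
  then show "w gs = (v \<otimes>\<^sub>C delta2 \<rho>) gs" unfolding gs using c by (simp add: cochains_mult)
qed

text \<open>
  Define a multiplication on the ideals \<open>D\<^sub>g\<close> by \<open>\<rho>(g,h) x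
  \<alpha>\<^sub>g(y1)\<close>. Its defect is the inverse of \<open>\<delta>\<^sup>2\<rho>\<close>, and defects are
  cocycles. This replaces a direct verification, whose factors are inverted in various ideals.
\<close>

lemma delta2_Z3:
  assumes \<rho>: "\<rho> \<in> carrier (cochains 2)" shows "delta2 \<rho> \<in> carrier Z3"
proof -
  interpret C3: comm_group "cochains 3" by (rule cochains_comm_group)
  define N where "N = (\<lambda>g. ideal_module R (PIdl\<^bsub>R\<^esub> (\<epsilon> g)))"
  define b where "b = (\<lambda>g h x y. \<rho> [g, h] \<star> (x \<star> act g y))"
  have Nc: "carrier (N g) = PIdl\<^bsub>R\<^esub> (\<epsilon> g)" "x \<oplus>\<^bsub>N g\<^esub> y = x \<oplus>\<^sub>R y" "r \<odot>\<^bsub>N g\<^esub> x = r \<star> x" for g r x y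
    by (simp_all add: N_def)
  have r: "\<rho> [g, h] \<in> carrier R" "\<epsilon> g \<star> \<rho> [g, h] = \<rho> [g, h]" "\<epsilon> (g \<bullet> h) \<star> \<rho> [g, h] = \<rho> [g, h]"
    "cinv \<rho> [g, h] \<in> carrier R" "\<rho> [g, h] \<star> cinv \<rho> [g, h] = \<epsilon> g \<star> \<epsilon> (g \<bullet> h)"
    if g: "g \<in> carrier G" and h: "h \<in> carrier G" for g h
  proof -
    have e: "\<epsilon> g \<in> carrier R" "\<epsilon> (g \<bullet> h) \<in> carrier R" using g h by (auto intro: eps)
    show c: "\<rho> [g, h] \<in> carrier R" "cinv \<rho> [g, h] \<in> carrier R" "\<rho> [g, h] \<star> cinv \<rho> [g, h] = \<epsilon> g \<star> \<epsilon> (g \<bullet> h)"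
      using cochainD(1,3,5)[OF \<rho>, of "[g, h]"] g h by (auto simp: eps_tuple_simps)
    have s: "(\<epsilon> g \<star> \<epsilon> (g \<bullet> h)) \<star> \<rho> [g, h] = \<rho> [g, h]"
      using cochainD(2)[OF \<rho>, of "[g, h]"] g h by (simp add: eps_tuple_simps)
    show "\<epsilon> g \<star> \<rho> [g, h] = \<rho> [g, h]"
      by (rule eps_absorb[OF _ e(1) c(1) _ s]) (use e g eps_support in auto)
    show "\<epsilon> (g \<bullet> h) \<star> \<rho> [g, h] = \<rho> [g, h]"
      by (rule eps_absorb[OF _ e(2) c(1) _ s]) (use e g h eps_support[of "g \<bullet> h" "\<epsilon> g"] in \<open>auto simp: R.m_comm[of "\<epsilon> g"]\<close>)
  qed
  have cl: "b g h x y \<in> PIdl\<^bsub>R\<^esub> (\<epsilon> (g \<bullet> h))" "\<epsilon> g \<star> b g h x y = b g h x y"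
    if g: "g \<in> carrier G" and h: "h \<in> carrier G" and xy: "x \<in> carrier R" "y \<in> carrier R" for g h x y
  proof -
    have e: "\<epsilon> g \<in> carrier R" "\<epsilon> (g \<bullet> h) \<in> carrier R" using g h by (auto intro: eps)
    show "\<epsilon> g \<star> b g h x y = b g h x y"
      unfolding b_def using r[OF g h] xy g e by (simp flip: R.m_assoc)
    show "b g h x y \<in> PIdl\<^bsub>R\<^esub> (\<epsilon> (g \<bullet> h))"
      unfolding b_def using r[OF g h] xy g h e by (simp add: eps_D flip: R.m_assoc)
  qed
  have N: "crossed_system N b"
    unfolding crossed_system_def
  proof (intro conjI ballI)
    show "rank_one R (N g) (\<epsilon> g)" if "g \<in> carrier G" for g
      unfolding N_def using that by (intro R.rank_one_ideal) (auto intro: eps)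
    fix g h assume g: "g \<in> carrier G" and h: "h \<in> carrier G"
    have gh: "g \<bullet> h \<in> carrier G" using g h by simp
    have e: "\<epsilon> g \<in> carrier R" "\<epsilon> (g \<bullet> h) \<in> carrier R" "\<epsilon> h \<in> carrier R" "\<epsilon> g \<star> \<epsilon> g = \<epsilon> g" "\<epsilon> h \<star> \<epsilon> h = \<epsilon> h" using g h by (auto intro: eps)
    show "bilinear_map R (act g) (N g) (N h) (N (g \<bullet> h)) (b g h)"
      using g h gh cl(1)[OF g h] r(1)[OF g h]
      by (intro bilinear_mapI)
        (auto simp: Nc eps_D, (auto simp: b_def act_add act_mult R.l_distr R.r_distr R.m_ac))
    show "R.spans (N (g \<bullet> h)) (\<epsilon> g) (values_of (N g) (N h) (b g h))"
      unfolding R.spans_def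
    proof (intro conjI ballI)
      show "values_of (N g) (N h) (b g h) \<subseteq> carrier (N (g \<bullet> h))"
        using cl(1)[OF g h] g h by (auto simp: values_of_def Nc eps_D)
      show "\<epsilon> g \<odot>\<^bsub>N (g \<bullet> h)\<^esub> s = s" if "s \<in> values_of (N g) (N h) (b g h)" for s
        using that cl(2)[OF g h] g h by (auto simp: values_of_def Nc eps_D)
      fix z assume "z \<in> carrier (N (g \<bullet> h))"
      then have z: "z \<in> carrier R" "\<epsilon> (g \<bullet> h) \<star> z = z" using gh by (auto simp: Nc eps_D)
      let ?x = "\<epsilon> g \<star> (cinv \<rho> [g, h] \<star> z)"
      let ?e = "\<epsilon> g" and ?f = "\<epsilon> (g \<bullet> h)"
      have "b g h ?x (\<epsilon> h) = (\<rho> [g, h] \<star> cinv \<rho> [g, h]) \<star> (?e \<star> ?e) \<star> (?f \<star> z)"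
        unfolding b_def using r(1,4)[OF g h] z(1) e g h by (simp add: act_eps eps_support[OF g] R.m_ac)
      also have "\<dots> = (?e \<star> ?f) \<star> ?e \<star> z" unfolding r(5)[OF g h] z(2) e(4) ..
      also have "\<dots> = (?e \<star> ?e) \<star> (?f \<star> z)" using e(1,2) z(1) by (simp only: R.m_ac R.m_closed)
      also have "\<dots> = ?e \<star> z" unfolding z(2) e(4) ..
      finally have "b g h ?x (\<epsilon> h) = ?e \<star> z" .
      moreover have "?x \<in> carrier (N g)" "\<epsilon> h \<in> carrier (N h)"
        using g h e z r(4)[OF g h] by (simp_all add: Nc eps_D eps_support)
      ultimately show "\<epsilon> g \<odot>\<^bsub>N (g \<bullet> h)\<^esub> z \<in> additive_span (N (g \<bullet> h)) (values_of (N g) (N h) (b g h))"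
        using values_ofI[of ?x "N g" "\<epsilon> h" "N h" "b g h"] by (auto simp: Nc intro: additive_span.gen)
    qed
  qed
  let ?v = "inv\<^bsub>cochains 3\<^esub> (delta2 \<rho>)"
  have vc: "?v \<in> carrier (cochains 3)" using delta2_closed[OF \<rho>] by simp
  have "defect N b ?v"
    unfolding defect_def
  proof (intro conjI ballI vc)
    fix g h l x y z assume g: "g \<in> carrier G" and h: "h \<in> carrier G" and l: "l \<in> carrier G"
      and "x \<in> carrier (N g)" "y \<in> carrier (N h)" "z \<in> carrier (N l)"
    then have xyz: "x \<in> carrier R" "\<epsilon> g \<star> x = x" "y \<in> carrier R" "z \<in> carrier R" by (auto simp: Nc eps_D)
    have gh: "g \<bullet> h \<in> carrier G" and hl: "h \<bullet> l \<in> carrier G" using g h l by auto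
    have rc: "\<rho> [g, h] \<in> carrier R" "\<rho> [h, l] \<in> carrier R" "\<rho> [g \<bullet> h, l] \<in> carrier R" "\<rho> [g, h \<bullet> l] \<in> carrier R"
      using r(1) g h l gh hl by auto
    have v: "?v [g, h, l] \<in> carrier R" "?v [g, h, l] \<star> delta2 \<rho> [g, h, l] = eps_tuple [g, h, l]"
      using cochain_closed3[OF vc g h l] fun_cong[OF C3.l_inv[OF delta2_closed[OF \<rho>]], of "[g, h, l]"] g h l
      by (auto simp: cochains_mult cochains_one)
    have "?v [g, h, l] \<star> (act g (\<rho> [h, l]) \<star> \<rho> [g, h \<bullet> l]) =
        (?v [g, h, l] \<star> delta2 \<rho> [g, h, l]) \<star> (\<rho> [g \<bullet> h, l] \<star> \<rho> [g, h])"
      unfolding delta2_eq(3)[OF \<rho> g h l, symmetric] using v(1) rc delta2_eq(1)[OF \<rho> g h l] by (simp add: R.m_assoc)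
    then have e: "?v [g, h, l] \<star> (act g (\<rho> [h, l]) \<star> \<rho> [g, h \<bullet> l]) = \<rho> [g \<bullet> h, l] \<star> \<rho> [g, h]"
      using v(2) delta2_support[OF \<rho> g h l] by simp
    have "?v [g, h, l] \<star> b g (h \<bullet> l) x (b h l y z) =
      (?v [g, h, l] \<star> (act g (\<rho> [h, l]) \<star> \<rho> [g, h \<bullet> l])) \<star> ((\<epsilon> g \<star> x) \<star> act g y \<star> act (g \<bullet> h) z)"
      unfolding b_def using xyz(1,3,4) rc v(1) g h l gh eps_closed[OF g] by (simp add: act_mult act_act R.m_ac)
    also have "\<dots> = b (g \<bullet> h) l (b g h x y) z"
      unfolding e xyz(2) b_def using xyz(1,3,4) rc g h l gh by (simp add: R.m_ac)
    finally show "b (g \<bullet> h) l (b g h x y) z = ?v [g, h, l] \<odot>\<^bsub>N (g \<bullet> (h \<bullet> l))\<^esub> b g (h \<bullet> l) x (b h l y z)"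
      by (simp add: Nc)
  qed
  then have "?v \<in> carrier Z3" by (rule defect_cocycle[OF N])
  then have "inv\<^bsub>cochains 3\<^esub> ?v \<in> carrier Z3" using subgroup.m_inv_closed[OF Z3_subgroup] by blast
  then show ?thesis using delta2_closed[OF \<rho>] by simp
qed

lemma B3_subgroup: "subgroup B3 Z3"
proof -
  interpret C: comm_group "cochains 3" by (rule cochains_comm_group)
  have "B3 \<subseteq> carrier Z3" using delta2_Z3 by (auto simp: B3_def)
  then have "subgroup B3 ((cochains 3)\<lparr>carrier := carrier Z3\<rparr>)"
    by (rule C.subgroup_incl[OF B3_subgroup_cochains Z3_subgroup])
  then show ?thesis by (simp add: Z3_def)
qed

lemma B3_normal: "B3 \<lhd> Z3"
  using comm_group.normal_iff_subgroup[OF Z3_comm_group] B3_subgroup by simp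

lemma H3_group: "group H3"
  unfolding H3_def by (rule normal.factorgroup_is_group[OF B3_normal])

lemma B3_coset_eq:
  assumes w: "w \<in> carrier Z3" and v: "v \<in> carrier Z3" and \<rho>: "\<rho> \<in> carrier (cochains 2)"
    and eq: "w = v \<otimes>\<^sub>C delta2 \<rho>"
  shows "B3 #>\<^bsub>Z3\<^esub> w = B3 #>\<^bsub>Z3\<^esub> v"
proof -
  interpret Z: comm_group Z3 by (rule Z3_comm_group)
  have d: "delta2 \<rho> \<in> B3" using \<rho> by (simp add: B3_def)
  have "w = delta2 \<rho> \<otimes>\<^bsub>Z3\<^esub> v"
    using eq Z.m_comm[OF v delta2_Z3[OF \<rho>]] by (simp add: Z3_mult)
  then have "w \<in> B3 #>\<^bsub>Z3\<^esub> v" using d by (auto simp: r_coset_def)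
  then show ?thesis using Z.repr_independence[OF _ v B3_subgroup] by simp
qed

lemma perfect_spans:
  assumes "perfect_pairing R M N L b" "module R L"
  shows "bilinear_map R (\<lambda>r. r) M N L b" "R.spans L \<one>\<^sub>R (values_of M N b)"
proof -
  show b: "bilinear_map R (\<lambda>r. r) M N L b" using assms(1) by (simp add: perfect_pairing_def)
  show "R.spans L \<one>\<^sub>R (values_of M N b)"
    using assms values_of_closed[OF b] module.smult_one[OF assms(2)] by (auto simp: perfect_pairing_def R.spans_def)
qed

text \<open>
  The products \<open>p(x,x') p(y,y')\<close> and the pairings \<open>p(xy, x'y')\<close> have the same linearity in
  \<open>x, x', y, y'\<close> and differ by units \<open>\<rho>(g,h)\<close>. Rewriting a threefold product of
  paired elements in both bracketings in terms of \<open>p(x(yz), x'(y'z'))\<close> compares the three defects.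
\<close>

lemma defect_product:
  assumes N: "crossed_system N b" and w: "defect N b w"
    and N': "crossed_system N' b'" and w': "defect N' b' w'"
    and N'': "crossed_system N'' b''" and w'': "defect N'' b'' w''"
    and p: "\<And>g. g \<in> carrier G \<Longrightarrow> perfect_pairing R (N g) (N' g) (N'' g) (p g)"
  shows "\<exists>\<rho>\<in>carrier (cochains 2). w \<otimes>\<^sub>C w' = w'' \<otimes>\<^sub>C delta2 \<rho>"
proof -
  interpret C3: comm_group "cochains 3" by (rule cochains_comm_group)
  note D = crossed_systemD[OF N] and D' = crossed_systemD[OF N'] and D'' = crossed_systemD[OF N'']
  note P = perfect_spans[OF p D''(2)]
  note B = bilinear_mapD[OF D(3)] and B' = bilinear_mapD[OF D'(3)] and B'' = bilinear_mapD[OF D''(3)] and PB = bilinear_mapD[OF P(1)]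
  have "\<exists>u\<in>Units (corner R (eps_tuple [g, h])). \<forall>x\<in>carrier (N g). \<forall>x'\<in>carrier (N' g). \<forall>y\<in>carrier (N h). \<forall>y'\<in>carrier (N' h).
      b'' g h (p g x x') (p h y y') = u \<odot>\<^bsub>N'' (g \<bullet> h)\<^esub> p (g \<bullet> h) (b g h x y) (b' g h x' y')"
    if g: "g \<in> carrier G" and h: "h \<in> carrier G" for g h
  proof -
    have gh: "g \<bullet> h \<in> carrier G" using g h by simp
    let ?L = "N'' (g \<bullet> h)"
    let ?a = "\<lambda>x x' y y'. p (g \<bullet> h) (b g h x y) (b' g h x' y')" and ?b = "\<lambda>x x' y y'. b'' g h (p g x x') (p h y y')"
    let ?A = "\<lambda>(x, x', y, y'). ?a x x' y y'" and ?B = "\<lambda>(x, x', y, y'). ?b x x' y y'"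
    let ?X = "carrier (N g) \<times> carrier (N' g) \<times> carrier (N h) \<times> carrier (N' h)"
    have e: "\<epsilon> g \<in> carrier R" "\<epsilon> g \<star> \<epsilon> g = \<epsilon> g" using g by (auto intro: eps)
    have A: "R.spans ?L (\<epsilon> g) (?A ` ?X)"
    proof -
      have "?A ` ?X = {p (g \<bullet> h) t t' | t t'. t \<in> values_of (N g) (N h) (b g h) \<and> t' \<in> values_of (N' g) (N' h) (b' g h)}"
        by (force simp: values_of_def)
      then show ?thesis
        using spans_compose[OF D(2)[OF gh] D'(2)[OF gh] D''(2)[OF gh] P(1,2)[OF gh gh] _ D(4)[OF g h] e(1) D'(4)[OF g h] e(1)] gh e by simp
    qed
    have B: "R.spans ?L (\<epsilon> g) (?B ` ?X)"
    proof -
      have "?B ` ?X = {b'' g h t t' | t t'. t \<in> values_of (N g) (N' g) (p g) \<and> t' \<in> values_of (N h) (N' h) (p h)}"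
        by (force simp: values_of_def)
      then show ?thesis
        using spans_compose[OF D''(2)[OF g] D''(2)[OF h] D''(2)[OF gh] D''(3,4)[OF g h] e(1) P(2)[OF g g] _ P(2)[OF h h]] g h e
        by (simp add: act_one)
    qed
    have "\<exists>u\<in>Units (corner R (\<epsilon> g \<star> \<epsilon> (g \<bullet> h))). \<forall>t\<in>?X. ?B t = u \<odot>\<^bsub>?L\<^esub> ?A t"
    proof (rule R.unit_ratio[OF D''(1)[OF gh] e A B])
      fix \<psi> t t' assume q: "\<psi> \<in> functionals R ?L" and t: "t \<in> ?X" "t' \<in> ?X"
      obtain x y z u x' y' z' u' where xyz: "t = (x, y, z, u)" "t' = (x', y', z', u')"
        and c: "x \<in> carrier (N g)" "y \<in> carrier (N' g)" "z \<in> carrier (N h)" "u \<in> carrier (N' h)"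
        "x' \<in> carrier (N g)" "y' \<in> carrier (N' g)" "z' \<in> carrier (N h)" "u' \<in> carrier (N' h)" using t by auto
      note L = D''(2)[OF gh]
      note pg = P(1)[OF g g] and ph = P(1)[OF h h] and pgh = P(1)[OF gh gh] and b1 = D(3)[OF g h] and b2 = D'(3)[OF g h] and b3 = D''(3)[OF g h]
      note cl = bilinear_mapD(1)[OF pg] bilinear_mapD(1)[OF ph] bilinear_mapD(1)[OF b1] bilinear_mapD(1)[OF b2]
      have 1: "\<psi> (?b x y z u) \<odot>\<^bsub>?L\<^esub> ?a x' y' z' u' = \<psi> (?b x' y z u) \<odot>\<^bsub>?L\<^esub> ?a x y' z' u'"
        by (rule R.slot_exchange[OF D(1)[OF g] L q semilinear_comp[OF bilinear_left[OF pg c(2)] bilinear_left[OF b3 cl(2)[OF c(3,4)]]]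
            semilinear_comp[OF bilinear_left[OF b1 c(7)] bilinear_left[OF pgh cl(4)[OF c(6,8)]]] _ c(1,5)]) auto
      have 2: "\<psi> (?b x' y z u) \<odot>\<^bsub>?L\<^esub> ?a x y' z' u' = \<psi> (?b x' y' z u) \<odot>\<^bsub>?L\<^esub> ?a x y z' u'"
        by (rule R.slot_exchange[OF D'(1)[OF g] L q semilinear_comp[OF bilinear_right[OF pg c(5)] bilinear_left[OF b3 cl(2)[OF c(3,4)]]]
            semilinear_comp[OF bilinear_left[OF b2 c(8)] bilinear_right[OF pgh cl(3)[OF c(1,7)]]] _ c(2,6)]) auto
      have 3: "\<psi> (?b x' y' z u) \<odot>\<^bsub>?L\<^esub> ?a x y z' u' = \<psi> (?b x' y' z' u) \<odot>\<^bsub>?L\<^esub> ?a x y z u'"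
        by (rule R.slot_exchange[OF D(1)[OF h] L q semilinear_comp[OF bilinear_left[OF ph c(4)] bilinear_right[OF b3 cl(1)[OF c(5,6)]]]
            semilinear_comp[OF bilinear_right[OF b1 c(1)] bilinear_left[OF pgh cl(4)[OF c(2,8)]]] _ c(3,7)]) (use g in auto)
      have 4: "\<psi> (?b x' y' z' u) \<odot>\<^bsub>?L\<^esub> ?a x y z u' = \<psi> (?b x' y' z' u') \<odot>\<^bsub>?L\<^esub> ?a x y z u"
        by (rule R.slot_exchange[OF D'(1)[OF h] L q semilinear_comp[OF bilinear_right[OF ph c(7)] bilinear_right[OF b3 cl(1)[OF c(5,6)]]]
            semilinear_comp[OF bilinear_right[OF b2 c(2)] bilinear_right[OF pgh cl(3)[OF c(1,3)]]] _ c(4,8)]) (use g in auto)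
      show "\<psi> (?B t) \<odot>\<^bsub>?L\<^esub> ?A t' = \<psi> (?B t') \<odot>\<^bsub>?L\<^esub> ?A t" unfolding xyz using 1 2 3 4 by simp
    qed
    then show ?thesis using g h by (fastforce simp: eps_tuple_simps)
  qed
  then obtain \<rho> where \<rho>: "\<rho> \<in> carrier (cochains 2)" and \<rho>eq: "\<And>g h. g \<in> carrier G \<Longrightarrow> h \<in> carrier G \<Longrightarrow>
      \<forall>x\<in>carrier (N g). \<forall>x'\<in>carrier (N' g). \<forall>y\<in>carrier (N h). \<forall>y'\<in>carrier (N' h).
      b'' g h (p g x x') (p h y y') = \<rho> [g, h] \<odot>\<^bsub>N'' (g \<bullet> h)\<^esub> p (g \<bullet> h) (b g h x y) (b' g h x' y')"
    using choose_cochain2[of "\<lambda>g h u. \<forall>x\<in>carrier (N g). \<forall>x'\<in>carrier (N' g). \<forall>y\<in>carrier (N h). \<forall>y'\<in>carrier (N' h).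
      b'' g h (p g x x') (p h y y') = u \<odot>\<^bsub>N'' (g \<bullet> h)\<^esub> p (g \<bullet> h) (b g h x y) (b' g h x' y')"] by blast
  have wc: "w \<in> carrier (cochains 3)" "w' \<in> carrier (cochains 3)" "w'' \<in> carrier (cochains 3)" using w w' w'' defectD(1) by blast+
  have "w \<otimes>\<^sub>C w' = w'' \<otimes>\<^sub>C delta2 \<rho>"
  proof (rule delta2_compare[OF \<rho> _ wc(3)])
    show "w \<otimes>\<^sub>C w' \<in> carrier (cochains 3)" using wc by simp
    fix g h l assume g: "g \<in> carrier G" and h: "h \<in> carrier G" and l: "l \<in> carrier G"
    have gh: "g \<bullet> h \<in> carrier G" and hl: "h \<bullet> l \<in> carrier G" and ghl: "g \<bullet> (h \<bullet> l) \<in> carrier G"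
      and as: "g \<bullet> h \<bullet> l = g \<bullet> (h \<bullet> l)" using g h l by (auto simp: G.m_assoc)
    let ?k = "g \<bullet> (h \<bullet> l)"
    let ?L = "N'' ?k"
    interpret L: module R ?L by (rule D''(2)[OF ghl])
    let ?T = "{p ?k t t' | t t'. t \<in> triple_products N b g h l \<and> t' \<in> triple_products N' b' g h l}"
    have ec: "act g (\<epsilon> h) \<in> carrier R" using g h by (simp add: eps)
    have ii: "act g (\<epsilon> h) \<star> act g (\<epsilon> h) = act g (\<epsilon> h)" using g h by (simp add: eps flip: act_mult)
    have T: "R.spans ?L (act g (\<epsilon> h)) ?T"
      using spans_compose[OF D(2)[OF ghl] D'(2)[OF ghl] D''(2)[OF ghl] P(1,2)[OF ghl ghl] _ triple_products_span[OF N g h l] ec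
          triple_products_span[OF N' g h l] ec] ec ii by simp
    have rc: "\<rho> [g, h] \<in> carrier R" "\<rho> [h, l] \<in> carrier R" "\<rho> [g \<bullet> h, l] \<in> carrier R" "\<rho> [g, h \<bullet> l] \<in> carrier R" "act g (\<rho> [h, l]) \<in> carrier R"
      using cochain_closed2[OF \<rho>] g h l gh hl by auto
    have wcl: "w [g, h, l] \<in> carrier R" "w' [g, h, l] \<in> carrier R" "w'' [g, h, l] \<in> carrier R"
      using wc g h l by (auto intro: cochain_closed3)
    let ?lhs = "(w [g, h, l] \<star> w' [g, h, l]) \<star> (\<rho> [g \<bullet> h, l] \<star> \<rho> [g, h])"
    let ?rhs = "w'' [g, h, l] \<star> (act g (\<rho> [h, l]) \<star> \<rho> [g, h \<bullet> l])"
    have "(act g (\<epsilon> h) \<star> \<epsilon> ?k) \<star> ?lhs = (act g (\<epsilon> h) \<star> \<epsilon> ?k) \<star> ?rhs"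
    proof (rule R.spans_unique[OF D''(1)[OF ghl] ec T])
      fix s assume "s \<in> ?T"
      then obtain x y z x' y' z' where s: "s = p ?k (b g (h \<bullet> l) x (b h l y z)) (b' g (h \<bullet> l) x' (b' h l y' z'))"
        and c: "x \<in> carrier (N g)" "y \<in> carrier (N h)" "z \<in> carrier (N l)" "x' \<in> carrier (N' g)" "y' \<in> carrier (N' h)" "z' \<in> carrier (N' l)"
        unfolding triple_products_def by blast
      have cl: "b g h x y \<in> carrier (N (g \<bullet> h))" "b' g h x' y' \<in> carrier (N' (g \<bullet> h))"
        "b h l y z \<in> carrier (N (h \<bullet> l))" "b' h l y' z' \<in> carrier (N' (h \<bullet> l))"
        "b g (h \<bullet> l) x (b h l y z) \<in> carrier (N ?k)" "b' g (h \<bullet> l) x' (b' h l y' z') \<in> carrier (N' ?k)"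
        using c g h l hl by (auto intro!: B(1) B'(1))
      have pc: "p g x x' \<in> carrier (N'' g)" "p h y y' \<in> carrier (N'' h)" "p l z z' \<in> carrier (N'' l)"
        "p (g \<bullet> h) (b g h x y) (b' g h x' y') \<in> carrier (N'' (g \<bullet> h))"
        "p (h \<bullet> l) (b h l y z) (b' h l y' z') \<in> carrier (N'' (h \<bullet> l))" "s \<in> carrier ?L"
        unfolding s using c cl g h l gh hl ghl by (auto intro!: PB(1))
      have "b'' (g \<bullet> h) l (b'' g h (p g x x') (p h y y')) (p l z z') =
        b'' (g \<bullet> h) l (\<rho> [g, h] \<odot>\<^bsub>N'' (g \<bullet> h)\<^esub> p (g \<bullet> h) (b g h x y) (b' g h x' y')) (p l z z')"
        using \<rho>eq[OF g h] c by simp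
      also have "\<dots> = \<rho> [g, h] \<odot>\<^bsub>?L\<^esub> b'' (g \<bullet> h) l (p (g \<bullet> h) (b g h x y) (b' g h x' y')) (p l z z')"
        using B''(4)[OF gh l rc(1) pc(4,3)] by (simp add: as)
      also have "b'' (g \<bullet> h) l (p (g \<bullet> h) (b g h x y) (b' g h x' y')) (p l z z') =
          \<rho> [g \<bullet> h, l] \<odot>\<^bsub>?L\<^esub> p ?k (b (g \<bullet> h) l (b g h x y) z) (b' (g \<bullet> h) l (b' g h x' y') z')"
        using \<rho>eq[OF gh l] cl c by (simp add: as)
      also have "p ?k (b (g \<bullet> h) l (b g h x y) z) (b' (g \<bullet> h) l (b' g h x' y') z') = w [g, h, l] \<odot>\<^bsub>?L\<^esub> (w' [g, h, l] \<odot>\<^bsub>?L\<^esub> s)"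
        unfolding s using defectD(2)[OF w g h l c(1-3)] defectD(2)[OF w' g h l c(4-6)] cl wcl
          D'(2)[OF ghl] by (simp add: PB(4,5)[OF ghl ghl] module.smult_closed)
      finally have 1: "b'' (g \<bullet> h) l (b'' g h (p g x x') (p h y y')) (p l z z') = ?lhs \<odot>\<^bsub>?L\<^esub> s"
        using rc wcl pc(6) by (simp add: R.m_ac flip: L.smult_assoc1)
      have "b'' g (h \<bullet> l) (p g x x') (b'' h l (p h y y') (p l z z')) =
        b'' g (h \<bullet> l) (p g x x') (\<rho> [h, l] \<odot>\<^bsub>N'' (h \<bullet> l)\<^esub> p (h \<bullet> l) (b h l y z) (b' h l y' z'))"
        using \<rho>eq[OF h l] c by simp
      also have "\<dots> = act g (\<rho> [h, l]) \<odot>\<^bsub>?L\<^esub> b'' g (h \<bullet> l) (p g x x') (p (h \<bullet> l) (b h l y z) (b' h l y' z'))"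
        by (rule B''(5)[OF g hl rc(2) pc(1,5)])
      also have "b'' g (h \<bullet> l) (p g x x') (p (h \<bullet> l) (b h l y z) (b' h l y' z')) = \<rho> [g, h \<bullet> l] \<odot>\<^bsub>?L\<^esub> s"
        unfolding s using \<rho>eq[OF g hl] cl c by simp
      finally have "b'' (g \<bullet> h) l (b'' g h (p g x x') (p h y y')) (p l z z') =
          w'' [g, h, l] \<odot>\<^bsub>?L\<^esub> (act g (\<rho> [h, l]) \<odot>\<^bsub>?L\<^esub> (\<rho> [g, h \<bullet> l] \<odot>\<^bsub>?L\<^esub> s))"
        using defectD(2)[OF w'' g h l pc(1-3)] by simp
      then show "?lhs \<odot>\<^bsub>?L\<^esub> s = ?rhs \<odot>\<^bsub>?L\<^esub> s" using 1 rc wcl pc(6) by (simp add: L.smult_assoc1)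
    qed (use rc wcl in auto)
    then show "eps_tuple [g, h, l] \<star> ((w \<otimes>\<^sub>C w') [g, h, l] \<star> (\<rho> [g \<bullet> h, l] \<star> \<rho> [g, h])) =
      eps_tuple [g, h, l] \<star> (w'' [g, h, l] \<star> (act g (\<rho> [h, l]) \<star> \<rho> [g, h \<bullet> l]))"
      unfolding eps_tuple_as_product[OF g h l] using g h l by (simp add: cochains_mult)
  qed
  then show ?thesis using \<rho> by blast
qed

section \<open>Crossed systems that act on a module\<close>

text \<open>
  Let \<open>(xy)q = \<rho>(g,h) x(yq)\<close>. Expressing \<open>((xy)z)q\<close> and \<open>(x(yz))q\<close> by
  \<open>x(y(zq))\<close> gives \<open>\<rho>(gh,l) \<rho>(g,h) = w(g,h,l) \<alpha>\<^sub>g(\<rho>(h,l)1)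
  \<rho>(g,hl)\<close>, so \<open>w\<close> is inverse to \<open>\<delta>\<^sup>2\<rho>\<close>.
\<close>

lemma defect_of_acting_system:
  assumes N: "crossed_system N b" and w: "defect N b w" and Q: "rank_one R Q \<one>\<^sub>R"
    and c: "\<And>g. g \<in> carrier G \<Longrightarrow> bilinear_map R (act g) (N g) Q Q (c g)"
    and S: "\<And>g. g \<in> carrier G \<Longrightarrow> R.spans Q (\<epsilon> g) (values_of (N g) Q (c g))"
  shows "w \<in> B3"
proof -
  interpret C3: comm_group "cochains 3" by (rule cochains_comm_group)
  interpret Q: module R Q by (rule R.rank_one_module[OF Q])
  note D = crossed_systemD[OF N] and m = Q.module_axioms
  note B = bilinear_mapD(1)[OF D(3)] and C = bilinear_mapD[OF c]
  have "\<exists>u\<in>Units (corner R (eps_tuple [g, h])). \<forall>x\<in>carrier (N g). \<forall>y\<in>carrier (N h). \<forall>z\<in>carrier Q.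
      c (g \<bullet> h) (b g h x y) z = u \<odot>\<^sub>Q c g x (c h y z)" if g: "g \<in> carrier G" and h: "h \<in> carrier G" for g h
  proof -
    have gh: "g \<bullet> h \<in> carrier G" using g h by simp
    have "(\<epsilon> g \<star> \<epsilon> (g \<bullet> h)) \<star> \<one>\<^sub>R = eps_tuple [g, h]" using g h gh by (simp add: eps_tuple_simps eps)
    then show ?thesis
      using associator[OF g h D(1)[OF g] D(1)[OF h] Q Q D(2)[OF gh] m D(3)[OF g h] c[OF gh] c[OF h] c[OF g] D(4)[OF g h] S[OF gh] S[OF h] S[OF g]]
      by simp
  qed
  then obtain \<rho> where \<rho>: "\<rho> \<in> carrier (cochains 2)" and \<rho>eq: "\<And>g h. g \<in> carrier G \<Longrightarrow> h \<in> carrier G \<Longrightarrow>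
      \<forall>x\<in>carrier (N g). \<forall>y\<in>carrier (N h). \<forall>z\<in>carrier Q. c (g \<bullet> h) (b g h x y) z = \<rho> [g, h] \<odot>\<^sub>Q c g x (c h y z)"
    using choose_cochain2[of "\<lambda>g h u. \<forall>x\<in>carrier (N g). \<forall>y\<in>carrier (N h). \<forall>z\<in>carrier Q.
      c (g \<bullet> h) (b g h x y) z = u \<odot>\<^sub>Q c g x (c h y z)"] by blast
  have wc: "w \<in> carrier (cochains 3)" using w by (rule defectD)
  have "\<one>\<^bsub>cochains 3\<^esub> = w \<otimes>\<^sub>C delta2 \<rho>"
  proof (rule delta2_compare[OF \<rho> C3.one_closed wc])
    fix g h l assume g: "g \<in> carrier G" and h: "h \<in> carrier G" and l: "l \<in> carrier G"
    have gh: "g \<bullet> h \<in> carrier G" and hl: "h \<bullet> l \<in> carrier G" and k: "g \<bullet> (h \<bullet> l) \<in> carrier G"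
      and as: "g \<bullet> h \<bullet> l = g \<bullet> (h \<bullet> l)" using g h l by (auto simp: G.m_assoc)
    let ?T1 = "{c h y t | y t. y \<in> carrier (N h) \<and> t \<in> values_of (N l) Q (c l)}"
    let ?T = "{c g x t | x t. x \<in> carrier (N g) \<and> t \<in> ?T1}"
    note e = eps_closed[OF g] eps_closed[OF h] eps_closed[OF l]
    have "R.spans Q (\<epsilon> h \<star> act h (\<epsilon> l)) ?T1"
      by (rule spans_compose_right[OF D(2)[OF h] m m c[OF h] S[OF h] e(2) S[OF l] e(3)]) (use e h in simp)
    then have "R.spans Q (\<epsilon> g \<star> act g (\<epsilon> h \<star> act h (\<epsilon> l))) ?T"
      by (intro spans_compose_right[OF D(2)[OF g] m m c[OF g] S[OF g] e(1)]) (use e g h in auto)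
    moreover have i: "\<epsilon> h \<star> act h (\<epsilon> l) = eps_tuple [h, l]" using h l hl e by (simp add: act_eps eps_tuple_simps eps_support eps)
    then have "\<epsilon> g \<star> act g (\<epsilon> h \<star> act h (\<epsilon> l)) = eps_tuple [g, h, l]"
      using act_eps_tuple(1)[OF g h l] eps_act[OF g, of "eps_tuple [h, l]"] g h l by simp
    ultimately have T: "R.spans Q (eps_tuple [g, h, l]) ?T" by simp
    have rc: "\<rho> [g, h] \<in> carrier R" "\<rho> [h, l] \<in> carrier R" "\<rho> [g \<bullet> h, l] \<in> carrier R" "\<rho> [g, h \<bullet> l] \<in> carrier R" "act g (\<rho> [h, l]) \<in> carrier R"
      using cochain_closed2[OF \<rho>] g h l gh hl by auto
    have wcl: "w [g, h, l] \<in> carrier R" using cochain_closed3[OF wc g h l] .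
    let ?lhs = "\<rho> [g \<bullet> h, l] \<star> \<rho> [g, h]"
    let ?rhs = "w [g, h, l] \<star> (act g (\<rho> [h, l]) \<star> \<rho> [g, h \<bullet> l])"
    have "(eps_tuple [g, h, l] \<star> \<one>\<^sub>R) \<star> ?lhs = (eps_tuple [g, h, l] \<star> \<one>\<^sub>R) \<star> ?rhs"
    proof (rule R.spans_unique[OF Q _ T])
      fix s assume "s \<in> ?T"
      then obtain x y z q where s: "s = c g x (c h y (c l z q))"
        and v: "x \<in> carrier (N g)" "y \<in> carrier (N h)" "z \<in> carrier (N l)" "q \<in> carrier Q" by (auto simp: values_of_def)
      note cl = B[OF g h v(1,2)] B[OF h l v(2,3)] B[OF g hl v(1) B[OF h l v(2,3)]]
      have q: "c l z q \<in> carrier Q" "c h y (c l z q) \<in> carrier Q" "s \<in> carrier Q"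
        using v g h l unfolding s by (auto intro!: C(1))
      \<comment> \<open>both bracketings of \<open>x y z\<close> are compared with the threefold action on \<open>q\<close>\<close>
      have 1: "c (g \<bullet> (h \<bullet> l)) (b (g \<bullet> h) l (b g h x y) z) q = ?lhs \<odot>\<^sub>Q s"
        using \<rho>eq[OF gh l] \<rho>eq[OF g h] cl v q rc unfolding s as by (simp add: Q.smult_assoc1)
      have "c (g \<bullet> (h \<bullet> l)) (b g (h \<bullet> l) x (b h l y z)) q = \<rho> [g, h \<bullet> l] \<odot>\<^sub>Q (act g (\<rho> [h, l]) \<odot>\<^sub>Q s)"
        using \<rho>eq[OF g hl] \<rho>eq[OF h l] cl v q C(5)[OF g rc(2) v(1) q(2)] unfolding s by simp
      then have "w [g, h, l] \<odot>\<^sub>Q c (g \<bullet> (h \<bullet> l)) (b g (h \<bullet> l) x (b h l y z)) q = ?rhs \<odot>\<^sub>Q s"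
        using rc wcl q by (simp add: R.m_comm[of "act g (\<rho> [h, l])"] Q.smult_assoc1)
      then show "?lhs \<odot>\<^sub>Q s = ?rhs \<odot>\<^sub>Q s"
        using 1 defectD(2)[OF w g h l v(1-3)] C(4)[OF k wcl cl(3) v(4)] by simp
    qed (use rc wcl g h l in auto)
    then show "eps_tuple [g, h, l] \<star> (\<one>\<^bsub>cochains 3\<^esub> [g, h, l] \<star> ?lhs) = eps_tuple [g, h, l] \<star> ?rhs"
      using g h l rc delta2_support[OF \<rho> g h l] by (simp add: cochains_one)
  qed
  then have "w = inv\<^bsub>cochains 3\<^esub> (delta2 \<rho>)"
    using C3.inv_equality[OF _ delta2_closed[OF \<rho>] wc] by simp
  moreover have "delta2 \<rho> \<in> B3" using \<rho> by (simp add: B3_def)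
  ultimately show ?thesis using subgroup.m_inv_closed[OF B3_subgroup_cochains] by simp
qed

text \<open>
  A linear pairing of \<open>N\<close> with the twisted module is a twisted linear action on \<open>Q\<close>
  itself.
\<close>

lemma semilinear_action:
  assumes g: "g \<in> carrier G" and N: "rank_one R N (\<epsilon> g)" and Q: "module R Q"
    and q: "perfect_pairing R N (tw g Q) (transport_module (\<epsilon> g) (\<lambda>r. \<epsilon> g \<star> r) Q) q"
  defines "c \<equiv> \<lambda>x y. q x (\<epsilon> g\<^sup>- \<odot>\<^sub>Q y)"
  shows "bilinear_map R (act g) N Q Q c" and "R.spans Q (\<epsilon> g) (values_of N Q c)"
proof -
  interpret Q: module R Q by (rule Q)
  let ?L = "transport_module (\<epsilon> g) (\<lambda>r. \<epsilon> g \<star> r) Q" and ?u = "\<epsilon> g\<^sup>-"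
  have gi: "g\<^sup>- \<in> carrier G" using g by simp
  note e = eps[OF g] eps[OF gi]
  note B = bilinear_mapD[OF q[unfolded perfect_pairing_def, THEN conjunct1]]
  have t: "?u \<odot>\<^sub>Q y \<in> carrier (tw g Q)" if "y \<in> carrier Q" for y using that e by (simp flip: Q.smult_assoc1)
  have c: "c x y \<in> carrier Q" "\<epsilon> g \<odot>\<^sub>Q c x y = c x y" if "x \<in> carrier N" "y \<in> carrier Q" for x y
    using B(1)[OF that(1) t[OF that(2)]] by (auto simp: c_def)
  have eg: "(\<epsilon> g \<star> r) \<odot>\<^sub>Q c x y = r \<odot>\<^sub>Q c x y" if "r \<in> carrier R" "x \<in> carrier N" "y \<in> carrier Q" for r x y
    using that e c[OF that(2,3)] by (simp add: R.m_comm[of "\<epsilon> g" r] Q.smult_assoc1)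
  show bil: "bilinear_map R (act g) N Q Q c"
  proof (rule bilinear_mapI)
    fix r x y assume r: "r \<in> carrier R" and x: "x \<in> carrier N" and y: "y \<in> carrier Q"
    show "c (r \<odot>\<^sub>N x) y = r \<odot>\<^sub>Q c x y" using B(4)[OF r x t[OF y]] eg[OF r x y] by (simp add: c_def)
    have "?u \<odot>\<^sub>Q (r \<odot>\<^sub>Q y) = act g r \<odot>\<^bsub>tw g Q\<^esub> (?u \<odot>\<^sub>Q y)"
      using e r y g by (simp add: act_inv_act R.m_ac flip: Q.smult_assoc1)
    then show "c x (r \<odot>\<^sub>Q y) = act g r \<odot>\<^sub>Q c x y"
      using B(5)[OF act_closed[OF g r] x t[OF y]] eg[OF act_closed[OF g r] x y] by (simp add: c_def)
  next
    fix x x' y assume "x \<in> carrier N" "x' \<in> carrier N" "y \<in> carrier Q"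
    then show "c (x \<oplus>\<^sub>N x') y = c x y \<oplus>\<^sub>Q c x' y" using B(2)[of x x'] t by (simp add: c_def)
  next
    fix x y y' assume "x \<in> carrier N" "y \<in> carrier Q" "y' \<in> carrier Q"
    then show "c x (y \<oplus>\<^sub>Q y') = c x y \<oplus>\<^sub>Q c x y'"
      using B(3)[of x "?u \<odot>\<^sub>Q y" "?u \<odot>\<^sub>Q y'"] t e by (simp add: c_def Q.smult_r_distr)
  qed (use c in auto)
  have v: "values_of N (tw g Q) q \<subseteq> values_of N Q c" by (force simp: values_of_def c_def)
  have "z \<in> additive_span Q (values_of N Q c)" if "z \<in> additive_span ?L (values_of N (tw g Q) q)" for z
    using that by (induction rule: additive_span.induct) (use v in \<open>auto intro: additive_span.intros\<close>)
  then have "\<epsilon> g \<odot>\<^sub>Q z \<in> additive_span Q (values_of N Q c)" if "z \<in> carrier Q" for z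
    using q that e by (auto simp: perfect_pairing_def simp flip: Q.smult_assoc1)
  then show "R.spans Q (\<epsilon> g) (values_of N Q c)" using c by (auto simp: R.spans_def values_of_def)
qed

section \<open>The bimodules and isomorphisms in the definition of the obstruction\<close>

lemma D_iff: "g \<in> carrier G \<Longrightarrow> x \<in> D g \<longleftrightarrow> x \<in> carrier R \<and> \<epsilon> g \<star> x = x"
  unfolding D_def by (rule eps_D)

lemma D_bimodule_simps:
  "carrier (D_bimodule g) = D g" "x \<oplus>\<^bsub>D_bimodule g\<^esub> y = x \<oplus>\<^sub>R y"
  "r \<odot>\<^bsub>D_bimodule g\<^esub> x = r \<star> x" "rsmult (D_bimodule g) x r = r \<star> x"
  by simp_all

lemma D_bimodule_bimodule: "g \<in> carrier G \<Longrightarrow> is_bimodule R (D_bimodule g)"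
  unfolding D_def by (intro is_bimodule_central R.ideal_module_module) (auto intro: eps)

lemma D_twisted_simps:
  assumes "g \<in> carrier G"
  shows "carrier (D_twisted g) = D g\<^sup>-" "x \<oplus>\<^bsub>D_twisted g\<^esub> y = x \<oplus>\<^sub>R y"
    "r \<odot>\<^bsub>D_twisted g\<^esub> x = act g\<^sup>- r \<star> x" "rsmult (D_twisted g) x r = x \<star> r"
    "\<zero>\<^bsub>D_twisted g\<^esub> = \<zero>\<^sub>R"
  using assms by (simp_all add: D_twisted_def act_def)

lemma D_ideal: "g \<in> carrier G \<Longrightarrow> ideal (D g) R"
  unfolding D_def by (intro R.cgenideal_ideal) (auto intro: eps)

lemma D_twisted_bimodule:
  assumes g: "g \<in> carrier G" shows "is_bimodule R (D_twisted g)"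
proof -
  have gi: "g\<^sup>- \<in> carrier G" using g by simp
  interpret I: ideal "D g\<^sup>-" R by (rule D_ideal[OF gi])
  note S = D_twisted_simps[OF g]
  have "module R (D_twisted g)"
  proof (rule moduleI[OF R.is_cring])
    show "abelian_group (D_twisted g)"
    proof (rule abelian_groupI)
      fix x assume "x \<in> carrier (D_twisted g)"
      then show "\<exists>y\<in>carrier (D_twisted g). y \<oplus>\<^bsub>D_twisted g\<^esub> x = \<zero>\<^bsub>D_twisted g\<^esub>"
        by (auto simp: S R.l_neg intro!: bexI[of _ "\<ominus>\<^sub>R x"])
    qed (auto simp: S R.a_ac)
  next
    fix x assume "x \<in> carrier (D_twisted g)"
    then show "\<one>\<^sub>R \<odot>\<^bsub>D_twisted g\<^esub> x = x" using gi by (simp add: S act_one D_iff)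
  qed (use gi in \<open>auto simp: S act_add act_mult R.l_distr R.r_distr R.m_assoc I.I_l_closed\<close>)
  then show ?thesis
    using gi by (auto simp: is_bimodule_def S R.l_distr R.m_assoc I.I_r_closed)
qed

text \<open>
  The multiplication \<open>D\<^sub>g \<otimes> N \<rightarrow> N\<close>, \<open>d \<otimes> n \<mapsto> d
  n\<close>. It is injective with image \<open>1\<^sub>g N\<close>.
\<close>

definition mu :: "'g \<Rightarrow> ('a, 'n) bimodule \<Rightarrow> ('a \<times> 'n \<Rightarrow>\<^sub>0 int) set \<Rightarrow> 'n" where
  "mu g N = tensor_lift R (D_bimodule g) N (additive_group N) (\<lambda>d n. d \<odot>\<^sub>N n)"

lemma
  assumes g: "g \<in> carrier G" and N: "is_bimodule R N"
  shows mu_hom: "mu g N \<in> mod_hom R (D_bimodule g \<boxtimes> N) N"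
    and mu_pt: "\<And>d n. d \<in> D g \<Longrightarrow> n \<in> carrier N \<Longrightarrow> mu g N (ptensor R (D_bimodule g) N d n) = d \<odot>\<^sub>N n"
    and mu_section: "\<And>t. t \<in> carrier (D_bimodule g \<boxtimes> N) \<Longrightarrow> ptensor R (D_bimodule g) N (\<epsilon> g) (mu g N t) = t"
    and mu_support: "\<And>t. t \<in> carrier (D_bimodule g \<boxtimes> N) \<Longrightarrow> \<epsilon> g \<odot>\<^sub>N mu g N t = mu g N t"
proof -
  interpret T: tensor_product R "D_bimodule g" N using D_bimodule_bimodule[OF g] N by unfold_locales
  interpret N: module R N by (rule bimoduleD(1)[OF N])
  note S = D_bimodule_simps
  have e: "\<epsilon> g \<in> D g" "\<epsilon> g \<in> carrier R" using g by (auto simp: D_iff eps)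
  have bal: "balanced R (D_bimodule g) N N (\<lambda>d n. d \<odot>\<^sub>N n)"
    using g by (auto simp: balanced_def S D_iff N.smult_l_distr N.smult_r_distr R.m_comm simp flip: N.smult_assoc1)
  show hom: "mu g N \<in> mod_hom R T.T N"
    unfolding mu_def by (rule T.lift_mod_hom[OF bimoduleD(1)[OF N] bal]) (use g in \<open>auto simp: S D_iff N.smult_assoc1\<close>)
  show pt: "mu g N (T.pt d n) = d \<odot>\<^sub>N n" if "d \<in> D g" "n \<in> carrier N" for d n
    unfolding mu_def using T.lift_pt[OF bimoduleD(2)[OF N] bal] that by simp
  note H = mod_homD[OF hom]
  show "T.pt (\<epsilon> g) (mu g N t) = t" if t: "t \<in> carrier T.T" for t
    using t
  proof (induction rule: T.tensor_induct)
    case (pt d n)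
    then have d: "d \<in> carrier R" "\<epsilon> g \<star> d = d" "d \<in> D g" using g by (auto simp: D_iff)
    have "T.pt (\<epsilon> g) (d \<odot>\<^sub>N n) = T.pt (d \<star> \<epsilon> g) n"
      using T.pt_balanced[of "\<epsilon> g" d n] d(1) e pt by (simp add: S)
    then show ?case using \<open>d \<in> D g \<Longrightarrow> n \<in> carrier N \<Longrightarrow> mu g N (T.pt d n) = d \<odot>\<^bsub>N\<^esub> n\<close> d pt e by (simp add: R.m_comm)
  next
    case (add s t)
    then show ?case using e T.pt_add_right[of "\<epsilon> g" "mu g N s" "mu g N t"] by (simp add: H)
  qed
  show "\<epsilon> g \<odot>\<^sub>N mu g N t = mu g N t" if t: "t \<in> carrier T.T" for t
    using t
  proof (induction rule: T.tensor_induct)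
    case (pt d n)
    then have d: "d \<in> carrier R" "\<epsilon> g \<star> d = d" "d \<in> D g" using g by (auto simp: D_iff)
    then show ?case using \<open>d \<in> D g \<Longrightarrow> n \<in> carrier N \<Longrightarrow> mu g N (T.pt d n) = d \<odot>\<^bsub>N\<^esub> n\<close> pt e
      by (simp flip: N.smult_assoc1)
  qed (use e in \<open>simp add: H N.smult_r_distr\<close>)
qed

lemma mu_inj: "g \<in> carrier G \<Longrightarrow> is_bimodule R N \<Longrightarrow> s \<in> carrier (D_bimodule g \<boxtimes> N) \<Longrightarrow> t \<in> carrier (D_bimodule g \<boxtimes> N) \<Longrightarrow>
    mu g N s = mu g N t \<Longrightarrow> s = t"
  using mu_section by metis

definition rank_one_family :: "('g \<Rightarrow> 'a small_module) \<Rightarrow> bool" where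
  "rank_one_family M \<longleftrightarrow> (\<forall>g\<in>carrier G. rank_one R (M g) (\<epsilon> g))"

lemma rank_one_familyD: "rank_one_family M \<Longrightarrow> g \<in> carrier G \<Longrightarrow> rank_one R (M g) (\<epsilon> g)"
  by (simp add: rank_one_family_def)

text \<open>The isomorphism of left modules \<open>J\<^sub>g \<cong> M\<^sub>g\<close>.\<close>

definition jmap :: "('g \<Rightarrow> 'a small_module) \<Rightarrow> 'g \<Rightarrow> 'a J_elem \<Rightarrow> nat \<Rightarrow> 'a" where
  "jmap M g = tensor_lift R (central (M g)) (D_twisted g) (additive_group (M g)) (\<lambda>m d. act g d \<odot>\<^bsub>M g\<^esub> m)"

lemma J_tensor:
  assumes "rank_one_family M" "g \<in> carrier G"
  shows "tensor_product R (central (M g)) (D_twisted g)"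
  using assms by (simp add: tensor_product_def D_twisted_bimodule is_bimodule_central R.rank_one_module[OF rank_one_familyD])

lemma J_bimodule: "rank_one_family M \<Longrightarrow> g \<in> carrier G \<Longrightarrow> is_bimodule R (J M g)"
  unfolding J_def by (rule tensor_product.tensor_bimodule[OF J_tensor])

lemma
  assumes M: "rank_one_family M" and g: "g \<in> carrier G"
  shows jmap_iso: "jmap M g \<in> mod_iso R (J M g) (M g)"
    and J_rsmult: "\<And>x r. x \<in> carrier (J M g) \<Longrightarrow> r \<in> carrier R \<Longrightarrow> rsmult (J M g) x r = act g r \<odot>\<^bsub>J M g\<^esub> x"
proof -
  let ?N = "J M g"
  interpret T: tensor_product R "central (M g)" "D_twisted g" by (rule J_tensor[OF M g])
  have N: "?N = T.T" by (simp add: J_def)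
  note Mr = rank_one_familyD[OF M g]
  interpret Mg: module R "M g" by (rule R.rank_one_module[OF Mr])
  note S = D_twisted_simps[OF g]
  have gi: "g\<^sup>- \<in> carrier G" using g by simp
  have e: "\<epsilon> g\<^sup>- \<in> D g\<^sup>-" "\<epsilon> g\<^sup>- \<in> carrier R" "\<epsilon> g \<in> carrier R" using gi g by (auto simp: D_iff eps)
  have dc: "d \<in> carrier R \<and> \<epsilon> g\<^sup>- \<star> d = d" if "d \<in> carrier (D_twisted g)" for d using that gi by (simp add: S D_iff)
  have em: "\<epsilon> g \<odot>\<^bsub>M g\<^esub> m = m" if "m \<in> carrier (M g)" for m using R.rank_one_support[OF Mr that] .
  have bal: "balanced R (central (M g)) (D_twisted g) (M g) (\<lambda>m d. act g d \<odot>\<^bsub>M g\<^esub> m)"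
    unfolding balanced_def
  proof (intro conjI ballI)
    fix m r d assume m: "m \<in> carrier (central (M g))" and r: "r \<in> carrier R" and "d \<in> carrier (D_twisted g)"
    then have d: "d \<in> carrier R" using dc by auto
    have "act g (act g\<^sup>- r \<star> d) = act g d \<star> r \<star> \<epsilon> g"
      using g r d e by (simp add: act_mult act_act_inv R.m_ac)
    then show "act g d \<odot>\<^bsub>M g\<^esub> rsmult (central (M g)) m r = act g (r \<odot>\<^bsub>D_twisted g\<^esub> d) \<odot>\<^bsub>M g\<^esub> m"
      using m r d g e by (simp add: S Mg.smult_assoc1 em)
  qed (use g dc in \<open>auto simp: S act_add Mg.smult_l_distr Mg.smult_r_distr\<close>)
  have hom: "jmap M g \<in> mod_hom R T.T (M g)"
    unfolding jmap_def by (rule T.lift_mod_hom[OF R.rank_one_module[OF Mr] bal])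
      (use g dc in \<open>auto simp: R.m_comm simp flip: Mg.smult_assoc1\<close>)
  have pt: "jmap M g (T.pt m d) = act g d \<odot>\<^bsub>M g\<^esub> m" if "m \<in> carrier (M g)" "d \<in> carrier (D_twisted g)" for m d
    unfolding jmap_def using T.lift_pt[OF Mg.M.abelian_group_axioms bal] that by simp
  note H = mod_homD[OF hom]
  have bl: "T.pt (r \<odot>\<^bsub>M g\<^esub> m) d = T.pt m (act g\<^sup>- r \<star> d)" if "m \<in> carrier (M g)" "d \<in> carrier (D_twisted g)" "r \<in> carrier R" for m d r
    using T.pt_balanced[of m r d] that by (simp add: S)
  have ec: "\<epsilon> g\<^sup>- \<in> carrier (D_twisted g)" using e by (simp add: S)
  have sec: "T.pt (jmap M g t) (\<epsilon> g\<^sup>-) = t" if t: "t \<in> carrier T.T" for t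
    using t
  proof (induction rule: T.tensor_induct)
    case (pt m d)
    have d: "d \<in> carrier R" "\<epsilon> g\<^sup>- \<star> d = d" using dc[OF pt(2)] by auto
    have "act g\<^sup>- (act g d) \<star> \<epsilon> g\<^sup>- = d" using g gi d e by (simp add: act_inv_act R.m_comm[of d])
    then show ?case using pt \<open>\<And>m d. m \<in> carrier (M g) \<Longrightarrow> d \<in> carrier (D_twisted g) \<Longrightarrow> jmap M g (T.pt m d) = act g d \<odot>\<^bsub>M g\<^esub> m\<close>
        bl[OF _ ec, of m "act g d"] d g by simp
  next
    case (add s t)
    then show ?case using ec T.pt_add_left[of "jmap M g s" "jmap M g t"] by (simp add: H)
  qed
  have "jmap M g (T.pt m (\<epsilon> g\<^sup>-)) = m" if "m \<in> carrier (M g)" for m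
    using pt[OF that ec] that g em e by (simp add: act_eps eps_one)
  then have "bij_betw (jmap M g) (carrier T.T) (carrier (M g))"
    using sec H ec by (intro bij_betw_byWitness[where f' = "\<lambda>m. T.pt m (\<epsilon> g\<^sup>-)"]) auto
  then show "jmap M g \<in> mod_iso R ?N (M g)" using hom by (simp add: mod_iso_def N)
  show "rsmult ?N x r = act g r \<odot>\<^bsub>?N\<^esub> x" if x: "x \<in> carrier ?N" and r: "r \<in> carrier R" for x r
    using x unfolding N
  proof (induction rule: T.tensor_induct)
    case (pt m d)
    have d: "d \<in> carrier R" "\<epsilon> g\<^sup>- \<star> d = d" using dc[OF pt(2)] by auto
    have "act g\<^sup>- (act g r) \<star> d = r \<star> (\<epsilon> g\<^sup>- \<star> d)" using g r d(1) e by (simp add: act_inv_act R.m_ac)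
    then have "act g\<^sup>- (act g r) \<star> d = d \<star> r" using d r by (simp add: R.m_comm)
    then show ?case using pt r g bl[OF _ pt(2), of m "act g r"] by (simp add: T.rsmult_pt T.smult_pt S)
  qed (use r g in \<open>simp_all add: T.rsmult_add T.smult_add\<close>)
qed

lemma J_rank_one:
  assumes M: "rank_one_family M" and g: "g \<in> carrier G" shows "rank_one R (J M g) (\<epsilon> g)"
proof -
  have m: "module R (J M g)" by (rule bimoduleD(1)[OF J_bimodule[OF M g]])
  show ?thesis by (rule R.rank_one_iso[OF rank_one_familyD[OF M g] mod_iso_inv[OF jmap_iso[OF M g] m] m])
qed

lemma flip_iso:
  assumes g: "g \<in> carrier G" and h: "h \<in> carrier G"
  shows "flip g h \<in> bimod_iso R (D_bimodule g \<boxtimes> D_bimodule h) (D_bimodule h \<boxtimes> D_bimodule g)"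
    and "\<And>u v. u \<in> D g \<Longrightarrow> v \<in> D h \<Longrightarrow>
      flip g h (ptensor R (D_bimodule g) (D_bimodule h) u v) = ptensor R (D_bimodule h) (D_bimodule g) v u"
proof -
  note S = D_bimodule_simps
  have hom: "flip g h \<in> bimod_hom R (D_bimodule g \<boxtimes> D_bimodule h) (D_bimodule h \<boxtimes> D_bimodule g)"
    and pt: "\<And>u v. u \<in> D g \<Longrightarrow> v \<in> D h \<Longrightarrow>
      flip g h (ptensor R (D_bimodule g) (D_bimodule h) u v) = ptensor R (D_bimodule h) (D_bimodule g) v u"
    if g: "g \<in> carrier G" and h: "h \<in> carrier G" for g h
  proof -
    interpret A: tensor_product R "D_bimodule g" "D_bimodule h" using D_bimodule_bimodule g h by unfold_locales auto
    interpret B: tensor_product R "D_bimodule h" "D_bimodule g" using D_bimodule_bimodule g h by unfold_locales auto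
    have bal: "balanced R (D_bimodule g) (D_bimodule h) B.T (\<lambda>u v. B.pt v u)"
      using B.pt_balanced by (simp add: balanced_def B.pt_add_left[simplified] B.pt_add_right[simplified] S)
    show "flip g h \<in> bimod_hom R A.T B.T"
      unfolding flip_def additive_group_tensor[symmetric]
      by (rule A.lift_bimod_hom[OF B.tensor_bimodule bal])
        (use B.pt_balanced B.smult_pt B.rsmult_pt in \<open>simp_all add: S\<close>)
    show "flip g h (A.pt u v) = B.pt v u" if "u \<in> D g" "v \<in> D h" for u v
      unfolding flip_def additive_group_tensor[symmetric] using A.lift_pt[OF B.tensor_abelian bal] that by simp
  qed
  interpret A: tensor_product R "D_bimodule g" "D_bimodule h" using D_bimodule_bimodule g h by unfold_locales auto
  interpret B: tensor_product R "D_bimodule h" "D_bimodule g" using D_bimodule_bimodule g h by unfold_locales auto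
  note ad = hom[OF g h, THEN bimod_hom_mod_hom, THEN mod_hom_additive] hom[OF h g, THEN bimod_hom_mod_hom, THEN mod_hom_additive]
  show "flip g h \<in> bimod_iso R A.T B.T"
  proof (rule bimod_iso_byWitness[OF hom[OF g h] hom[OF h g]])
    show "flip h g (flip g h t) = t" if "t \<in> carrier A.T" for t
      by (rule A.additive_map_eqI[OF additive_map_comp[OF ad] additive_map_ident that]) (simp add: pt[OF g h] pt[OF h g])
    show "flip g h (flip h g t) = t" if "t \<in> carrier B.T" for t
      by (rule B.additive_map_eqI[OF additive_map_comp[OF ad(2,1)] additive_map_ident that]) (simp add: pt[OF g h] pt[OF h g])
  qed
  show "\<And>u v. u \<in> D g \<Longrightarrow> v \<in> D h \<Longrightarrow> flip g h (A.pt u v) = B.pt v u" by (rule pt[OF g h])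
qed

text \<open>
  The inverse is \<open>d \<otimes> a \<mapsto> a \<otimes>
  \<alpha>\<^bsub>g\<^sup>-\<^sup>1\<^esub>(d1\<^sub>g)\<close>. Both maps are balanced because the right action on
  \<open>J\<^sub>g\<close> is \<open>a r = \<alpha>\<^sub>g(r1) a\<close>.
\<close>

lemma
  assumes M: "rank_one_family M" and g: "g \<in> carrier G" and h: "h \<in> carrier G"
  shows kappa_iso: "kappa M g h \<in> bimod_iso R (J M g \<boxtimes> D_bimodule h) (D_bimodule (g \<bullet> h) \<boxtimes> J M g)"
    and kappa_pt: "\<And>a b. a \<in> carrier (J M g) \<Longrightarrow> b \<in> D h \<Longrightarrow>
      kappa M g h (ptensor R (J M g) (D_bimodule h) a b) = ptensor R (D_bimodule (g \<bullet> h)) (J M g) (act g b) a"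
proof -
  note S = D_bimodule_simps
  have gh: "g \<bullet> h \<in> carrier G" and gi: "g\<^sup>- \<in> carrier G" using g h by auto
  let ?N = "J M g" and ?D = "D_bimodule h" and ?D' = "D_bimodule (g \<bullet> h)"
  note NB = J_bimodule[OF M g] and Nr = J_rank_one[OF M g]
  note ND = bimoduleD[OF NB]
  interpret N: module R ?N by (rule ND(1))
  interpret A: tensor_product R ?N ?D using NB D_bimodule_bimodule[OF h] by unfold_locales
  interpret B: tensor_product R ?D' ?N using NB D_bimodule_bimodule[OF gh] by unfold_locales
  have e: "\<epsilon> g \<in> carrier R" "\<epsilon> g\<^sup>- \<in> carrier R" using g gi by (auto intro: eps)
  have rs: "rsmult ?N x r = act g r \<odot>\<^bsub>?N\<^esub> x" if "x \<in> carrier ?N" "r \<in> carrier R" for x r using J_rsmult[OF M g that] .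
  have en: "\<epsilon> g \<odot>\<^bsub>?N\<^esub> x = x" if "x \<in> carrier ?N" for x using R.rank_one_support[OF Nr that] .
  have Dc: "b \<in> carrier R" if "b \<in> D k" "k \<in> carrier G" for b k using that D_iff by blast
  have f: "act g b \<in> D (g \<bullet> h)" if "b \<in> D h" for b
  proof -
    have b: "b \<in> carrier R" "\<epsilon> h \<star> b = b" using that h by (auto simp: D_iff)
    have "(\<epsilon> g \<star> \<epsilon> (g \<bullet> h)) \<star> act g b = act g b" using act_support[OF g _ b] g h by (simp add: act_eps eps)
    then have "\<epsilon> (g \<bullet> h) \<star> act g b = act g b"
      by (rule eps_absorb[rotated 4]) (use g h gh b eps_support[OF gh, of "\<epsilon> g"] in \<open>auto simp: eps R.m_comm[of "\<epsilon> g"]\<close>)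
    then show ?thesis using gh g b by (simp add: D_iff)
  qed
  have f': "act g\<^sup>- d \<in> D h" if "d \<in> D (g \<bullet> h)" for d
  proof -
    have b: "d \<in> carrier R" "\<epsilon> (g \<bullet> h) \<star> d = d" using that gh by (auto simp: D_iff)
    have k: "g\<^sup>- \<bullet> (g \<bullet> h) = h" using g h by (simp add: G.m_assoc[symmetric])
    have "(\<epsilon> g\<^sup>- \<star> \<epsilon> h) \<star> act g\<^sup>- d = act g\<^sup>- d"
      using act_support[OF gi _ b] gi gh k by (simp add: act_eps eps)
    then have "\<epsilon> h \<star> act g\<^sup>- d = act g\<^sup>- d"
      by (rule eps_absorb[rotated 4]) (use g h gi b eps_support[OF h, of "\<epsilon> g\<^sup>-"] in \<open>auto simp: eps R.m_comm[of "\<epsilon> g\<^sup>-"]\<close>)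
    then show ?thesis using h gi b by (simp add: D_iff)
  qed
  have Bbal: "B.pt (r \<star> d) x = B.pt d (r \<odot>\<^bsub>?N\<^esub> x)" if "d \<in> D (g \<bullet> h)" "r \<in> carrier R" "x \<in> carrier ?N" for d r x
    using B.pt_balanced[of d r x] that by (simp add: S)
  have Abal: "A.pt (act g r \<odot>\<^bsub>?N\<^esub> x) b = A.pt x (r \<star> b)" if "b \<in> D h" "r \<in> carrier R" "x \<in> carrier ?N" for b r x
    using A.pt_balanced[of x r b] that by (simp add: S rs)
  have bal: "balanced R ?N ?D B.T (\<lambda>a b. B.pt (act g b) a)"
    unfolding balanced_def
  proof (intro conjI ballI)
    fix a r b assume a: "a \<in> carrier ?N" and r: "r \<in> carrier R" and b: "b \<in> carrier ?D"
    then have b': "b \<in> D h" "b \<in> carrier R" using Dc h by (auto)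
    have "B.pt (act g b) (act g r \<odot>\<^bsub>?N\<^esub> a) = B.pt (act g r \<star> act g b) a" using Bbal[OF f[OF b'(1)], of "act g r" a] r a g by simp
    then show "B.pt (act g b) (rsmult ?N a r) = B.pt (act g (r \<odot>\<^bsub>?D\<^esub> b)) a"
      using rs[OF a r] b' r g by (simp add: S act_mult)
  qed (use f Dc g h in \<open>auto simp: act_add B.pt_add_left[simplified] B.pt_add_right\<close>)
  have bal': "balanced R ?D' ?N A.T (\<lambda>d a. A.pt a (act g\<^sup>- d))"
    unfolding balanced_def
  proof (intro conjI ballI)
    fix d r a assume d: "d \<in> carrier ?D'" and r: "r \<in> carrier R" and a: "a \<in> carrier ?N"
    then have d': "d \<in> D (g \<bullet> h)" "d \<in> carrier R" using Dc gh by (auto)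
    have "A.pt a (act g\<^sup>- r \<star> act g\<^sup>- d) = A.pt (act g (act g\<^sup>- r) \<odot>\<^bsub>?N\<^esub> a) (act g\<^sup>- d)"
      using Abal[OF f'[OF d'(1)], of "act g\<^sup>- r" a] r a gi by simp
    also have "act g (act g\<^sup>- r) \<odot>\<^bsub>?N\<^esub> a = r \<odot>\<^bsub>?N\<^esub> a"
      using g r a e en by (simp add: act_act_inv R.m_comm[of "\<epsilon> g"] N.smult_assoc1)
    finally show "A.pt a (act g\<^sup>- (rsmult ?D' d r)) = A.pt (r \<odot>\<^bsub>?N\<^esub> a) (act g\<^sup>- d)"
      using d' r gi by (simp add: S act_mult)
  qed (use f' Dc gi gh in \<open>auto simp: act_add A.pt_add_left A.pt_add_right[simplified]\<close>)
  have hom: "kappa M g h \<in> bimod_hom R A.T B.T"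
    unfolding kappa_def additive_group_tensor[symmetric] act_def[symmetric]
  proof (rule A.lift_bimod_hom[OF B.tensor_bimodule bal])
    fix r a b assume r: "r \<in> carrier R" and a: "a \<in> carrier ?N" and b: "b \<in> carrier ?D"
    then have b': "b \<in> D h" "b \<in> carrier R" using Dc h by (auto)
    show "B.pt (act g b) (r \<odot>\<^bsub>?N\<^esub> a) = r \<odot>\<^bsub>B.T\<^esub> B.pt (act g b) a"
      using Bbal[OF f[OF b'(1)] r a] B.smult_pt[of r "act g b" a] f[OF b'(1)] r a by (simp add: S)
    have "B.pt (act g r \<star> act g b) a = B.pt (act g b) (act g r \<odot>\<^bsub>?N\<^esub> a)"
      using Bbal[OF f[OF b'(1)] _ a] r g by simp
    then show "B.pt (act g (rsmult ?D b r)) a = rsmult B.T (B.pt (act g b) a) r"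
      using B.rsmult_pt[of r "act g b" a] f[OF b'(1)] r a b' g rs[OF a r] by (simp add: S act_mult)
  qed
  show pt: "kappa M g h (A.pt a b) = B.pt (act g b) a" if "a \<in> carrier ?N" "b \<in> D h" for a b
    unfolding kappa_def additive_group_tensor[symmetric] act_def[symmetric]
    using A.lift_pt[OF B.tensor_abelian bal] that by simp
  let ?k = "tensor_lift R ?D' ?N (additive_group A.T) (\<lambda>d a. A.pt a (act g\<^sup>- d))"
  have hom': "?k \<in> bimod_hom R B.T A.T"
  proof (rule B.lift_bimod_hom[OF A.tensor_bimodule bal'])
    fix r d a assume r: "r \<in> carrier R" and d: "d \<in> carrier ?D'" and a: "a \<in> carrier ?N"
    then have d': "d \<in> D (g \<bullet> h)" "d \<in> carrier R" using Dc gh by (auto)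
    have "A.pt a (act g\<^sup>- (r \<star> d)) = A.pt (r \<odot>\<^bsub>?N\<^esub> a) (act g\<^sup>- d)"
      using bal' d r a by (simp add: balanced_def S)
    then show "A.pt a (act g\<^sup>- (r \<odot>\<^bsub>?D'\<^esub> d)) = r \<odot>\<^bsub>A.T\<^esub> A.pt a (act g\<^sup>- d)"
      using A.smult_pt[of r a "act g\<^sup>- d"] f'[OF d'(1)] r a by (simp add: S)
    show "A.pt (rsmult ?N a r) (act g\<^sup>- d) = rsmult A.T (A.pt a (act g\<^sup>- d)) r"
      using A.rsmult_pt[of r a "act g\<^sup>- d"] A.pt_balanced[of a r "act g\<^sup>- d"] f'[OF d'(1)] r a by (simp add: S)
  qed
  have pt': "?k (B.pt d a) = A.pt a (act g\<^sup>- d)" if "d \<in> D (g \<bullet> h)" "a \<in> carrier ?N" for d a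
    using B.lift_pt[OF A.tensor_abelian bal'] that by simp
  note ad = hom[THEN bimod_hom_mod_hom, THEN mod_hom_additive] hom'[THEN bimod_hom_mod_hom, THEN mod_hom_additive]
  show "kappa M g h \<in> bimod_iso R A.T B.T"
  proof (rule bimod_iso_byWitness[OF hom hom'])
    fix t assume t: "t \<in> carrier A.T"
    show "?k (kappa M g h t) = t"
    proof (rule A.additive_map_eqI[OF additive_map_comp[OF ad] additive_map_ident t])
      fix a b assume a: "a \<in> carrier ?N" and b: "b \<in> carrier ?D"
      then have b': "b \<in> D h" "b \<in> carrier R" using Dc h by (auto)
      have "?k (kappa M g h (A.pt a b)) = A.pt a (\<epsilon> g\<^sup>- \<star> b)"
        using a b' g by (simp add: pt pt'[OF f] act_inv_act)
      also have "\<dots> = A.pt (act g (\<epsilon> g\<^sup>-) \<odot>\<^bsub>?N\<^esub> a) b" using Abal[OF b'(1) e(2) a] by simp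
      finally show "?k (kappa M g h (A.pt a b)) = A.pt a b" using g a en e by (simp add: act_eps eps_one)
    qed
  next
    fix t assume t: "t \<in> carrier B.T"
    show "kappa M g h (?k t) = t"
    proof (rule B.additive_map_eqI[OF additive_map_comp[OF ad(2,1)] additive_map_ident t])
      fix d a assume d: "d \<in> carrier ?D'" and a: "a \<in> carrier ?N"
      then have d': "d \<in> D (g \<bullet> h)" "d \<in> carrier R" using Dc gh by (auto)
      have "kappa M g h (?k (B.pt d a)) = B.pt (\<epsilon> g \<star> d) a"
        using a d' g by (simp add: pt'[OF d'(1) a] pt[OF a f'] act_act_inv)
      then show "kappa M g h (?k (B.pt d a)) = B.pt d a" using Bbal[OF d'(1) e(1) a] en[OF a] by simp
    qed
  qed
qed

end

section \<open>The obstruction is a defect\<close>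

lemma bimod_iso_hom: "f \<in> bimod_iso R M N \<Longrightarrow> f \<in> bimod_hom R M N"
  by (simp add: bimod_iso_iff)

lemma bimod_iso_additive: "f \<in> bimod_iso R M N \<Longrightarrow> additive_map M N f"
  by (intro mod_hom_additive bimod_hom_mod_hom bimod_iso_hom)

lemma bimod_iso_solve:
  assumes "f \<in> bimod_iso R M N" "y \<in> carrier N"
  shows "inv_into (carrier M) f y \<in> carrier M" "f (inv_into (carrier M) f y) = y"
proof -
  have "f ` carrier M = carrier N" using assms(1) by (simp add: bimod_iso_iff bij_betw_def)
  then show "inv_into (carrier M) f y \<in> carrier M" "f (inv_into (carrier M) f y) = y"
    using assms(2) by (auto intro: inv_into_into f_inv_into_f)
qed

context unital_partial_action
begin

definition chi_product :: "('g \<Rightarrow> 'a small_module) \<Rightarrow> ('g \<Rightarrow> 'g \<Rightarrow> 'a chi_map) \<Rightarrow> 'g \<Rightarrow> 'g \<Rightarrow> 'a J_elem \<Rightarrow> 'a J_elem \<Rightarrow> 'a J_elem" where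
  "chi_product M \<chi> g h x y = mu g (J M (g \<bullet> h)) (\<chi> g h (ptensor R (J M g) (J M h) x y))"

lemma chi_familyD: "chi_family M \<chi> \<Longrightarrow> g \<in> carrier G \<Longrightarrow> h \<in> carrier G \<Longrightarrow>
    \<chi> g h \<in> bimod_iso R (J M g \<boxtimes> J M h) (D_bimodule g \<boxtimes> J M (g \<bullet> h))"
  by (simp add: chi_family_def)

text \<open>
  The twisted linearity in the second variable is the balancing relation of \<open>J\<^sub>g \<otimes>
  J\<^sub>h\<close>. The values span \<open>1\<^sub>g J\<^bsub>gh\<^esub>\<close> because
  \<open>\<chi>\<^bsub>g,h\<^esub>\<close> is surjective.
\<close>

lemma crossed_system_chi:
  assumes M: "rank_one_family M" and \<chi>: "chi_family M \<chi>"
  shows "crossed_system (J M) (chi_product M \<chi>)"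
proof -
  have main: "bilinear_map R (act g) (J M g) (J M h) (J M (g \<bullet> h)) (chi_product M \<chi> g h) \<and>
      R.spans (J M (g \<bullet> h)) (\<epsilon> g) (values_of (J M g) (J M h) (chi_product M \<chi> g h))"
    if g: "g \<in> carrier G" and h: "h \<in> carrier G" for g h
  proof -
    have gh: "g \<bullet> h \<in> carrier G" using g h by simp
    let ?A = "J M g" and ?B = "J M h" and ?K = "J M (g \<bullet> h)" and ?b = "chi_product M \<chi> g h"
    note KB = J_bimodule[OF M gh] and X = chi_familyD[OF \<chi> g h]
    interpret T: tensor_product R ?A ?B using J_bimodule[OF M] g h by unfold_locales auto
    interpret K: module R ?K by (rule bimoduleD(1)[OF KB])
    define E where "E t = mu g ?K (\<chi> g h t)" for t
    have E: "E \<in> mod_hom R T.T ?K"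
      unfolding E_def by (rule mod_hom_compose[OF bimod_hom_mod_hom[OF bimod_iso_hom[OF X]] mu_hom[OF g KB]])
    note H = mod_homD[OF E]
    have b: "?b x y = E (T.pt x y)" for x y by (simp add: chi_product_def E_def)
    have r: "T.pt (act g r \<odot>\<^bsub>?A\<^esub> x) y = T.pt x (r \<odot>\<^bsub>?B\<^esub> y)" if "x \<in> carrier ?A" "r \<in> carrier R" "y \<in> carrier ?B" for x r y
      using T.pt_balanced[OF that] J_rsmult[OF M g that(1,2)] by simp
    have bil: "bilinear_map R (act g) ?A ?B ?K ?b"
      by (rule bilinear_mapI) (auto simp: b H T.pt_add_left T.pt_add_right r[symmetric] g simp flip: T.smult_pt)
    have sp: "R.spans ?K (\<epsilon> g) (values_of ?A ?B ?b)"
      unfolding R.spans_def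
    proof (intro conjI ballI)
      show "values_of ?A ?B ?b \<subseteq> carrier ?K" by (rule values_of_closed[OF bil])
      fix s assume "s \<in> values_of ?A ?B ?b"
      then show "\<epsilon> g \<odot>\<^bsub>?K\<^esub> s = s"
        using mu_support[OF g KB] mod_homD(1)[OF bimod_hom_mod_hom[OF bimod_iso_hom[OF X]]] by (auto simp: values_of_def b E_def)
    next
      fix z assume z: "z \<in> carrier ?K"
      interpret U: tensor_product R "D_bimodule g" ?K using D_bimodule_bimodule[OF g] KB by unfold_locales
      have "\<epsilon> g \<in> D g" using g by (simp add: D_iff eps)
      then have u: "U.pt (\<epsilon> g) z \<in> carrier U.T" "mu g ?K (U.pt (\<epsilon> g) z) = \<epsilon> g \<odot>\<^bsub>?K\<^esub> z"
        using z mu_pt[OF g KB] by auto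
      note s = bimod_iso_solve[OF X u(1)]
      have "E t \<in> additive_span ?K (values_of ?A ?B ?b)" if "t \<in> carrier T.T" for t
        using that
      proof (induction rule: T.tensor_induct)
        case (pt x y)
        then show ?case by (subst b[symmetric]) (rule additive_span.gen[OF values_ofI])
      qed (simp add: H additive_span.add)
      from this[OF s(1)] show "\<epsilon> g \<odot>\<^bsub>?K\<^esub> z \<in> additive_span ?K (values_of ?A ?B ?b)"
        using s(2) u(2) by (simp add: E_def)
    qed
    show ?thesis using bil sp by blast
  qed
  show ?thesis unfolding crossed_system_def using main J_rank_one[OF M] by blast
qed

text \<open>
  Each of the threefold tensor products in the composite is mapped to \<open>J\<^bsub>ghl\<^esub>\<close> by
  multiplying its factors, and each step of the composite is compatible with these maps, except for one: between
  \<open>J\<^sub>g \<otimes> (J\<^sub>h \<otimes> J\<^sub>l)\<close> and \<open>(J\<^sub>g \<otimes> J\<^sub>h)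
  \<otimes> J\<^sub>l\<close> the bracketing of the product changes, which introduces the factor
  \<open>w(g,h,l)\<close>. As the multiplication map is injective on \<open>D\<^sub>g \<otimes> (D\<^bsub>gh\<^esub>
  \<otimes> J\<^bsub>ghl\<^esub>)\<close>, the composite is determined.
\<close>

lemma omega_tilde_defect:
  assumes M: "rank_one_family M" and \<chi>: "chi_family M \<chi>" and w: "defect (J M) (chi_product M \<chi>) w"
    and g: "g \<in> carrier G" and h: "h \<in> carrier G" and l: "l \<in> carrier G"
    and z: "z \<in> carrier (D_bimodule g \<boxtimes> D_bimodule (g \<bullet> h) \<boxtimes> J M (g \<bullet> h \<bullet> l))"
  shows "omega_tilde M \<chi> g h l z =
    w [g, h, l] \<odot>\<^bsub>D_bimodule g \<boxtimes> D_bimodule (g \<bullet> h) \<boxtimes> J M (g \<bullet> h \<bullet> l)\<^esub> z"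
proof -
  let ?gh = "g \<bullet> h" and ?hl = "h \<bullet> l"
  have gh: "?gh \<in> carrier G" and hl: "?hl \<in> carrier G" and k: "?gh \<bullet> l \<in> carrier G"
    and as: "g \<bullet> ?hl = ?gh \<bullet> l"
    using g h l by (auto simp: G.m_assoc)
  let ?Dg = "D_bimodule g" and ?Dh = "D_bimodule h" and ?Dgh = "D_bimodule ?gh"
  let ?Jg = "J M g" and ?Jh = "J M h" and ?Jl = "J M l" and ?Jgh = "J M ?gh" and ?Jhl = "J M ?hl" and ?K = "J M (?gh \<bullet> l)"
  let ?V = "?Dg \<boxtimes> ?Dgh \<boxtimes> ?K"
  note B = J_bimodule[OF M] and DB = D_bimodule_bimodule
  note bm = B[OF g] B[OF h] B[OF l] B[OF gh] B[OF hl] B[OF k] DB[OF g] DB[OF h] DB[OF gh]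
  interpret T1: tensor_triple R ?Jg ?Jh ?Jl by unfold_locales (rule bm)+
  interpret T2: tensor_triple R ?Jg ?Dh ?Jhl by unfold_locales (rule bm)+
  interpret T3: tensor_triple R ?Dgh ?Jg ?Jhl by unfold_locales (rule bm)+
  interpret T4: tensor_triple R ?Dgh ?Dg ?K by unfold_locales (rule bm)+
  interpret T5: tensor_triple R ?Dg ?Dgh ?K by unfold_locales (rule bm)+
  interpret T6: tensor_triple R ?Dg ?Jgh ?Jl by unfold_locales (rule bm)+
  interpret K: module R ?K by (rule bimoduleD(1)[OF B[OF k]])
  note tb = T1.AB.tensor_bimodule T1.BC.tensor_bimodule T2.AB.tensor_bimodule T2.BC.tensor_bimodule T3.AB.tensor_bimodule
    T3.BC.tensor_bimodule T4.AB.tensor_bimodule T4.BC.tensor_bimodule T5.AB.tensor_bimodule T5.BC.tensor_bimodule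
    T6.AB.tensor_bimodule T6.BC.tensor_bimodule
  note X = chi_familyD[OF \<chi> g h] chi_familyD[OF \<chi> h l] chi_familyD[OF \<chi> gh l] chi_familyD[OF \<chi> g hl, unfolded as]
  note XH = X[THEN bimod_iso_hom]
  note Xc = XH[THEN bimod_hom_mod_hom, THEN mod_homD(1)]
  note ka = kappa_iso[OF M g h] and fl = flip_iso(1)[OF gh g]
  let ?m4 = "tensor_map R ?Dg (?Jgh \<boxtimes> ?Jl) ?Dg (?Dgh \<boxtimes> ?K) id (\<chi> ?gh l)"
  let ?m3 = "tensor_map R (?Jg \<boxtimes> ?Jh) ?Jl (?Dg \<boxtimes> ?Jgh) ?Jl (\<chi> g h) id"
  let ?m2 = "tensor_map R ?Dgh (?Jg \<boxtimes> ?Jhl) ?Dgh (?Dg \<boxtimes> ?K) id (\<chi> g ?hl)"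
  let ?m1 = "tensor_map R ?Jg (?Jh \<boxtimes> ?Jl) ?Jg (?Dh \<boxtimes> ?Jhl) id (\<chi> h l)"
  let ?kk = "tensor_map R (?Jg \<boxtimes> ?Dh) ?Jhl (?Dgh \<boxtimes> ?Jg) ?Jhl (kappa M g h) id"
  let ?f = "tensor_map R (?Dgh \<boxtimes> ?Dg) ?K (?Dg \<boxtimes> ?Dgh) ?K (flip ?gh g) id"
  note i4 = tensor_map_iso[OF bm(7) tb(12) bm(7) tb(10) bimod_iso_id X(3)]
  note i3 = tensor_map_iso[OF tb(1) bm(3) tb(11) bm(3) X(1) bimod_iso_id]
  note i2 = tensor_map_iso[OF bm(9) tb(6) bm(9) tb(8) bimod_iso_id X(4)]
  note i1 = tensor_map_iso[OF bm(1) tb(2) bm(1) tb(4) bimod_iso_id X(2)]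
  note ik = tensor_map_iso[OF tb(3) bm(5) tb(5) bm(5) ka bimod_iso_id]
  note jf = tensor_map_iso[OF tb(7) bm(6) tb(9) bm(6) fl bimod_iso_id]
  note p4 = tensor_map_pt[OF bm(7) tb(12) bm(7) tb(10) bimod_hom_id XH(3)]
  note p3 = tensor_map_pt[OF tb(1) bm(3) tb(11) bm(3) XH(1) bimod_hom_id]
  note p2 = tensor_map_pt[OF bm(9) tb(6) bm(9) tb(8) bimod_hom_id XH(4)]
  note p1 = tensor_map_pt[OF bm(1) tb(2) bm(1) tb(4) bimod_hom_id XH(2)]
  note pk = tensor_map_pt[OF tb(3) bm(5) tb(5) bm(5) bimod_iso_hom[OF ka] bimod_hom_id]
  note pf = tensor_map_pt[OF tb(7) bm(6) tb(9) bm(6) bimod_iso_hom[OF fl] bimod_hom_id]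
  note ad = i4[THEN bimod_iso_additive] i3[THEN bimod_iso_additive] i2[THEN bimod_iso_additive] i1[THEN bimod_iso_additive]
    ik[THEN bimod_iso_additive] jf[THEN bimod_iso_additive]
  note aa = T1.assoc_iso[THEN bimod_iso_additive] T2.assoc_iso[THEN bimod_iso_additive] T3.assoc_iso[THEN bimod_iso_additive]
    T4.assoc_iso[THEN bimod_iso_additive] T5.assoc_iso[THEN bimod_iso_additive] T6.assoc_iso[THEN bimod_iso_additive]
  let ?b = "chi_product M \<chi>"
  note cs = crossed_system_chi[OF M \<chi>]
  note bl = crossed_systemD(3)[OF cs, THEN bilinear_mapD(1)] crossed_systemD(3)[OF cs, THEN bilinear_mapD(2)]
    crossed_systemD(3)[OF cs, THEN bilinear_mapD(3)] crossed_systemD(3)[OF cs, THEN bilinear_mapD(4)] crossed_systemD(3)[OF cs, THEN bilinear_mapD(5)]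
  have bgk: "bilinear_map R (act g) ?Jg ?Jhl ?K (?b g ?hl)" using crossed_systemD(3)[OF cs g hl] as by simp
  note bg = bilinear_mapD[OF bgk]
  have wc: "w [g, h, l] \<in> carrier R" using defectD(1)[OF w] cochainD(1)[of w 3 "[g, h, l]"] g h l by simp
  \<comment> \<open>every threefold product is compared with \<open>J\<^bsub>ghl\<^esub>\<close> by multiplying its factors together\<close>
  define \<nu> where "\<nu> t = mu ?gh ?K (mu g (?Dgh \<boxtimes> ?K) t)" for t
  define \<nu>' where "\<nu>' t = mu g ?K (mu ?gh (?Dg \<boxtimes> ?K) t)" for t
  define F where "F = tensor_lift R ?Jg (?Dh \<boxtimes> ?Jhl) (additive_group ?K) (\<lambda>x t. ?b g ?hl x (mu h ?Jhl t))"
  have nu: "\<nu> \<in> mod_hom R ?V ?K" and nu': "\<nu>' \<in> mod_hom R (?Dgh \<boxtimes> ?Dg \<boxtimes> ?K) ?K"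
    unfolding \<nu>_def \<nu>'_def
    by (rule mod_hom_compose[OF mu_hom[OF g tb(10)] mu_hom[OF gh bm(6)]])
      (rule mod_hom_compose[OF mu_hom[OF gh tb(8)] mu_hom[OF g bm(6)]])
  note muh = mod_homD[OF mu_hom[OF h bm(5)]]
  have F_bal: "balanced R ?Jg (?Dh \<boxtimes> ?Jhl) ?K (\<lambda>x t. ?b g ?hl x (mu h ?Jhl t))"
    using g by (auto simp: balanced_def muh bg J_rsmult[OF M])
  note F = T2.U.lift_additive[OF K.M.abelian_group_axioms F_bal, folded F_def]
    T2.U.lift_pt[OF K.M.abelian_group_axioms F_bal, folded F_def]
  have Dc: "d \<in> carrier R" if "d \<in> D g \<or> d \<in> D ?gh \<or> d \<in> D h" for d using that g gh h by (auto simp: D_iff)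
  have A: "\<nu> (tensor_assoc R ?Dg ?Dgh ?K (?f t)) = \<nu>' (tensor_assoc R ?Dgh ?Dg ?K t)"
    if t: "t \<in> carrier ((?Dgh \<boxtimes> ?Dg) \<boxtimes> ?K)" for t
  proof (rule T4.triple_left_eqI[OF _ _ _ t])
    show "additive_map ((?Dgh \<boxtimes> ?Dg) \<boxtimes> ?K) ?K (\<lambda>t. \<nu> (tensor_assoc R ?Dg ?Dgh ?K (?f t)))"
      by (rule additive_map_comp[OF additive_map_comp[OF ad(6) aa(5)] mod_hom_additive[OF nu]])
    show "additive_map ((?Dgh \<boxtimes> ?Dg) \<boxtimes> ?K) ?K (\<lambda>t. \<nu>' (tensor_assoc R ?Dgh ?Dg ?K t))"
      by (rule additive_map_comp[OF aa(4) mod_hom_additive[OF nu']])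
    fix d' d x assume "d' \<in> carrier ?Dgh" "d \<in> carrier ?Dg" and x: "x \<in> carrier ?K"
    then have d: "d' \<in> D ?gh" "d \<in> D g" by auto
    have "\<nu> (tensor_assoc R ?Dg ?Dgh ?K (?f (T4.L.pt (T4.AB.pt d' d) x))) = d \<odot>\<^bsub>?K\<^esub> (d' \<odot>\<^bsub>?K\<^esub> x)"
      using d x Dc mod_homD(3)[OF mu_hom[OF gh bm(6)]]
      by (simp add: pf flip_iso(2)[OF gh g] T5.assoc_pt \<nu>_def mu_pt[OF g tb(10)] mu_pt[OF gh bm(6)])
    also have "\<dots> = d' \<odot>\<^bsub>?K\<^esub> (d \<odot>\<^bsub>?K\<^esub> x)" using d x Dc by (simp add: R.m_comm flip: K.smult_assoc1)
    also have "\<dots> = \<nu>' (tensor_assoc R ?Dgh ?Dg ?K (T4.L.pt (T4.AB.pt d' d) x))"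
      using d x Dc mod_homD(3)[OF mu_hom[OF g bm(6)]]
      by (simp add: T4.assoc_pt \<nu>'_def mu_pt[OF gh tb(8)] mu_pt[OF g bm(6)])
    finally show "\<nu> (tensor_assoc R ?Dg ?Dgh ?K (?f (T4.L.pt (T4.AB.pt d' d) x))) =
      \<nu>' (tensor_assoc R ?Dgh ?Dg ?K (T4.L.pt (T4.AB.pt d' d) x))" .
  qed
  have Bq: "\<nu>' (?m2 (tensor_assoc R ?Dgh ?Jg ?Jhl (T3.L.pt (T3.AB.pt d x) v))) = d \<odot>\<^bsub>?K\<^esub> ?b g ?hl x v"
    if "d \<in> D ?gh" "x \<in> carrier ?Jg" "v \<in> carrier ?Jhl" for d x v
    using that Dc mod_homD(3)[OF mu_hom[OF g bm(6)]] Xc(4)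
    by (simp add: T3.assoc_pt p2 \<nu>'_def mu_pt[OF gh tb(8)] chi_product_def as)
  have C: "\<nu>' (?m2 (tensor_assoc R ?Dgh ?Jg ?Jhl (?kk t))) = F (tensor_assoc R ?Jg ?Dh ?Jhl t)"
    if t: "t \<in> carrier ((?Jg \<boxtimes> ?Dh) \<boxtimes> ?Jhl)" for t
  proof (rule T2.triple_left_eqI[OF _ _ _ t])
    show "additive_map ((?Jg \<boxtimes> ?Dh) \<boxtimes> ?Jhl) ?K (\<lambda>t. \<nu>' (?m2 (tensor_assoc R ?Dgh ?Jg ?Jhl (?kk t))))"
      by (rule additive_map_comp[OF additive_map_comp[OF additive_map_comp[OF ad(5) aa(3)] ad(3)] mod_hom_additive[OF nu']])
    show "additive_map ((?Jg \<boxtimes> ?Dh) \<boxtimes> ?Jhl) ?K (\<lambda>t. F (tensor_assoc R ?Jg ?Dh ?Jhl t))"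
      by (rule additive_map_comp[OF aa(2) F(1)])
    fix x d v assume x: "x \<in> carrier ?Jg" and "d \<in> carrier ?Dh" and v: "v \<in> carrier ?Jhl"
    then have d: "d \<in> D h" "d \<in> carrier R" using Dc by auto
    have "act g d \<in> D ?gh"
    proof -
      have "\<epsilon> ?gh \<star> act g (\<epsilon> h \<star> d) = act g (\<epsilon> h \<star> d)"
        using g h gh d eps_support[OF gh, of "act g d"] by (simp add: act_mult act_eps eps eps_act R.m_ac)
      then show ?thesis using d h gh g by (simp add: D_iff)
    qed
    then show "\<nu>' (?m2 (tensor_assoc R ?Dgh ?Jg ?Jhl (?kk (T2.L.pt (T2.AB.pt x d) v)))) =
      F (tensor_assoc R ?Jg ?Dh ?Jhl (T2.L.pt (T2.AB.pt x d) v))"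
      using x d v by (simp add: pk kappa_pt[OF M g h] Bq T2.assoc_pt F(2) mu_pt[OF h bm(5)] bg)
  qed
  have Q: "\<nu> (?m4 (tensor_assoc R ?Dg ?Jgh ?Jl (T6.L.pt s y))) = ?b ?gh l (mu g ?Jgh s) y"
    if s: "s \<in> carrier (?Dg \<boxtimes> ?Jgh)" and y: "y \<in> carrier ?Jl" for s y
  proof (rule T6.AB.additive_map_eqI[OF _ _ s])
    have "additive_map (?Dg \<boxtimes> ?Jgh) ((?Dg \<boxtimes> ?Jgh) \<boxtimes> ?Jl) (\<lambda>s. T6.L.pt s y)"
      using y by (simp add: additive_map_def T6.L.pt_add_left)
    then show "additive_map (?Dg \<boxtimes> ?Jgh) ?K (\<lambda>s. \<nu> (?m4 (tensor_assoc R ?Dg ?Jgh ?Jl (T6.L.pt s y))))"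
      by (rule additive_map_comp[OF additive_map_comp[OF additive_map_comp[OF _ aa(6)] ad(1)] mod_hom_additive[OF nu]])
    have "additive_map ?Jgh ?K (\<lambda>x. ?b ?gh l x y)" using y gh l by (simp add: additive_map_def bl)
    then show "additive_map (?Dg \<boxtimes> ?Jgh) ?K (\<lambda>s. ?b ?gh l (mu g ?Jgh s) y)"
      by (rule additive_map_comp[OF mod_hom_additive[OF mu_hom[OF g bm(4)]]])
    fix d x assume "d \<in> carrier ?Dg" and x: "x \<in> carrier ?Jgh"
    then have d: "d \<in> D g" by simp
    then show "\<nu> (?m4 (tensor_assoc R ?Dg ?Jgh ?Jl (T6.L.pt (T6.AB.pt d x) y))) = ?b ?gh l (mu g ?Jgh (T6.AB.pt d x)) y"
      using x y Dc mod_homD(3)[OF mu_hom[OF gh bm(6)]] Xc(3) gh l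
      by (simp add: T6.assoc_pt p4 \<nu>_def mu_pt[OF g tb(10)] mu_pt[OF g bm(4)] chi_product_def bl(4)[unfolded chi_product_def])
  qed
  have W: "\<nu> (?m4 (tensor_assoc R ?Dg ?Jgh ?Jl (?m3 u))) = w [g, h, l] \<odot>\<^bsub>?K\<^esub> F (?m1 (tensor_assoc R ?Jg ?Jh ?Jl u))"
    if u: "u \<in> carrier ((?Jg \<boxtimes> ?Jh) \<boxtimes> ?Jl)" for u
  proof (rule T1.triple_left_eqI[OF _ _ _ u])
    show "additive_map ((?Jg \<boxtimes> ?Jh) \<boxtimes> ?Jl) ?K (\<lambda>u. \<nu> (?m4 (tensor_assoc R ?Dg ?Jgh ?Jl (?m3 u))))"
      by (rule additive_map_comp[OF additive_map_comp[OF additive_map_comp[OF ad(2) aa(6)] ad(1)] mod_hom_additive[OF nu]])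
    have "additive_map ?K ?K (\<lambda>v. w [g, h, l] \<odot>\<^bsub>?K\<^esub> v)" using wc by (simp add: additive_map_def K.smult_r_distr)
    then show "additive_map ((?Jg \<boxtimes> ?Jh) \<boxtimes> ?Jl) ?K (\<lambda>u. w [g, h, l] \<odot>\<^bsub>?K\<^esub> F (?m1 (tensor_assoc R ?Jg ?Jh ?Jl u)))"
      by (rule additive_map_comp[OF additive_map_comp[OF additive_map_comp[OF aa(1) ad(4)] F(1)]])
    fix x y v assume c: "x \<in> carrier ?Jg" "y \<in> carrier ?Jh" "v \<in> carrier ?Jl"
    have "\<nu> (?m4 (tensor_assoc R ?Dg ?Jgh ?Jl (?m3 (T1.L.pt (T1.AB.pt x y) v)))) = ?b ?gh l (?b g h x y) v"
      using c Xc(1) by (simp add: p3 Q chi_product_def)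
    also have "\<dots> = w [g, h, l] \<odot>\<^bsub>?K\<^esub> ?b g ?hl x (?b h l y v)"
      using defectD(2)[OF w g h l c] as by simp
    also have "?b g ?hl x (?b h l y v) = F (?m1 (tensor_assoc R ?Jg ?Jh ?Jl (T1.L.pt (T1.AB.pt x y) v)))"
      using c Xc(2) by (simp add: T1.assoc_pt p1 F(2) chi_product_def)
    finally show "\<nu> (?m4 (tensor_assoc R ?Dg ?Jgh ?Jl (?m3 (T1.L.pt (T1.AB.pt x y) v)))) =
      w [g, h, l] \<odot>\<^bsub>?K\<^esub> F (?m1 (tensor_assoc R ?Jg ?Jh ?Jl (T1.L.pt (T1.AB.pt x y) v)))" .
  qed
  have clo: "f y \<in> carrier N" if "f \<in> bimod_iso R A N" "y \<in> carrier A"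
    for A :: "('a, 'm) bimodule" and N :: "('a, 'n) bimodule" and f y
    using bimod_iso_additive[OF that(1)] that(2) by (simp add: additive_map_def)
  define z1 where "z1 = inv_into (carrier ((?Dg \<boxtimes> ?Dgh) \<boxtimes> ?K)) (tensor_assoc R ?Dg ?Dgh ?K) z"
  define z2 where "z2 = inv_into (carrier ((?Dgh \<boxtimes> ?Dg) \<boxtimes> ?K)) ?f z1"
  define z3 where "z3 = inv_into (carrier (?Dgh \<boxtimes> ?Jg \<boxtimes> ?Jhl)) ?m2 (tensor_assoc R ?Dgh ?Dg ?K z2)"
  define z4 where "z4 = inv_into (carrier ((?Dgh \<boxtimes> ?Jg) \<boxtimes> ?Jhl)) (tensor_assoc R ?Dgh ?Jg ?Jhl) z3"
  define z5 where "z5 = inv_into (carrier ((?Jg \<boxtimes> ?Dh) \<boxtimes> ?Jhl)) ?kk z4"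
  define z6 where "z6 = inv_into (carrier (?Jg \<boxtimes> ?Jh \<boxtimes> ?Jl)) ?m1 (tensor_assoc R ?Jg ?Dh ?Jhl z5)"
  define z7 where "z7 = inv_into (carrier ((?Jg \<boxtimes> ?Jh) \<boxtimes> ?Jl)) (tensor_assoc R ?Jg ?Jh ?Jl) z6"
  note s1 = bimod_iso_solve[OF T5.assoc_iso z, folded z1_def]
  note s2 = bimod_iso_solve[OF jf s1(1), folded z2_def]
  note s3 = bimod_iso_solve[OF i2 clo[OF T4.assoc_iso s2(1)], folded z3_def]
  note s4 = bimod_iso_solve[OF T3.assoc_iso s3(1), folded z4_def]
  note s5 = bimod_iso_solve[OF ik s4(1), folded z5_def]
  note s6 = bimod_iso_solve[OF i1 clo[OF T2.assoc_iso s5(1)], folded z6_def]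
  note s7 = bimod_iso_solve[OF T1.assoc_iso s6(1), folded z7_def]
  have om: "omega_tilde M \<chi> g h l z = ?m4 (tensor_assoc R ?Dg ?Jgh ?Jl (?m3 z7))"
    by (simp add: omega_tilde_def Let_def z1_def z2_def z3_def z4_def z5_def z6_def z7_def)
  have omc: "omega_tilde M \<chi> g h l z \<in> carrier ?V"
    unfolding om by (rule clo[OF i4 clo[OF T6.assoc_iso clo[OF i3 s7(1)]]])
  have "\<nu> z = \<nu>' (tensor_assoc R ?Dgh ?Dg ?K z2)" using A[OF s2(1)] s2(2) s1(2) by simp
  also have "\<dots> = F (tensor_assoc R ?Jg ?Dh ?Jhl z5)" using C[OF s5(1)] s5(2) s4(2) s3(2) by simp
  finally have "\<nu> (omega_tilde M \<chi> g h l z) = w [g, h, l] \<odot>\<^bsub>?K\<^esub> \<nu> z"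
    using W[OF s7(1)] s7(2) s6(2) om by simp
  also have "\<dots> = \<nu> (w [g, h, l] \<odot>\<^bsub>?V\<^esub> z)" using mod_homD(3)[OF nu wc z] by simp
  finally have eq: "\<nu> (omega_tilde M \<chi> g h l z) = \<nu> (w [g, h, l] \<odot>\<^bsub>?V\<^esub> z)" .
  have c: "w [g, h, l] \<odot>\<^bsub>?V\<^esub> z \<in> carrier ?V" by (rule T5.U.smult_closed[OF wc z])
  note mc = mod_homD(1)[OF mu_hom[OF g tb(10)]]
  show ?thesis
    by (rule mu_inj[OF g tb(10) omc c], rule mu_inj[OF gh bm(6) mc[OF omc] mc[OF c]]) (use eq in \<open>simp add: \<nu>_def\<close>)
qed

end

section \<open>Existence of representatives and isomorphisms\<close>

lemma mod_iso_byWitness: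
  assumes "f \<in> mod_hom R M N" "g \<in> mod_hom R N M"
    "\<And>x. x \<in> carrier M \<Longrightarrow> g (f x) = x" "\<And>y. y \<in> carrier N \<Longrightarrow> f (g y) = y"
  shows "f \<in> mod_iso R M N"
  using assms mod_homD(1)[OF assms(1)] mod_homD(1)[OF assms(2)]
  by (auto simp: mod_iso_def intro!: bij_betw_byWitness[where f' = g])

context unital_partial_action
begin

text \<open>
  The scalar is unique because multiplying out \<open>1\<^sub>g \<otimes> (1\<^bsub>gh\<^esub> \<otimes> x)\<close>
  reduces the question to the faithful action on the rank one module \<open>J\<^bsub>ghl\<^esub>\<close>.
\<close>

lemma omega_eq:
  assumes M: "rank_one_family M" and \<chi>: "chi_family M \<chi>" and w: "defect (J M) (chi_product M \<chi>) w"
  shows "omega M \<chi> = w"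
proof (rule extensionalityI[of _ "tuples 3"])
  note wc = defectD(1)[OF w]
  show "omega M \<chi> \<in> extensional (tuples 3)" "w \<in> extensional (tuples 3)"
    using wc by (auto simp: omega_def cochains_iff)
  fix gs assume gs: "gs \<in> tuples 3"
  show "omega M \<chi> gs = w gs"
  proof -
    obtain g h l where 1: "gs = [g, h, l]" and g: "g \<in> carrier G" and h: "h \<in> carrier G" and l: "l \<in> carrier G"
      using gs by (rule tuplesE(2))
    let ?gh = "g \<bullet> h" and ?e = "eps_tuple [g, h, l]"
    let ?K = "J M (g \<bullet> h \<bullet> l)"
    let ?W = "D_bimodule ?gh \<boxtimes> ?K" let ?V = "D_bimodule g \<boxtimes> ?W"
    have gh: "?gh \<in> carrier G" and k: "?gh \<bullet> l \<in> carrier G" using g h l by auto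
    have e: "\<epsilon> g \<in> carrier R" "\<epsilon> ?gh \<in> carrier R" "\<epsilon> (?gh \<bullet> l) \<in> carrier R" using g gh k by (auto intro: eps)
    note KB = J_bimodule[OF M k]
    interpret W: tensor_product R "D_bimodule ?gh" ?K using D_bimodule_bimodule[OF gh] KB by unfold_locales
    interpret V: tensor_product R "D_bimodule g" ?W using D_bimodule_bimodule[OF g] W.tensor_bimodule by unfold_locales
    interpret K: module R ?K by (rule bimoduleD(1)[OF KB])
    have U: "w [g, h, l] \<in> Units (corner R ?e)" using wc gs 1 by (auto simp: cochains_iff)
    have ec: "?e \<in> carrier R" "?e \<star> ?e = ?e" using eps_tuple_closed[OF gs] 1 by auto
    note UD = R.Units_corner_iff[OF ec]
    have unique: "u = w [g, h, l]"
      if u: "u \<in> Units (corner R ?e)" and eq: "\<forall>z\<in>carrier ?V. omega_tilde M \<chi> g h l z = u \<odot>\<^bsub>?V\<^esub> z" for u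
    proof -
      have uc: "u \<in> carrier R" "w [g, h, l] \<in> carrier R" using u U UD by auto
      have key: "(u \<star> (\<epsilon> g \<star> \<epsilon> ?gh)) \<star> \<epsilon> (?gh \<bullet> l) = (w [g, h, l] \<star> (\<epsilon> g \<star> \<epsilon> ?gh)) \<star> \<epsilon> (?gh \<bullet> l)"
      proof (rule R.rank_one_faithful[OF J_rank_one[OF M k]])
        fix x assume x: "x \<in> carrier ?K"
        let ?z = "V.pt (\<epsilon> g) (W.pt (\<epsilon> ?gh) x)"
        have d: "\<epsilon> g \<in> D g" "\<epsilon> ?gh \<in> D ?gh" using g gh by (auto simp: D_iff eps)
        then have z: "?z \<in> carrier ?V" "W.pt (\<epsilon> ?gh) x \<in> carrier ?W" using x by auto
        have \<nu>: "mu ?gh ?K (mu g ?W (r \<odot>\<^bsub>?V\<^esub> ?z)) = (r \<star> (\<epsilon> g \<star> \<epsilon> ?gh)) \<odot>\<^bsub>?K\<^esub> x" if r: "r \<in> carrier R" for r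
          using r x z d e mod_homD[OF mu_hom[OF g W.tensor_bimodule]] mod_homD[OF mu_hom[OF gh KB]]
          by (simp add: mu_pt[OF g W.tensor_bimodule] mu_pt[OF gh KB] K.smult_assoc1 W.smult_closed)
        have "u \<odot>\<^bsub>?V\<^esub> ?z = w [g, h, l] \<odot>\<^bsub>?V\<^esub> ?z" using eq z(1) omega_tilde_defect[OF M \<chi> w g h l z(1)] by auto
        then show "(u \<star> (\<epsilon> g \<star> \<epsilon> ?gh)) \<odot>\<^bsub>?K\<^esub> x = (w [g, h, l] \<star> (\<epsilon> g \<star> \<epsilon> ?gh)) \<odot>\<^bsub>?K\<^esub> x"
          using \<nu>[OF uc(1)] \<nu>[OF uc(2)] by simp
      qed (use uc e in auto)
      have "?e \<star> u = ?e \<star> w [g, h, l]"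
        using key uc e g h l by (simp add: eps_tuple_simps G.m_assoc[symmetric] R.m_ac)
      then show ?thesis using u U UD by auto
    qed
    have "(THE u. u \<in> Units (corner R ?e) \<and> (\<forall>z\<in>carrier ?V. omega_tilde M \<chi> g h l z = u \<odot>\<^bsub>?V\<^esub> z)) = w [g, h, l]"
      by (rule the_equality, intro conjI ballI U omega_tilde_defect[OF M \<chi> w g h l]) (auto intro: unique)
    then show ?thesis using gs 1 by (simp add: omega_def Let_def)
  qed
qed

lemma representatives_rank_one:
  assumes f: "f \<in> carrier Z1" and M: "representatives f M" shows "rank_one_family M"
  unfolding rank_one_family_def
proof
  fix g assume g: "g \<in> carrier G"
  have "picS_module R (M g)" using M g by (simp add: representatives_def)
  then obtain e where e: "rank_one R (M g) e" using R.picS_module_rank_one by blast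
  have "f g = iso_class R (M g)" using M g by (simp add: representatives_def)
  then have "e = \<epsilon> g" using R.line_class_support_unique R.iso_class_line[OF e] f g by (auto simp: Z1_iff)
  then show "rank_one R (M g) (\<epsilon> g)" using e by simp
qed

lemma representatives_exist:
  assumes f: "f \<in> carrier Z1" obtains M where "representatives f M"
proof -
  have "\<exists>E :: 'a small_module. picS_module R E \<and> f g = iso_class R E" if "g \<in> carrier G" for g
    using f that R.rank_one_picS_module by (auto simp: Z1_iff line_classes_def) blast
  then show ?thesis using that unfolding representatives_def by metis
qed

text \<open>
  Under \<open>J\<^sub>g \<cong> M\<^sub>g\<close> and \<open>J\<^sub>h \<cong> M\<^sub>h\<close>, the twisted right
  action on \<open>J\<^sub>g\<close> becomes the twist of \<open>M\<^sub>h\<close> by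
  \<open>\<alpha>\<^sub>g\<close>.
\<close>

lemma J_product_iso:
  assumes M: "rank_one_family M" and g: "g \<in> carrier G" and h: "h \<in> carrier G"
  shows "\<exists>\<Phi>. \<Phi> \<in> mod_iso R (J M g \<boxtimes> J M h) (central (M g) \<boxtimes> central (tw g (M h)))"
proof -
  let ?A = "J M g" and ?B = "J M h" and ?E = "M g" and ?F = "tw g (M h)" and ?u = "\<epsilon> g\<^sup>-"
  have gi: "g\<^sup>- \<in> carrier G" using g by simp
  note e = eps[OF g] eps[OF gi]
  interpret E: module R ?E by (rule R.rank_one_module[OF rank_one_familyD[OF M g]])
  interpret H: module R "M h" by (rule R.rank_one_module[OF rank_one_familyD[OF M h]])
  interpret c: corner_iso R ?u "\<epsilon> g" "act g" "act g\<^sup>-" by (rule corner_iso_act[OF g])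
  have F: "module R ?F" by (rule c.transport_module_module[OF H.module_axioms])
  interpret S: tensor_product R ?A ?B using J_bimodule[OF M] g h by unfold_locales auto
  interpret T: tensor_product R "central ?E" "central ?F" by (rule R.tensor_central[OF E.module_axioms F])
  interpret A: module R ?A by (rule S.MD(1))
  let ?j = "jmap M g" and ?k = "jmap M h"
  let ?j' = "inv_into (carrier ?A) ?j" and ?k' = "inv_into (carrier ?B) ?k"
  note ji = jmap_iso[OF M g] jmap_iso[OF M h]
  note j = mod_homD[OF mod_iso_imp_hom[OF ji(1)]] and k = mod_homD[OF mod_iso_imp_hom[OF ji(2)]]
  note j' = mod_homD[OF mod_iso_imp_hom[OF mod_iso_inv[OF ji(1) S.MD(1)]]]
  note k' = mod_homD[OF mod_iso_imp_hom[OF mod_iso_inv[OF ji(2) S.ND(1)]]]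
  have bij: "bij_betw ?j (carrier ?A) (carrier ?E)" "bij_betw ?k (carrier ?B) (carrier (M h))" using ji by (auto simp: mod_iso_def)
  note inv = bij_betw_inv_into_left[OF bij(1)] bij_betw_inv_into_right[OF bij(1)] bij_betw_inv_into_left[OF bij(2)] bij_betw_inv_into_right[OF bij(2)]
  have Spt: "S.pt (act g r \<odot>\<^bsub>?A\<^esub> x) y = S.pt x (r \<odot>\<^bsub>?B\<^esub> y)" if "x \<in> carrier ?A" "r \<in> carrier R" "y \<in> carrier ?B" for x r y
    using S.pt_balanced[OF that] J_rsmult[OF M g that(1,2)] by simp
  have Tpt: "T.pt (r \<odot>\<^bsub>?E\<^esub> x) y = T.pt x (act g\<^sup>- r \<odot>\<^bsub>M h\<^esub> y)"
    if "x \<in> carrier ?E" "r \<in> carrier R" "y \<in> carrier (M h)" "?u \<odot>\<^bsub>M h\<^esub> y = y" for x r y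
    using T.pt_balanced[of x r y] that by simp
  have uF: "?u \<odot>\<^bsub>M h\<^esub> y \<in> carrier ?F" if "y \<in> carrier (M h)" for y using that e by (simp flip: H.smult_assoc1)
  have eA: "\<epsilon> g \<odot>\<^bsub>?A\<^esub> x = x" if "x \<in> carrier ?A" for x using R.rank_one_support[OF J_rank_one[OF M g] that] .
  have eE: "\<epsilon> g \<odot>\<^bsub>?E\<^esub> x = x" if "x \<in> carrier ?E" for x using R.rank_one_support[OF rank_one_familyD[OF M g] that] .
  have b1: "balanced R ?A ?B T.T (\<lambda>s t. T.pt (?j s) (?u \<odot>\<^bsub>M h\<^esub> ?k t))"
    unfolding balanced_def
  proof (intro conjI ballI)
    fix x r y assume x: "x \<in> carrier ?A" and r: "r \<in> carrier R" and y: "y \<in> carrier ?B"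
    have "act g\<^sup>- (act g r) \<odot>\<^bsub>M h\<^esub> (?u \<odot>\<^bsub>M h\<^esub> ?k y) = ?u \<odot>\<^bsub>M h\<^esub> (r \<odot>\<^bsub>M h\<^esub> ?k y)"
      using e r y k g by (simp add: act_inv_act R.m_ac flip: H.smult_assoc1)
    then show "T.pt (?j (rsmult ?A x r)) (?u \<odot>\<^bsub>M h\<^esub> ?k y) = T.pt (?j x) (?u \<odot>\<^bsub>M h\<^esub> ?k (r \<odot>\<^bsub>?B\<^esub> y))"
      using x r y g J_rsmult[OF M g x r] Tpt[OF j(1)[OF x] _ _, of "act g r" "?u \<odot>\<^bsub>M h\<^esub> ?k y"] uF[OF k(1)[OF y]] by (simp add: j k)
  next
    fix x x' y assume "x \<in> carrier ?A" "x' \<in> carrier ?A" "y \<in> carrier ?B"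
    then show "T.pt (?j (x \<oplus>\<^bsub>?A\<^esub> x')) (?u \<odot>\<^bsub>M h\<^esub> ?k y) = T.pt (?j x) (?u \<odot>\<^bsub>M h\<^esub> ?k y) \<oplus>\<^bsub>T.T\<^esub> T.pt (?j x') (?u \<odot>\<^bsub>M h\<^esub> ?k y)"
      using T.pt_add_left[of "?j x" "?j x'" "?u \<odot>\<^bsub>M h\<^esub> ?k y"] uF[OF k(1)] by (simp add: j k)
  next
    fix x y y' assume "x \<in> carrier ?A" "y \<in> carrier ?B" "y' \<in> carrier ?B"
    then show "T.pt (?j x) (?u \<odot>\<^bsub>M h\<^esub> ?k (y \<oplus>\<^bsub>?B\<^esub> y')) = T.pt (?j x) (?u \<odot>\<^bsub>M h\<^esub> ?k y) \<oplus>\<^bsub>T.T\<^esub> T.pt (?j x) (?u \<odot>\<^bsub>M h\<^esub> ?k y')"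
      using T.pt_add_right[of "?j x" "?u \<odot>\<^bsub>M h\<^esub> ?k y" "?u \<odot>\<^bsub>M h\<^esub> ?k y'"] uF[OF k(1)] e by (simp add: j k H.smult_r_distr)
  qed (use j k uF in auto)
  have b2: "balanced R (central ?E) (central ?F) S.T (\<lambda>x y. S.pt (?j' x) (?k' y))"
    unfolding balanced_def
  proof (intro conjI ballI)
    fix x r y assume "x \<in> carrier (central ?E)" and r: "r \<in> carrier R" and "y \<in> carrier (central ?F)"
    then have x: "x \<in> carrier ?E" and y: "y \<in> carrier (M h)" by auto
    have "S.pt (act g (act g\<^sup>- r) \<odot>\<^bsub>?A\<^esub> ?j' x) (?k' y) = S.pt (?j' x) (act g\<^sup>- r \<odot>\<^bsub>?B\<^esub> ?k' y)"
      using Spt[of "?j' x" "act g\<^sup>- r" "?k' y"] x y r gi by (simp add: j' k')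
    moreover have "act g (act g\<^sup>- r) \<odot>\<^bsub>?A\<^esub> ?j' x = r \<odot>\<^bsub>?A\<^esub> ?j' x"
      using x r g e j' eA by (simp add: act_act_inv R.m_comm[of "\<epsilon> g" r] A.smult_assoc1)
    ultimately show "S.pt (?j' (rsmult (central ?E) x r)) (?k' y) = S.pt (?j' x) (?k' (r \<odot>\<^bsub>central ?F\<^esub> y))"
      using x y r gi by (simp add: j' k')
  qed (use j' k' in \<open>auto simp: S.pt_add_left S.pt_add_right\<close>)
  let ?f = "tensor_lift R ?A ?B (additive_group T.T) (\<lambda>s t. T.pt (?j s) (?u \<odot>\<^bsub>M h\<^esub> ?k t))"
  let ?g = "tensor_lift R (central ?E) (central ?F) (additive_group S.T) (\<lambda>x y. S.pt (?j' x) (?k' y))"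
  have f: "?f \<in> mod_hom R S.T T.T"
    by (rule S.lift_mod_hom[OF T.tensor_module b1]) (use uF k j in \<open>simp add: T.smult_pt\<close>)
  have g': "?g \<in> mod_hom R T.T S.T"
    by (rule T.lift_mod_hom[OF S.tensor_module b2]) (use k' j' in \<open>simp add: S.smult_pt\<close>)
  note ad = f[THEN mod_hom_additive] g'[THEN mod_hom_additive]
  note fp = S.lift_pt[OF T.tensor_abelian b1] and gp = T.lift_pt[OF S.tensor_abelian b2]
  have "?f \<in> mod_iso R S.T T.T"
  proof (rule mod_iso_byWitness[OF f g'])
    fix t assume t: "t \<in> carrier S.T"
    show "?g (?f t) = t"
    proof (rule S.additive_map_eqI[OF additive_map_comp[OF ad] additive_map_ident t])
      fix x y assume x: "x \<in> carrier ?A" and y: "y \<in> carrier ?B"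
      have "?g (?f (S.pt x y)) = S.pt x (?u \<odot>\<^bsub>?B\<^esub> y)"
        using x y gp[of "?j x" "?u \<odot>\<^bsub>M h\<^esub> ?k y"] uF[OF k(1)[OF y]] e by (simp add: fp j k k' inv)
      also have "\<dots> = S.pt (act g ?u \<odot>\<^bsub>?A\<^esub> x) y" using Spt[OF x e(3) y] by simp
      finally show "?g (?f (S.pt x y)) = S.pt x y" using g x e eA by (simp add: act_eps eps_one)
    qed
  next
    fix t assume t: "t \<in> carrier T.T"
    show "?f (?g t) = t"
    proof (rule T.additive_map_eqI[OF additive_map_comp[OF ad(2,1)] additive_map_ident t])
      fix x y assume "x \<in> carrier (central ?E)" and y: "y \<in> carrier (central ?F)"
      then have "x \<in> carrier ?E" "y \<in> carrier (M h)" "?u \<odot>\<^bsub>M h\<^esub> y = y" by auto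
      then show "?f (?g (T.pt x y)) = T.pt x y" using y by (simp add: fp gp j' k' inv)
    qed
  qed
  then show ?thesis by blast
qed

text \<open>
  The image of the multiplication map is the submodule \<open>1\<^sub>g J\<^sub>k \<cong> 1\<^sub>g
  M\<^sub>k\<close>.
\<close>

lemma D_J_iso:
  assumes M: "rank_one_family M" and g: "g \<in> carrier G" and k: "k \<in> carrier G"
  shows "(\<lambda>t. jmap M k (mu g (J M k) t)) \<in> mod_iso R (D_bimodule g \<boxtimes> J M k) (transport_module (\<epsilon> g) (\<lambda>r. \<epsilon> g \<star> r) (M k))"
    (is "?f \<in> mod_iso R ?T ?L")
proof -
  note KB = J_bimodule[OF M k] and ji = jmap_iso[OF M k] and e = eps[OF g]
  interpret T: tensor_product R "D_bimodule g" "J M k" using D_bimodule_bimodule[OF g] KB by unfold_locales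
  interpret K: module R "M k" by (rule R.rank_one_module[OF rank_one_familyD[OF M k]])
  note j = mod_homD[OF mod_iso_imp_hom[OF ji]] and j' = mod_homD[OF mod_iso_imp_hom[OF mod_iso_inv[OF ji T.ND(1)]]]
  note m = mod_homD[OF mu_hom[OF g KB]] and ms = mu_support[OF g KB]
  let ?i = "inv_into (carrier (J M k)) (jmap M k)"
  have bij: "bij_betw (jmap M k) (carrier (J M k)) (carrier (M k))" using ji by (simp add: mod_iso_def)
  note inv = bij_betw_inv_into_left[OF bij] bij_betw_inv_into_right[OF bij]
  have d: "\<epsilon> g \<in> D g" using g by (simp add: D_iff eps)
  have s: "\<epsilon> g \<odot>\<^bsub>M k\<^esub> ?f t = ?f t" if "t \<in> carrier ?T" for t using j(3)[OF e(1) m(1)[OF that]] ms[OF that] by simp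
  have f: "?f \<in> mod_hom R ?T ?L"
  proof (rule mod_homI)
    fix r t assume r: "r \<in> carrier R" and t: "t \<in> carrier ?T"
    have "(\<epsilon> g \<star> r) \<odot>\<^bsub>M k\<^esub> ?f t = r \<odot>\<^bsub>M k\<^esub> ?f t"
      using r e s[OF t] j(1)[OF m(1)[OF t]] by (simp add: R.m_comm[of "\<epsilon> g" r] K.smult_assoc1)
    then show "?f (r \<odot>\<^bsub>?T\<^esub> t) = r \<odot>\<^bsub>?L\<^esub> ?f t" using r t by (simp add: j m)
  qed (use s in \<open>auto simp: j m\<close>)
  have "bij_betw ?f (carrier ?T) (carrier ?L)"
  proof (rule bij_betw_byWitness[where f' = "\<lambda>x. T.pt (\<epsilon> g) (?i x)"])
    show "\<forall>t\<in>carrier ?T. T.pt (\<epsilon> g) (?i (?f t)) = t" using mu_section[OF g KB] m by (simp add: inv)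
    show "\<forall>x\<in>carrier ?L. ?f (T.pt (\<epsilon> g) (?i x)) = x" using e d by (auto simp: mu_pt[OF g KB] j j' inv)
    show "?f ` carrier ?T \<subseteq> carrier ?L" using mod_homD(1)[OF f] by blast
    show "(\<lambda>x. T.pt (\<epsilon> g) (?i x)) ` carrier ?L \<subseteq> carrier ?T" using d j' by auto
  qed
  then show ?thesis using f by (simp add: mod_iso_def)
qed

text \<open>
  The cocycle condition for \<open>f\<close> says that \<open>M\<^sub>g \<otimes> (M\<^sub>h)\<^sub>g\<close>, with
  the twisted module restricted to \<open>D\<^bsub>g\<^sup>-\<^sup>1\<^esub>\<close>, is isomorphic to
  \<open>1\<^sub>g M\<^bsub>gh\<^esub>\<close>. The two preceding lemmas identify these modules with the source and
  target of \<open>\<chi>\<^bsub>g,h\<^esub>\<close>.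
\<close>

lemma chi_family_exists:
  assumes f: "f \<in> carrier Z1" and MM: "representatives f M" obtains \<chi> where "chi_family M \<chi>"
proof -
  note M = representatives_rank_one[OF f MM]
  have "\<exists>\<chi>. \<chi> \<in> bimod_iso R (J M g \<boxtimes> J M h) (D_bimodule g \<boxtimes> J M (g \<bullet> h))"
    if g: "g \<in> carrier G" and h: "h \<in> carrier G" for g h
  proof -
    let ?k = "g \<bullet> h"
    have k: "?k \<in> carrier G" using g h by simp
    let ?L = "transport_module (\<epsilon> g) (\<lambda>r. \<epsilon> g \<star> r) (M ?k)" and ?T = "central (M g) \<boxtimes> central (tw g (M h))"
    note r = rank_one_familyD[OF M g] rank_one_familyD[OF M h] rank_one_familyD[OF M k]
    interpret c: corner_iso R "\<epsilon> g\<^sup>-" "\<epsilon> g" "act g" "act g\<^sup>-" by (rule corner_iso_act[OF g])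
    interpret c': corner_iso R "\<epsilon> g" "\<epsilon> g" "\<lambda>r. \<epsilon> g \<star> r" "\<lambda>r. \<epsilon> g \<star> r" by (rule R.corner_iso_mult[OF eps[OF g]])
    have rF: "rank_one R (tw g (M h)) (act g (\<epsilon> h))" by (rule c.rank_one_transport[OF r(2)])
    have rT: "rank_one R ?T (\<epsilon> g \<star> act g (\<epsilon> h))" by (rule R.rank_one_tensor[OF r(1) rF])
    have "iso_class R ?L = f ?k \<otimes>\<^sub>P D_class g"
      using R.ideal_class_mult_restrict[OF eps[OF g] r(3)] MM k by (simp add: D_class_ideal_class representatives_def)
    also have "\<dots> = f g \<otimes>\<^sub>P translate g (f h)" using f g h by (simp add: Z1_iff)
    also have "\<dots> = iso_class R ?T"
      using R.PicS_mult[OF r(1) rF] translate_iso_class[OF g r(2)] MM g h by (simp add: representatives_def)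
    finally have eq: "iso_class R ?T = iso_class R ?L" by simp
    obtain S where S: "S \<in> iso_class R ?T" using R.iso_class_nonempty[OF rT] by blast
    have Lm: "module R ?L" by (rule c'.transport_module_module[OF R.rank_one_module[OF r(3)]])
    obtain \<theta> where \<theta>: "\<theta> \<in> mod_iso R ?T ?L" using iso_class_eqD[OF eq Lm S] by blast
    obtain \<Phi> where \<Phi>: "\<Phi> \<in> mod_iso R (J M g \<boxtimes> J M h) ?T" using J_product_iso[OF M g h] by blast
    interpret S: tensor_product R "J M g" "J M h" using J_bimodule[OF M] g h by unfold_locales auto
    interpret U: tensor_product R "D_bimodule g" "J M ?k" using J_bimodule[OF M k] D_bimodule_bimodule[OF g] by unfold_locales
    obtain \<chi> where \<chi>: "\<chi> \<in> mod_iso R S.T U.T"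
      using mod_iso_compose[OF mod_iso_compose[OF \<Phi> \<theta>] mod_iso_inv[OF D_J_iso[OF M g k] U.tensor_module]] by blast
    note X = mod_homD[OF mod_iso_imp_hom[OF \<chi>]]
    \<comment> \<open>on both sides the right action is \<open>x r = \<alpha>\<^bsub>gh\<^esub>(r 1) x\<close>, so left linearity suffices\<close>
    have S: "rsmult S.T t r = act ?k r \<odot>\<^bsub>S.T\<^esub> t" if "t \<in> carrier S.T" and r: "r \<in> carrier R" for t r
      using that(1)
    proof (induction rule: S.tensor_induct)
      case (pt x y)
      interpret A: module R "J M g" by (rule S.MD(1))
      have ex: "\<epsilon> g \<odot>\<^bsub>J M g\<^esub> x = x" using R.rank_one_support[OF J_rank_one[OF M g] pt(1)] .
      have "S.pt x (rsmult (J M h) y r) = S.pt (rsmult (J M g) x (act h r)) y"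
        using pt r h by (simp add: S.pt_balanced J_rsmult[OF M h])
      also have "rsmult (J M g) x (act h r) = act ?k r \<odot>\<^bsub>J M g\<^esub> x"
        using pt r g h k eps[OF g] ex by (simp add: J_rsmult[OF M g] act_act R.m_comm[of "\<epsilon> g" "act ?k r"] A.smult_assoc1)
      finally show ?case using pt r k by (simp add: S.rsmult_pt S.smult_pt)
    qed (use r k in \<open>simp add: S.rsmult_add S.smult_add\<close>)
    have U: "rsmult U.T t r = act ?k r \<odot>\<^bsub>U.T\<^esub> t" if "t \<in> carrier U.T" and r: "r \<in> carrier R" for t r
      using that(1)
    proof (induction rule: U.tensor_induct)
      case (pt d x)
      have "U.pt d (rsmult (J M ?k) x r) = U.pt (rsmult (D_bimodule g) d (act ?k r)) x"
        using pt r k U.pt_balanced[OF pt(1) _ pt(2), of "act ?k r"] by (simp add: J_rsmult[OF M k])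
      then show ?case using pt r k U.rsmult_pt[OF r pt] U.smult_pt[OF _ pt, of "act ?k r"] by simp
    qed (use r k in \<open>simp add: U.rsmult_add U.smult_add\<close>)
    have "\<chi> \<in> bimod_iso R S.T U.T" using \<chi> k by (auto simp: bimod_iso_def S U X)
    then show ?thesis by blast
  qed
  then have "\<exists>\<chi>. chi_family M \<chi>" unfolding chi_family_def by metis
  then show ?thesis using that by blast
qed

end

section \<open>The homomorphism on cohomology\<close>

lemma perfect_pairing_iso:
  assumes b: "perfect_pairing R E F L b" and L: "module R L"
    and f: "f \<in> mod_iso R E' E" and g: "g \<in> mod_iso R F' F" and h: "h \<in> mod_iso R L L'"
  shows "perfect_pairing R E' F' L' (\<lambda>x y. h (b (f x) (g y)))"
proof -
  note B = bilinear_mapD[OF b[unfolded perfect_pairing_def, THEN conjunct1]]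
  note H = mod_homD[OF mod_iso_imp_hom[OF f]] mod_homD[OF mod_iso_imp_hom[OF g]] mod_homD[OF mod_iso_imp_hom[OF h]]
  have s: "f ` carrier E' = carrier E" "g ` carrier F' = carrier F" "h ` carrier L = carrier L'"
    using f g h by (auto simp: mod_iso_def bij_betw_def)
  have "bilinear_map R (\<lambda>r. r) E' F' L' (\<lambda>x y. h (b (f x) (g y)))"
    by (rule bilinear_mapI) (simp_all add: B H)
  moreover have "h z \<in> additive_span L' (h ` values_of E F b)" if "z \<in> carrier L" for z
    by (rule additive_span_image[OF module_abelian[OF L] mod_hom_additive[OF mod_iso_imp_hom[OF h]]])
      (use b that B in \<open>auto simp: perfect_pairing_def values_of_def\<close>)
  moreover have "h ` values_of E F b = values_of E' F' (\<lambda>x y. h (b (f x) (g y)))"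
    unfolding values_of_def s(1,2)[symmetric] by blast
  ultimately show ?thesis unfolding perfect_pairing_def s(3)[symmetric] by auto
qed

context unital_partial_action
begin

definition obstruction :: "('g \<Rightarrow> 'a small_module set) \<Rightarrow> ('g list \<Rightarrow> 'a) \<Rightarrow> bool" where
  "obstruction f w \<longleftrightarrow> (\<exists>M \<chi>. representatives f M \<and> chi_family M \<chi> \<and> w = omega M \<chi>)"

lemma obstruction_exists: "f \<in> carrier Z1 \<Longrightarrow> \<exists>w. obstruction f w"
  using representatives_exist chi_family_exists unfolding obstruction_def by metis

lemma obstructionE:
  assumes f: "f \<in> carrier Z1" and w: "obstruction f w"
  obtains M b where "representatives f M" "rank_one_family M" "crossed_system (J M) b" "defect (J M) b w" "w \<in> carrier Z3"
proof -
  obtain M \<chi> where M: "representatives f M" and \<chi>: "chi_family M \<chi>" and w': "w = omega M \<chi>"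
    using w by (auto simp: obstruction_def)
  note r = representatives_rank_one[OF f M]
  note cs = crossed_system_chi[OF r \<chi>]
  obtain v where v: "defect (J M) (chi_product M \<chi>) v" using defect_exists[OF cs] by blast
  then have "defect (J M) (chi_product M \<chi>) w" using omega_eq[OF r \<chi> v] w' by simp
  then show ?thesis using that[OF M r cs] defect_cocycle[OF cs] by blast
qed

text \<open>
  The equation \<open>f(g) f'(g) = (ff')(g)\<close> provides perfect pairings of the representing modules, which
  carry over to the bimodules \<open>J\<^sub>g\<close>.
\<close>

lemma obstruction_mult:
  assumes f: "f \<in> carrier Z1" "obstruction f w" and f': "f' \<in> carrier Z1" "obstruction f' w'"
    and w'': "obstruction (f \<otimes>\<^bsub>Z1\<^esub> f') w''"
  shows "B3 #>\<^bsub>Z3\<^esub> (w \<otimes>\<^bsub>Z3\<^esub> w') = B3 #>\<^bsub>Z3\<^esub> w''"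
proof -
  interpret Z1: comm_group Z1 by (rule Z1_comm_group)
  interpret Z3: comm_group Z3 by (rule Z3_comm_group)
  have ff: "f \<otimes>\<^bsub>Z1\<^esub> f' \<in> carrier Z1" using f f' by simp
  obtain M b where M: "representatives f M" "rank_one_family M" "crossed_system (J M) b" "defect (J M) b w" "w \<in> carrier Z3"
    using obstructionE[OF f] .
  obtain M' b' where M': "representatives f' M'" "rank_one_family M'" "crossed_system (J M') b'" "defect (J M') b' w'" "w' \<in> carrier Z3"
    using obstructionE[OF f'] .
  obtain N c where N: "representatives (f \<otimes>\<^bsub>Z1\<^esub> f') N" "rank_one_family N" "crossed_system (J N) c" "defect (J N) c w''" "w'' \<in> carrier Z3"
    using obstructionE[OF ff w''] .
  have "\<exists>p. perfect_pairing R (J M g) (J M' g) (J N g) p" if g: "g \<in> carrier G" for g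
  proof -
    note r = rank_one_familyD[OF M(2) g] rank_one_familyD[OF M'(2) g] rank_one_familyD[OF N(2) g]
    note m = R.rank_one_module[OF r(3)]
    have "iso_class R (M g) \<otimes>\<^sub>P iso_class R (M' g) = iso_class R (N g)"
      using M(1) M'(1) N(1) g by (simp add: representatives_def Z1_def)
    then obtain p where p: "perfect_pairing R (M g) (M' g) (N g) p" using R.pairing_of_classes[OF r(1,2) m] by blast
    show ?thesis
      using perfect_pairing_iso[OF p m jmap_iso[OF M(2) g] jmap_iso[OF M'(2) g]
          mod_iso_inv[OF jmap_iso[OF N(2) g] bimoduleD(1)[OF J_bimodule[OF N(2) g]]]] by blast
  qed
  then obtain p where "\<And>g. g \<in> carrier G \<Longrightarrow> perfect_pairing R (J M g) (J M' g) (J N g) (p g)" by metis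
  then obtain \<rho> where \<rho>: "\<rho> \<in> carrier (cochains 2)" "w \<otimes>\<^sub>C w' = w'' \<otimes>\<^sub>C delta2 \<rho>"
    using defect_product[OF M(3,4) M'(3,4) N(3,4)] by blast
  have "w \<otimes>\<^bsub>Z3\<^esub> w' \<in> carrier Z3" using M(5) M'(5) by simp
  from B3_coset_eq[OF this N(5) \<rho>(1)] show ?thesis using \<rho>(2) by (simp add: Z3_mult)
qed

text \<open>
  Let \<open>f(g) = \<alpha>\<^sub>g\<^sup>*(c) d\<close> with \<open>cd = 1\<close> and \<open>d = [Q]\<close>, the
  restrictions to \<open>D\<^bsub>g\<^sup>-\<^sup>1\<^esub>\<close> being understood. Then \<open>f(g)
  \<alpha>\<^sub>g\<^sup>*(d) = \<alpha>\<^sub>g\<^sup>*(cd) d = [D\<^sub>g] d\<close>, so \<open>J\<^sub>g\<close>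
  pairs with the twist of \<open>Q\<close> into \<open>1\<^sub>g Q\<close>. This is an action of the system on
  \<open>Q\<close>.
\<close>

lemma obstruction_coboundary:
  assumes f: "f \<in> B1" and w: "obstruction f w" shows "w \<in> B3"
proof -
  have fZ: "f \<in> carrier Z1" using f subgroup.subset[OF B1_subgroup] by auto
  obtain M b where M: "representatives f M" "rank_one_family M" "crossed_system (J M) b" "defect (J M) b w"
    using obstructionE[OF fZ w] by blast
  obtain c d where c: "c \<in> line_classes R \<one>\<^sub>R" and d: "d \<in> line_classes R \<one>\<^sub>R"
    and cd: "c \<otimes>\<^sub>P d = ideal_class R \<one>\<^sub>R" and fc: "f = coboundary1 c d"
    using f by (auto simp: B1_iff)
  obtain Q :: "'a small_module" where Q: "rank_one R Q \<one>\<^sub>R" "d = iso_class R Q" using d by (auto simp: line_classes_def)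
  let ?L = "\<lambda>g. transport_module (\<epsilon> g) (\<lambda>r. \<epsilon> g \<star> r) Q"
  have "\<exists>q. perfect_pairing R (J M g) (tw g Q) (?L g) q" if g: "g \<in> carrier G" for g
  proof -
    interpret c: corner_iso R "\<epsilon> g\<^sup>-" "\<epsilon> g" "act g" "act g\<^sup>-" by (rule corner_iso_act[OF g])
    interpret L: corner_iso R "\<epsilon> g" "\<epsilon> g" "\<lambda>r. \<epsilon> g \<star> r" "\<lambda>r. \<epsilon> g \<star> r" by (rule R.corner_iso_mult[OF eps[OF g]])
    note m = L.transport_module_module[OF R.rank_one_module[OF Q(1)]]
    note t = line_carrier[OF translate_line[OF g c]] line_carrier[OF translate_line[OF g d]] line_carrier[OF d]
    have "iso_class R (M g) = translate g c \<otimes>\<^sub>P d" using M(1) g fc by (simp add: representatives_def coboundary1_def)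
    then have "iso_class R (M g) \<otimes>\<^sub>P translate g d = (translate g c \<otimes>\<^sub>P translate g d) \<otimes>\<^sub>P d"
      using t by (simp add: P.m_ac)
    also have "\<dots> = d \<otimes>\<^sub>P D_class g"
      using translate_mult[OF g c d] translate_one[OF g] cd t line_carrier[OF D_class_line[OF g]] by (simp add: P.m_comm)
    also have "\<dots> = iso_class R (?L g)"
      using R.ideal_class_mult_restrict[OF eps[OF g] Q(1)] by (simp add: Q(2) D_class_ideal_class)
    finally have "iso_class R (M g) \<otimes>\<^sub>P iso_class R (tw g Q) = iso_class R (?L g)"
      using translate_iso_class[OF g Q(1)] by (simp add: Q(2))
    then obtain q where q: "perfect_pairing R (M g) (tw g Q) (?L g) q"
      using R.pairing_of_classes[OF rank_one_familyD[OF M(2) g] c.rank_one_transport[OF Q(1)] m] by blast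
    show ?thesis using perfect_pairing_iso[OF q m jmap_iso[OF M(2) g] mod_iso_ident mod_iso_ident] by blast
  qed
  then obtain q where q: "\<And>g. g \<in> carrier G \<Longrightarrow> perfect_pairing R (J M g) (tw g Q) (?L g) (q g)" by metis
  note a = semilinear_action[OF _ J_rank_one[OF M(2)] R.rank_one_module[OF Q(1)] q]
  show ?thesis by (rule defect_of_acting_system[OF M(3,4) Q(1) a(1) a(2)])
qed

text \<open>
  If \<open>b \<in> B\<^sup>1\<close>, an obstruction of \<open>bf\<close> is cohomologous to the product of one of
  \<open>b\<close>, which is a coboundary, and one of \<open>f\<close>. This also covers different choices for the
  same \<open>f\<close>, with \<open>b = 1\<close>.
\<close>

lemma phi6_eq:
  assumes f: "f \<in> carrier Z1" and w: "obstruction f w"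
  shows "phi6 (B1 #>\<^bsub>Z1\<^esub> f) = B3 #>\<^bsub>Z3\<^esub> w"
proof -
  interpret Z1: comm_group Z1 by (rule Z1_comm_group)
  interpret Z3: comm_group Z3 by (rule Z3_comm_group)
  note sub = subgroup.subset[OF B1_subgroup] subgroup.subset[OF B3_subgroup]
  have phi6: "phi6 (B1 #>\<^bsub>Z1\<^esub> f) = (THE D. \<exists>f'\<in>B1 #>\<^bsub>Z1\<^esub> f. \<exists>v. obstruction f' v \<and> D = B3 #>\<^bsub>Z3\<^esub> v)"
    unfolding phi6_def obstruction_def by (rule arg_cong[of _ _ The]) blast
  have unique: "B3 #>\<^bsub>Z3\<^esub> v = B3 #>\<^bsub>Z3\<^esub> w" if f': "f' \<in> B1 #>\<^bsub>Z1\<^esub> f" and v: "obstruction f' v" for f' v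
  proof -
    obtain b where b: "b \<in> B1" "f' = b \<otimes>\<^bsub>Z1\<^esub> f" using f' by (auto simp: r_coset_def)
    have bZ: "b \<in> carrier Z1" using b sub by auto
    obtain u where u: "obstruction b u" using obstruction_exists[OF bZ] by blast
    have uB: "u \<in> B3" by (rule obstruction_coboundary[OF b(1) u])
    have wZ: "w \<in> carrier Z3" using obstructionE[OF f w] .
    have "B3 #>\<^bsub>Z3\<^esub> v = B3 #>\<^bsub>Z3\<^esub> (u \<otimes>\<^bsub>Z3\<^esub> w)" using obstruction_mult[OF bZ u f w] v b(2) by simp
    also have "\<dots> = (B3 #>\<^bsub>Z3\<^esub> u) #>\<^bsub>Z3\<^esub> w" using sub uB wZ by (intro Z3.coset_mult_assoc[symmetric]) auto
    also have "B3 #>\<^bsub>Z3\<^esub> u = B3" using sub uB by (intro Z3.coset_join2 B3_subgroup) auto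
    finally show ?thesis .
  qed
  have "f \<in> B1 #>\<^bsub>Z1\<^esub> f" by (rule Z1.rcos_self[OF f B1_subgroup])
  then show ?thesis unfolding phi6 using w unique by (intro the_equality) blast+
qed

lemma phi6_hom: "group_hom H1 H3 phi6"
proof -
  interpret Z1: comm_group Z1 by (rule Z1_comm_group)
  interpret Z3: comm_group Z3 by (rule Z3_comm_group)
  interpret B1: normal B1 Z1 using B1_subgroup by (simp add: Z1.normal_iff_subgroup)
  interpret B3: normal B3 Z3 by (rule B3_normal)
  have cos: "\<exists>f w. f \<in> carrier Z1 \<and> obstruction f w \<and> w \<in> carrier Z3 \<and> c = B1 #>\<^bsub>Z1\<^esub> f" if c: "c \<in> carrier H1" for c
  proof -
    obtain f where f: "f \<in> carrier Z1" "c = B1 #>\<^bsub>Z1\<^esub> f" using c by (auto simp: H1_def carrier_FactGroup)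
    then show ?thesis using obstruction_exists[OF f(1)] obstructionE[OF f(1)] by metis
  qed
  have "phi6 \<in> hom H1 H3"
  proof (rule homI)
    fix c assume "c \<in> carrier H1"
    then obtain f w where f: "f \<in> carrier Z1" "obstruction f w" "w \<in> carrier Z3" "c = B1 #>\<^bsub>Z1\<^esub> f" using cos by blast
    then show "phi6 c \<in> carrier H3" by (auto simp: phi6_eq H3_def carrier_FactGroup)
  next
    fix c c' assume c: "c \<in> carrier H1" "c' \<in> carrier H1"
    obtain f w where f: "f \<in> carrier Z1" "obstruction f w" "w \<in> carrier Z3" "c = B1 #>\<^bsub>Z1\<^esub> f" using cos c by blast
    obtain f' w' where f': "f' \<in> carrier Z1" "obstruction f' w'" "w' \<in> carrier Z3" "c' = B1 #>\<^bsub>Z1\<^esub> f'" using cos c by blast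
    have ff: "f \<otimes>\<^bsub>Z1\<^esub> f' \<in> carrier Z1" using f f' by simp
    obtain v where v: "obstruction (f \<otimes>\<^bsub>Z1\<^esub> f') v" using obstruction_exists[OF ff] by blast
    have "phi6 (c \<otimes>\<^bsub>H1\<^esub> c') = phi6 (B1 #>\<^bsub>Z1\<^esub> (f \<otimes>\<^bsub>Z1\<^esub> f'))" using f f' by (simp add: H1_def B1.rcos_sum)
    also have "\<dots> = B3 #>\<^bsub>Z3\<^esub> (w \<otimes>\<^bsub>Z3\<^esub> w')" using phi6_eq[OF ff v] obstruction_mult[OF f(1,2) f'(1,2) v] by simp
    also have "\<dots> = phi6 c \<otimes>\<^bsub>H3\<^esub> phi6 c'"
      using f f' by (simp add: H3_def B3.rcos_sum phi6_eq[OF f(1,2)] phi6_eq[OF f'(1,2)])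
    finally show "phi6 (c \<otimes>\<^bsub>H1\<^esub> c') = phi6 c \<otimes>\<^bsub>H3\<^esub> phi6 c'" .
  qed
  then show ?thesis using H1_group H3_group by (simp add: group_hom_def group_hom_axioms_def)
qed

end

theorem theorem6p9:
  fixes G :: "('g, 'c) monoid_scheme" and R :: "('a, 'r) ring_scheme"
    and \<epsilon> :: "'g \<Rightarrow> 'a" and \<alpha> :: "'g \<Rightarrow> 'a \<Rightarrow> 'a"
  assumes "unital_partial_action G R \<epsilon> \<alpha>"
    and "finite (carrier G)"
    and "unital_partial_action.partial_Galois_extension G R \<epsilon> \<alpha>
           (unital_partial_action.invariants G R \<epsilon> \<alpha>)"
  shows "group_hom (unital_partial_action.H1 G R \<epsilon> \<alpha>) (unital_partial_action.H3 G R \<epsilon> \<alpha>)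
           (unital_partial_action.phi6 G R \<epsilon> \<alpha>)"
  using assms(1) by (rule unital_partial_action.phi6_hom)

end
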